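(* For every $k\in\mathbb{N}$, the map $\underline{\psi_k}\circ\varphi: Z_{k+2}^+\to\mathbb{R}^2/G'$ is a smooth symplectic resolution of the Poisson quotient $(\mathbb{R}^2/G',\{\cdot,\cdot\})$.
   Context: Quotients. Let $M$ be a smooth manifold with a Poisson structure and $\Gamma$ a discrete group of Poisson automorphisms. $M/\Gamma$ denotes the quotient of $M$ by the closure of the equivalence relation induced by $\Gamma$, i.e. the equivalence relation generated by: $x\sim y$ iff there are sequences $x_n\to x$, $y_n\to y$ with $x_n,y_n$ in the same $\Gamma$-orbit for all $n$. Put $C^\infty(M/\Gamma):=C^\infty(M)^\Gamma$ ($\Gamma$-invariant smooth functions, viewed as functions on $M/\Gamma$); it is a Poisson algebra with the bracket of $M$. Symplectic resolution. A symplectic realization of $M/\Gamma$ is a triple $(\Sigma,\pi_\Sigma,\Phi)$ with $(\Sigma,\pi_\Sigma)$ a symplectic manifold (maybe with boundary) and $\Phi:\Sigma\to M/\Gamma$ a map such that (i) $\Phi$ is smooth, i.e. $\Phi^*F$ is a smooth function on $\Sigma$ for all $F\in C^\infty(M/\Gamma)$; (ii) the algebra morphism $\Phi^*:C^\infty(M/\Gamma)\to C^\infty(\Sigma)$ is a Poisson morphism. It is called a symplectic resolution if moreover (iii) there is an open dense $\Gamma$-saturated subset $U\subset M$ on which the $\Gamma$-action is discrete, proper and free (so that $U/\Gamma$ is a manifold), and (iv) $\Phi:\Phi^{-1}(U/\Gamma)\to U/\Gamma$ is a diffeomorphism. The group. Here $M=\mathbb{R}^2$ with coordinates $(p,q)$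 and Poisson bracket $\{p,q\}=\frac{q}{2\pi}$, and $\Gamma=G'=\left\{\begin{pmatrix}1&n\\0&\epsilon\end{pmatrix}: n\in\mathbb{Z},\ \epsilon\in\{\pm1\}\right\}$ acts by $(n,\epsilon)\cdot(p,q)=(p+nq,\epsilon q)$. The closed equivalence relation identifies points of the same $G'$-orbit and identifies all points $(p,0)$, $p\in\mathbb{R}$. The Du Val variety and the bijection. $D_{2k+1}=\{(x,y,z)\in\mathbb{R}^3: zx^2+y^2=z^{2k+1}\}$ with the Poisson bracket $\{x,y\}=-(2k+1)z^{2k}+x^2$, $\{y,z\}=2zx$, $\{z,x\}=2y$, and $D_{2k+1}^+=D_{2k+1}\cap\{z\geq0\}$. The map $\phi_k:\mathbb{R}^2\to\mathbb{R}^3$, $\phi_k(p,q)=\left(q^{2k}\cos\frac{2\pi p}{q},\,q^{2k+1}\sin\frac{2\pi p}{q},\,q^2\right)$ for $q\neq0$ and $\phi_k(p,0)=(0,0,0)$, takes values in $D_{2k+1}^+$ and induces a map $\overline{\phi_k}:\mathbb{R}^2/G'\to D_{2k+1}^+$, which the paper states to be bijective; $\underline{\psi_k}:D_{2k+1}^+\to\mathbb{R}^2/G'$ denotes its inverse. The resolution. $\varphi:Z_{k+2}\to D_{2k+1}$ is the usual (Du Val) symplectic resolution, obtained by successive blow-ups (taking strict transforms). Blowing up $D_{2k+1}$ at the origin: in the $x$-chart the strict transform is $zx-z^{2k+1}x^{2k-1}=-y^2$, whose only singular point is the origin, and blowing up this point gives a smooth strict transform with symplectic pulled-back Poisson structure;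 in the $y$-chart the strict transform is smooth and the pulled-back structure is symplectic; in the $z$-chart the strict transform is $D_{2k-1}$, with the same Poisson structure, $k$ being replaced by $k-1$. One repeats the procedure. At the $k$-th step the strict transform is $zx^2+y^2-z=0$, with bracket $\{x,y\}=x^2-1$, $\{y,z\}=2xz$, $\{z,x\}=2y$, and has two singular points $(1,0,0)$ and $(-1,0,0)$. For each of these two points, the blow-up at the point admits a singular point, and blowing up at this point one obtains at last a smooth variety on which the pulled-back Poisson structure is symplectic. The resulting symplectic manifold is $(Z_{k+2},\pi_{k+2})$. Finally $Z_{k+2}^+=\varphi^{-1}(D_{2k+1}\cap\{z\geq0\})\subset Z_{k+2}$, considered as a manifold with boundary and equipped with the restriction of $\pi_{k+2}$, and $\varphi:Z_{k+2}^+\to D_{2k+1}^+$ is the restriction.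
   Formalization: Since D⁺ contains the whole line y=z=0, the preimage φ⁻¹(D⁺) has one-dimensional pieces and φ̄_k is not onto: Z⁺ is taken as the closure of the interior of φ⁻¹(D⁺), and ψ_k sends points of that line outside the image of φ_k to the class of q=0. *)

theory Defs
  imports "HOL-Analysis.Analysis"
begin

section \<open>Smooth structures given by their smooth functions\<close>

text \<open>
  A smooth structure on a set is recorded by its real-valued smooth functions.  Functions are
  extensional (equal to \<^term>\<open>undefined\<close> off the set), so that a function on the set is a
  unique HOL function.  The topology is the initial topology of the smooth functions, which for a
  (Hausdorff, second countable) manifold, with or without boundary, is the manifold topology.
\<close>

record 'a smooth_space =
  points :: "'a set"
  smooth_funs :: "('a \<Rightarrow> real) set"

definition space_topology :: "'a smooth_space \<Rightarrow> 'a topology" where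
  "space_topology X =
     topology_generated_by {points X \<inter> f -` V | f V. f \<in> smooth_funs X \<and> open V}"

text \<open>A function on a subset is smooth iff it is locally the restriction of a smooth function.\<close>

definition smooth_subspace :: "'a smooth_space \<Rightarrow> 'a set \<Rightarrow> 'a smooth_space" where
  "smooth_subspace X S = \<lparr> points = S,
     smooth_funs = {f \<in> extensional S. \<forall>s\<in>S. \<exists>W F. openin (space_topology X) W \<and> s \<in> W \<and>
               F \<in> smooth_funs X \<and> (\<forall>t\<in>W \<inter> S. f t = F t)} \<rparr>"

definition smooth_map :: "'a smooth_space \<Rightarrow> 'b smooth_space \<Rightarrow> ('a \<Rightarrow> 'b) \<Rightarrow> bool" where
  "smooth_map X Y h \<longleftrightarrow>
     h \<in> points X \<rightarrow> points Y \<and> (\<forall>F \<in> smooth_funs Y. compose (points X) F h \<in> smooth_funs X)"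

definition diffeomorphism :: "'a smooth_space \<Rightarrow> 'b smooth_space \<Rightarrow> ('a \<Rightarrow> 'b) \<Rightarrow> bool" where
  "diffeomorphism X Y h \<longleftrightarrow>
     bij_betw h (points X) (points Y) \<and> smooth_map X Y h \<and>
     smooth_map Y X (inv_into (points X) h)"

text \<open>
  \<open>Ck_on n S f\<close>, for open \<open>S\<close>: all iterated directional derivatives of \<open>f\<close> of order at most
  \<open>n\<close> exist and are continuous on \<open>S\<close>.
\<close>

primrec Ck_on :: "nat \<Rightarrow> 'a::euclidean_space set \<Rightarrow> ('a \<Rightarrow> real) \<Rightarrow> bool" where
  "Ck_on 0 S f \<longleftrightarrow> continuous_on S f"
| "Ck_on (Suc n) S f \<longleftrightarrow> (\<forall>x\<in>S. f differentiable (at x)) \<and>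
     (\<forall>v. Ck_on n S (\<lambda>x. frechet_derivative f (at x) v))"

definition smooth_on :: "'a::euclidean_space set \<Rightarrow> ('a \<Rightarrow> real) \<Rightarrow> bool" where
  "smooth_on S f \<longleftrightarrow> (\<forall>n. Ck_on n S f)"

definition euclidean_smooth :: "'a::euclidean_space smooth_space" where
  "euclidean_smooth = \<lparr> points = UNIV, smooth_funs = {f. smooth_on UNIV f} \<rparr>"

text \<open>
  Manifolds, possibly with boundary, are the spaces that are locally diffeomorphic to relatively
  open subsets of a coordinate half-space of \<open>'e\<close>; the type argument fixes the dimension
  \<open>DIM('e)\<close>.
\<close>

definition manifold_with_boundary :: "'e::euclidean_space itself \<Rightarrow> 'a smooth_space \<Rightarrow> bool" where
  "manifold_with_boundary _ X \<longleftrightarrow>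
     Hausdorff_space (space_topology X) \<and> second_countable (space_topology X) \<and>
     smooth_funs (smooth_subspace X (points X)) = smooth_funs X \<and>
     (\<forall>s\<in>points X. \<exists>W H h. \<exists>b\<in>Basis.
        openin (space_topology X) W \<and> s \<in> W \<and>
        openin (top_of_set {v::'e. 0 \<le> v \<bullet> b}) H \<and>
        diffeomorphism (smooth_subspace X W) (smooth_subspace euclidean_smooth H) h)"


section \<open>Poisson and symplectic structures\<close>

type_synonym 'a bracket = "('a \<Rightarrow> real) \<Rightarrow> ('a \<Rightarrow> real) \<Rightarrow> ('a \<Rightarrow> real)"

definition poisson_bracket :: "'a smooth_space \<Rightarrow> 'a bracket \<Rightarrow> bool" where
  "poisson_bracket X B \<longleftrightarrow>
     B \<in> smooth_funs X \<rightarrow>\<^sub>E (smooth_funs X \<rightarrow>\<^sub>E smooth_funs X) \<and>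
     (\<forall>f\<in>smooth_funs X. \<forall>g\<in>smooth_funs X. \<forall>s\<in>points X. B f g s = - B g f s) \<and>
     (\<forall>f\<in>smooth_funs X. \<forall>g\<in>smooth_funs X. \<forall>h\<in>smooth_funs X. \<forall>a. \<forall>s\<in>points X.
        B (\<lambda>t\<in>points X. a * f t + g t) h s = a * B f h s + B g h s \<and>
        B (\<lambda>t\<in>points X. f t * g t) h s = f s * B g h s + g s * B f h s \<and>
        B f (B g h) s + B g (B h f) s + B h (B f g) s = 0)"

definition poisson_map ::
  "'a smooth_space \<Rightarrow> 'a bracket \<Rightarrow> 'b smooth_space \<Rightarrow> 'b bracket \<Rightarrow> ('a \<Rightarrow> 'b) \<Rightarrow> bool" where
  "poisson_map X BX Y BY h \<longleftrightarrow> smooth_map X Y h \<and>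
     (\<forall>F\<in>smooth_funs Y. \<forall>G\<in>smooth_funs Y.
        BX (compose (points X) F h) (compose (points X) G h) = compose (points X) (BY F G) h)"

text \<open>
  The unique Poisson structure making \<open>h\<close> a Poisson map.  It is used for the lift of a Poisson
  structure along a resolution, and for the restriction to a subspace (\<open>h\<close> the inclusion).
\<close>

definition pullback_bracket ::
  "'a smooth_space \<Rightarrow> 'b smooth_space \<Rightarrow> 'b bracket \<Rightarrow> ('a \<Rightarrow> 'b) \<Rightarrow> 'a bracket" where
  "pullback_bracket X Y BY h = (THE B. poisson_bracket X B \<and> poisson_map X B Y BY h)"

text \<open>Tangent vectors are the derivations of the algebra of smooth functions at a point.\<close>

definition tangent_vectors :: "'a smooth_space \<Rightarrow> 'a \<Rightarrow> (('a \<Rightarrow> real) \<Rightarrow> real) set" where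
  "tangent_vectors X s = {v. \<forall>f\<in>smooth_funs X. \<forall>g\<in>smooth_funs X. \<forall>a.
     v (\<lambda>t\<in>points X. a * f t + g t) = a * v f + v g \<and>
     v (\<lambda>t\<in>points X. f t * g t) = f s * v g + g s * v f}"

text \<open>
  Symplectic: the map \<open>d\<^sub>s f \<mapsto> {f, -}(s)\<close> from the cotangent to the tangent space is injective
  at every point \<open>s\<close>; the differential \<open>d\<^sub>s f\<close> vanishes iff every tangent vector kills \<open>f\<close>.
\<close>

definition symplectic_manifold ::
  "'e::euclidean_space itself \<Rightarrow> 'a smooth_space \<Rightarrow> 'a bracket \<Rightarrow> bool" where
  "symplectic_manifold E X B \<longleftrightarrow>
     manifold_with_boundary E X \<and> poisson_bracket X B \<and>
     (\<forall>s\<in>points X. \<forall>f\<in>smooth_funs X.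
        (\<forall>g\<in>smooth_funs X. B f g s = 0) \<longrightarrow> (\<forall>v\<in>tangent_vectors X s. v f = 0))"


section \<open>Quotients and symplectic resolutions\<close>

text \<open>\<open>\<Gamma>\<close> is a discrete group acting on \<open>points X\<close> by \<open>act\<close>.\<close>

definition closed_orbit_rel ::
  "'m smooth_space \<Rightarrow> 'g set \<Rightarrow> ('g \<Rightarrow> 'm \<Rightarrow> 'm) \<Rightarrow> ('m \<times> 'm) set" where
  "closed_orbit_rel X \<Gamma> act = \<Inter> {R. equiv (points X) R \<and>
     {(x, y) | x y. \<exists>xs ys :: nat \<Rightarrow> 'm.
        (\<forall>n. xs n \<in> points X \<and> (\<exists>g\<in>\<Gamma>. ys n = act g (xs n))) \<and>
        limitin (space_topology X) xs x sequentially \<and>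
        limitin (space_topology X) ys y sequentially} \<subseteq> R}"

text \<open>
  The quotient by an equivalence relation \<open>R\<close> whose functions are the invariant smooth functions,
  viewed as functions on classes.  With \<open>R\<close> the closed orbit relation of \<open>X\<close>, it gives
  \<open>X/\<Gamma>\<close>; replacing \<open>X\<close> by \<open>smooth_subspace X U\<close> but keeping \<open>R\<close>, it gives \<open>U/\<Gamma>\<close> as a subset
  of \<open>X/\<Gamma>\<close>, with its own smooth functions \<open>C\<^sup>\<infinity>(U)\<^sup>\<Gamma>\<close>.
\<close>

definition quotient_space ::
  "('m \<times> 'm) set \<Rightarrow> 'm smooth_space \<Rightarrow> 'g set \<Rightarrow> ('g \<Rightarrow> 'm \<Rightarrow> 'm) \<Rightarrow> 'm set smooth_space" where
  "quotient_space R X \<Gamma> act =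
     (let Q = (\<lambda>m. R `` {m}) ` points X in
      \<lparr> points = Q,
        smooth_funs = {F \<in> extensional Q. \<exists>f\<in>smooth_funs X.
                  (\<forall>g\<in>\<Gamma>. \<forall>m\<in>points X. f (act g m) = f m) \<and>
                  (\<forall>m\<in>points X. F (R `` {m}) = f m)} \<rparr>)"

definition poisson_quotient ::
  "'m smooth_space \<Rightarrow> 'g set \<Rightarrow> ('g \<Rightarrow> 'm \<Rightarrow> 'm) \<Rightarrow> 'm set smooth_space" where
  "poisson_quotient X \<Gamma> act = quotient_space (closed_orbit_rel X \<Gamma> act) X \<Gamma> act"

definition quotient_bracket ::
  "'m smooth_space \<Rightarrow> 'm bracket \<Rightarrow> 'g set \<Rightarrow> ('g \<Rightarrow> 'm \<Rightarrow> 'm) \<Rightarrow> 'm set bracket" where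
  "quotient_bracket X B \<Gamma> act =
     (let Q = poisson_quotient X \<Gamma> act;
          lift = (\<lambda>F. \<lambda>m\<in>points X. F (closed_orbit_rel X \<Gamma> act `` {m}))
      in (\<lambda>F\<in>smooth_funs Q. \<lambda>G\<in>smooth_funs Q. \<lambda>c\<in>points Q. B (lift F) (lift G) (SOME m. m \<in> c)))"

definition symplectic_realization ::
  "'e::euclidean_space itself \<Rightarrow> 'm smooth_space \<Rightarrow> 'm bracket \<Rightarrow> 'g set \<Rightarrow> ('g \<Rightarrow> 'm \<Rightarrow> 'm) \<Rightarrow>
   'a smooth_space \<Rightarrow> 'a bracket \<Rightarrow> ('a \<Rightarrow> 'm set) \<Rightarrow> bool" where
  "symplectic_realization E X B \<Gamma> act \<Sigma> \<pi> \<Phi> \<longleftrightarrow>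
     symplectic_manifold E \<Sigma> \<pi> \<and>
     smooth_map \<Sigma> (poisson_quotient X \<Gamma> act) \<Phi> \<and>
     poisson_map \<Sigma> \<pi> (poisson_quotient X \<Gamma> act) (quotient_bracket X B \<Gamma> act) \<Phi>"

definition free_on :: "'g set \<Rightarrow> 'g \<Rightarrow> ('g \<Rightarrow> 'm \<Rightarrow> 'm) \<Rightarrow> 'm set \<Rightarrow> bool" where
  "free_on \<Gamma> e act U \<longleftrightarrow> (\<forall>g\<in>\<Gamma>. \<forall>m\<in>U. act g m = m \<longrightarrow> g = e)"

definition proper_on ::
  "'m smooth_space \<Rightarrow> 'g set \<Rightarrow> ('g \<Rightarrow> 'm \<Rightarrow> 'm) \<Rightarrow> 'm set \<Rightarrow> bool" where
  "proper_on X \<Gamma> act U \<longleftrightarrow>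
     (\<forall>K\<subseteq>U. compactin (space_topology X) K \<longrightarrow> finite {g \<in> \<Gamma>. act g ` K \<inter> K \<noteq> {}})"

definition discrete_orbits_on ::
  "'m smooth_space \<Rightarrow> 'g set \<Rightarrow> ('g \<Rightarrow> 'm \<Rightarrow> 'm) \<Rightarrow> 'm set \<Rightarrow> bool" where
  "discrete_orbits_on X \<Gamma> act U \<longleftrightarrow>
     (\<forall>m\<in>U. \<exists>W. openin (space_topology X) W \<and> m \<in> W \<and>
        (\<forall>g\<in>\<Gamma>. act g m \<in> W \<longrightarrow> act g m = m))"

text \<open>The argument \<open>e\<close> is the neutral element of \<open>\<Gamma>\<close>.\<close>

definition symplectic_resolution ::
  "'e::euclidean_space itself \<Rightarrow> 'm smooth_space \<Rightarrow> 'm bracket \<Rightarrow>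
   'g set \<Rightarrow> 'g \<Rightarrow> ('g \<Rightarrow> 'm \<Rightarrow> 'm) \<Rightarrow>
   'a smooth_space \<Rightarrow> 'a bracket \<Rightarrow> ('a \<Rightarrow> 'm set) \<Rightarrow> bool" where
  "symplectic_resolution E X B \<Gamma> e act \<Sigma> \<pi> \<Phi> \<longleftrightarrow>
     symplectic_realization E X B \<Gamma> act \<Sigma> \<pi> \<Phi> \<and>
     (let R = closed_orbit_rel X \<Gamma> act in
      \<exists>U. openin (space_topology X) U \<and>
          space_topology X closure_of U = points X \<and>
          R `` U \<subseteq> U \<and>
          discrete_orbits_on X \<Gamma> act U \<and> proper_on X \<Gamma> act U \<and> free_on \<Gamma> e act U \<and>
          (let UQ = quotient_space R (smooth_subspace X U) \<Gamma> act in
           diffeomorphism (smooth_subspace \<Sigma> {s \<in> points \<Sigma>. \<Phi> s \<in> points UQ}) UQ \<Phi>))"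


section \<open>The plane modulo the group of matrices\<close>

abbreviation partial :: "(real^'n \<Rightarrow> real) \<Rightarrow> 'n \<Rightarrow> real^'n \<Rightarrow> real" where
  "partial f i v \<equiv> frechet_derivative f (at v) (axis i 1)"

text \<open>Coordinates \<open>p = v $ 1\<close> and \<open>q = v $ 2\<close>.\<close>

definition plane_bracket :: "(real^2) bracket" where
  "plane_bracket = (\<lambda>f\<in>smooth_funs euclidean_smooth. \<lambda>g\<in>smooth_funs euclidean_smooth. \<lambda>v.
     v$2 / (2 * pi) * (partial f 1 v * partial g 2 v - partial f 2 v * partial g 1 v))"

definition G' :: "(real^2^2) set" where
  "G' = {vector [vector [1, of_int n], vector [0, \<epsilon>]] | (n::int) \<epsilon>. \<epsilon> \<in> {1, -1}}"

abbreviation plane_rel :: "((real^2) \<times> (real^2)) set" where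
  "plane_rel \<equiv> closed_orbit_rel euclidean_smooth G' (*v)"

abbreviation plane_quotient :: "(real^2) set smooth_space" where
  "plane_quotient \<equiv> poisson_quotient euclidean_smooth G' (*v)"


section \<open>The Du Val surface and the plane quotient\<close>

text \<open>Coordinates \<open>x = v $ 1\<close>, \<open>y = v $ 2\<close> and \<open>z = v $ 3\<close>.\<close>

definition duval :: "nat \<Rightarrow> (real^3) set" where
  "duval k = {v. v$3 * (v$1)^2 + (v$2)^2 = (v$3)^(2*k+1)}"

definition duval_plus :: "nat \<Rightarrow> (real^3) set" where
  "duval_plus k = duval k \<inter> {v. 0 \<le> v$3}"

text \<open>
  The bracket of \<open>\<real>\<^sup>3\<close> determined by the brackets of the coordinate functions.  The equation of
  \<open>duval k\<close> is a Casimir function, so a map into \<open>duval k\<close> is Poisson iff it is Poisson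
  as a map into \<open>\<real>\<^sup>3\<close>.
\<close>

definition duval_bracket :: "nat \<Rightarrow> (real^3) bracket" where
  "duval_bracket k = (\<lambda>f\<in>smooth_funs euclidean_smooth. \<lambda>g\<in>smooth_funs euclidean_smooth. \<lambda>v.
     (let xy = - (2 * real k + 1) * (v$3)^(2*k) + (v$1)^2; yz = 2 * v$3 * v$1; zx = 2 * v$2 in
      xy * (partial f 1 v * partial g 2 v - partial f 2 v * partial g 1 v) +
      yz * (partial f 2 v * partial g 3 v - partial f 3 v * partial g 2 v) +
      zx * (partial f 3 v * partial g 1 v - partial f 1 v * partial g 3 v)))"

definition phi_map :: "nat \<Rightarrow> real^2 \<Rightarrow> real^3" where
  "phi_map k v = (let p = v$1; q = v$2 in
     if q = 0 then 0
     else vector [q^(2*k) * cos (2*pi*p/q), q^(2*k+1) * sin (2*pi*p/q), q^2])"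

definition phi_bar :: "nat \<Rightarrow> (real^2) set \<Rightarrow> real^3" where
  "phi_bar k c = the_elem (phi_map k ` c)"

text \<open>
  The image of \<open>phi_map k\<close> consists of the origin and of the points of \<open>duval k\<close> with \<open>z > 0\<close>.
  The other points of \<open>duval_plus k\<close> lie on the line \<open>y = z = 0\<close>, and are sent to the class of
  the line \<open>q = 0\<close>, the only choice for which \<open>q\<^sup>2 = z\<close>.
\<close>

definition psi_map :: "nat \<Rightarrow> real^3 \<Rightarrow> (real^2) set" where
  "psi_map k d = (if d \<in> phi_bar k ` points plane_quotient
              then inv_into (points plane_quotient) (phi_bar k) d
              else plane_rel `` {0})"


section \<open>Iterated blow-ups of three-space at points\<close>

text \<open>
  The points of an iterated blow-up of \<open>\<real>\<^sup>3\<close>: those of \<open>\<real>\<^sup>3\<close> away from the centres, and, for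
  each blown-up point \<open>c\<close>, the points \<open>Exc c l\<close> of its exceptional projective plane, \<open>l\<close> being
  a line through \<open>0\<close> in the coordinates in which \<open>c\<close> was blown up.
\<close>

datatype bpoint = Base "real^3" | Exc bpoint "(real^3) set"

primrec blowdown :: "bpoint \<Rightarrow> real^3" where
  "blowdown (Base v) = v"
| "blowdown (Exc c l) = blowdown c"

text \<open>An atlas is a set of injective parametrizations, each with its open domain in \<open>\<real>\<^sup>3\<close>.\<close>

type_synonym param = "(real^3) set \<times> (real^3 \<Rightarrow> bpoint)"

definition atlas_space :: "param set \<Rightarrow> bpoint smooth_space" where
  "atlas_space A = (let M = (\<Union>(V, g)\<in>A. g ` V) in
     \<lparr> points = M, smooth_funs = {f \<in> extensional M. \<forall>(V, g)\<in>A. smooth_on V (f \<circ> g)} \<rparr>)"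

text \<open>
  The affine charts of the blow-up of \<open>\<real>\<^sup>3\<close> at \<open>0\<close>: the \<open>i\<close>-th one is
  \<open>w \<mapsto> w $ i *\<^sub>R chart_dir i w\<close>; e.g. for \<open>i = 1\<close> it is \<open>(x, y, z) \<mapsto> (x, xy, xz)\<close>.
\<close>

definition chart_dir :: "3 \<Rightarrow> real^3 \<Rightarrow> real^3" where
  "chart_dir i w = (\<chi> j. if j = i then 1 else w $ j)"

definition blow_param :: "(real^3 \<Rightarrow> bpoint) \<Rightarrow> real^3 \<Rightarrow> 3 \<Rightarrow> real^3 \<Rightarrow> bpoint" where
  "blow_param g c i w =
     (if w $ i = 0 then Exc (g c) (span {chart_dir i w}) else g (c + w $ i *\<^sub>R chart_dir i w))"

definition blow_atlas :: "param set \<Rightarrow> param \<Rightarrow> real^3 \<Rightarrow> param set" where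
  "blow_atlas A P c = (case P of (V, g) \<Rightarrow>
     {({w \<in> V'. g' w \<noteq> g c}, g') | V' g'. (V', g') \<in> A} \<union>
     {({w. c + w $ i *\<^sub>R chart_dir i w \<in> V}, blow_param g c i) | i. True})"

text \<open>
  Blow-up, at the point with coordinates \<open>c\<close> in the parametrization \<open>P\<close>, of an ambient space with
  a surface \<open>S\<close> in it, which is replaced by its strict transform: the closure of the part of \<open>S\<close>
  outside the centre.
\<close>

definition blow_up :: "param \<Rightarrow> real^3 \<Rightarrow> param set \<times> bpoint set \<Rightarrow> param set \<times> bpoint set" where
  "blow_up P c AS = (case AS of (A, S) \<Rightarrow>
     (let A' = blow_atlas A P c in
      (A', space_topology (atlas_space A') closure_of (S - {snd P c}))))"


section \<open>The Du Val resolution\<close>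

text \<open>
  \<open>main_chart j\<close> is the \<open>z\<close>-chart (\<open>i = 3\<close>) reached after \<open>j\<close> blow-ups at the origin of the
  previous one; the strict transform of \<open>duval k\<close> is \<open>duval (k - j)\<close> there.
\<close>

primrec main_chart :: "nat \<Rightarrow> real^3 \<Rightarrow> bpoint" where
  "main_chart 0 = Base"
| "main_chart (Suc j) = blow_param (main_chart j) 0 3"

text \<open>
  Each stage blows up the origin of the main chart, then the singular point of the strict transform
  at the origin of the resulting \<open>x\<close>-chart.  Both charts are defined on the whole of \<open>\<real>\<^sup>3\<close>.
\<close>

primrec stage :: "nat \<Rightarrow> nat \<Rightarrow> param set \<times> bpoint set" where
  "stage k 0 = ({(UNIV, Base)}, Base ` duval k)"
| "stage k (Suc j) =
     blow_up (UNIV, blow_param (main_chart j) 0 1) 0 (blow_up (UNIV, main_chart j) 0 (stage k j))"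

text \<open>
  After \<open>k\<close> stages the surface \<open>zx\<^sup>2 + y\<^sup>2 = z\<close> of the main chart is blown up at \<open>(1,0,0)\<close> and
  \<open>(-1,0,0)\<close>, its singular points.  The second blow-up uses the main chart without \<open>(1,0,0)\<close>,
  which the first one has removed.
\<close>

definition resolved :: "nat \<Rightarrow> param set \<times> bpoint set" where
  "resolved k =
     blow_up (- {axis 1 1}, main_chart k) (axis 1 (-1))
       (blow_up (UNIV, main_chart k) (axis 1 1) (stage k k))"

definition Z_space :: "nat \<Rightarrow> bpoint smooth_space" where
  "Z_space k = smooth_subspace (atlas_space (fst (resolved k))) (snd (resolved k))"

definition Z_bracket :: "nat \<Rightarrow> bpoint bracket" where
  "Z_bracket k = pullback_bracket (Z_space k) euclidean_smooth (duval_bracket k) blowdown"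

text \<open>
  The preimage of \<open>duval_plus k\<close> consists of a surface with boundary and of curves in the
  exceptional set along which \<open>z \<le> 0\<close> in a neighbourhood (together with the strict transform of
  the line \<open>y = z = 0\<close>).  Passing to the closure of the interior discards these curves, and does
  not change a codimension-zero submanifold with boundary.
\<close>

definition Z_plus :: "nat \<Rightarrow> bpoint smooth_space" where
  "Z_plus k = smooth_subspace (Z_space k)
     (space_topology (Z_space k) closure_of
       (space_topology (Z_space k) interior_of {s \<in> points (Z_space k). blowdown s \<in> duval_plus k}))"

definition Z_plus_bracket :: "nat \<Rightarrow> bpoint bracket" where
  "Z_plus_bracket k = pullback_bracket (Z_plus k) (Z_space k) (Z_bracket k) id"

end

theory Submission
  imports Defs
begin

text \<open>
  The charts of the iterated blow-up are crepant: the equation of \<open>duval k\<close> pulls back to the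
  equation \<open>F\<close> of the strict transform times the Jacobian determinant of the chart.  Hence the
  bracket lifts to the Jacobian bracket of \<open>F\<close>, which is symplectic because the last surfaces
  \<open>F = 0\<close> are smooth; near the boundary \<open>z = 0\<close> they are parametrized by half-planes.

  An invariant smooth function \<open>f\<close> on the plane has a period \<open>q\<close> in \<open>p\<close>, so by Rolle's theorem
  \<open>\<partial>f/\<partial>p\<close> has zeros at distance at most \<open>q\<close> from every point; the same holds for all its
  \<open>p\<close>-derivatives, so it is flat at \<open>q = 0\<close>.  As \<open>f (0, q)\<close> is even in \<open>q\<close>, Borel's theorem gives
  \<open>f (p, q) = h (q\<^sup>2) + r (p, q)\<close> with \<open>h\<close> smooth on the line and \<open>r\<close> flat.  On the resolution
  \<open>h (q\<^sup>2)\<close> is \<open>h (z)\<close>, and \<open>r\<close> extends smoothly by \<open>0\<close> across \<open>z = 0\<close>: each derivative of the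
  polar coordinates \<open>2\<pi>p/q\<close> and \<open>q\<close> only costs powers of \<open>1/q\<close>, which the flatness of \<open>r\<close> absorbs.
  That the resolution map is Poisson need only be checked on the dense part where \<open>x\<close> and \<open>z\<close>
  are local coordinates.
\<close>

section \<open>Smooth functions\<close>

text \<open>The data come in indirect form: the strict transform is a closure in a three-dimensional
  blow-up, its smooth functions are local restrictions of ambient ones, and the brackets are defined
  by \<open>THE\<close>. One dense set controls all of them, the points with
  \<open>y \<noteq> 0\<close>: every centre lies over \<open>y = z = 0\<close>, so no blow-up moves
  these points, and the surface is a graph over the \<open>(x, z)\<close>-plane there. Brackets are
  computed on it in two variables; crepant charts supply smooth extensions to all other points, and
  density supplies uniqueness as well as the Poisson identities. The price of working with closures
  is that their points over \<open>z = 0\<close> have to be located, which takes a compactness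
  argument. Smoothness at the boundary means extension to an ambient neighbourhood, hence also to
  negative \<open>z\<close>, where the coordinates \<open>p\<close> and \<open>q\<close> have no
  meaning. This is why an even function of \<open>q\<close> has to be turned into a function on the
  whole line, and why the remainder has to vanish to infinite order rather than merely be
  small.\<close>

lemma Ck_on_cong:
  assumes "open S" "\<And>x. x \<in> S \<Longrightarrow> f x = g x"
  shows "Ck_on n S f = Ck_on n S g"
proof -
  have "Ck_on n S g" if "Ck_on n S f" "\<And>x. x \<in> S \<Longrightarrow> f x = g x" for f g
    using that
  proof (induction n arbitrary: f g)
    case 0
    then show ?case using continuous_on_cong by (metis Ck_on.simps(1))
  next
    case (Suc n)
    have d: "(g has_derivative frechet_derivative f (at x)) (at x)" if "x \<in> S" for x
    proof -
      have "(f has_derivative frechet_derivative f (at x)) (at x)"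
        using Suc.prems(1) that by (simp add: frechet_derivative_works)
      then show ?thesis
        using has_derivative_transform_within_open[OF _ \<open>open S\<close> that] Suc.prems(2) by blast
    qed
    then have "frechet_derivative g (at x) = frechet_derivative f (at x)" if "x \<in> S" for x
      using that by (metis frechet_derivative_at)
    then have "Ck_on n S (\<lambda>x. frechet_derivative g (at x) v)" for v
      using Suc.IH[of "\<lambda>x. frechet_derivative f (at x) v"] Suc.prems by auto
    then show ?case using d by (auto simp: differentiable_def)
  qed
  then show ?thesis using assms by metis
qed

lemma Ck_on_subset: "Ck_on n S f \<Longrightarrow> T \<subseteq> S \<Longrightarrow> Ck_on n T f"
  by (induction n arbitrary: f) (auto intro: continuous_on_subset)

lemma Ck_on_local:
  assumes "\<And>x. x \<in> S \<Longrightarrow> \<exists>N. open N \<and> x \<in> N \<and> Ck_on n N f"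
  shows "Ck_on n S f"
  using assms
proof (induction n arbitrary: f)
  case 0
  then have "isCont f x" if "x \<in> S" for x
    using that by (metis Ck_on.simps(1) continuous_on_eq_continuous_at)
  then show ?case by (simp add: continuous_at_imp_continuous_on)
next
  case (Suc n)
  then show ?case unfolding Ck_on.simps by metis
qed

text \<open>Lets any explicit derivative \<open>f'\<close> stand for
  \<open>frechet_derivative\<close>, so that each closure property of \<open>Ck_on\<close> becomes
  one induction on the order.\<close>

lemma Ck_on_SucI:
  assumes "open S" "\<And>x. x \<in> S \<Longrightarrow> (f has_derivative f' x) (at x)"
    and "\<And>v. Ck_on n S (\<lambda>x. f' x v)"
  shows "Ck_on (Suc n) S f"
proof -
  have "frechet_derivative f (at x) = f' x" if "x \<in> S" for x
    using assms(2)[OF that] by (metis frechet_derivative_at)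
  then have "Ck_on n S (\<lambda>x. frechet_derivative f (at x) v)" for v
    using assms(3)[of v] Ck_on_cong[OF assms(1), of "\<lambda>x. f' x v" "\<lambda>x. frechet_derivative f (at x) v"] by simp
  then show ?thesis using assms(2) by (auto simp: differentiable_def)
qed

lemma Ck_on_Suc_imp: "Ck_on (Suc n) S f \<Longrightarrow> Ck_on n S f"
proof (induction n arbitrary: f)
  case 0
  then show ?case
    by (simp add: continuous_at_imp_continuous_on differentiable_imp_continuous_within)
next
  case (Suc n)
  then show ?case by (metis Ck_on.simps(2))
qed

lemma Ck_on_const: "Ck_on n S (\<lambda>x. c)"
  by (induction n arbitrary: c) auto

lemma Ck_on_linear: "bounded_linear f \<Longrightarrow> Ck_on n S f"
  by (cases n) (auto simp: Ck_on_const linear_continuous_on bounded_linear_imp_differentiable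
      frechet_derivative_at[OF bounded_linear_imp_has_derivative, symmetric])

lemma Ck_on_add:
  "open S \<Longrightarrow> Ck_on n S f \<Longrightarrow> Ck_on n S g \<Longrightarrow> Ck_on n S (\<lambda>x. f x + g x)"
proof (induction n arbitrary: f g)
  case (Suc n)
  show ?case
    by (rule Ck_on_SucI[where f' = "\<lambda>x v. frechet_derivative f (at x) v + frechet_derivative g (at x) v"])
      (use Suc in \<open>auto intro!: derivative_intros simp: frechet_derivative_works\<close>)
qed (auto intro: continuous_intros)

lemma Ck_on_mult:
  "open S \<Longrightarrow> Ck_on n S f \<Longrightarrow> Ck_on n S g \<Longrightarrow> Ck_on n S (\<lambda>x. f x * g x)"
proof (induction n arbitrary: f g)
  case (Suc n)
  have c: "Ck_on n S f" "Ck_on n S g" using Suc.prems Ck_on_Suc_imp by blast+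
  show ?case
    by (rule Ck_on_SucI[where f' = "\<lambda>x v. f x * frechet_derivative g (at x) v + frechet_derivative f (at x) v * g x"])
      (use Suc c in \<open>auto intro!: derivative_intros Ck_on_add simp: frechet_derivative_works\<close>)
qed (auto intro: continuous_intros)

lemma Ck_on_sum:
  "open S \<Longrightarrow> (\<And>i. i \<in> I \<Longrightarrow> Ck_on n S (f i)) \<Longrightarrow> Ck_on n S (\<lambda>x. \<Sum>i\<in>I. f i x)"
  by (induction I rule: infinite_finite_induct) (auto simp: Ck_on_const Ck_on_add)

text \<open>The derivative of the composite is a sum of products whose factors have one order less.
  The induction hypothesis is needed for the partial derivatives of \<open>\<phi>\<close>, hence the
  generalization over \<open>\<phi>\<close> but not over \<open>f\<close>.\<close>

lemma Ck_on_compose: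
  fixes f :: "'a::euclidean_space \<Rightarrow> 'b::euclidean_space"
  assumes "open S" "open T" "f ` S \<subseteq> T" "Ck_on n T \<phi>"
    and "\<And>b. b \<in> Basis \<Longrightarrow> Ck_on n S (\<lambda>x. f x \<bullet> b)"
  shows "Ck_on n S (\<lambda>x. \<phi> (f x))"
  using assms(4,5)
proof (induction n arbitrary: \<phi>)
  case 0
  then have "continuous_on S f" by (simp add: continuous_on_componentwise[of S f])
  then show ?case using 0 assms(3) by (auto intro: continuous_on_compose2)
next
  case (Suc n)
  \<comment> \<open>Smoothness is known for the components of \<open>f\<close> only, so its
    derivative is assembled from theirs.\<close>
  let ?D = "\<lambda>x v. \<Sum>b\<in>Basis. (frechet_derivative (\<lambda>x. f x \<bullet> b) (at x) v) *\<^sub>R b"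
  have df: "(f has_derivative ?D x) (at x)" if "x \<in> S" for x
  proof -
    have "((\<lambda>x. \<Sum>b\<in>Basis. (f x \<bullet> b) *\<^sub>R b) has_derivative ?D x) (at x)"
      by (rule has_derivative_sum, rule has_derivative_scaleR_left)
        (use Suc.prems that in \<open>simp add: frechet_derivative_works\<close>)
    then show ?thesis by (simp add: euclidean_representation)
  qed
  have chain: "((\<lambda>x. \<phi> (f x)) has_derivative
      (\<lambda>v. \<Sum>b\<in>Basis. frechet_derivative (\<lambda>x. f x \<bullet> b) (at x) v * frechet_derivative \<phi> (at (f x)) b)) (at x)"
    if "x \<in> S" for x
  proof -
    have d: "(\<phi> has_derivative frechet_derivative \<phi> (at (f x))) (at (f x))"
      using Suc.prems(1) assms(3) that by (auto simp: frechet_derivative_works)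
    then have "linear (frechet_derivative \<phi> (at (f x)))" by (rule has_derivative_linear)
    from has_derivative_compose[OF df[OF that] d] show ?thesis
      by (simp add: linear_sum[OF \<open>linear _\<close>] linear_scale[OF \<open>linear _\<close>])
  qed
  show ?case
  proof (rule Ck_on_SucI[OF assms(1) chain])
    fix v
    show "Ck_on n S (\<lambda>x. \<Sum>b\<in>Basis. frechet_derivative (\<lambda>x. f x \<bullet> b) (at x) v * frechet_derivative \<phi> (at (f x)) b)"
    proof (intro Ck_on_sum Ck_on_mult assms(1))
      fix b :: 'b assume b: "b \<in> Basis"
      show "Ck_on n S (\<lambda>x. frechet_derivative (\<lambda>x. f x \<bullet> b) (at x) v)"
        using Suc.prems(2)[OF b] by simp
      show "Ck_on n S (\<lambda>x. frechet_derivative \<phi> (at (f x)) b)"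
        by (rule Suc.IH[of "\<lambda>x. frechet_derivative \<phi> (at x) b"])
          (use Suc.prems Ck_on_Suc_imp in \<open>auto simp del: Ck_on.simps(2)\<close>, use Suc.prems in auto)
    qed
  qed auto
qed

named_theorems smooth_intros

lemma smooth_on_cong: "open S \<Longrightarrow> (\<And>x. x \<in> S \<Longrightarrow> f x = g x) \<Longrightarrow> smooth_on S f = smooth_on S g"
  unfolding smooth_on_def using Ck_on_cong by metis

lemma smooth_on_subset: "smooth_on S f \<Longrightarrow> T \<subseteq> S \<Longrightarrow> smooth_on T f"
  unfolding smooth_on_def using Ck_on_subset by blast

lemma smooth_on_local:
  assumes "\<And>x. x \<in> S \<Longrightarrow> \<exists>N. open N \<and> x \<in> N \<and> smooth_on N f"
  shows "smooth_on S f"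
  unfolding smooth_on_def by (metis Ck_on_local assms smooth_on_def)

lemma smooth_on_const [smooth_intros]: "smooth_on S (\<lambda>x. c)"
  by (simp add: smooth_on_def Ck_on_const)

lemma smooth_on_linear: "bounded_linear f \<Longrightarrow> smooth_on S f"
  by (simp add: smooth_on_def Ck_on_linear)

lemma smooth_on_inner [smooth_intros]: "smooth_on S (\<lambda>x. x \<bullet> b)"
  by (rule smooth_on_linear) (rule bounded_linear_inner_left)

lemma smooth_on_ident [smooth_intros]: "smooth_on S (\<lambda>x::real. x)"
  by (rule smooth_on_linear) (rule bounded_linear_ident)

lemma smooth_on_nth [smooth_intros]: "smooth_on S (\<lambda>x. x $ i)"
  by (rule smooth_on_linear) (rule bounded_linear_vec_nth)

lemma smooth_on_add [smooth_intros]: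
  "open S \<Longrightarrow> smooth_on S f \<Longrightarrow> smooth_on S g \<Longrightarrow> smooth_on S (\<lambda>x. f x + g x)"
  by (simp add: smooth_on_def Ck_on_add)

lemma smooth_on_mult [smooth_intros]:
  "open S \<Longrightarrow> smooth_on S f \<Longrightarrow> smooth_on S g \<Longrightarrow> smooth_on S (\<lambda>x. f x * g x)"
  by (simp add: smooth_on_def Ck_on_mult)

lemma smooth_on_minus [smooth_intros]:
  "open S \<Longrightarrow> smooth_on S f \<Longrightarrow> smooth_on S (\<lambda>x. - f x)"
  using smooth_on_mult[of S "\<lambda>_. -1" f] by (simp add: smooth_on_const)

lemma smooth_on_diff [smooth_intros]:
  "open S \<Longrightarrow> smooth_on S f \<Longrightarrow> smooth_on S g \<Longrightarrow> smooth_on S (\<lambda>x. f x - g x)"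
  using smooth_on_add[of S f "\<lambda>x. - g x"] smooth_on_minus[of S g] by simp

lemma smooth_on_sum [smooth_intros]:
  "open S \<Longrightarrow> (\<And>i. i \<in> I \<Longrightarrow> smooth_on S (f i)) \<Longrightarrow> smooth_on S (\<lambda>x. \<Sum>i\<in>I. f i x)"
  by (simp add: smooth_on_def Ck_on_sum)

lemma smooth_on_power [smooth_intros]:
  "open S \<Longrightarrow> smooth_on S f \<Longrightarrow> smooth_on S (\<lambda>x. f x ^ n)"
  by (induction n) (auto intro: smooth_intros)

lemma smooth_on_frechet:
  "smooth_on S f \<Longrightarrow> smooth_on S (\<lambda>x. frechet_derivative f (at x) v)"
  unfolding smooth_on_def by (metis Ck_on.simps(2))

lemma smooth_on_differentiable: "smooth_on S f \<Longrightarrow> x \<in> S \<Longrightarrow> f differentiable (at x)"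
  unfolding smooth_on_def by (metis Ck_on.simps(2))

lemma smooth_on_has_derivative:
  "smooth_on S f \<Longrightarrow> x \<in> S \<Longrightarrow> (f has_derivative frechet_derivative f (at x)) (at x)"
  using smooth_on_differentiable frechet_derivative_works by blast

lemma smooth_on_continuous: "smooth_on S f \<Longrightarrow> continuous_on S f"
  unfolding smooth_on_def by (metis Ck_on.simps(1))

section \<open>Smooth maps between Euclidean spaces\<close>

definition smooth_vec :: "'a::euclidean_space set \<Rightarrow> ('a \<Rightarrow> 'b::euclidean_space) \<Rightarrow> bool" where
  "smooth_vec S f \<longleftrightarrow> (\<forall>b\<in>Basis. smooth_on S (\<lambda>x. f x \<bullet> b))"

lemma smooth_vec_real [simp]: "smooth_vec S (f :: _ \<Rightarrow> real) = smooth_on S f"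
  by (simp add: smooth_vec_def)

lemma smooth_vec_cart: "smooth_vec S (f :: _ \<Rightarrow> real^'n) \<longleftrightarrow> (\<forall>i. smooth_on S (\<lambda>x. f x $ i))"
  by (auto simp: smooth_vec_def Basis_vec_def inner_axis)

lemma smooth_vec_subset: "smooth_vec S f \<Longrightarrow> T \<subseteq> S \<Longrightarrow> smooth_vec T f"
  unfolding smooth_vec_def using smooth_on_subset by blast

lemma smooth_vec_ident: "smooth_vec S (\<lambda>x. x)"
  by (simp add: smooth_vec_def smooth_on_inner)

lemma smooth_vec_continuous: "smooth_vec S f \<Longrightarrow> continuous_on S f"
  unfolding smooth_vec_def continuous_on_componentwise[of S f] using smooth_on_continuous by blast

lemma smooth_on_compose:
  "smooth_on T \<phi> \<Longrightarrow> smooth_vec S f \<Longrightarrow> open S \<Longrightarrow> open T \<Longrightarrow> (\<And>x. x \<in> S \<Longrightarrow> f x \<in> T) \<Longrightarrow>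
   smooth_on S (\<lambda>x. \<phi> (f x))"
  unfolding smooth_on_def smooth_vec_def using Ck_on_compose by blast

lemma smooth_vec_compose:
  "smooth_vec T \<phi> \<Longrightarrow> smooth_vec S f \<Longrightarrow> open S \<Longrightarrow> open T \<Longrightarrow> (\<And>x. x \<in> S \<Longrightarrow> f x \<in> T) \<Longrightarrow>
   smooth_vec S (\<lambda>x. \<phi> (f x))"
  unfolding smooth_vec_def[of _ \<phi>] smooth_vec_def[of _ "\<lambda>x. \<phi> (f x)"] using smooth_on_compose by blast

lemma smooth_vec_differentiable: "smooth_vec S f \<Longrightarrow> x \<in> S \<Longrightarrow> f differentiable (at x)"
  unfolding smooth_vec_def differentiable_componentwise_within[of f]
  using smooth_on_differentiable by blast

section \<open>Elementary functions of one real variable\<close>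

lemma Ck_on_SucI_DERIV:
  fixes f :: "real \<Rightarrow> real"
  assumes "open S" "\<And>x. x \<in> S \<Longrightarrow> (f has_real_derivative f' x) (at x)" "Ck_on n S f'"
  shows "Ck_on (Suc n) S f"
  by (rule Ck_on_SucI[where f' = "\<lambda>x v. f' x * v"])
    (use assms in \<open>auto simp: has_field_derivative_def intro: Ck_on_mult Ck_on_const\<close>)

text \<open>For functions given as series: the candidates for all derivatives are known at once, and
  each has the next one as its derivative. Used in Borel's theorem.\<close>

lemma smooth_on_DERIV_sequence:
  fixes h :: "nat \<Rightarrow> real \<Rightarrow> real"
  assumes "open S" "\<And>m x. x \<in> S \<Longrightarrow> (h m has_real_derivative h (Suc m) x) (at x)"
  shows "smooth_on S (h m)"
proof -
  have "Ck_on n S (h m)" for n m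
  proof (induction n arbitrary: m)
    case 0
    show ?case using DERIV_isCont[OF assms(2)] by (auto intro!: continuous_at_imp_continuous_on)
  qed (use Ck_on_SucI_DERIV[OF assms(1)] assms(2) in blast)
  then show ?thesis by (simp add: smooth_on_def)
qed

text \<open>Bootstrapping: the derivative is a polynomial in the function itself, so
  \<open>Ck_on n\<close> passes from the function to its derivative.\<close>

lemma smooth_on_inverse_real: "smooth_on (- {0}) (inverse :: real \<Rightarrow> real)"
proof -
  have "Ck_on n (- {0}) (inverse :: real \<Rightarrow> real)" for n
  proof (induction n)
    case (Suc n)
    have "Ck_on n (- {0}) (\<lambda>x::real. (-1) * (inverse x * inverse x))"
      by (intro Ck_on_mult Ck_on_const Suc) (simp_all add: open_Compl)
    then show ?case
      by (rule Ck_on_SucI_DERIV[rotated 2]) (auto intro!: derivative_eq_intros)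
  qed (auto intro!: continuous_intros)
  then show ?thesis by (simp add: smooth_on_def)
qed

text \<open>Bootstrapping again; the derivative is half the reciprocal of the function, and
  reciprocals have just been treated.\<close>

lemma smooth_on_sqrt_real: "smooth_on {0<..} sqrt"
proof -
  have "Ck_on n {0<..} sqrt" for n
  proof (induction n)
    case (Suc n)
    have i: "Ck_on n {0<..} (\<lambda>x. inverse (sqrt x))"
      by (rule Ck_on_compose[where T = "- {0}"])
        (use Suc smooth_on_inverse_real in \<open>auto simp: smooth_on_def\<close>)
    have "Ck_on n {0<..} (\<lambda>x. inverse (sqrt x) * (1/2))"
      by (intro Ck_on_mult Ck_on_const i) simp
    then show ?case
      by (rule Ck_on_SucI_DERIV[rotated 2]) (auto intro!: derivative_eq_intros)
  qed (auto intro!: continuous_intros)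
  then show ?thesis by (simp add: smooth_on_def)
qed

lemma smooth_on_arctan_real: "smooth_on UNIV arctan"
proof -
  have s: "smooth_on UNIV (\<lambda>x::real. inverse (1 + x^2))"
    by (rule smooth_on_compose[OF smooth_on_inverse_real])
      (auto intro!: smooth_intros simp: add_nonneg_eq_0_iff)
  have "Ck_on (Suc n) UNIV arctan" for n
    by (rule Ck_on_SucI_DERIV[OF _ DERIV_arctan]) (use s in \<open>auto simp: smooth_on_def\<close>)
  then show ?thesis by (metis smooth_on_def Ck_on_Suc_imp)
qed

lemma smooth_on_cos_sin_real: "smooth_on UNIV (cos :: real \<Rightarrow> real)" "smooth_on UNIV (sin :: real \<Rightarrow> real)"
proof -
  have "Ck_on n UNIV (cos :: real \<Rightarrow> real) \<and> Ck_on n UNIV (sin :: real \<Rightarrow> real)" for n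
  proof (induction n)
    case (Suc n)
    have "Ck_on n UNIV (\<lambda>x::real. (-1) * sin x)" using Suc by (intro Ck_on_mult Ck_on_const) auto
    then have "Ck_on (Suc n) UNIV (cos :: real \<Rightarrow> real)"
      by (rule Ck_on_SucI_DERIV[rotated 2]) (auto intro!: derivative_eq_intros)
    moreover have "Ck_on (Suc n) UNIV (sin :: real \<Rightarrow> real)"
      by (rule Ck_on_SucI_DERIV[where f' = cos]) (use Suc in auto)
    ultimately show ?case by blast
  qed (auto intro!: continuous_intros)
  then show "smooth_on UNIV (cos :: real \<Rightarrow> real)" "smooth_on UNIV (sin :: real \<Rightarrow> real)"
    by (auto simp: smooth_on_def)
qed

lemma smooth_on_inverse [smooth_intros]:
  "open S \<Longrightarrow> smooth_on S f \<Longrightarrow> (\<And>x. x \<in> S \<Longrightarrow> f x \<noteq> 0) \<Longrightarrow> smooth_on S (\<lambda>x. inverse (f x))"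
  by (rule smooth_on_compose[OF smooth_on_inverse_real]) auto

lemma smooth_on_divide [smooth_intros]:
  "open S \<Longrightarrow> smooth_on S f \<Longrightarrow> smooth_on S g \<Longrightarrow> (\<And>x. x \<in> S \<Longrightarrow> g x \<noteq> 0) \<Longrightarrow>
   smooth_on S (\<lambda>x. f x / g x)"
  unfolding divide_inverse by (intro smooth_intros)

lemma smooth_on_sqrt [smooth_intros]:
  "open S \<Longrightarrow> smooth_on S f \<Longrightarrow> (\<And>x. x \<in> S \<Longrightarrow> 0 < f x) \<Longrightarrow> smooth_on S (\<lambda>x. sqrt (f x))"
  by (rule smooth_on_compose[OF smooth_on_sqrt_real]) auto

lemma smooth_on_arctan [smooth_intros]:
  "open S \<Longrightarrow> smooth_on S f \<Longrightarrow> smooth_on S (\<lambda>x. arctan (f x))"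
  by (rule smooth_on_compose[OF smooth_on_arctan_real]) auto

lemma smooth_on_cos [smooth_intros]: "open S \<Longrightarrow> smooth_on S f \<Longrightarrow> smooth_on S (\<lambda>x. cos (f x))"
  by (rule smooth_on_compose[OF smooth_on_cos_sin_real(1)]) auto

lemma smooth_on_sin [smooth_intros]: "open S \<Longrightarrow> smooth_on S f \<Longrightarrow> smooth_on S (\<lambda>x. sin (f x))"
  by (rule smooth_on_compose[OF smooth_on_cos_sin_real(2)]) auto

lemma smooth_vec_vector2:
  "smooth_on S f \<Longrightarrow> smooth_on S g \<Longrightarrow> smooth_vec S (\<lambda>x. vector [f x, g x] :: real^2)"
  by (simp add: smooth_vec_cart forall_2)

lemma smooth_vec_vector3:
  "smooth_on S f \<Longrightarrow> smooth_on S g \<Longrightarrow> smooth_on S h \<Longrightarrow> smooth_vec S (\<lambda>x. vector [f x, g x, h x] :: real^3)"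
  by (simp add: smooth_vec_cart forall_3)

lemma smooth_vec_lambda:
  "(\<And>i. smooth_on S (\<lambda>x. f x i)) \<Longrightarrow> smooth_vec S (\<lambda>x. \<chi> i. f x i)"
  by (simp add: smooth_vec_cart)

section \<open>Bump functions\<close>

text \<open>The functions \<open>exp (- 1 / t) / t^m\<close> for all \<open>m\<close> together are
  closed under differentiation up to linear combinations, which \<open>exp (- 1 / t)\<close> alone
  is not.\<close>

definition flat_exp :: "nat \<Rightarrow> real \<Rightarrow> real" where
  "flat_exp m t = (if 0 < t then exp (- inverse t) * inverse t ^ m else 0)"

lemma flat_exp_tendsto_0: "(flat_exp m \<longlongrightarrow> 0) (at 0)"
proof -
  have "((\<lambda>t. inverse t ^ m / exp (inverse t)) \<longlongrightarrow> 0) (at_right (0::real))"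
    by (rule filterlim_compose[OF tendsto_power_div_exp_0 filterlim_inverse_at_top_right])
  then have r: "(flat_exp m \<longlongrightarrow> 0) (at_right 0)"
    by (rule Lim_transform_eventually)
      (auto simp: flat_exp_def exp_minus field_simps eventually_at_right_field intro!: exI[of _ 1])
  have "(flat_exp m \<longlongrightarrow> 0) (at_left 0)"
    by (rule Lim_transform_eventually[OF tendsto_const])
      (auto simp: flat_exp_def eventually_at_left_field intro!: exI[of _ "-1"])
  with r show ?thesis by (simp add: filterlim_split_at)
qed

lemma flat_exp_DERIV:
  "(flat_exp m has_real_derivative flat_exp (m + 2) t - real m * flat_exp (Suc m) t) (at t)"
proof (cases "t = 0")
  case True
  \<comment> \<open>The difference quotient at \<open>0\<close> is \<open>flat_exp (Suc m)\<close>,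
    so its limit is already known.\<close>
  have "((\<lambda>h. (flat_exp m h - flat_exp m 0) / (h - 0)) \<longlongrightarrow> 0) (at 0)"
    by (rule Lim_transform_eventually[OF flat_exp_tendsto_0[of "Suc m"]])
      (auto simp: flat_exp_def field_simps)
  then show ?thesis using True by (simp add: has_field_derivative_iff flat_exp_def)
next
  case False
  show ?thesis
  proof (cases "0 < t")
    case True
    have "((\<lambda>t. exp (- inverse t) * inverse t ^ m) has_real_derivative
        exp (- inverse t) * inverse t ^ (m + 2) - real m * (exp (- inverse t) * inverse t ^ Suc m)) (at t)"
    proof (cases m)
      case 0
      then show ?thesis
        using True by (auto intro!: derivative_eq_intros simp: field_simps power2_eq_square)
    next
      case (Suc l)
      have "((\<lambda>t. exp (- inverse t) * inverse t ^ Suc l) has_real_derivative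
        exp (- inverse t) * (inverse t * inverse t) * inverse t ^ Suc l
        + exp (- inverse t) * (real (Suc l) * inverse t ^ l * (- (inverse t * inverse t)))) (at t)"
        by (rule derivative_eq_intros refl | use True in simp)+
      then show ?thesis by (simp add: Suc algebra_simps)
    qed
    then have "(flat_exp m has_real_derivative
        exp (- inverse t) * inverse t ^ (m + 2) - real m * (exp (- inverse t) * inverse t ^ Suc m)) (at t)"
      by (rule has_field_derivative_transform_within_open[where S = "{0<..}"])
        (use True in \<open>auto simp: flat_exp_def\<close>)
    then show ?thesis using True by (simp add: flat_exp_def)
  next
    case neg: False
    have "(flat_exp m has_real_derivative 0) (at t)"
      by (rule has_field_derivative_transform_within_open[OF DERIV_const, where S = "{..<0}"])
        (use neg False in \<open>auto simp: flat_exp_def\<close>)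
    then show ?thesis using neg by (simp add: flat_exp_def)
  qed
qed

lemma smooth_on_flat_exp: "smooth_on UNIV (flat_exp m)"
proof -
  have "Ck_on n UNIV (flat_exp m)" for n m
  proof (induction n arbitrary: m)
    case 0
    show ?case using DERIV_isCont[OF flat_exp_DERIV] by (auto intro!: continuous_at_imp_continuous_on)
  next
    case (Suc n)
    have "Ck_on n UNIV (\<lambda>t. flat_exp (m + 2) t + (- real m) * flat_exp (Suc m) t)"
      using Suc by (intro Ck_on_add Ck_on_mult Ck_on_const) auto
    then show ?case
      by (rule Ck_on_SucI_DERIV[rotated 2]) (use flat_exp_DERIV in auto)
  qed
  then show ?thesis by (simp add: smooth_on_def)
qed

definition smooth_step :: "real \<Rightarrow> real" where
  "smooth_step t = flat_exp 0 t / (flat_exp 0 t + flat_exp 0 (1 - t))"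

lemma smooth_step_denominator: "flat_exp 0 t + flat_exp 0 (1 - t) > 0"
  by (auto simp: flat_exp_def add_pos_pos)

lemma smooth_step_eq: "t \<le> 0 \<Longrightarrow> smooth_step t = 0" "1 \<le> t \<Longrightarrow> smooth_step t = 1"
  by (auto simp: smooth_step_def flat_exp_def)

lemma smooth_on_smooth_step: "smooth_on UNIV smooth_step"
proof -
  have "smooth_on UNIV (\<lambda>t::real. flat_exp 0 (1 - t))"
    by (rule smooth_on_compose[OF smooth_on_flat_exp]) (auto intro!: smooth_intros)
  then show ?thesis unfolding smooth_step_def[abs_def]
    using smooth_step_denominator smooth_on_flat_exp
    by (intro smooth_intros) (auto simp: less_imp_neq[symmetric])
qed

text \<open>The compact set \<open>K\<close> between the neighbourhood and \<open>N\<close> is what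
  makes extension by zero work: a function on \<open>N\<close> multiplied by \<open>\<eta>\<close>
  vanishes off a closed subset of \<open>N\<close>.\<close>

lemma smooth_bump:
  fixes x :: "'a::euclidean_space"
  assumes "open N" "x \<in> N"
  obtains \<eta> N' K where "smooth_on UNIV \<eta>" "open N'" "x \<in> N'" "compact K" "N' \<subseteq> K" "K \<subseteq> N"
    "\<And>y. y \<in> N' \<Longrightarrow> \<eta> y = 1" "\<And>y. y \<notin> K \<Longrightarrow> \<eta> y = 0"
proof -
  obtain r where r: "r > 0" "cball x r \<subseteq> N" using assms open_contains_cball by blast
  \<comment> \<open>The squared distance from \<open>x\<close>, written in coordinates so that its
    smoothness is visible.\<close>
  define s where "s y = (\<Sum>b\<in>Basis. (y \<bullet> b - x \<bullet> b)^2)" for y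
  have s: "s y = (dist x y)^2" for y
  proof -
    have "(dist x y)^2 = (x - y) \<bullet> (x - y)" by (simp add: dist_norm power2_norm_eq_inner)
    also have "\<dots> = s y"
      unfolding s_def by (subst euclidean_inner) (simp add: inner_diff_left power2_eq_square algebra_simps)
    finally show ?thesis by simp
  qed
  \<comment> \<open>The argument of the step function is at least \<open>1\<close> when the squared
    distance is at most \<open>r^2 / 2\<close>, and at most \<open>0\<close> when it is at least
    \<open>r^2\<close>; hence the two radii.\<close>
  define \<eta> where "\<eta> y = smooth_step (2 - 2 / r^2 * s y)" for y
  show ?thesis
  proof (rule that[of \<eta> "ball x (r / sqrt 2)" "cball x r"])
    show "smooth_on UNIV \<eta>" unfolding \<eta>_def[abs_def] s_def
      by (rule smooth_on_compose[OF smooth_on_smooth_step])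
        (use r(1) in \<open>auto intro!: smooth_intros\<close>)
    have "r / sqrt 2 \<le> r" using r(1) by (simp add: divide_le_eq)
    then show "ball x (r / sqrt 2) \<subseteq> cball x r" by auto
    show "\<eta> y = 1" if "y \<in> ball x (r / sqrt 2)" for y
    proof -
      have "dist x y ^ 2 \<le> (r / sqrt 2)^2"
        using that by (intro power_mono) auto
      then show ?thesis using r(1) by (auto simp: \<eta>_def s field_simps intro!: smooth_step_eq)
    qed
    show "\<eta> y = 0" if "y \<notin> cball x r" for y
    proof -
      have "r ^ 2 \<le> dist x y ^ 2"
        using that r(1) by (intro power_mono) auto
      then show ?thesis using r(1) by (auto simp: \<eta>_def s field_simps intro!: smooth_step_eq)
    qed
  qed (use r in auto)
qed

section \<open>Smooth spaces with bump functions\<close>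

text \<open>The working interface: an algebra of functions with bump functions for its own initial
  topology, in which smoothness is a local property. It passes to arbitrary subsets, so it applies
  to the surface and to its half before these are known to be manifolds.\<close>

definition nice_space :: "'a smooth_space \<Rightarrow> bool" where
  "nice_space X \<longleftrightarrow>
     smooth_funs X \<subseteq> extensional (points X) \<and>
     (\<forall>c. (\<lambda>t\<in>points X. c) \<in> smooth_funs X) \<and>
     (\<forall>f\<in>smooth_funs X. \<forall>g\<in>smooth_funs X. \<forall>a.
        (\<lambda>t\<in>points X. f t * g t) \<in> smooth_funs X \<and> (\<lambda>t\<in>points X. a * f t + g t) \<in> smooth_funs X) \<and>
     (\<forall>U s. openin (space_topology X) U \<and> s \<in> U \<longrightarrow> (\<exists>f\<in>smooth_funs X. \<exists>W.
        openin (space_topology X) W \<and> s \<in> W \<and> W \<subseteq> U \<and> (\<forall>t\<in>W. f t = 1) \<and>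
        (\<forall>t\<in>points X - U. f t = 0))) \<and>
     (\<forall>f\<in>extensional (points X). (\<forall>s\<in>points X. \<exists>W. \<exists>F\<in>smooth_funs X.
        openin (space_topology X) W \<and> s \<in> W \<and> (\<forall>t\<in>W. f t = F t)) \<longrightarrow> f \<in> smooth_funs X)"

lemma nice_extensional: "nice_space X \<Longrightarrow> f \<in> smooth_funs X \<Longrightarrow> f \<in> extensional (points X)"
  by (auto simp: nice_space_def)

lemma nice_const: "nice_space X \<Longrightarrow> (\<lambda>t\<in>points X. c) \<in> smooth_funs X"
  by (simp add: nice_space_def)

lemma nice_mult: "nice_space X \<Longrightarrow> f \<in> smooth_funs X \<Longrightarrow> g \<in> smooth_funs X \<Longrightarrow>
    (\<lambda>t\<in>points X. f t * g t) \<in> smooth_funs X"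
  by (simp add: nice_space_def)

lemma nice_lin: "nice_space X \<Longrightarrow> f \<in> smooth_funs X \<Longrightarrow> g \<in> smooth_funs X \<Longrightarrow>
    (\<lambda>t\<in>points X. a * f t + g t) \<in> smooth_funs X"
  by (simp add: nice_space_def)

lemma nice_bump:
  assumes "nice_space X" "openin (space_topology X) U" "s \<in> U"
  obtains f W where "f \<in> smooth_funs X" "openin (space_topology X) W" "s \<in> W" "W \<subseteq> U"
    "\<And>t. t \<in> W \<Longrightarrow> f t = 1" "\<And>t. t \<in> points X - U \<Longrightarrow> f t = 0"
proof -
  have "\<exists>f\<in>smooth_funs X. \<exists>W. openin (space_topology X) W \<and> s \<in> W \<and> W \<subseteq> U \<and> (\<forall>t\<in>W. f t = 1) \<and>
      (\<forall>t\<in>points X - U. f t = 0)"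
    using assms by (simp add: nice_space_def)
  then show ?thesis using that by blast
qed

lemma nice_localI:
  assumes "nice_space X" "f \<in> extensional (points X)"
    and "\<And>s. s \<in> points X \<Longrightarrow> \<exists>W. \<exists>F\<in>smooth_funs X.
        openin (space_topology X) W \<and> s \<in> W \<and> (\<forall>t\<in>W. f t = F t)"
  shows "f \<in> smooth_funs X"
  using assms by (simp add: nice_space_def)

section \<open>The initial topology and the passage to subsets\<close>

lemma space_topology_generator:
  "f \<in> smooth_funs X \<Longrightarrow> open V \<Longrightarrow> openin (space_topology X) (points X \<inter> f -` V)"
  unfolding space_topology_def by (intro topology_generated_by_Basis) blast

text \<open>Minimality of the initial topology. Topologies are compared through it by exhibiting a
  topology \<open>T\<close> for which the smooth functions are continuous.\<close>

lemma space_topology_least: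
  assumes "\<And>f V. f \<in> smooth_funs X \<Longrightarrow> open V \<Longrightarrow> openin T (points X \<inter> f -` V)"
    and "openin (space_topology X) U"
  shows "openin T U"
proof -
  have "generate_topology_on {points X \<inter> f -` V |f V. f \<in> smooth_funs X \<and> open V} U"
    using assms(2) by (simp add: space_topology_def openin_topology_generated_by_iff)
  then show ?thesis by induction (use assms(1) in auto)
qed

lemma topspace_space_topology: "smooth_funs X \<noteq> {} \<Longrightarrow> topspace (space_topology X) = points X"
  unfolding space_topology_def topology_generated_by_topspace by (auto intro: open_UNIV)

lemma nice_topspace: "nice_space X \<Longrightarrow> topspace (space_topology X) = points X"
  using nice_const topspace_space_topology by blast

lemma smooth_subspace_sel [simp]:
  "points (smooth_subspace X S) = S"
  "f \<in> smooth_funs (smooth_subspace X S) \<longleftrightarrow> f \<in> extensional S \<and>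
     (\<forall>s\<in>S. \<exists>W F. openin (space_topology X) W \<and> s \<in> W \<and>
               F \<in> smooth_funs X \<and> (\<forall>t\<in>W \<inter> S. f t = F t))"
  by (simp_all add: smooth_subspace_def)

lemma smooth_subspace_restrict:
  "nice_space X \<Longrightarrow> S \<subseteq> points X \<Longrightarrow> F \<in> smooth_funs X \<Longrightarrow> restrict F S \<in> smooth_funs (smooth_subspace X S)"
  using openin_topspace[of "space_topology X"] nice_topspace[of X] by fastforce

text \<open>A subset carries two topologies: the initial one of its own smooth functions and the
  trace of the ambient one. Local ambient extensions give one inclusion, restrictions of global
  functions the other.\<close>

lemma subspace_topology:
  assumes "nice_space X" "S \<subseteq> points X"
  shows "space_topology (smooth_subspace X S) = subtopology (space_topology X) S" (is "?T = ?T'")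
  unfolding topology_eq
proof (intro allI iffI)
  fix U assume U: "openin ?T U"
  show "openin ?T' U"
  proof (rule space_topology_least[OF _ U])
    fix f and V :: "real set" assume f: "f \<in> smooth_funs (smooth_subspace X S)" and V: "open V"
    show "openin ?T' (points (smooth_subspace X S) \<inter> f -` V)"
    proof (subst openin_subopen, safe)
      fix s assume s: "s \<in> points (smooth_subspace X S)" "f s \<in> V"
      then obtain W F where WF: "openin (space_topology X) W" "s \<in> W" "F \<in> smooth_funs X"
        "\<forall>t\<in>W \<inter> S. f t = F t" using f by auto
      have "openin (space_topology X) (W \<inter> (points X \<inter> F -` V))"
        using WF V space_topology_generator by blast
      then have "openin ?T' (W \<inter> (points X \<inter> F -` V) \<inter> S)"
        by (metis openin_subtopology)
      then show "\<exists>T. openin ?T' T \<and> s \<in> T \<and> T \<subseteq> points (smooth_subspace X S) \<inter> f -` V"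
        using WF s assms(2) by (intro exI[of _ "W \<inter> (points X \<inter> F -` V) \<inter> S"]) auto
    qed
  qed
next
  fix U assume "openin ?T' U"
  then obtain U0 where U0: "openin (space_topology X) U0" "U = U0 \<inter> S" by (metis openin_subtopology)
  have "topspace ?T = S"
    using smooth_subspace_restrict[OF assms nice_const[OF assms(1), of 0]]
      topspace_space_topology[of "smooth_subspace X S"] by (metis empty_iff smooth_subspace_sel(1))
  then have S: "openin ?T S" by (metis openin_empty openin_topspace)
  \<comment> \<open>Its open sets are those whose trace on \<open>S\<close> is open for the initial
    topology of the subspace. All smooth functions of \<open>X\<close> are continuous for it, so it
    contains the topology of \<open>X\<close>.\<close>
  let ?TS = "topology (\<lambda>A. A \<subseteq> points X \<and> openin ?T (A \<inter> S))"
  have T0: "openin ?TS A \<longleftrightarrow> A \<subseteq> points X \<and> openin ?T (A \<inter> S)" for A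
  proof -
    have "istopology (\<lambda>A. A \<subseteq> points X \<and> openin ?T (A \<inter> S))"
      unfolding istopology_def
    proof (intro conjI allI impI)
      fix A B assume "A \<subseteq> points X \<and> openin ?T (A \<inter> S)" "B \<subseteq> points X \<and> openin ?T (B \<inter> S)"
      then have "openin ?T ((A \<inter> S) \<inter> (B \<inter> S))" by blast
      then show "openin ?T (A \<inter> B \<inter> S)" by (simp add: Int_ac Int_left_absorb)
    next
      fix K assume "\<forall>A\<in>K. A \<subseteq> points X \<and> openin ?T (A \<inter> S)"
      then show "openin ?T (\<Union> K \<inter> S)"
        unfolding Int_Union2 by (intro openin_Union) auto
    qed auto
    from topology_inverse'[OF this] show ?thesis by simp
  qed
  have "openin ?TS U0"
  proof (rule space_topology_least[OF _ U0(1)])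
    fix f and V :: "real set" assume f: "f \<in> smooth_funs X" and V: "open V"
    have "points X \<inter> f -` V \<inter> S = points (smooth_subspace X S) \<inter> restrict f S -` V"
      using assms(2) by auto
    then show "openin ?TS (points X \<inter> f -` V)"
      using space_topology_generator[OF smooth_subspace_restrict[OF assms f] V] T0 by auto
  qed
  then show "openin ?T U" using T0 U0 by auto
qed

lemma nice_subspace:
  assumes "nice_space X" "S \<subseteq> points X"
  shows "nice_space (smooth_subspace X S)"
proof -
  note top = subspace_topology[OF assms]
  note const = smooth_subspace_restrict[OF assms nice_const[OF assms(1)]]
  show ?thesis
    unfolding nice_space_def top
  proof (intro conjI allI ballI impI)
    show "smooth_funs (smooth_subspace X S) \<subseteq> extensional (points (smooth_subspace X S))" by auto
    show "(\<lambda>t\<in>points (smooth_subspace X S). c) \<in> smooth_funs (smooth_subspace X S)" for c :: real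
    proof -
      have "restrict (\<lambda>t\<in>points X. c) S = (\<lambda>t\<in>S. c)" using assms(2) by (intro ext) (auto simp: restrict_def)
      then show ?thesis using const[of c] by simp
    qed
  next
    fix f g and a :: real
    assume f: "f \<in> smooth_funs (smooth_subspace X S)" and g: "g \<in> smooth_funs (smooth_subspace X S)"
    have ex: "\<exists>W F G. openin (space_topology X) W \<and> s \<in> W \<and> F \<in> smooth_funs X \<and> G \<in> smooth_funs X \<and>
        (\<forall>t\<in>W \<inter> S. f t = F t \<and> g t = G t)" if s: "s \<in> S" for s
    proof -
      obtain W F where 1: "openin (space_topology X) W" "s \<in> W" "F \<in> smooth_funs X" "\<forall>t\<in>W \<inter> S. f t = F t"
        using f s by auto
      obtain W' G where 2: "openin (space_topology X) W'" "s \<in> W'" "G \<in> smooth_funs X" "\<forall>t\<in>W' \<inter> S. g t = G t"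
        using g s by auto
      show ?thesis by (rule exI[of _ "W \<inter> W'"], rule exI[of _ F], rule exI[of _ G]) (use 1 2 in auto)
    qed
    have "\<exists>W H. openin (space_topology X) W \<and> s \<in> W \<and> H \<in> smooth_funs X \<and> (\<forall>t\<in>W \<inter> S. f t * g t = H t)"
      if s: "s \<in> S" for s
    proof -
      obtain W F G where W: "openin (space_topology X) W" "s \<in> W" "F \<in> smooth_funs X" "G \<in> smooth_funs X"
        "\<forall>t\<in>W \<inter> S. f t = F t \<and> g t = G t" using ex[OF s] by blast
      show ?thesis
        by (rule exI[of _ W], rule exI[of _ "\<lambda>t\<in>points X. F t * G t"])
          (use W nice_mult[OF assms(1)] assms(2) in auto)
    qed
    then show "(\<lambda>t\<in>points (smooth_subspace X S). f t * g t) \<in> smooth_funs (smooth_subspace X S)"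
      by (auto simp: Ball_def)
    have "\<exists>W H. openin (space_topology X) W \<and> s \<in> W \<and> H \<in> smooth_funs X \<and> (\<forall>t\<in>W \<inter> S. a * f t + g t = H t)"
      if s: "s \<in> S" for s
    proof -
      obtain W F G where W: "openin (space_topology X) W" "s \<in> W" "F \<in> smooth_funs X" "G \<in> smooth_funs X"
        "\<forall>t\<in>W \<inter> S. f t = F t \<and> g t = G t" using ex[OF s] by blast
      show ?thesis
        by (rule exI[of _ W], rule exI[of _ "\<lambda>t\<in>points X. a * F t + G t"])
          (use W nice_lin[OF assms(1)] assms(2) in auto)
    qed
    then show "(\<lambda>t\<in>points (smooth_subspace X S). a * f t + g t) \<in> smooth_funs (smooth_subspace X S)"
      by (auto simp: Ball_def)
  next
    fix U s assume "openin (subtopology (space_topology X) S) U \<and> s \<in> U"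
    then obtain U0 where U0: "openin (space_topology X) U0" "U = U0 \<inter> S" "s \<in> U" by (metis openin_subtopology)
    obtain f W where f: "f \<in> smooth_funs X" "openin (space_topology X) W" "s \<in> W" "W \<subseteq> U0"
      "\<And>t. t \<in> W \<Longrightarrow> f t = 1" "\<And>t. t \<in> points X - U0 \<Longrightarrow> f t = 0"
      by (rule nice_bump[OF assms(1) U0(1), of s]) (use U0 in auto)
    show "\<exists>f\<in>smooth_funs (smooth_subspace X S). \<exists>W. openin (subtopology (space_topology X) S) W \<and>
        s \<in> W \<and> W \<subseteq> U \<and> (\<forall>t\<in>W. f t = 1) \<and> (\<forall>t\<in>points (smooth_subspace X S) - U. f t = 0)"
    proof (intro bexI[OF _ smooth_subspace_restrict[OF assms f(1)]] exI[of _ "W \<inter> S"] conjI)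
      show "openin (subtopology (space_topology X) S) (W \<inter> S)" using f(2) by (metis openin_subtopology)
    qed (use f U0 assms(2) in auto)
  next
    fix f assume f: "f \<in> extensional (points (smooth_subspace X S))"
      and loc: "\<forall>s\<in>points (smooth_subspace X S). \<exists>W. \<exists>F\<in>smooth_funs (smooth_subspace X S).
        openin (subtopology (space_topology X) S) W \<and> s \<in> W \<and> (\<forall>t\<in>W. f t = F t)"
    have "\<exists>W F. openin (space_topology X) W \<and> s \<in> W \<and> F \<in> smooth_funs X \<and> (\<forall>t\<in>W \<inter> S. f t = F t)"
      if s: "s \<in> S" for s
    proof -
      obtain W F where W: "openin (subtopology (space_topology X) S) W" "s \<in> W"
        "F \<in> smooth_funs (smooth_subspace X S)" "\<forall>t\<in>W. f t = F t" using loc s unfolding smooth_subspace_sel(1) by meson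
      obtain W0 where W0: "openin (space_topology X) W0" "W = W0 \<inter> S" using W(1) by (metis openin_subtopology)
      obtain W1 G where W1: "openin (space_topology X) W1" "s \<in> W1" "G \<in> smooth_funs X" "\<forall>t\<in>W1 \<inter> S. F t = G t"
        using W(3) s by auto
      show ?thesis by (rule exI[of _ "W0 \<inter> W1"], rule exI[of _ G]) (use W W0 W1 in auto)
    qed
    then show "f \<in> smooth_funs (smooth_subspace X S)" using f by simp
  qed
qed

lemma subspace_subspace:
  assumes "nice_space X" "S \<subseteq> points X" "T \<subseteq> S"
  shows "smooth_subspace (smooth_subspace X S) T = smooth_subspace X T"
proof -
  have "f \<in> smooth_funs (smooth_subspace (smooth_subspace X S) T) \<longleftrightarrow> f \<in> smooth_funs (smooth_subspace X T)" for f
  proof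
    assume f: "f \<in> smooth_funs (smooth_subspace (smooth_subspace X S) T)"
    have "\<exists>W F. openin (space_topology X) W \<and> s \<in> W \<and> F \<in> smooth_funs X \<and> (\<forall>t\<in>W \<inter> T. f t = F t)"
      if s: "s \<in> T" for s
    proof -
      obtain W F where W: "openin (subtopology (space_topology X) S) W" "s \<in> W"
        "F \<in> smooth_funs (smooth_subspace X S)" "\<forall>t\<in>W \<inter> T. f t = F t"
        using f s unfolding smooth_subspace_sel(2)[of f] subspace_topology[OF assms(1,2)] by meson
      obtain W0 where W0: "openin (space_topology X) W0" "W = W0 \<inter> S" using W(1) by (metis openin_subtopology)
      obtain W1 G where W1: "openin (space_topology X) W1" "s \<in> W1" "G \<in> smooth_funs X" "\<forall>t\<in>W1 \<inter> S. F t = G t"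
        using W(3) s assms(3) unfolding smooth_subspace_sel(2) by blast
      show ?thesis by (rule exI[of _ "W0 \<inter> W1"], rule exI[of _ G]) (use W W0 W1 assms(3) in auto)
    qed
    then show "f \<in> smooth_funs (smooth_subspace X T)" using f by simp
  next
    assume f: "f \<in> smooth_funs (smooth_subspace X T)"
    have "\<exists>W F. openin (subtopology (space_topology X) S) W \<and> s \<in> W \<and> F \<in> smooth_funs (smooth_subspace X S) \<and> (\<forall>t\<in>W \<inter> T. f t = F t)"
      if s: "s \<in> T" for s
    proof -
      obtain W F where W: "openin (space_topology X) W" "s \<in> W" "F \<in> smooth_funs X" "\<forall>t\<in>W \<inter> T. f t = F t"
        using f s by auto
      have "openin (subtopology (space_topology X) S) (W \<inter> S)" using W(1) by (metis openin_subtopology)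
      then show ?thesis
        using W s assms smooth_subspace_restrict[OF assms(1,2) W(3)]
        by (intro exI[of _ "W \<inter> S"] exI[of _ "restrict F S"]) auto
    qed
    then show "f \<in> smooth_funs (smooth_subspace (smooth_subspace X S) T)"
      using f unfolding smooth_subspace_sel(2)[of f] subspace_topology[OF assms(1,2)] by blast
  qed
  then show ?thesis by (simp add: smooth_subspace_def set_eq_iff)
qed

lemma nice_subspace_self:
  assumes "nice_space X"
  shows "smooth_funs (smooth_subspace X (points X)) = smooth_funs X"
proof (intro set_eqI iffI)
  fix f assume f: "f \<in> smooth_funs (smooth_subspace X (points X))"
  show "f \<in> smooth_funs X"
  proof (rule nice_localI[OF assms])
    fix s assume "s \<in> points X"
    then obtain W F where W: "openin (space_topology X) W" "s \<in> W" "F \<in> smooth_funs X" "\<forall>t\<in>W \<inter> points X. f t = F t"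
      using f by auto
    have "W \<subseteq> points X" using W(1) nice_topspace[OF assms] by (metis openin_subset)
    then show "\<exists>W. \<exists>F\<in>smooth_funs X. openin (space_topology X) W \<and> s \<in> W \<and> (\<forall>t\<in>W. f t = F t)"
      using W by blast
  qed (use f in auto)
next
  fix f assume "f \<in> smooth_funs X"
  then show "f \<in> smooth_funs (smooth_subspace X (points X))"
    using smooth_subspace_restrict[OF assms order_refl] nice_extensional[OF assms] by (metis extensional_restrict)
qed

lemma smooth_fun_continuous:
  assumes "nice_space X" "f \<in> smooth_funs X"
  shows "continuous_map (space_topology X) euclideanreal f"
  unfolding continuous_map
  using space_topology_generator[OF assms(2)] nice_topspace[OF assms(1)]
  by (auto simp: vimage_def Int_def)

lemma smooth_funs_eq_on_closure:
  assumes "nice_space X" "f \<in> smooth_funs X" "g \<in> smooth_funs X"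
    and "\<And>s. s \<in> D \<Longrightarrow> f s = g s" "s \<in> space_topology X closure_of D"
  shows "f s = g s"
proof (rule forall_in_closure_of_eq[OF assms(5)])
  show "Hausdorff_space euclideanreal" by simp
qed (use assms smooth_fun_continuous in auto)

text \<open>Uniqueness by density; extensionality turns agreement at the points into equality of
  functions.\<close>

lemma smooth_map_closure_eq:
  assumes "nice_space X" "f \<in> smooth_funs X" "g \<in> smooth_funs X"
    and "\<And>s. s \<in> D \<Longrightarrow> f s = g s" "points X \<subseteq> space_topology X closure_of D"
  shows "f = g"
proof (rule extensionalityI)
  show "f \<in> extensional (points X)" "g \<in> extensional (points X)"
    using assms nice_extensional by auto
qed (use smooth_funs_eq_on_closure[OF assms(1-4)] assms(5) in blast)

subsection \<open>Locality of derivations and brackets\<close>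

lemma derivation_zero:
  assumes "nice_space X" "\<And>f g a. f \<in> smooth_funs X \<Longrightarrow> g \<in> smooth_funs X \<Longrightarrow> v (\<lambda>t\<in>points X. a * f t + g t) = a * v f + (v g :: real)"
  shows "v (\<lambda>t\<in>points X. 0) = 0"
proof -
  let ?c = "\<lambda>t\<in>points X. 0 :: real"
  have "(\<lambda>t\<in>points X. 1 * ?c t + ?c t) = ?c" by auto
  then show ?thesis
    using assms(2)[OF nice_const[OF assms(1), of 0] nice_const[OF assms(1), of 0], of 1] by simp
qed

text \<open>A bump function at \<open>s\<close> that vanishes off \<open>U\<close>, times
  \<open>f - g\<close>, is zero; the Leibniz rule at \<open>s\<close>, where \<open>f - g\<close>
  vanishes and the bump is \<open>1\<close>, leaves \<open>v (f - g) = 0\<close>. The assumptions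
  concern a single functional \<open>v\<close>, so that they fit tangent vectors as well as brackets
  with one argument fixed.\<close>

lemma derivation_local:
  assumes X: "nice_space X"
    and lin: "\<And>f g a. f \<in> smooth_funs X \<Longrightarrow> g \<in> smooth_funs X \<Longrightarrow> v (\<lambda>t\<in>points X. a * f t + g t) = a * v f + (v g :: real)"
    and prod: "\<And>f g. f \<in> smooth_funs X \<Longrightarrow> g \<in> smooth_funs X \<Longrightarrow> v (\<lambda>t\<in>points X. f t * g t) = f s * v g + g s * v f"
    and f: "f \<in> smooth_funs X" and g: "g \<in> smooth_funs X"
    and U: "openin (space_topology X) U" "s \<in> U" "\<And>t. t \<in> U \<Longrightarrow> f t = g t"
  shows "v f = v g"
proof -
  obtain \<eta> W where \<eta>: "\<eta> \<in> smooth_funs X" "s \<in> W" "W \<subseteq> U"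
    "\<And>t. t \<in> W \<Longrightarrow> \<eta> t = 1" "\<And>t. t \<in> points X - U \<Longrightarrow> \<eta> t = 0"
    using nice_bump[OF X U(1,2)] by metis
  define d where "d = (\<lambda>t\<in>points X. (-1) * g t + f t)"
  have d: "d \<in> smooth_funs X" unfolding d_def by (rule nice_lin[OF X g f])
  have s: "s \<in> points X" using U nice_topspace[OF X] openin_subset by fastforce
  have "(\<lambda>t\<in>points X. \<eta> t * d t) = (\<lambda>t\<in>points X. 0)" using U \<eta> by (force simp: d_def)
  then have "\<eta> s * v d + d s * v \<eta> = 0"
    using prod[OF \<eta>(1) d] derivation_zero[where v = v, OF X lin] by metis
  moreover have "d s = 0" using U s by (simp add: d_def)
  ultimately have "v d = 0" using \<eta> by simp
  moreover have "v d = -1 * v g + v f" unfolding d_def by (rule lin[OF g f])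
  ultimately show ?thesis by simp
qed

lemma poisson_bracketD:
  assumes "poisson_bracket X B" "f \<in> smooth_funs X" "g \<in> smooth_funs X" "h \<in> smooth_funs X" "s \<in> points X"
  shows "B f g \<in> smooth_funs X" "B f g s = - B g f s"
    "B (\<lambda>t\<in>points X. a * f t + g t) h s = a * B f h s + B g h s"
    "B (\<lambda>t\<in>points X. f t * g t) h s = f s * B g h s + g s * B f h s"
proof -
  have "B \<in> smooth_funs X \<rightarrow>\<^sub>E (smooth_funs X \<rightarrow>\<^sub>E smooth_funs X)"
    using assms(1) unfolding poisson_bracket_def by (rule conjunct1)
  from PiE_mem[OF PiE_mem[OF this assms(2)] assms(3)] show "B f g \<in> smooth_funs X" .
  show "B f g s = - B g f s" using assms unfolding poisson_bracket_def by blast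
  show "B (\<lambda>t\<in>points X. a * f t + g t) h s = a * B f h s + B g h s"
    "B (\<lambda>t\<in>points X. f t * g t) h s = f s * B g h s + g s * B f h s"
    using assms unfolding poisson_bracket_def by blast+
qed

lemma tangent_vector_local:
  assumes "nice_space X" "v \<in> tangent_vectors X s" "f \<in> smooth_funs X" "g \<in> smooth_funs X"
    "openin (space_topology X) U" "s \<in> U" "\<And>t. t \<in> U \<Longrightarrow> f t = g t"
  shows "v f = v g"
proof -
  have lin: "\<And>f g a. f \<in> smooth_funs X \<Longrightarrow> g \<in> smooth_funs X \<Longrightarrow> v (\<lambda>t\<in>points X. a * f t + g t) = a * v f + v g"
    and prd: "\<And>f g. f \<in> smooth_funs X \<Longrightarrow> g \<in> smooth_funs X \<Longrightarrow> v (\<lambda>t\<in>points X. f t * g t) = f s * v g + g s * v f"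
    using assms(2) by (auto simp: tangent_vectors_def)
  show ?thesis
    by (rule derivation_local[where v = v and s = s and f = f and g = g and U = U and X = X])
      (fact assms lin prd)+
qed

lemma poisson_bracket_local:
  assumes X: "nice_space X" and B: "poisson_bracket X B"
    and "f \<in> smooth_funs X" "f' \<in> smooth_funs X" "g \<in> smooth_funs X" "g' \<in> smooth_funs X"
    and U: "openin (space_topology X) U" "s \<in> U" "\<And>t. t \<in> U \<Longrightarrow> f t = f' t" "\<And>t. t \<in> U \<Longrightarrow> g t = g' t"
  shows "B f g s = B f' g' s"
proof -
  have s: "s \<in> points X" using U nice_topspace[OF X] openin_subset by fastforce
  have loc: "B f g s = B f' g s" if "f \<in> smooth_funs X" "f' \<in> smooth_funs X" "g \<in> smooth_funs X"
    "\<And>t. t \<in> U \<Longrightarrow> f t = f' t" for f f' g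
    by (rule derivation_local[OF X poisson_bracketD(3)[OF B _ _ that(3) s]
          poisson_bracketD(4)[OF B _ _ that(3) s] that(1,2) U(1,2) that(4)])
  have anti: "B f g s = - B g f s" if "f \<in> smooth_funs X" "g \<in> smooth_funs X" for f g
    using poisson_bracketD(2)[OF B that that(1) s] .
  show ?thesis using loc[of f f' g] loc[of g g' f'] anti[of f' g] anti[of f' g'] assms by simp
qed

lemma tangent_vector_const:
  assumes "nice_space X" "v \<in> tangent_vectors X s" "s \<in> points X"
  shows "v (\<lambda>t\<in>points X. c) = 0"
proof -
  have l: "v (\<lambda>t\<in>points X. a * f t + g t) = a * v f + v g"
    and p: "v (\<lambda>t\<in>points X. f t * g t) = f s * v g + g s * v f"
    if "f \<in> smooth_funs X" "g \<in> smooth_funs X" for f g a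
    using assms(2) that by (auto simp: tangent_vectors_def)
  let ?c = "\<lambda>c. \<lambda>t\<in>points X. c :: real"
  \<comment> \<open>The constant \<open>1\<close> is its own square, which forces its image to be
    twice itself.\<close>
  have "(\<lambda>t\<in>points X. ?c 1 t * ?c 1 t) = ?c 1" "(\<lambda>t\<in>points X. c * ?c 1 t + ?c 0 t) = ?c c" by auto
  then have "v (?c 1) = 0" "v (?c c) = c * v (?c 1) + v (?c 0)"
    using p[OF nice_const[OF assms(1), of 1] nice_const[OF assms(1), of 1]]
      l[OF nice_const[OF assms(1), of 1] nice_const[OF assms(1), of 0], of c] assms(3) by simp_all
  moreover have "v (?c 0) = 0" using derivation_zero[OF assms(1), of v] l by blast
  ultimately show ?thesis by simp
qed

section \<open>Charts\<close>

text \<open>Smoothness of the inverse is encoded by the last clause: every smooth function of the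
  coordinates is, near a given point, the restriction of a global smooth function.\<close>

definition is_chart :: "'a smooth_space \<Rightarrow> 'e::euclidean_space set \<Rightarrow> ('e \<Rightarrow> 'a) \<Rightarrow> bool" where
  "is_chart X V g \<longleftrightarrow> open V \<and> inj_on g V \<and>
     (\<forall>U. openin (space_topology X) U \<longrightarrow> open {w\<in>V. g w \<in> U}) \<and>
     (\<forall>N. open N \<and> N \<subseteq> V \<longrightarrow> openin (space_topology X) (g ` N)) \<and>
     (\<forall>F\<in>smooth_funs X. smooth_on V (\<lambda>w. F (g w))) \<and>
     (\<forall>N \<phi> w. open N \<and> N \<subseteq> V \<and> w \<in> N \<and> smooth_on N \<phi> \<longrightarrow>
        (\<exists>F\<in>smooth_funs X. \<exists>N'. open N' \<and> w \<in> N' \<and> N' \<subseteq> N \<and> (\<forall>v\<in>N'. F (g v) = \<phi> v)))"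

lemma chart_open: "is_chart X V g \<Longrightarrow> open V"
  and chart_inj: "is_chart X V g \<Longrightarrow> inj_on g V"
  and chart_preimage: "is_chart X V g \<Longrightarrow> openin (space_topology X) U \<Longrightarrow> open {w\<in>V. g w \<in> U}"
  and chart_image: "is_chart X V g \<Longrightarrow> open N \<Longrightarrow> N \<subseteq> V \<Longrightarrow> openin (space_topology X) (g ` N)"
  and chart_smooth: "is_chart X V g \<Longrightarrow> F \<in> smooth_funs X \<Longrightarrow> smooth_on V (\<lambda>w. F (g w))"
  by (auto simp: is_chart_def)

lemma chart_extend:
  assumes "is_chart X V g" "open N" "N \<subseteq> V" "w \<in> N" "smooth_on N \<phi>"
  obtains F N' where "F \<in> smooth_funs X" "open N'" "w \<in> N'" "N' \<subseteq> N" "\<And>v. v \<in> N' \<Longrightarrow> F (g v) = \<phi> v"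
proof -
  have "\<exists>F\<in>smooth_funs X. \<exists>N'. open N' \<and> w \<in> N' \<and> N' \<subseteq> N \<and> (\<forall>v\<in>N'. F (g v) = \<phi> v)"
    using assms by (simp add: is_chart_def)
  then show ?thesis using that by blast
qed

lemma smooth_subspaceD:
  assumes "f \<in> smooth_funs (smooth_subspace X S)" "is_chart X V g" "w \<in> V" "g w \<in> S"
  obtains N \<phi> where "open N" "w \<in> N" "N \<subseteq> V" "smooth_on N \<phi>" "\<And>v. v \<in> N \<Longrightarrow> g v \<in> S \<Longrightarrow> f (g v) = \<phi> v"
proof -
  obtain W F where W: "openin (space_topology X) W" "g w \<in> W" "F \<in> smooth_funs X" "\<forall>t\<in>W \<inter> S. f t = F t"
    using assms by auto
  have "smooth_on {v\<in>V. g v \<in> W} (\<lambda>v. F (g v))"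
    by (rule smooth_on_subset[OF chart_smooth[OF assms(2) W(3)]]) auto
  then show ?thesis
    using W assms(3) chart_preimage[OF assms(2) W(1)]
    by (intro that[of "{v\<in>V. g v \<in> W}" "\<lambda>v. F (g v)"]) auto
qed

text \<open>Smoothness on a subset is tested in coordinates on a full open set of the ambient space,
  where \<open>\<phi>\<close> is constrained only at the parameters of points of \<open>S\<close>.
  The chart may be chosen anew at every point.\<close>

lemma smooth_subspaceI:
  fixes X :: "'a smooth_space"
  assumes "f \<in> extensional S"
    and "\<And>s. s \<in> S \<Longrightarrow> \<exists>V g w N \<phi>. is_chart X V g \<and> s = g w \<and> open N \<and> w \<in> N \<and> N \<subseteq> V \<and>
       smooth_on N (\<phi> :: 'e::euclidean_space \<Rightarrow> real) \<and> (\<forall>v\<in>N. g v \<in> S \<longrightarrow> f (g v) = \<phi> v)"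
  shows "f \<in> smooth_funs (smooth_subspace X S)"
proof -
  have "\<exists>W F. openin (space_topology X) W \<and> s \<in> W \<and> F \<in> smooth_funs X \<and> (\<forall>t\<in>W \<inter> S. f t = F t)"
    if s: "s \<in> S" for s
  proof -
    obtain V and g :: "'e \<Rightarrow> 'a" and w N and \<phi> :: "'e \<Rightarrow> real" where c: "is_chart X V g" "s = g w" "open N" "w \<in> N" "N \<subseteq> V" "smooth_on N \<phi>"
      "\<forall>v\<in>N. g v \<in> S \<longrightarrow> f (g v) = \<phi> v" using assms(2)[OF s] by blast
    obtain F N' where F: "F \<in> smooth_funs X" "open N'" "w \<in> N'" "N' \<subseteq> N" "\<And>v. v \<in> N' \<Longrightarrow> F (g v) = \<phi> v"
      using chart_extend[OF c(1,3,5,4,6)] by metis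
    have "openin (space_topology X) (g ` N')" using chart_image[OF c(1) F(2)] F(4) c(5) by blast
    moreover have "\<forall>t\<in>g ` N' \<inter> S. f t = F t" using F(4,5) c(7) by auto
    ultimately show ?thesis using F(1,3) c(2) by blast
  qed
  then show ?thesis using assms(1) by simp
qed

text \<open>\<open>\<pi>\<close> and \<open>\<rho>\<close> are smooth on open sets, but mutually
  inverse only between the part of \<open>S\<close> in the chart and \<open>H\<close>. This is how a
  surface with boundary in three-space acquires charts onto pieces of a half-plane.\<close>

lemma chart_diffeomorphism:
  fixes g :: "'e::euclidean_space \<Rightarrow> 'a" and \<pi> :: "'e \<Rightarrow> 'd::euclidean_space"
  assumes c: "is_chart X V g" and euc: "is_chart euclidean_smooth UNIV (\<lambda>a::'d. a)"
    and N: "open N" "N \<subseteq> V" and \<pi>: "smooth_vec N \<pi>" and Q: "open Q" "H \<subseteq> Q" "smooth_vec Q \<rho>"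
    and fwd: "\<And>w. w \<in> N \<Longrightarrow> g w \<in> S \<Longrightarrow> \<pi> w \<in> H \<and> \<rho> (\<pi> w) = w"
    and bwd: "\<And>a. a \<in> H \<Longrightarrow> \<rho> a \<in> N \<and> g (\<rho> a) \<in> S \<and> \<pi> (\<rho> a) = a"
  shows "diffeomorphism (smooth_subspace X (g ` N \<inter> S)) (smooth_subspace euclidean_smooth H)
           (\<lambda>s. \<pi> (inv_into V g s))"
proof -
  let ?h = "\<lambda>s. \<pi> (inv_into V g s)" and ?W = "g ` N \<inter> S"
  have hg: "?h (g w) = \<pi> w" if "w \<in> N" for w
    using that N chart_inj[OF c] by (simp add: inv_into_f_f subset_iff)
  have "inj_on ?h ?W"
    using hg fwd by (intro inj_onI) (metis IntE imageE)
  moreover have "?h ` ?W = H"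
  proof
    show "H \<subseteq> ?h ` ?W" using bwd hg by (force intro!: image_eqI[where x = "g (\<rho> _)"])
  qed (use hg fwd in auto)
  ultimately have bij: "bij_betw ?h ?W H" by (simp add: bij_betw_def)
  have inv: "inv_into ?W ?h a = g (\<rho> a)" if "a \<in> H" for a
    by (rule inv_into_f_eq) (use \<open>inj_on ?h ?W\<close> bwd[OF that] hg in auto)
  have sm1: "smooth_map (smooth_subspace X ?W) (smooth_subspace euclidean_smooth H) ?h"
    unfolding smooth_map_def
  proof (intro conjI ballI)
    show "?h \<in> points (smooth_subspace X ?W) \<rightarrow> points (smooth_subspace euclidean_smooth H)"
      using bij by (auto simp: bij_betw_def)
    fix F assume F: "F \<in> smooth_funs (smooth_subspace euclidean_smooth H)"
    show "compose (points (smooth_subspace X ?W)) F ?h \<in> smooth_funs (smooth_subspace X ?W)"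
    proof (rule smooth_subspaceI)
      fix s assume "s \<in> ?W"
      then obtain w where w: "w \<in> N" "s = g w" "g w \<in> S" by auto
      obtain M \<phi> where M: "open M" "\<pi> w \<in> M" "smooth_on M \<phi>" "\<And>v. v \<in> M \<Longrightarrow> v \<in> H \<Longrightarrow> F v = \<phi> v"
        using smooth_subspaceD[OF F euc, of "\<pi> w"] fwd[OF w(1,3)] by auto
      have o: "open (N \<inter> \<pi> -` M)"
        by (rule continuous_open_preimage[OF smooth_vec_continuous[OF \<pi>] N(1) M(1)])
      have "smooth_on (N \<inter> \<pi> -` M) (\<lambda>v. \<phi> (\<pi> v))"
        by (rule smooth_on_compose[OF M(3) smooth_vec_subset[OF \<pi>] o M(1)]) auto
      then show "\<exists>V g w N \<phi>. is_chart X V g \<and> s = g w \<and> open N \<and> w \<in> N \<and> N \<subseteq> V \<and> smooth_on N (\<phi> :: 'e \<Rightarrow> real) \<and>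
          (\<forall>v\<in>N. g v \<in> ?W \<longrightarrow> compose (points (smooth_subspace X ?W)) F ?h (g v) = \<phi> v)"
        using c w o N(2) M hg fwd
        by (intro exI[of _ V] exI[of _ g] exI[of _ w] exI[of _ "N \<inter> \<pi> -` M"] exI[of _ "\<lambda>v. \<phi> (\<pi> v)"])
          (auto simp: compose_def)
    qed (simp add: compose_def)
  qed
  have sm2: "smooth_map (smooth_subspace euclidean_smooth H) (smooth_subspace X ?W) (inv_into ?W ?h)"
    unfolding smooth_map_def
  proof (intro conjI ballI)
    show "inv_into ?W ?h \<in> points (smooth_subspace euclidean_smooth H) \<rightarrow> points (smooth_subspace X ?W)"
      using inv bwd by auto
    fix F assume F: "F \<in> smooth_funs (smooth_subspace X ?W)"
    show "compose (points (smooth_subspace euclidean_smooth H)) F (inv_into ?W ?h) \<in> smooth_funs (smooth_subspace euclidean_smooth H)"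
    proof (rule smooth_subspaceI)
      fix a assume a: "a \<in> H"
      have r: "\<rho> a \<in> V" "g (\<rho> a) \<in> ?W" using bwd[OF a] N by auto
      obtain M \<phi> where M: "open M" "\<rho> a \<in> M" "smooth_on M \<phi>" "\<And>v. v \<in> M \<Longrightarrow> g v \<in> ?W \<Longrightarrow> F (g v) = \<phi> v"
        by (rule smooth_subspaceD[OF F c r]) (rule that)
      have o: "open (Q \<inter> \<rho> -` M)"
        by (rule continuous_open_preimage[OF smooth_vec_continuous[OF Q(3)] Q(1) M(1)])
      have "smooth_on (Q \<inter> \<rho> -` M) (\<lambda>v. \<phi> (\<rho> v))"
        by (rule smooth_on_compose[OF M(3) smooth_vec_subset[OF Q(3)] o M(1)]) auto
      then show "\<exists>V g w N \<phi>. is_chart euclidean_smooth V g \<and> a = g w \<and> open N \<and> w \<in> N \<and> N \<subseteq> V \<and> smooth_on N (\<phi> :: 'd \<Rightarrow> real) \<and>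
          (\<forall>v\<in>N. g v \<in> H \<longrightarrow> compose (points (smooth_subspace euclidean_smooth H)) F (inv_into ?W ?h) (g v) = \<phi> v)"
        using euc a Q(2) o M inv bwd
        by (intro exI[of _ UNIV] exI[of _ "\<lambda>a. a"] exI[of _ a] exI[of _ "Q \<inter> \<rho> -` M"] exI[of _ "\<lambda>v. \<phi> (\<rho> v)"])
          (auto simp: compose_def)
    qed (simp add: compose_def)
  qed
  show ?thesis using bij sm1 sm2 by (simp add: diffeomorphism_def)
qed

section \<open>Euclidean space\<close>

lemma euclidean_smooth_sel [simp]:
  "points euclidean_smooth = UNIV" "smooth_funs euclidean_smooth = {f. smooth_on UNIV f}"
  by (simp_all add: euclidean_smooth_def)

lemma euclidean_topology [simp]: "space_topology euclidean_smooth = euclidean"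
  unfolding topology_eq
proof (intro allI iffI)
  fix U :: "'a set" assume "openin (space_topology euclidean_smooth) U"
  then show "openin euclidean U"
  proof (rule space_topology_least[rotated])
    fix f :: "'a \<Rightarrow> real" and V :: "real set" assume "f \<in> smooth_funs euclidean_smooth" "open V"
    then show "openin euclidean (points euclidean_smooth \<inter> f -` V)"
      using continuous_open_preimage[OF smooth_on_continuous, of UNIV f V] by (simp add: Int_commute)
  qed
next
  fix U :: "'a set" assume U: "openin euclidean U"
  show "openin (space_topology euclidean_smooth) U"
  proof (subst openin_subopen, safe)
    fix x assume "x \<in> U"
    then obtain \<eta> N' K where \<eta>: "smooth_on UNIV \<eta>" "x \<in> N'" "K \<subseteq> U"
      "\<And>y. y \<in> N' \<Longrightarrow> \<eta> y = 1" "\<And>y. y \<notin> K \<Longrightarrow> \<eta> y = 0"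
      using smooth_bump[of U x] U by (metis open_openin)
    have "openin (space_topology euclidean_smooth) (points euclidean_smooth \<inter> \<eta> -` (- {0}))"
      by (rule space_topology_generator) (use \<eta> in auto)
    moreover have "points euclidean_smooth \<inter> \<eta> -` (- {0}) \<subseteq> U" using \<eta> by auto
    ultimately show "\<exists>T. openin (space_topology euclidean_smooth) T \<and> x \<in> T \<and> T \<subseteq> U"
      using \<eta> by (intro exI[of _ "points euclidean_smooth \<inter> \<eta> -` (- {0})"]) auto
  qed
qed

lemma restrict_UNIV_eq [simp]: "restrict f UNIV = f"
  by auto

lemma euclidean_extend:
  fixes \<phi> :: "'a::euclidean_space \<Rightarrow> real"
  assumes "open N" "w \<in> N" "smooth_on N \<phi>"
  obtains F N' where "smooth_on UNIV F" "open N'" "w \<in> N'" "N' \<subseteq> N" "\<And>v. v \<in> N' \<Longrightarrow> F v = \<phi> v"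
proof -
  obtain \<eta> N' K where \<eta>: "smooth_on UNIV \<eta>" "open N'" "w \<in> N'" "compact K" "N' \<subseteq> K" "K \<subseteq> N"
      "\<And>y. y \<in> N' \<Longrightarrow> \<eta> y = 1" "\<And>y. y \<notin> K \<Longrightarrow> \<eta> y = 0"
    using smooth_bump[OF assms(1,2)] by metis
  define F where "F v = (if v \<in> N then \<eta> v * \<phi> v else 0)" for v
  have "\<exists>M. open M \<and> v \<in> M \<and> smooth_on M F" for v
  proof (cases "v \<in> N")
    case True
    have "smooth_on N (\<lambda>v. \<eta> v * \<phi> v)"
      using smooth_on_mult[OF assms(1) smooth_on_subset[OF \<eta>(1) subset_UNIV] assms(3)] .
    then have "smooth_on N F" by (subst smooth_on_cong[OF assms(1)]) (auto simp: F_def)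
    then show ?thesis using True assms(1) by blast
  next
    case False
    have "smooth_on (- K) F"
      by (subst smooth_on_cong[where g = "\<lambda>_. 0"])
        (use \<eta> in \<open>auto simp: F_def smooth_on_const compact_imp_closed open_Compl\<close>)
    moreover have "v \<in> - K" "open (- K)" using False \<eta> by (auto simp: compact_imp_closed open_Compl)
    ultimately show ?thesis by blast
  qed
  then have "smooth_on UNIV F" by (rule smooth_on_local)
  moreover have "F v = \<phi> v" if "v \<in> N'" for v using \<eta>(5-7) that by (auto simp: F_def)
  ultimately show ?thesis using that[of F N'] \<eta> by blast
qed

lemma chart_euclidean: "is_chart euclidean_smooth UNIV (\<lambda>a. a)"
proof -
  have "\<exists>F\<in>smooth_funs euclidean_smooth. \<exists>N'. open N' \<and> w \<in> N' \<and> N' \<subseteq> N \<and> (\<forall>v\<in>N'. F v = \<phi> v)"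
    if N: "open N" "w \<in> N" "smooth_on N \<phi>" for N \<phi> and w :: 'a
  proof -
    obtain F N' where "smooth_on UNIV F" "open N'" "w \<in> N'" "N' \<subseteq> N" "\<And>v. v \<in> N' \<Longrightarrow> F v = \<phi> v"
      using euclidean_extend[OF N] by metis
    then show ?thesis by auto
  qed
  then show ?thesis unfolding is_chart_def by auto
qed

section \<open>The lemmas of Hadamard and Clairaut\<close>

lemma radial_in_ball:
  fixes x :: "'a::real_normed_vector"
  assumes "x \<in> ball w r" "0 \<le> t" "t \<le> 1"
  shows "w + t *\<^sub>R (x - w) \<in> ball w r"
proof -
  have "dist w (w + t *\<^sub>R (x - w)) = t * dist w x"
    using assms(2) by (simp add: dist_norm norm_minus_commute)
  also have "\<dots> \<le> 1 * dist w x" using assms(3) by (intro mult_right_mono) auto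
  finally show ?thesis using assms(1) by simp
qed

text \<open>The weight \<open>t^m\<close> is there because differentiation under the integral sign
  multiplies by \<open>t\<close>: the family of these integrals is closed under
  differentiation.\<close>

lemma radial_integral_has_derivative:
  fixes \<phi> :: "'a::euclidean_space \<Rightarrow> real"
  assumes \<phi>: "smooth_on (ball w r) \<phi>" and x: "x \<in> ball w r"
  shows "((\<lambda>x. integral {0..1} (\<lambda>t. t ^ m * \<phi> (w + t *\<^sub>R (x - w)))) has_derivative
    (\<lambda>v. integral {0..1} (\<lambda>t. t ^ Suc m * frechet_derivative \<phi> (at (w + t *\<^sub>R (x - w))) v))) (at x)"
proof -
  let ?U = "ball w r" and ?p = "\<lambda>x t. w + t *\<^sub>R (x - w)"
  let ?D = "\<lambda>x. frechet_derivative \<phi> (at x)"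
  \<comment> \<open>Differentiation under the integral asks for the derivative as a bounded linear
    map depending continuously on \<open>(x, t)\<close>; in finite dimension continuity may be
    checked on vectors of the basis.\<close>
  define fx where "fx x t = Blinfun (\<lambda>v. t ^ Suc m * ?D (?p x t) v)" for x t
  have dphi: "(\<phi> has_derivative ?D y) (at y)" if "y \<in> ?U" for y
    using smooth_on_has_derivative[OF \<phi> that] .
  have fx: "blinfun_apply (fx y t) = (\<lambda>v. t ^ Suc m * ?D (?p y t) v)" if "y \<in> ?U" "t \<in> {0..1}" for y t
  proof -
    have "bounded_linear (?D (?p y t))"
      using dphi radial_in_ball[OF that(1)] that(2) by (meson atLeastAtMost_iff has_derivative_bounded_linear)
    then show ?thesis unfolding fx_def
      by (intro bounded_linear_Blinfun_apply bounded_linear_const_mult)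
  qed
  have cont: "continuous_on (?U \<times> {0..1}) (\<lambda>(x, t). \<psi> (?p x t))" if "continuous_on ?U \<psi>" for \<psi> :: "'a \<Rightarrow> real"
    unfolding case_prod_beta
    by (rule continuous_on_compose2[OF that, of _ "\<lambda>z. ?p (fst z) (snd z)"])
      (intro continuous_intros, clarsimp simp del: mem_ball, rule radial_in_ball, simp_all)
  have contfx: "continuous_on (?U \<times> {0..1}) (\<lambda>(x, t). fx x t)"
  proof (rule continuous_on_blinfun_componentwise)
    fix i :: 'a
    have "continuous_on (?U \<times> {0..1}) (\<lambda>(x, t). t ^ Suc m * (case (x, t) of (x, t) \<Rightarrow> ?D (?p x t) i))"
      using cont[OF smooth_on_continuous[OF smooth_on_frechet[OF \<phi>]], of i]
      unfolding case_prod_beta by (intro continuous_intros) auto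
    then show "continuous_on (?U \<times> {0..1}) (\<lambda>z. blinfun_apply (case z of (x, t) \<Rightarrow> fx x t) i)"
      by (rule continuous_on_eq) (auto simp: fx)
  qed
  have section_cont: "continuous_on {0..1} (\<lambda>t. h y t)" if "continuous_on (?U \<times> {0..1}) (\<lambda>(x, t). h x t)" "y \<in> ?U"
    for h :: "'a \<Rightarrow> real \<Rightarrow> 'c::topological_space" and y
  proof -
    have "continuous_on {0..1} (\<lambda>t. case (y, t) of (x, t) \<Rightarrow> h x t)"
      by (rule continuous_on_compose2[OF that(1)]) (use that(2) in \<open>auto intro!: continuous_intros\<close>)
    then show ?thesis by simp
  qed
  have "((\<lambda>x. integral (cbox 0 1) (\<lambda>t. t ^ m * \<phi> (?p x t))) has_derivative integral (cbox 0 1) (fx x)) (at x within ?U)"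
  proof (rule leibniz_rule[OF _ _ _ x convex_ball])
    fix y and t :: real assume y: "y \<in> ?U" "t \<in> cbox 0 1"
    then have "?p y t \<in> ?U" by (intro radial_in_ball) auto
    have "((\<lambda>y. \<phi> (?p y t)) has_derivative (\<lambda>v. ?D (?p y t) (t *\<^sub>R v))) (at y)"
      by (rule has_derivative_compose[where f = "\<lambda>y. ?p y t", OF _ dphi[OF \<open>?p y t \<in> ?U\<close>]]) (auto intro!: derivative_eq_intros)
    then have "((\<lambda>y. t ^ m * \<phi> (?p y t)) has_derivative (\<lambda>v. t ^ m * ?D (?p y t) (t *\<^sub>R v))) (at y)"
      by (rule has_derivative_mult_right)
    moreover have "linear (?D (?p y t))" using dphi[OF \<open>?p y t \<in> ?U\<close>] by (rule has_derivative_linear)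
    ultimately show "((\<lambda>y. t ^ m * \<phi> (?p y t)) has_derivative blinfun_apply (fx y t)) (at y within ?U)"
      using y by (auto intro!: has_derivative_at_withinI simp: fx linear_scale mult_ac)
  next
    fix y assume "y \<in> ?U"
    then have "continuous_on {0..1} (\<lambda>t. \<phi> (?p y t))"
      using section_cont[OF cont[OF smooth_on_continuous[OF \<phi>]]] by simp
    then show "(\<lambda>t. t ^ m * \<phi> (?p y t)) integrable_on cbox 0 1"
      by (auto intro!: integrable_continuous_real continuous_intros)
  qed (use contfx in simp)
  moreover have "fx x integrable_on {0..1}"
    using section_cont[OF contfx x] by (rule integrable_continuous_real)
  then have "blinfun_apply (integral {0..1} (fx x)) = (\<lambda>v. integral {0..1} (\<lambda>t. t ^ Suc m * ?D (?p x t) v))"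
    by (intro ext, subst blinfun_apply_integral, assumption, intro integral_cong) (simp only: fx[OF x])
  moreover have "at x within ?U = at x" by (rule at_within_open[OF x open_ball])
  ultimately show ?thesis by (simp only: cbox_interval)
qed

lemma smooth_on_radial_integral:
  fixes \<phi> :: "'a::euclidean_space \<Rightarrow> real"
  assumes "smooth_on (ball w r) \<phi>"
  shows "smooth_on (ball w r) (\<lambda>x. integral {0..1} (\<lambda>t. t ^ m * \<phi> (w + t *\<^sub>R (x - w))))"
proof -
  have "Ck_on n (ball w r) (\<lambda>x. integral {0..1} (\<lambda>t. t ^ m * \<phi> (w + t *\<^sub>R (x - w))))" for n
    using assms
  proof (induction n arbitrary: \<phi> m)
    case 0
    then show ?case
      using has_derivative_continuous[OF radial_integral_has_derivative[OF 0]]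
      by (auto intro!: continuous_at_imp_continuous_on)
  next
    case (Suc n)
    show ?case
      by (rule Ck_on_SucI[OF open_ball radial_integral_has_derivative[OF Suc.prems]], assumption)
        (rule Suc.IH[OF smooth_on_frechet[OF Suc.prems]])
  qed
  then show ?thesis by (simp add: smooth_on_def)
qed

text \<open>Integrate the derivative along the segment from \<open>w\<close> to \<open>x\<close>;
  \<open>h b\<close> is the mean of the partial derivative in direction \<open>b\<close>. The
  application is to tangent vectors: a function with vanishing gradient at \<open>w\<close> is a
  constant plus products of functions vanishing at \<open>w\<close>.\<close>

lemma hadamard:
  fixes \<phi> :: "'a::euclidean_space \<Rightarrow> real"
  assumes \<phi>: "smooth_on (ball w r) \<phi>" and r: "0 < r"
  obtains h where "\<And>b. smooth_on (ball w r) (h b)"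
    "\<And>x. x \<in> ball w r \<Longrightarrow> \<phi> x = \<phi> w + (\<Sum>b\<in>Basis. ((x - w) \<bullet> b) * h b x)"
    "\<And>b. h b w = frechet_derivative \<phi> (at w) b"
proof
  let ?D = "\<lambda>x. frechet_derivative \<phi> (at x)"
  define h where "h b x = integral {0..1} (\<lambda>t. t ^ 0 * ?D (w + t *\<^sub>R (x - w)) b)" for b x
  show "smooth_on (ball w r) (h b)" for b
    unfolding h_def[abs_def] by (intro smooth_on_radial_integral smooth_on_frechet \<phi>)
  show "h b w = ?D w b" for b by (simp add: h_def)
  show "\<phi> x = \<phi> w + (\<Sum>b\<in>Basis. ((x - w) \<bullet> b) * h b x)" if x: "x \<in> ball w r" for x
  proof -
    have dphi: "(\<phi> has_derivative ?D (w + t *\<^sub>R (x - w))) (at (w + t *\<^sub>R (x - w)))" if "t \<in> {0..1}" for t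
      using smooth_on_has_derivative[OF \<phi>] radial_in_ball[OF x] that by auto
    have expand: "?D (w + t *\<^sub>R (x - w)) (x - w) = (\<Sum>b\<in>Basis. ((x - w) \<bullet> b) * ?D (w + t *\<^sub>R (x - w)) b)"
      if "t \<in> {0..1}" for t
    proof -
      have l: "linear (?D (w + t *\<^sub>R (x - w)))" using dphi[OF that] by (rule has_derivative_linear)
      have "?D (w + t *\<^sub>R (x - w)) (\<Sum>b\<in>Basis. ((x - w) \<bullet> b) *\<^sub>R b) = (\<Sum>b\<in>Basis. ((x - w) \<bullet> b) * ?D (w + t *\<^sub>R (x - w)) b)"
        by (simp add: linear_sum[OF l] linear_scale[OF l])
      then show ?thesis by (simp only: euclidean_representation)
    qed
    have int: "(\<lambda>t. ?D (w + t *\<^sub>R (x - w)) b) integrable_on {0..1}" for b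
      by (rule integrable_continuous_real,
          rule continuous_on_compose2[OF smooth_on_continuous[OF smooth_on_frechet[OF \<phi>]]])
        (use radial_in_ball[OF x] in \<open>auto intro!: continuous_intros simp del: mem_ball\<close>)
    have "((\<lambda>t. ?D (w + t *\<^sub>R (x - w)) (x - w)) has_integral \<phi> (w + 1 *\<^sub>R (x - w)) - \<phi> (w + 0 *\<^sub>R (x - w))) {0..1}"
    proof (rule fundamental_theorem_of_calculus)
      fix t :: real assume t: "t \<in> {0..1}"
      have "((\<lambda>t. \<phi> (w + t *\<^sub>R (x - w))) has_derivative (\<lambda>s. ?D (w + t *\<^sub>R (x - w)) (s *\<^sub>R (x - w)))) (at t)"
        by (rule has_derivative_compose[where f = "\<lambda>t. w + t *\<^sub>R (x - w)", OF _ dphi[OF t]]) (auto intro!: derivative_eq_intros)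
      then show "((\<lambda>t. \<phi> (w + t *\<^sub>R (x - w))) has_vector_derivative ?D (w + t *\<^sub>R (x - w)) (x - w)) (at t within {0..1})"
        using has_derivative_linear[OF dphi[OF t]]
        by (auto simp: has_vector_derivative_def linear_scale intro: has_derivative_at_withinI)
    qed simp
    then have "\<phi> x - \<phi> w = integral {0..1} (\<lambda>t. ?D (w + t *\<^sub>R (x - w)) (x - w))"
      by (simp add: integral_unique)
    also have "\<dots> = integral {0..1} (\<lambda>t. \<Sum>b\<in>Basis. ((x - w) \<bullet> b) * ?D (w + t *\<^sub>R (x - w)) b)"
      by (rule integral_cong) (rule expand)
    also have "\<dots> = (\<Sum>b\<in>Basis. ((x - w) \<bullet> b) * h b x)"
      by (subst integral_sum) (auto intro!: integrable_on_mult_right int simp: h_def)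
    finally show ?thesis by simp
  qed
qed

section \<open>Symmetry of second derivatives\<close>

lemma directional_DERIV:
  fixes f :: "'a::euclidean_space \<Rightarrow> real"
  assumes "smooth_on S f" "p + t *\<^sub>R v \<in> S"
  shows "((\<lambda>t. f (p + t *\<^sub>R v)) has_real_derivative frechet_derivative f (at (p + t *\<^sub>R v)) v) (at t)"
proof -
  have d: "(f has_derivative frechet_derivative f (at (p + t *\<^sub>R v))) (at (p + t *\<^sub>R v))"
    by (rule smooth_on_has_derivative[OF assms])
  have "((\<lambda>t. f (p + t *\<^sub>R v)) has_derivative (\<lambda>s. frechet_derivative f (at (p + t *\<^sub>R v)) (s *\<^sub>R v))) (at t)"
    by (rule has_derivative_compose[where f = "\<lambda>t. p + t *\<^sub>R v", OF _ d]) (auto intro!: derivative_eq_intros)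
  then show ?thesis
    using has_derivative_linear[OF d]
    by (simp add: has_field_derivative_def linear_scale mult.commute[of _ "frechet_derivative f _ v"])
qed

text \<open>The mean value theorem twice: for the increment in direction \<open>w\<close> as a
  function of the step along \<open>v\<close>, then for the derivative along \<open>v\<close> on a
  segment in direction \<open>w\<close>.\<close>

lemma second_difference:
  fixes f :: "'a::euclidean_space \<Rightarrow> real"
  assumes f: "smooth_on (ball x r) f" and h: "0 < h" "h * (norm v + norm w) < r"
  obtains y where "dist x y \<le> h * (norm v + norm w)"
    "f (x + h *\<^sub>R v + h *\<^sub>R w) - f (x + h *\<^sub>R w) - f (x + h *\<^sub>R v) + f x
      = h * h * frechet_derivative (\<lambda>y. frechet_derivative f (at y) v) (at y) w"
proof -
  have b: "dist x (x + s *\<^sub>R v + t *\<^sub>R w) \<le> h * (norm v + norm w)" if "0 \<le> s" "s \<le> h" "0 \<le> t" "t \<le> h" for s t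
  proof -
    have "dist x (x + s *\<^sub>R v + t *\<^sub>R w) = norm (s *\<^sub>R v + t *\<^sub>R w)"
      by (metis add.assoc add_diff_cancel_left' dist_commute dist_norm)
    also have "\<dots> \<le> s * norm v + t * norm w" using norm_triangle_ineq[of "s *\<^sub>R v" "t *\<^sub>R w"] that by simp
    also have "\<dots> \<le> h * norm v + h * norm w" using that by (intro add_mono mult_right_mono) auto
    finally show ?thesis by (simp add: algebra_simps)
  qed
  then have i: "x + s *\<^sub>R v + t *\<^sub>R w \<in> ball x r" if "0 \<le> s" "s \<le> h" "0 \<le> t" "t \<le> h" for s t
    using h(2) that by fastforce
  let ?g = "\<lambda>y. frechet_derivative f (at y) v"
  have d1: "((\<lambda>s. f (x + s *\<^sub>R v + t *\<^sub>R w)) has_real_derivative ?g (x + s *\<^sub>R v + t *\<^sub>R w)) (at s)"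
    if "0 \<le> s" "s \<le> h" "0 \<le> t" "t \<le> h" for s t
    using directional_DERIV[OF f, of "x + t *\<^sub>R w" s v] i[OF that] by (simp add: add_ac)
  have "\<exists>s. 0 < s \<and> s < h \<and> (f (x + h *\<^sub>R v + h *\<^sub>R w) - f (x + h *\<^sub>R v + 0 *\<^sub>R w)) - (f (x + 0 *\<^sub>R v + h *\<^sub>R w) - f (x + 0 *\<^sub>R v + 0 *\<^sub>R w))
      = (h - 0) * (?g (x + s *\<^sub>R v + h *\<^sub>R w) - ?g (x + s *\<^sub>R v + 0 *\<^sub>R w))"
    by (rule MVT2[OF h(1)]) (use h(1) in \<open>intro DERIV_diff d1; simp\<close>)
  then obtain s where s: "0 < s" "s < h" and
    e1: "(f (x + h *\<^sub>R v + h *\<^sub>R w) - f (x + h *\<^sub>R v)) - (f (x + h *\<^sub>R w) - f x)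
      = h * (?g (x + s *\<^sub>R v + h *\<^sub>R w) - ?g (x + s *\<^sub>R v))" by auto
  have "\<exists>t. 0 < t \<and> t < h \<and> ?g (x + s *\<^sub>R v + h *\<^sub>R w) - ?g (x + s *\<^sub>R v + 0 *\<^sub>R w)
      = (h - 0) * frechet_derivative ?g (at (x + s *\<^sub>R v + t *\<^sub>R w)) w"
    by (rule MVT2[OF h(1)]) (use s i in \<open>intro directional_DERIV[OF smooth_on_frechet[OF f]]; simp\<close>)
  then obtain t where t: "0 < t" "t < h" and
    e2: "?g (x + s *\<^sub>R v + h *\<^sub>R w) - ?g (x + s *\<^sub>R v) = h * frechet_derivative ?g (at (x + s *\<^sub>R v + t *\<^sub>R w)) w" by auto
  show ?thesis
    by (rule that[OF b[of s t]]) (use s t e1 e2 in \<open>auto simp: algebra_simps\<close>)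
qed

text \<open>The second difference does not depend on the order of \<open>v\<close> and
  \<open>w\<close>, so the two mixed derivatives take a common value at points \<open>y\<close> and
  \<open>z\<close> arbitrarily close to \<open>x\<close>; both are continuous.\<close>

lemma clairaut:
  fixes f :: "'a::euclidean_space \<Rightarrow> real"
  assumes f: "smooth_on S f" and "open S" "x \<in> S"
  shows "frechet_derivative (\<lambda>y. frechet_derivative f (at y) v) (at x) w
       = frechet_derivative (\<lambda>y. frechet_derivative f (at y) w) (at x) v"
    (is "?A x = ?B x")
proof -
  obtain r where r: "0 < r" "ball x r \<subseteq> S" using assms open_contains_ball by blast
  have fr: "smooth_on (ball x r) f" using smooth_on_subset[OF f r(2)] .
  define c where "c = norm v + norm w + 1"
  have c: "c > 0" by (simp add: c_def add_nonneg_pos)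
  have ex: "\<exists>y z. dist x y \<le> e \<and> dist x z \<le> e \<and> ?A y = ?B z" if e: "0 < e" "e < r" for e
  proof -
    define h where "h = e / c"
    have h: "0 < h" using e c by (simp add: h_def)
    have "h * (norm v + norm w) \<le> h * c" using h by (intro mult_left_mono) (auto simp: c_def)
    then have hb: "h * (norm v + norm w) \<le> e" "h * (norm w + norm v) \<le> e" using c by (simp_all add: h_def add.commute)
    obtain y where y: "dist x y \<le> h * (norm v + norm w)"
      "f (x + h *\<^sub>R v + h *\<^sub>R w) - f (x + h *\<^sub>R w) - f (x + h *\<^sub>R v) + f x = h * h * ?A y"
      using second_difference[OF fr h, of v w] hb e by (metis le_less_trans)
    obtain z where z: "dist x z \<le> h * (norm w + norm v)"
      "f (x + h *\<^sub>R w + h *\<^sub>R v) - f (x + h *\<^sub>R v) - f (x + h *\<^sub>R w) + f x = h * h * ?B z"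
      using second_difference[OF fr h, of w v] hb e by (metis le_less_trans)
    have e: "x + h *\<^sub>R w + h *\<^sub>R v = x + h *\<^sub>R v + h *\<^sub>R w" by simp
    have "h * h * ?A y = h * h * ?B z" using y(2) z(2) unfolding e by linarith
    then have "?A y = ?B z" using h by simp
    then show ?thesis using y(1) z(1) hb by (meson order_trans)
  qed
  \<comment> \<open>The summand \<open>2\<close> keeps the radius below \<open>r\<close> also for
    \<open>n = 0\<close>.\<close>
  define e where "e n = r / (real n + 2)" for n
  have e: "0 < e n" "e n < r" for n
    unfolding e_def using r(1) by (auto simp: field_simps add_pos_nonneg)
  obtain y z where yz: "\<And>n. dist x (y n) \<le> e n" "\<And>n. dist x (z n) \<le> e n" "\<And>n. ?A (y n) = ?B (z n)"
    using ex[OF e] by metis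
  have e0: "e \<longlonglongrightarrow> 0" unfolding e_def[abs_def] by real_asymp
  have lim: "y \<longlonglongrightarrow> x" "z \<longlonglongrightarrow> x"
    unfolding tendsto_dist_iff[of _ x]
    using yz by (auto intro!: tendsto_sandwich[OF _ _ tendsto_const e0] simp: dist_commute)
  have cont: "isCont ?A x" "isCont ?B x"
    using smooth_on_continuous[OF smooth_on_frechet[OF smooth_on_frechet[OF f]]] assms(2,3)
      continuous_on_eq_continuous_at by blast+
  have "(\<lambda>n. ?A (y n)) \<longlonglongrightarrow> ?A x" "(\<lambda>n. ?B (z n)) \<longlonglongrightarrow> ?B x"
    using cont lim isCont_tendsto_compose by blast+
  then show ?thesis using yz(3) LIMSEQ_unique by auto
qed

section \<open>Partial derivatives and Jacobians\<close>

lemma partial_cong: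
  assumes "open N" "w \<in> N" "\<And>v. v \<in> N \<Longrightarrow> f v = g v"
  shows "frechet_derivative f (at w) = frechet_derivative g (at w)"
proof -
  have "(f has_derivative D) (at w) \<longleftrightarrow> (g has_derivative D) (at w)" for D
    using has_derivative_transform_within_open[OF _ assms(1,2)] assms(3) by metis
  then show ?thesis by (simp add: frechet_derivative_def)
qed

lemma frechet_add: "f differentiable (at x) \<Longrightarrow> g differentiable (at x) \<Longrightarrow>
    frechet_derivative (\<lambda>x. f x + g x) (at x) v = frechet_derivative f (at x) v + frechet_derivative g (at x) v"
proof -
  assume "f differentiable (at x)" "g differentiable (at x)"
  then have "((\<lambda>x. f x + g x) has_derivative (\<lambda>v. frechet_derivative f (at x) v + frechet_derivative g (at x) v)) (at x)"
    unfolding frechet_derivative_works by (rule has_derivative_add)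
  from frechet_derivative_at[OF this] show ?thesis by metis
qed

lemma frechet_mult:
  fixes f g :: "'a::real_normed_vector \<Rightarrow> real"
  shows "f differentiable (at x) \<Longrightarrow> g differentiable (at x) \<Longrightarrow>
    frechet_derivative (\<lambda>x. f x * g x) (at x) v = f x * frechet_derivative g (at x) v + frechet_derivative f (at x) v * g x"
proof -
  assume "f differentiable (at x)" "g differentiable (at x)"
  then have "((\<lambda>x. f x * g x) has_derivative (\<lambda>v. f x * frechet_derivative g (at x) v + frechet_derivative f (at x) v * g x)) (at x)"
    unfolding frechet_derivative_works by (rule has_derivative_mult)
  from frechet_derivative_at[OF this] show ?thesis by metis
qed

lemma frechet_nth [simp]: "frechet_derivative (\<lambda>v::real^'n. v $ i) (at x) v = v $ i"
  using frechet_derivative_at[OF bounded_linear_imp_has_derivative[OF bounded_linear_vec_nth]] by metis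

lemma partial_compose:
  fixes \<beta> :: "real^'m \<Rightarrow> real^'n"
  assumes "\<beta> differentiable (at w)" "a differentiable (at (\<beta> w))"
  shows "partial (\<lambda>x. a (\<beta> x)) i w = (\<Sum>j\<in>UNIV. partial a j (\<beta> w) * partial (\<lambda>x. \<beta> x $ j) i w)"
proof -
  let ?B = "frechet_derivative \<beta> (at w)" and ?A = "frechet_derivative a (at (\<beta> w))"
  have B: "(\<beta> has_derivative ?B) (at w)" and A: "(a has_derivative ?A) (at (\<beta> w))"
    using assms frechet_derivative_works by blast+
  have l: "linear ?A" using A by (rule has_derivative_linear)
  have "((\<lambda>x. \<beta> x $ j) has_derivative (\<lambda>v. ?B v $ j)) (at w)" for j
    using bounded_linear.has_derivative[OF bounded_linear_vec_nth B] .
  then have Bj: "frechet_derivative (\<lambda>x. \<beta> x $ j) (at w) = (\<lambda>v. ?B v $ j)" for j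
    using frechet_derivative_at by metis
  have "frechet_derivative (\<lambda>x. a (\<beta> x)) (at w) = (\<lambda>v. ?A (?B v))"
    using frechet_derivative_at[OF has_derivative_compose[OF B A]] by simp
  moreover have "?A v = (\<Sum>j\<in>UNIV. ?A (axis j 1) * v $ j)" for v
  proof -
    have "?A (\<Sum>j\<in>UNIV. v $ j *\<^sub>R axis j 1) = (\<Sum>j\<in>UNIV. ?A (axis j 1) * v $ j)"
      by (simp add: linear_sum[OF l] linear_scale[OF l] mult.commute)
    then show ?thesis using basis_expansion[of v] by (simp add: scalar_mult_eq_scaleR)
  qed
  ultimately show ?thesis unfolding Bj by metis
qed

lemma partial_frechet:
  assumes "a differentiable (at (w :: real^'n))"
  shows "frechet_derivative a (at w) v = (\<Sum>j\<in>UNIV. v $ j * partial a j w)"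
proof -
  have l: "linear (frechet_derivative a (at w))"
    using assms frechet_derivative_works has_derivative_linear by blast
  have "frechet_derivative a (at w) (\<Sum>j\<in>UNIV. v $ j *\<^sub>R axis j 1) = (\<Sum>j\<in>UNIV. v $ j * partial a j w)"
    by (simp add: linear_sum[OF l] linear_scale[OF l])
  then show ?thesis using basis_expansion[of v] by (simp add: scalar_mult_eq_scaleR)
qed

text \<open>The determinant of the three gradients, expanded along that of \<open>a\<close>. With
  \<open>a\<close> fixed it is the Jacobian bracket of \<open>b\<close> and \<open>c\<close>, for
  which \<open>a\<close> is a Casimir function.\<close>

definition jac :: "(real^3 \<Rightarrow> real) \<Rightarrow> (real^3 \<Rightarrow> real) \<Rightarrow> (real^3 \<Rightarrow> real) \<Rightarrow> real^3 \<Rightarrow> real" where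
  "jac a b c w =
     partial a 3 w * (partial b 1 w * partial c 2 w - partial b 2 w * partial c 1 w) +
     partial a 1 w * (partial b 2 w * partial c 3 w - partial b 3 w * partial c 2 w) +
     partial a 2 w * (partial b 3 w * partial c 1 w - partial b 1 w * partial c 3 w)"

lemma jac_compose:
  assumes "\<beta> differentiable (at w)" "a differentiable (at (\<beta> w))" "b differentiable (at (\<beta> w))" "c differentiable (at (\<beta> w))"
  shows "jac (\<lambda>x. a (\<beta> x)) (\<lambda>x. b (\<beta> x)) (\<lambda>x. c (\<beta> x)) w
    = jac (\<lambda>x. \<beta> x $ 1) (\<lambda>x. \<beta> x $ 2) (\<lambda>x. \<beta> x $ 3) w * jac a b c (\<beta> w)"
  unfolding jac_def partial_compose[OF assms(1,2)] partial_compose[OF assms(1,3)] partial_compose[OF assms(1,4)] sum_3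
  by algebra

lemma jac_cong:
  assumes "open N" "w \<in> N" "\<And>v. v \<in> N \<Longrightarrow> a v = a' v" "\<And>v. v \<in> N \<Longrightarrow> b v = b' v" "\<And>v. v \<in> N \<Longrightarrow> c v = c' v"
  shows "jac a b c w = jac a' b' c' w"
  unfolding jac_def using partial_cong[OF assms(1,2,3)] partial_cong[OF assms(1,2,4)] partial_cong[OF assms(1,2,5)] by simp

lemma smooth_on_jac:
  "open S \<Longrightarrow> smooth_on S a \<Longrightarrow> smooth_on S b \<Longrightarrow> smooth_on S c \<Longrightarrow> smooth_on S (jac a b c)"
  unfolding jac_def[abs_def] by (intro smooth_intros smooth_on_frechet)

text \<open>The three vanishing Jacobians are the components of the cross product of the gradients
  of \<open>F\<close> and \<open>f\<close>.\<close>

lemma jac_gradient_parallel: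
  assumes "\<And>j. jac F f (\<lambda>v. v $ j) w = 0" "\<exists>i. partial F i w \<noteq> 0"
  obtains l where "\<And>i. partial f i w = l * partial F i w"
proof -
  have e: "partial F 3 w * partial f 1 w = partial F 1 w * partial f 3 w"
    "partial F 3 w * partial f 2 w = partial F 2 w * partial f 3 w"
    "partial F 2 w * partial f 1 w = partial F 1 w * partial f 2 w"
    using assms(1)[of 1] assms(1)[of 2] assms(1)[of 3] by (simp_all add: jac_def axis_def)
  from assms(2) obtain i where i: "partial F i w \<noteq> 0" by blast
  have "partial f j w * partial F i w = partial f i w * partial F j w" for j
    using e exhaust_3[of i] exhaust_3[of j] by (auto simp: mult.commute)
  then show ?thesis using i by (intro that[of "partial f i w / partial F i w"]) (simp add: field_simps)
qed

lemma smooth_on_eq: "open S \<Longrightarrow> smooth_on S g \<Longrightarrow> (\<And>x. x \<in> S \<Longrightarrow> f x = g x) \<Longrightarrow> smooth_on S f"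
  using smooth_on_cong by metis

section \<open>Compatible and separated atlases\<close>

text \<open>A coordinate change is asked for only near parameters with a common image; its inverse
  comes from imposing the condition on both ordered pairs of charts.\<close>

definition transition :: "(real^3) set \<Rightarrow> (real^3 \<Rightarrow> 'a) \<Rightarrow> (real^3) set \<Rightarrow> (real^3 \<Rightarrow> 'a) \<Rightarrow> bool" where
  "transition V g V' g' \<longleftrightarrow> (\<forall>w\<in>V. \<forall>w'\<in>V'. g w = g' w' \<longrightarrow>
     (\<exists>N \<tau>. open N \<and> w \<in> N \<and> N \<subseteq> V \<and> smooth_vec N \<tau> \<and> (\<forall>v\<in>N. \<tau> v \<in> V' \<and> g' (\<tau> v) = g v)))"

text \<open>Required besides compatibility, since compatible charts may glue to a space that is not
  Hausdorff.\<close>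

definition separated_charts :: "(real^3) set \<Rightarrow> (real^3 \<Rightarrow> 'a) \<Rightarrow> (real^3) set \<Rightarrow> (real^3 \<Rightarrow> 'a) \<Rightarrow> bool" where
  "separated_charts V g V' g' \<longleftrightarrow> (\<forall>w\<in>V. \<forall>w'\<in>V'. g w \<noteq> g' w' \<longrightarrow>
     (\<exists>N N'. open N \<and> open N' \<and> w \<in> N \<and> w' \<in> N' \<and> (\<forall>v\<in>N \<inter> V. \<forall>v'\<in>N' \<inter> V'. g v \<noteq> g' v')))"

definition good_atlas :: "param set \<Rightarrow> bool" where
  "good_atlas A \<longleftrightarrow> finite A \<and> (\<forall>(V, g)\<in>A. open V \<and> inj_on g V) \<and>
     (\<forall>(V, g)\<in>A. \<forall>(V', g')\<in>A. transition V g V' g' \<and> separated_charts V g V' g')"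

lemma transitionE:
  assumes "transition V g V' g'" "w \<in> V" "w' \<in> V'" "g w = g' w'"
  obtains N \<tau> where "open N" "w \<in> N" "N \<subseteq> V" "smooth_vec N \<tau>"
    "\<And>v. v \<in> N \<Longrightarrow> \<tau> v \<in> V'" "\<And>v. v \<in> N \<Longrightarrow> g' (\<tau> v) = g v"
proof -
  have "\<exists>N \<tau>. open N \<and> w \<in> N \<and> N \<subseteq> V \<and> smooth_vec N \<tau> \<and> (\<forall>v\<in>N. \<tau> v \<in> V' \<and> g' (\<tau> v) = g v)"
    using assms unfolding transition_def by blast
  then show ?thesis using that by blast
qed

lemma separated_chartsE:
  assumes "separated_charts V g V' g'" "w \<in> V" "w' \<in> V'" "g w \<noteq> g' w'"
  obtains N N' where "open N" "open N'" "w \<in> N" "w' \<in> N'"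
    "\<And>v v'. v \<in> N \<Longrightarrow> v \<in> V \<Longrightarrow> v' \<in> N' \<Longrightarrow> v' \<in> V' \<Longrightarrow> g v \<noteq> g' v'"
proof -
  have "\<exists>N N'. open N \<and> open N' \<and> w \<in> N \<and> w' \<in> N' \<and> (\<forall>v\<in>N \<inter> V. \<forall>v'\<in>N' \<inter> V'. g v \<noteq> g' v')"
    using assms unfolding separated_charts_def by blast
  then show ?thesis using that by blast
qed

lemma separated_charts_sym: "separated_charts V g V' g' \<Longrightarrow> separated_charts V' g' V g"
  unfolding separated_charts_def by metis

lemma separated_charts_subset:
  assumes "separated_charts V g V' g'" "W \<subseteq> V" "W' \<subseteq> V'"
  shows "separated_charts W g W' g'"
  unfolding separated_charts_def
proof (intro ballI impI)
  fix w w' assume w: "w \<in> W" "w' \<in> W'" "g w \<noteq> g' w'"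
  then have V: "w \<in> V" "w' \<in> V'" using assms by auto
  obtain N N' where "open N" "open N'" "w \<in> N" "w' \<in> N'"
    "\<And>v v'. v \<in> N \<Longrightarrow> v \<in> V \<Longrightarrow> v' \<in> N' \<Longrightarrow> v' \<in> V' \<Longrightarrow> g v \<noteq> g' v'"
    by (rule separated_chartsE[OF assms(1) V w(3)]) (rule that)
  then show "\<exists>N N'. open N \<and> open N' \<and> w \<in> N \<and> w' \<in> N' \<and> (\<forall>v\<in>N \<inter> W. \<forall>v'\<in>N' \<inter> W'. g v \<noteq> g' v')"
    using assms(2,3) by (intro exI[of _ N] exI[of _ N']) auto
qed

lemma good_atlasD:
  assumes "good_atlas A" "(V, g) \<in> A"
  shows "open V" "inj_on g V" "(V', g') \<in> A \<Longrightarrow> transition V g V' g'"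
    "(V', g') \<in> A \<Longrightarrow> separated_charts V g V' g'"
  using assms unfolding good_atlas_def by blast+

lemma atlas_space_sel:
  "points (atlas_space A) = (\<Union>(V, g)\<in>A. g ` V)"
  "f \<in> smooth_funs (atlas_space A) \<longleftrightarrow>
     f \<in> extensional (points (atlas_space A)) \<and> (\<forall>(V, g)\<in>A. smooth_on V (f \<circ> g))"
  by (simp_all add: atlas_space_def Let_def)

lemma atlas_points: "(V, g) \<in> A \<Longrightarrow> w \<in> V \<Longrightarrow> g w \<in> points (atlas_space A)"
  by (auto simp: atlas_space_sel)

lemma atlas_pointsE:
  assumes "p \<in> points (atlas_space A)"
  obtains V g w where "(V, g) \<in> A" "w \<in> V" "p = g w"
  using assms by (auto simp: atlas_space_sel)

lemma atlas_smooth_funI: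
  assumes A: "good_atlas A" and f: "f \<in> extensional (points (atlas_space A))"
    and h: "\<And>V g. (V, g) \<in> A \<Longrightarrow> \<exists>h. smooth_on V h \<and> (\<forall>w\<in>V. f (g w) = h w)"
  shows "f \<in> smooth_funs (atlas_space A)"
  unfolding atlas_space_sel(2)
proof (safe intro!: f)
  fix V g assume Vg: "(V, g) \<in> A"
  obtain h where h: "smooth_on V h" "\<forall>w\<in>V. f (g w) = h w" using h[OF Vg] by blast
  show "smooth_on V (f \<circ> g)"
    by (rule smooth_on_eq[OF good_atlasD(1)[OF A Vg] h(1)]) (simp add: h(2))
qed

lemma atlas_const:
  assumes A: "good_atlas A"
  shows "(\<lambda>_\<in>points (atlas_space A). c) \<in> smooth_funs (atlas_space A)"
proof (rule atlas_smooth_funI[OF A])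
  fix V g assume Vg: "(V, g) \<in> A"
  show "\<exists>h. smooth_on V h \<and> (\<forall>w\<in>V. (\<lambda>_\<in>points (atlas_space A). c) (g w) = h w)"
    by (rule exI[of _ "\<lambda>_. c"]) (use atlas_points[OF Vg] smooth_on_const in auto)
qed simp

text \<open>Extension by zero from one chart to the whole space. In other charts it is smooth
  because the charts are separated: otherwise a point outside the chart could be a limit of images
  of the compact support.\<close>

lemma atlas_extend:
  assumes A: "good_atlas A" "(V, g) \<in> A" and N: "open N" "N \<subseteq> V" "w \<in> N" and \<phi>: "smooth_on N \<phi>"
  obtains F N' where "F \<in> smooth_funs (atlas_space A)" "open N'" "w \<in> N'" "N' \<subseteq> N"
    "\<And>v. v \<in> N' \<Longrightarrow> F (g v) = \<phi> v" "\<And>p. p \<in> points (atlas_space A) \<Longrightarrow> p \<notin> g ` N \<Longrightarrow> F p = 0"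
proof -
  obtain \<eta> N' K where \<eta>: "smooth_on UNIV \<eta>" "open N'" "w \<in> N'" "compact K" "N' \<subseteq> K" "K \<subseteq> N"
    and \<eta>1: "\<And>y. y \<in> N' \<Longrightarrow> \<eta> y = 1" and \<eta>0: "\<And>y. y \<notin> K \<Longrightarrow> \<eta> y = 0"
    by (rule smooth_bump[OF N(1,3)]) (rule that)
  define F where "F = (\<lambda>p\<in>points (atlas_space A).
      if p \<in> g ` N then \<eta> (inv_into V g p) * \<phi> (inv_into V g p) else 0)"
  have Fg: "F (g v) = \<eta> v * \<phi> v" if "v \<in> N" for v
    using that N(2) atlas_points[OF A(2)] good_atlasD(2)[OF A] by (auto simp: F_def inv_into_f_f)
  have F0: "F p = 0" if "p \<in> points (atlas_space A)" "p \<notin> g ` N" for p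
    using that by (simp add: F_def)
  have prod: "smooth_on N (\<lambda>v. \<eta> v * \<phi> v)"
    using smooth_on_mult[OF N(1) smooth_on_subset[OF \<eta>(1) subset_UNIV] \<phi>] .
  have "smooth_on V' (F \<circ> g')" if A': "(V', g') \<in> A" for V' g'
  proof (rule smooth_on_local)
    fix w' assume w': "w' \<in> V'"
    show "\<exists>M. open M \<and> w' \<in> M \<and> smooth_on M (F \<circ> g')"
    proof (cases "g' w' \<in> g ` N")
      case True
      then obtain v where v: "v \<in> N" "g' w' = g v" by auto
      have vV: "v \<in> V" using v(1) N(2) by blast
      obtain N1 \<tau> where \<tau>: "open N1" "w' \<in> N1" "N1 \<subseteq> V'" "smooth_vec N1 \<tau>"
        "\<And>u. u \<in> N1 \<Longrightarrow> \<tau> u \<in> V" "\<And>u. u \<in> N1 \<Longrightarrow> g (\<tau> u) = g' u"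
        by (rule transitionE[OF good_atlasD(3)[OF A(1) A' A(2)] w' vV v(2)]) (rule that)
      have tv: "\<tau> w' = v"
        by (rule inj_onD[OF good_atlasD(2)[OF A]]) (use \<tau>(5,6)[OF \<tau>(2)] v vV in auto)
      have o: "open (N1 \<inter> \<tau> -` N)"
        by (rule continuous_open_preimage[OF smooth_vec_continuous[OF \<tau>(4)] \<tau>(1) N(1)])
      have "smooth_on (N1 \<inter> \<tau> -` N) (\<lambda>u. \<eta> (\<tau> u) * \<phi> (\<tau> u))"
        by (rule smooth_on_compose[OF prod smooth_vec_subset[OF \<tau>(4)] o N(1)]) auto
      moreover have "(F \<circ> g') u = \<eta> (\<tau> u) * \<phi> (\<tau> u)" if "u \<in> N1 \<inter> \<tau> -` N" for u
        using Fg[of "\<tau> u"] \<tau>(6)[of u] that by auto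
      ultimately have "smooth_on (N1 \<inter> \<tau> -` N) (F \<circ> g')" by (rule smooth_on_eq[OF o])
      then show ?thesis using o \<tau>(2) tv v(1) by blast
    next
      case False
      \<comment> \<open>The parameter \<open>w'\<close> is separated from each
        \<open>k \<in> K\<close>; compactness of \<open>K\<close> then yields one neighbourhood of
        \<open>w'\<close> on which the extension is zero.\<close>
      have "\<exists>N1 N2. open N1 \<and> open N2 \<and> k \<in> N1 \<and> w' \<in> N2 \<and> (\<forall>v\<in>N1 \<inter> V. \<forall>v'\<in>N2 \<inter> V'. g v \<noteq> g' v')"
        if k: "k \<in> K" for k
      proof -
        have "k \<in> N" using k \<eta>(6) by blast
        then have kV: "k \<in> V" "g k \<noteq> g' w'" using N(2) False by (blast, metis image_eqI)
        show ?thesis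
          using good_atlasD(4)[OF A A', unfolded separated_charts_def, rule_format, OF kV(1) w' kV(2)] by simp
      qed
      then obtain N1 N2 where sep: "\<And>k. k \<in> K \<Longrightarrow> open (N1 k) \<and> open (N2 k) \<and> k \<in> N1 k \<and> w' \<in> N2 k \<and>
          (\<forall>v\<in>N1 k \<inter> V. \<forall>v'\<in>N2 k \<inter> V'. g v \<noteq> g' v')" by metis
      have "\<And>k. k \<in> K \<Longrightarrow> open (N1 k)" "K \<subseteq> (\<Union>k\<in>K. N1 k)" using sep by auto
      then obtain D where D: "D \<subseteq> K" "finite D" "K \<subseteq> (\<Union>k\<in>D. N1 k)"
        by (rule compactE_image[OF \<eta>(4)])
      let ?M = "V' \<inter> (\<Inter>k\<in>D. N2 k)"
      have o: "open ?M" using D sep good_atlasD(1)[OF A(1) A'] by (intro open_Int open_INT) auto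
      have z: "(F \<circ> g') u = 0" if u: "u \<in> ?M" for u
      proof (cases "g' u \<in> g ` N")
        case True
        then obtain v where v: "v \<in> N" "g' u = g v" by auto
        have "v \<notin> K"
        proof
          assume "v \<in> K"
          then obtain k where k: "k \<in> D" "v \<in> N1 k" using D by auto
          then have "v \<in> N1 k \<inter> V" "u \<in> N2 k \<inter> V'" "k \<in> K" using D(1) u v(1) N(2) k by auto
          then show False using sep[of k] v(2) by (metis (no_types))
        qed
        then show ?thesis using Fg[OF v(1)] v(2) \<eta>0 by simp
      next
        case False
        then show ?thesis using F0 atlas_points[OF A'] u by simp
      qed
      have "smooth_on ?M (F \<circ> g')"
        by (rule smooth_on_eq[OF o smooth_on_const[of _ 0] z])
      then show ?thesis using o w' sep D by blast
    qed
  qed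
  then have "F \<in> smooth_funs (atlas_space A)"
    unfolding atlas_space_sel(2) by (auto simp: F_def)
  moreover have "F (g v) = \<phi> v" if "v \<in> N'" for v using Fg[of v] \<eta>1[OF that] that \<eta>(5,6) by auto
  ultimately show ?thesis using that[of F N'] \<eta>(2,3,5,6) F0 by blast
qed

lemma atlas_preimage:
  assumes A: "good_atlas A" "(V, g) \<in> A" and U: "openin (space_topology (atlas_space A)) U"
  shows "open {w\<in>V. g w \<in> U}"
proof -
  have "continuous_map (top_of_set V) (space_topology (atlas_space A)) g"
    unfolding space_topology_def
  proof (rule continuous_on_generated_topo)
    fix T assume "T \<in> {points (atlas_space A) \<inter> f -` S |f S. f \<in> smooth_funs (atlas_space A) \<and> open S}"
    then obtain f S where f: "T = points (atlas_space A) \<inter> f -` S" "f \<in> smooth_funs (atlas_space A)" "open S" by blast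
    have "smooth_on V (f \<circ> g)" using f(2) A(2) by (auto simp: atlas_space_sel(2))
    then have "open (V \<inter> (f \<circ> g) -` S)"
      by (intro continuous_open_preimage smooth_on_continuous good_atlasD(1)[OF A] f(3))
    moreover have "g -` T \<inter> V = V \<inter> (f \<circ> g) -` S" using f atlas_points[OF A(2)] by auto
    ultimately show "openin (top_of_set V) (g -` T \<inter> topspace (top_of_set V))"
      by (auto simp: openin_open_eq good_atlasD(1)[OF A])
  next
    have "points (atlas_space A) \<in> {points (atlas_space A) \<inter> f -` S |f S. f \<in> smooth_funs (atlas_space A) \<and> open S}"
      using atlas_const[OF A(1), of 0] by (intro CollectI exI[of _ "\<lambda>_\<in>points (atlas_space A). 0"] exI[of _ UNIV]) simp
    then show "g ` topspace (top_of_set V) \<subseteq> \<Union> {points (atlas_space A) \<inter> f -` S |f S. f \<in> smooth_funs (atlas_space A) \<and> open S}"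
      using atlas_points[OF A(2)] by (auto intro!: UnionI)
  qed
  from openin_continuous_map_preimage[OF this U] show ?thesis
    by (simp add: openin_open_eq good_atlasD(1)[OF A])
qed

text \<open>At each point of the image there is a smooth function that is nonzero there and vanishes
  outside the image; such a function is what openness in the initial topology requires.\<close>

lemma atlas_image_open:
  assumes A: "good_atlas A" "(V, g) \<in> A" and N: "open N" "N \<subseteq> V"
  shows "openin (space_topology (atlas_space A)) (g ` N)"
proof (subst openin_subopen, safe)
  fix w assume w: "w \<in> N"
  obtain F N' where F: "F \<in> smooth_funs (atlas_space A)" "w \<in> N'" "\<And>v. v \<in> N' \<Longrightarrow> F (g v) = 1"
    "\<And>p. p \<in> points (atlas_space A) \<Longrightarrow> p \<notin> g ` N \<Longrightarrow> F p = 0"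
    using atlas_extend[OF A N w smooth_on_const[of N 1]] by metis
  have "openin (space_topology (atlas_space A)) (points (atlas_space A) \<inter> F -` (- {0}))"
    by (rule space_topology_generator[OF F(1)]) (simp add: open_Compl)
  moreover have "g w \<in> points (atlas_space A) \<inter> F -` (- {0})"
    using F(3)[OF F(2)] w N atlas_points[OF A(2)] by auto
  moreover have "points (atlas_space A) \<inter> F -` (- {0}) \<subseteq> g ` N" using F(4) by auto
  ultimately show "\<exists>T. openin (space_topology (atlas_space A)) T \<and> g w \<in> T \<and> T \<subseteq> g ` N" by blast
qed

lemma atlas_openI:
  assumes A: "good_atlas A" and U: "U \<subseteq> points (atlas_space A)" "\<And>V g. (V, g) \<in> A \<Longrightarrow> open {w\<in>V. g w \<in> U}"
  shows "openin (space_topology (atlas_space A)) U"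
proof (subst openin_subopen, intro ballI)
  fix p assume p: "p \<in> U"
  then obtain V g w where w: "(V, g) \<in> A" "w \<in> V" "p = g w" using U(1) by (blast elim: atlas_pointsE)
  have "openin (space_topology (atlas_space A)) (g ` {w\<in>V. g w \<in> U})"
    by (rule atlas_image_open[OF A w(1) U(2)[OF w(1)]]) auto
  then show "\<exists>T. openin (space_topology (atlas_space A)) T \<and> p \<in> T \<and> T \<subseteq> U" using w p by blast
qed

lemma nice_atlas:
  assumes A: "good_atlas A"
  shows "nice_space (atlas_space A)"
  unfolding nice_space_def
proof (intro conjI allI ballI impI)
  let ?X = "atlas_space A"
  note smI = atlas_smooth_funI[OF A]
  have ch: "smooth_on V (\<lambda>w. f (g w))" if "f \<in> smooth_funs ?X" "(V, g) \<in> A" for f V g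
    using that unfolding atlas_space_sel(2) comp_def by blast
  note op = good_atlasD(1)[OF A]
  show "smooth_funs ?X \<subseteq> extensional (points ?X)" unfolding subset_iff atlas_space_sel(2) by blast
  show "(\<lambda>t\<in>points ?X. c) \<in> smooth_funs ?X" for c :: real
    by (rule atlas_const[OF A])
  fix f h and a :: real assume f: "f \<in> smooth_funs ?X" and h: "h \<in> smooth_funs ?X"
  show "(\<lambda>t\<in>points ?X. f t * h t) \<in> smooth_funs ?X"
  proof (rule smI)
    fix V g assume Vg: "(V, g) \<in> A"
    show "\<exists>k. smooth_on V k \<and> (\<forall>w\<in>V. (\<lambda>t\<in>points ?X. f t * h t) (g w) = k w)"
      by (rule exI[of _ "\<lambda>w. f (g w) * h (g w)"])
        (use smooth_on_mult[OF op[OF Vg] ch[OF f Vg] ch[OF h Vg]] atlas_points[OF Vg] in auto)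
  qed simp
  show "(\<lambda>t\<in>points ?X. a * f t + h t) \<in> smooth_funs ?X"
  proof (rule smI)
    fix V g assume Vg: "(V, g) \<in> A"
    show "\<exists>k. smooth_on V k \<and> (\<forall>w\<in>V. (\<lambda>t\<in>points ?X. a * f t + h t) (g w) = k w)"
      by (rule exI[of _ "\<lambda>w. a * f (g w) + h (g w)"])
        (use smooth_on_add[OF op[OF Vg] smooth_on_mult[OF op[OF Vg] smooth_on_const ch[OF f Vg]] ch[OF h Vg]] atlas_points[OF Vg] in auto)
  qed simp
next
  let ?X = "atlas_space A"
  fix U s assume U: "openin (space_topology ?X) U \<and> s \<in> U"
  then have "s \<in> points ?X"
    using openin_subset unfolding space_topology_def topology_generated_by_topspace by fastforce
  then obtain V g w where w: "(V, g) \<in> A" "w \<in> V" "s = g w" by (rule atlas_pointsE)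
  let ?N = "{w\<in>V. g w \<in> U}"
  have N: "open ?N" "?N \<subseteq> V" "w \<in> ?N" using atlas_preimage[OF A w(1)] U w by auto
  obtain F N' where F: "F \<in> smooth_funs ?X" "open N'" "w \<in> N'" "N' \<subseteq> ?N" "\<And>v. v \<in> N' \<Longrightarrow> F (g v) = 1"
    "\<And>p. p \<in> points ?X \<Longrightarrow> p \<notin> g ` ?N \<Longrightarrow> F p = 0"
    by (rule atlas_extend[OF A w(1) N smooth_on_const[of ?N 1]]) (rule that)
  show "\<exists>f\<in>smooth_funs ?X. \<exists>W. openin (space_topology ?X) W \<and> s \<in> W \<and> W \<subseteq> U \<and> (\<forall>t\<in>W. f t = 1) \<and> (\<forall>t\<in>points ?X - U. f t = 0)"
  proof (intro bexI[OF _ F(1)] exI[of _ "g ` N'"] conjI)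
    show "openin (space_topology ?X) (g ` N')" using F(2,4) by (intro atlas_image_open[OF A w(1)]) auto
  qed (use F w in auto)
next
  let ?X = "atlas_space A"
  fix f assume f: "f \<in> extensional (points ?X)" and loc: "\<forall>s\<in>points ?X. \<exists>W. \<exists>F\<in>smooth_funs ?X.
      openin (space_topology ?X) W \<and> s \<in> W \<and> (\<forall>t\<in>W. f t = F t)"
  have "smooth_on V (f \<circ> g)" if Vg: "(V, g) \<in> A" for V g
  proof (rule smooth_on_local)
    fix w assume w: "w \<in> V"
    obtain W F where W: "F \<in> smooth_funs ?X" "openin (space_topology ?X) W" "g w \<in> W" "\<forall>t\<in>W. f t = F t"
      using loc atlas_points[OF Vg w] by blast
    have o: "open {v\<in>V. g v \<in> W}" by (rule atlas_preimage[OF A Vg W(2)])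
    have "smooth_on V (F \<circ> g)" using W(1) Vg unfolding atlas_space_sel(2) by blast
    then have "smooth_on {v\<in>V. g v \<in> W} (F \<circ> g)" by (rule smooth_on_subset) auto
    then have "smooth_on {v\<in>V. g v \<in> W} (f \<circ> g)"
      using smooth_on_cong[OF o, of "f \<circ> g" "F \<circ> g"] W(4) by simp
    then show "\<exists>N. open N \<and> w \<in> N \<and> smooth_on N (f \<circ> g)" using o w W(3) by blast
  qed
  then show "f \<in> smooth_funs ?X" unfolding atlas_space_sel(2) using f by blast
qed

lemma atlas_chart:
  assumes A: "good_atlas A" "(V, g) \<in> A"
  shows "is_chart (atlas_space A) V g"
proof -
  have "\<exists>F\<in>smooth_funs (atlas_space A). \<exists>N'. open N' \<and> w \<in> N' \<and> N' \<subseteq> N \<and> (\<forall>v\<in>N'. F (g v) = \<phi> v)"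
    if N: "open N" "N \<subseteq> V" "w \<in> N" "smooth_on N \<phi>" for N \<phi> w
  proof -
    obtain F N' where F: "F \<in> smooth_funs (atlas_space A)" "open N'" "w \<in> N'" "N' \<subseteq> N" "\<And>v. v \<in> N' \<Longrightarrow> F (g v) = \<phi> v"
      by (rule atlas_extend[OF A N]) (rule that)
    then show ?thesis by blast
  qed
  moreover have "smooth_on V (\<lambda>w. F (g w))" if "F \<in> smooth_funs (atlas_space A)" for F
    using that A(2) unfolding atlas_space_sel(2) comp_def by blast
  ultimately show ?thesis
    unfolding is_chart_def
    using good_atlasD(1,2)[OF A] atlas_preimage[OF A] atlas_image_open[OF A] by blast
qed

lemma Hausdorff_atlas:
  assumes A: "good_atlas A"
  shows "Hausdorff_space (space_topology (atlas_space A))"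
  unfolding Hausdorff_space_def nice_topspace[OF nice_atlas[OF A]]
proof (intro allI impI)
  fix p q assume pq: "p \<in> points (atlas_space A) \<and> q \<in> points (atlas_space A) \<and> p \<noteq> q"
  obtain V g w where w: "(V, g) \<in> A" "w \<in> V" "p = g w" using pq by (blast elim: atlas_pointsE)
  obtain V' g' w' where w': "(V', g') \<in> A" "w' \<in> V'" "q = g' w'" using pq by (blast elim: atlas_pointsE)
  obtain N N' where N: "open N" "open N'" "w \<in> N" "w' \<in> N'"
    "\<And>v v'. v \<in> N \<Longrightarrow> v \<in> V \<Longrightarrow> v' \<in> N' \<Longrightarrow> v' \<in> V' \<Longrightarrow> g v \<noteq> g' v'"
    by (rule separated_chartsE[OF good_atlasD(4)[OF A w(1) w'(1)] w(2) w'(2)]) (use pq w w' that in auto)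
  have "openin (space_topology (atlas_space A)) (g ` (N \<inter> V))" "openin (space_topology (atlas_space A)) (g' ` (N' \<inter> V'))"
    using N(1,2) good_atlasD(1)[OF A w(1)] good_atlasD(1)[OF A w'(1)]
    by (auto intro!: atlas_image_open[OF A w(1)] atlas_image_open[OF A w'(1)])
  moreover have "disjnt (g ` (N \<inter> V)) (g' ` (N' \<inter> V'))" using N(5) by (auto simp: disjnt_def)
  ultimately show "\<exists>U V. openin (space_topology (atlas_space A)) U \<and> openin (space_topology (atlas_space A)) V \<and> p \<in> U \<and> q \<in> V \<and> disjnt U V"
    using w w' N by blast
qed

lemma second_countable_atlas:
  assumes A: "good_atlas A"
  shows "second_countable (space_topology (atlas_space A))"
proof -
  obtain B :: "(real^3) set set" where B: "countable B" "\<And>C. C \<in> B \<Longrightarrow> open C"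
    "\<And>S. open S \<Longrightarrow> \<exists>U. U \<subseteq> B \<and> S = \<Union>U" using univ_second_countable by metis
  let ?B = "(\<lambda>((V, g), C). g ` (C \<inter> V)) ` (A \<times> B)"
  have "finite A" using A by (simp add: good_atlas_def)
  then have "countable ?B" using B(1) by (intro countable_image countable_SIGMA) (auto simp: countable_finite)
  moreover have "openin (space_topology (atlas_space A)) C" if "C \<in> ?B" for C
  proof -
    obtain V g D where D: "C = g ` (D \<inter> V)" "(V, g) \<in> A" "D \<in> B" using \<open>C \<in> ?B\<close> by auto
    show ?thesis unfolding D(1)
      using B(2)[OF D(3)] good_atlasD(1)[OF A D(2)] by (intro atlas_image_open[OF A D(2)]) auto
  qed
  moreover have "\<exists>C\<in>?B. p \<in> C \<and> C \<subseteq> U" if U: "openin (space_topology (atlas_space A)) U" "p \<in> U" for U p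
  proof -
    have "p \<in> points (atlas_space A)" using U openin_subset nice_topspace[OF nice_atlas[OF A]] by fastforce
    then obtain V g w where w: "(V, g) \<in> A" "w \<in> V" "p = g w" by (rule atlas_pointsE)
    have "open {w\<in>V. g w \<in> U}" by (rule atlas_preimage[OF A w(1) U(1)])
    then obtain B' where B': "B' \<subseteq> B" "{w\<in>V. g w \<in> U} = \<Union>B'" using B(3) by blast
    have "w \<in> \<Union>B'" using w U(2) unfolding B'(2)[symmetric] by simp
    then obtain D where "D \<in> B" "w \<in> D" "D \<subseteq> {w\<in>V. g w \<in> U}" unfolding B'(2) using B'(1) by blast
    then have "g ` (D \<inter> V) \<in> ?B" using w(1) by (intro image_eqI[of _ _ "((V, g), D)"]) auto
    moreover have "p \<in> g ` (D \<inter> V)" "g ` (D \<inter> V) \<subseteq> U" using w \<open>w \<in> D\<close> \<open>D \<subseteq> _\<close> by auto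
    ultimately show ?thesis by blast
  qed
  ultimately have "countable ?B \<and> (\<forall>V\<in>?B. openin (space_topology (atlas_space A)) V) \<and>
      (\<forall>U x. openin (space_topology (atlas_space A)) U \<and> x \<in> U \<longrightarrow> (\<exists>V\<in>?B. x \<in> V \<and> V \<subseteq> U))"
    by (intro conjI ballI allI impI) (assumption, simp only:, simp only:)
  then show ?thesis unfolding second_countable_def by (rule exI)
qed

section \<open>Blowing up an atlas\<close>

primrec centres :: "bpoint \<Rightarrow> bpoint set" where
  "centres (Base v) = {}"
| "centres (Exc c l) = insert c (centres c)"

text \<open>No point of the space has been blown up on the way to another point; so a point of a new
  exceptional divisor differs from all points present before.\<close>

definition fresh :: "param set \<Rightarrow> bool" where
  "fresh A \<longleftrightarrow> (\<forall>p\<in>points (atlas_space A). centres p \<inter> points (atlas_space A) = {})"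

lemma centres_trans: "q \<in> centres p \<Longrightarrow> centres q \<subseteq> centres p"
  by (induction p) auto

lemma centres_size: "q \<in> centres p \<Longrightarrow> size q < size p"
  by (induction p) auto

lemma fresh_Exc: "fresh A \<Longrightarrow> c \<in> points (atlas_space A) \<Longrightarrow> Exc c l \<notin> points (atlas_space A)"
  by (auto simp: fresh_def)

lemma chart_dir_nth: "chart_dir i w $ j = (if j = i then 1 else w $ j)"
  by (simp add: chart_dir_def)

lemma chart_dir_self [simp]: "chart_dir i w $ i = 1"
  by (simp add: chart_dir_def)

definition blow_map :: "real^3 \<Rightarrow> 3 \<Rightarrow> real^3 \<Rightarrow> real^3" where
  "blow_map c i w = c + w $ i *\<^sub>R chart_dir i w"

lemma blow_map_nth: "blow_map c i w $ j = c $ j + w $ i * (if j = i then 1 else w $ j)"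
  by (simp add: blow_map_def chart_dir_nth)

lemma smooth_blow_map: "open S \<Longrightarrow> smooth_vec S (blow_map c i)"
  unfolding smooth_vec_cart blow_map_nth
proof
  fix j
  assume "open S"
  then show "smooth_on S (\<lambda>x. c $ j + x $ i * (if j = i then 1 else x $ j))"
    by (cases "j = i") (auto intro!: smooth_intros)
qed

lemma blow_map_eq_centre: "blow_map c i w = c \<longleftrightarrow> w $ i = 0"
  by (auto simp: vec_eq_iff blow_map_nth)

lemma blow_param_eq:
  "blow_param g c i w = (if w $ i = 0 then Exc (g c) (span {chart_dir i w}) else g (blow_map c i w))"
  by (simp add: blow_param_def blow_map_def)

definition blow_dom :: "(real^3) set \<Rightarrow> real^3 \<Rightarrow> 3 \<Rightarrow> (real^3) set" where
  "blow_dom V c i = {w. blow_map c i w \<in> V}"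

lemma blow_atlas_eq:
  "blow_atlas A (V, g) c = (\<lambda>(V', g'). ({w \<in> V'. g' w \<noteq> g c}, g')) ` A \<union>
     (\<lambda>i. (blow_dom V c i, blow_param g c i)) ` UNIV"
  by (auto simp: blow_atlas_def blow_dom_def blow_map_def)

lemma open_blow_dom: "open V \<Longrightarrow> open (blow_dom V c i)"
  using continuous_open_preimage[OF smooth_vec_continuous[OF smooth_blow_map[OF open_UNIV]] open_UNIV, of V c i]
  by (simp add: blow_dom_def vimage_def)

text \<open>The relation between the affine coordinates of one line in two charts; by the last
  conclusion the two normalizing entries are inverse to each other.\<close>

lemma span_chart_dir_eqD:
  assumes "span {chart_dir i w} = span {chart_dir i' w'}"
  obtains k where "chart_dir i w = k *\<^sub>R chart_dir i' w'" "k \<noteq> 0" "chart_dir i w $ i' = k"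
    "chart_dir i w $ i' * chart_dir i' w' $ i = 1"
proof -
  have "chart_dir i w \<in> span {chart_dir i' w'}" using assms span_base by blast
  then obtain k where k: "chart_dir i w = k *\<^sub>R chart_dir i' w'" by (auto simp: span_singleton)
  then have e: "1 = k * chart_dir i' w' $ i" "chart_dir i w $ i' = k"
    by (metis chart_dir_self vector_scaleR_component real_scaleR_def, metis chart_dir_self vector_scaleR_component real_scaleR_def mult.right_neutral)
  show ?thesis by (rule that[OF k _ e(2)]) (use e in auto)
qed

lemma span_singleton_scale: "(k::real) \<noteq> 0 \<Longrightarrow> span {k *\<^sub>R v} = span {v}"
  unfolding span_singleton
proof safe
  fix c assume "k \<noteq> 0"
  show "c *\<^sub>R k *\<^sub>R v \<in> range (\<lambda>k. k *\<^sub>R v)" by (rule image_eqI[of _ _ "c * k"]) auto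
  show "c *\<^sub>R v \<in> range (\<lambda>c. c *\<^sub>R k *\<^sub>R v)" using \<open>k \<noteq> 0\<close> by (intro image_eqI[of _ _ "c / k"]) auto
qed

locale blow_setup =
  fixes A :: "param set" and V :: "(real^3) set" and g :: "real^3 \<Rightarrow> bpoint" and c :: "real^3"
  assumes good: "good_atlas A" and fresh: "fresh A" and Vg: "(V, g) \<in> A" and cV: "c \<in> V"
begin

abbreviation "M \<equiv> points (atlas_space A)"
abbreviation "new i \<equiv> blow_param g c i"
abbreviation "ndom i \<equiv> blow_dom V c i"

lemma inj_g: "inj_on g V" and open_V: "open V"
  using good_atlasD[OF good Vg] by auto

lemma old_not_Exc: "(V', g') \<in> A \<Longrightarrow> w \<in> V' \<Longrightarrow> g' w \<noteq> Exc (g c) l"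
  using fresh_Exc[OF fresh atlas_points[OF Vg cV]] atlas_points by metis

lemma new_eq_old_iff:
  assumes "(V', g') \<in> A" "w' \<in> V'" "w \<in> ndom i" "new i w = g' w'"
  shows "w $ i \<noteq> 0" "g (blow_map c i w) = g' w'"
  using assms(4) old_not_Exc[OF assms(1,2), symmetric] by (auto simp: blow_param_eq split: if_splits)

lemma new_not_centre: "w \<in> ndom i \<Longrightarrow> w $ i \<noteq> 0 \<Longrightarrow> g (blow_map c i w) \<noteq> g c"
  using inj_g cV blow_map_eq_centre unfolding blow_dom_def by (metis inj_onD mem_Collect_eq)

text \<open>The incidence model of the blow-up: a point is a pair of a point below and a line.
  Freshness of the atlas keeps exceptional points apart from old ones.\<close>

lemma new_eq_iff:
  assumes "w \<in> ndom i" "w' \<in> ndom i'"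
  shows "new i w = new i' w' \<longleftrightarrow> blow_map c i w = blow_map c i' w' \<and> span {chart_dir i w} = span {chart_dir i' w'}"
proof
  assume eq: "new i w = new i' w'"
  have V: "blow_map c i w \<in> V" "blow_map c i' w' \<in> V" using assms by (auto simp: blow_dom_def)
  show "blow_map c i w = blow_map c i' w' \<and> span {chart_dir i w} = span {chart_dir i' w'}"
  proof (cases "w $ i = 0")
    case True
    then have "w' $ i' = 0" using eq old_not_Exc[OF Vg V(2), symmetric] by (auto simp: blow_param_eq split: if_splits)
    then show ?thesis using True eq blow_map_eq_centre by (simp add: blow_param_eq) metis
  next
    case False
    then have w': "w' $ i' \<noteq> 0" using eq old_not_Exc[OF Vg V(1)] by (auto simp: blow_param_eq split: if_splits)
    then have b: "blow_map c i w = blow_map c i' w'" using False eq inj_g V by (simp add: blow_param_eq inj_on_def)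
    then have "w $ i *\<^sub>R chart_dir i w = w' $ i' *\<^sub>R chart_dir i' w'" by (simp add: blow_map_def)
    then show ?thesis using b False w' span_singleton_scale by metis
  qed
next
  assume "blow_map c i w = blow_map c i' w' \<and> span {chart_dir i w} = span {chart_dir i' w'}"
  then show "new i w = new i' w'" using blow_map_eq_centre by (simp add: blow_param_eq) metis
qed

lemma inj_new: "inj_on (new i) (ndom i)"
proof (rule inj_onI)
  fix w w' assume w: "w \<in> ndom i" "w' \<in> ndom i" "new i w = new i w'"
  then have eq: "blow_map c i w = blow_map c i w'" "span {chart_dir i w} = span {chart_dir i w'}"
    using new_eq_iff by blast+
  obtain k where k: "chart_dir i w = k *\<^sub>R chart_dir i w'" "chart_dir i w $ i = k"
    by (rule span_chart_dir_eqD[OF eq(2)]) (rule that)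
  have "k = 1" using k(2) by simp
  then have d: "chart_dir i w = chart_dir i w'" using k(1) by simp
  have "w $ i = w' $ i" using eq(1) blow_map_nth[of c i w i] blow_map_nth[of c i w' i] by simp
  then have "w $ j = w' $ j" for j
    using d chart_dir_nth[of i w j] chart_dir_nth[of i w' j] by (cases "j = i") auto
  then show "w = w'" by (simp add: vec_eq_iff)
qed

text \<open>The usual change between affine charts of a blow-up: the direction is rescaled so that
  its entry \<open>i'\<close> becomes \<open>1\<close>, and the scale moves into the new coordinate
  \<open>i'\<close>.\<close>

definition change :: "3 \<Rightarrow> 3 \<Rightarrow> real^3 \<Rightarrow> real^3" where
  "change i i' w = (\<chi> j. if j = i' then w $ i * chart_dir i w $ i' else chart_dir i w $ j / chart_dir i w $ i')"

lemma change:
  assumes "w \<in> ndom i" "chart_dir i w $ i' \<noteq> 0"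
  shows "change i i' w \<in> ndom i'" "new i' (change i i' w) = new i w"
proof -
  have d: "chart_dir i' (change i i' w) = (1 / chart_dir i w $ i') *\<^sub>R chart_dir i w"
    using assms(2) by (auto simp: vec_eq_iff chart_dir_nth[of i'] change_def)
  have b: "blow_map c i' (change i i' w) = blow_map c i w"
    unfolding blow_map_def d using assms(2) by (simp add: change_def)
  then show dm: "change i i' w \<in> ndom i'" using assms(1) by (simp add: blow_dom_def)
  have "span {chart_dir i' (change i i' w)} = span {chart_dir i w}"
    unfolding d using assms(2) by (intro span_singleton_scale) simp
  then show "new i' (change i i' w) = new i w" using new_eq_iff[OF dm assms(1)] b by blast
qed

definition change_dom :: "3 \<Rightarrow> 3 \<Rightarrow> (real^3) set" where
  "change_dom i i' = {w \<in> ndom i. chart_dir i w $ i' \<noteq> 0}"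

lemma smooth_chart_dir: "open S \<Longrightarrow> smooth_on S (\<lambda>w. chart_dir i w $ j)"
  unfolding chart_dir_nth by (cases "j = i") (auto intro: smooth_intros)

lemma open_change_dom: "open (change_dom i i')"
proof -
  have "open (ndom i \<inter> (\<lambda>w. chart_dir i w $ i') -` (- {0}))"
    by (intro continuous_open_preimage smooth_on_continuous smooth_chart_dir open_blow_dom open_V) (simp add: open_Compl)
  moreover have "change_dom i i' = ndom i \<inter> (\<lambda>w. chart_dir i w $ i') -` (- {0})" by (auto simp: change_dom_def)
  ultimately show ?thesis by simp
qed

lemma smooth_change: "smooth_vec (change_dom i i') (change i i')"
  unfolding change_def
proof (rule smooth_vec_lambda)
  have nz: "x \<in> change_dom i i' \<Longrightarrow> chart_dir i x $ i' \<noteq> 0" for x by (simp add: change_dom_def)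
  fix j
  show "smooth_on (change_dom i i') (\<lambda>w. if j = i' then w $ i * chart_dir i w $ i' else chart_dir i w $ j / chart_dir i w $ i')"
    using open_change_dom nz by (cases "j = i'") (auto intro!: smooth_intros smooth_chart_dir)
qed

lemma new_eq_change_dom:
  assumes "w \<in> ndom i" "w' \<in> ndom i'" "new i w = new i' w'"
  shows "w \<in> change_dom i i'" "chart_dir i w $ i' * chart_dir i' w' $ i = 1"
proof -
  have "span {chart_dir i w} = span {chart_dir i' w'}" using assms new_eq_iff by blast
  then obtain k where "k \<noteq> 0" "chart_dir i w $ i' = k" "chart_dir i w $ i' * chart_dir i' w' $ i = 1"
    by (rule span_chart_dir_eqD) (rule that)
  then show "w \<in> change_dom i i'" "chart_dir i w $ i' * chart_dir i' w' $ i = 1"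
    using assms(1) by (auto simp: change_dom_def)
qed

section \<open>Compatibility and separation of the charts of a blow-up\<close>

lemma transition_new_new: "transition (ndom i) (new i) (ndom i') (new i')"
  unfolding transition_def
proof (intro ballI impI)
  fix w w' assume w: "w \<in> ndom i" "w' \<in> ndom i'" "new i w = new i' w'"
  show "\<exists>N \<tau>. open N \<and> w \<in> N \<and> N \<subseteq> ndom i \<and> smooth_vec N \<tau> \<and> (\<forall>v\<in>N. \<tau> v \<in> ndom i' \<and> new i' (\<tau> v) = new i v)"
    by (rule exI[of _ "change_dom i i'"], rule exI[of _ "change i i'"])
      (use open_change_dom smooth_change change new_eq_change_dom[OF w] in \<open>auto simp: change_dom_def\<close>)
qed

text \<open>Where a change of charts exists, both points can be compared inside the second chart,
  whose domain lies in three-space and is therefore Hausdorff.\<close>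

lemma separated_change:
  assumes "w \<in> change_dom i i'" "w' \<in> ndom i'" "new i w \<noteq> new i' w'"
  shows "\<exists>N N'. open N \<and> open N' \<and> w \<in> N \<and> w' \<in> N' \<and> (\<forall>v\<in>N \<inter> ndom i. \<forall>v'\<in>N' \<inter> ndom i'. new i v \<noteq> new i' v')"
proof -
  have "change i i' w \<noteq> w'" using assms change[of w i i'] by (auto simp: change_dom_def)
  then obtain U U' where U: "open U" "open U'" "change i i' w \<in> U" "w' \<in> U'" "U \<inter> U' = {}"
    using hausdorff[of "change i i' w" w'] by metis
  have "open (change_dom i i' \<inter> change i i' -` U)"
    by (rule continuous_open_preimage[OF smooth_vec_continuous[OF smooth_change] open_change_dom U(1)])
  moreover have "new i v \<noteq> new i' v'" if "v \<in> change_dom i i' \<inter> change i i' -` U" "v' \<in> U'" "v' \<in> ndom i'" for v v'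
  proof
    assume "new i v = new i' v'"
    then have "change i i' v = v'"
      using change[of v i i'] that inj_new[of i'] unfolding change_dom_def by (auto dest: inj_onD)
    then show False using that U by auto
  qed
  ultimately show ?thesis using assms(1) U by blast
qed

lemma separated_new_new: "separated_charts (ndom i) (new i) (ndom i') (new i')"
  unfolding separated_charts_def
proof (intro ballI impI)
  fix w w' assume w: "w \<in> ndom i" "w' \<in> ndom i'" "new i w \<noteq> new i' w'"
  show "\<exists>N N'. open N \<and> open N' \<and> w \<in> N \<and> w' \<in> N' \<and> (\<forall>v\<in>N \<inter> ndom i. \<forall>v'\<in>N' \<inter> ndom i'. new i v \<noteq> new i' v')"
  proof (cases "w \<in> change_dom i i'")
    case True
    show ?thesis by (rule separated_change[OF True w(2,3)])
  next
    case False
    show ?thesis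
    proof (cases "w' \<in> change_dom i' i")
      case True
      then show ?thesis using separated_change[OF True w(1)] w(3) by metis
    next
      case nin: False
      have z: "chart_dir i w $ i' = 0" "chart_dir i' w' $ i = 0" using False nin w by (auto simp: change_dom_def)
      \<comment> \<open>Neither direction is visible in the other chart. At a common point the two
        entries would have product \<open>1\<close>, which is impossible when both are below
        \<open>1/2\<close> in absolute value.\<close>
      let ?N = "\<lambda>i i'. {v. \<bar>chart_dir i v $ i'\<bar> < 1/2}"
      have o: "open (?N i i')" for i i'
        by (rule open_Collect_less[OF continuous_on_rabs[OF smooth_on_continuous[OF smooth_chart_dir]]]) (auto intro: continuous_intros)
      have "new i v \<noteq> new i' v'" if "v \<in> ?N i i' \<inter> ndom i" "v' \<in> ?N i' i \<inter> ndom i'" for v v'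
      proof
        assume "new i v = new i' v'"
        then have "chart_dir i v $ i' * chart_dir i' v' $ i = 1" using new_eq_change_dom that by blast
        then have "\<bar>chart_dir i v $ i'\<bar> * \<bar>chart_dir i' v' $ i\<bar> = 1" by (metis abs_mult abs_one)
        moreover have "\<bar>chart_dir i v $ i'\<bar> * \<bar>chart_dir i' v' $ i\<bar> \<le> (1/2) * (1/2)"
          using that by (intro mult_mono) auto
        ultimately show False by simp
      qed
      then show ?thesis using o z by (intro exI[of _ "?N i i'"] exI[of _ "?N i' i"]) auto
    qed
  qed
qed

text \<open>The inverse of \<open>blow_map c i\<close> off the plane on which coordinate
  \<open>i\<close> equals that of the centre.\<close>

definition lift_point :: "3 \<Rightarrow> real^3 \<Rightarrow> real^3" where
  "lift_point i v = (\<chi> j. if j = i then v $ i - c $ i else (v $ j - c $ j) / (v $ i - c $ i))"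

lemma lift_point:
  assumes "v $ i \<noteq> c $ i"
  shows "blow_map c i (lift_point i v) = v" "lift_point i v $ i \<noteq> 0"
  using assms by (auto simp: vec_eq_iff blow_map_nth lift_point_def)

lemma transition_new_old:
  assumes "(V', g') \<in> A"
  shows "transition (ndom i) (new i) {w\<in>V'. g' w \<noteq> g c} g'"
  unfolding transition_def
proof (intro ballI impI)
  fix w w' assume w: "w \<in> ndom i" "w' \<in> {w\<in>V'. g' w \<noteq> g c}" "new i w = g' w'"
  have w': "w' \<in> V'" using w(2) by simp
  note n = new_eq_old_iff[OF assms w' w(1,3)]
  have b: "blow_map c i w \<in> V" using w(1) by (simp add: blow_dom_def)
  obtain N0 \<tau> where \<tau>: "open N0" "blow_map c i w \<in> N0" "N0 \<subseteq> V" "smooth_vec N0 \<tau>"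
    "\<And>v. v \<in> N0 \<Longrightarrow> \<tau> v \<in> V'" "\<And>v. v \<in> N0 \<Longrightarrow> g' (\<tau> v) = g v"
    by (rule transitionE[OF good_atlasD(3)[OF good Vg assms] b w' n(2)]) (rule that)
  let ?N = "{v. v $ i \<noteq> 0} \<inter> blow_map c i -` N0"
  have o: "open ?N"
    by (intro continuous_open_preimage[OF smooth_vec_continuous[OF smooth_blow_map]] \<tau>(1))
      (auto intro!: open_Collect_neq continuous_intros)
  have "smooth_vec ?N (\<lambda>v. \<tau> (blow_map c i v))"
    by (rule smooth_vec_compose[OF \<tau>(4) smooth_blow_map[OF o] o \<tau>(1)]) auto
  moreover have "\<forall>v\<in>?N. \<tau> (blow_map c i v) \<in> {w\<in>V'. g' w \<noteq> g c} \<and> g' (\<tau> (blow_map c i v)) = new i v"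
    using \<tau>(3,5,6) new_not_centre[of _ i] by (auto simp: blow_param_eq blow_dom_def)
  moreover have "?N \<subseteq> ndom i" "w \<in> ?N" using \<tau>(2,3) n(1) by (auto simp: blow_dom_def)
  ultimately show "\<exists>N \<tau>. open N \<and> w \<in> N \<and> N \<subseteq> ndom i \<and> smooth_vec N \<tau> \<and> (\<forall>v\<in>N. \<tau> v \<in> {w\<in>V'. g' w \<noteq> g c} \<and> g' (\<tau> v) = new i v)"
    using o by (intro exI[of _ ?N] exI[of _ "\<lambda>v. \<tau> (blow_map c i v)"]) blast
qed

lemma transition_old_new:
  assumes A': "(V', g') \<in> A"
  shows "transition {w\<in>V'. g' w \<noteq> g c} g' (ndom i) (new i)"
  unfolding transition_def
proof (intro ballI impI)
  fix w w' assume w: "w \<in> {w\<in>V'. g' w \<noteq> g c}" "w' \<in> ndom i" "g' w = new i w'"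
  have wV: "w \<in> V'" using w(1) by simp
  note n = new_eq_old_iff[OF A' wV w(2) w(3)[symmetric]]
  have b: "blow_map c i w' \<in> V" using w(2) by (simp add: blow_dom_def)
  obtain N0 \<tau> where \<tau>: "open N0" "w \<in> N0" "N0 \<subseteq> V'" "smooth_vec N0 \<tau>"
    "\<And>v. v \<in> N0 \<Longrightarrow> \<tau> v \<in> V" "\<And>v. v \<in> N0 \<Longrightarrow> g (\<tau> v) = g' v"
    by (rule transitionE[OF good_atlasD(3)[OF good A' Vg] wV b n(2)[symmetric]]) (rule that)
  have tw: "\<tau> w = blow_map c i w'" by (rule inj_onD[OF inj_g]) (use \<tau>(5,6)[OF \<tau>(2)] n(2) b in auto)
  let ?N = "N0 \<inter> (\<lambda>v. \<tau> v $ i) -` (- {c $ i})"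
  have ti: "smooth_on N0 (\<lambda>v. \<tau> v $ j)" for j using \<tau>(4) by (simp add: smooth_vec_cart)
  have o: "open ?N"
    by (rule continuous_open_preimage[OF smooth_on_continuous[OF ti] \<tau>(1)]) (simp add: open_Compl)
  have tN: "smooth_on ?N (\<lambda>v. \<tau> v $ j)" for j using smooth_on_subset[OF ti] by blast
  have "smooth_vec ?N (\<lambda>v. lift_point i (\<tau> v))"
    unfolding lift_point_def
  proof (rule smooth_vec_lambda)
    fix j
    show "smooth_on ?N (\<lambda>v. if j = i then \<tau> v $ i - c $ i else (\<tau> v $ j - c $ j) / (\<tau> v $ i - c $ i))"
      by (cases "j = i") (auto intro!: smooth_on_diff smooth_on_divide smooth_on_const o tN)
  qed
  moreover have "lift_point i (\<tau> v) \<in> ndom i \<and> new i (lift_point i (\<tau> v)) = g' v \<and> g' v \<noteq> g c" if v: "v \<in> ?N" for v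
  proof -
    have l: "blow_map c i (lift_point i (\<tau> v)) = \<tau> v" "lift_point i (\<tau> v) $ i \<noteq> 0"
      using lift_point[of "\<tau> v" i] v by auto
    then have d: "lift_point i (\<tau> v) \<in> ndom i" using \<tau>(5) v by (simp add: blow_dom_def)
    show ?thesis using d l \<tau>(6) v new_not_centre[OF d l(2)] by (simp add: blow_param_eq)
  qed
  moreover have "w \<in> ?N" using \<tau>(2) tw n(1) by (simp add: blow_map_nth)
  ultimately show "\<exists>N \<tau>. open N \<and> w \<in> N \<and> N \<subseteq> {w\<in>V'. g' w \<noteq> g c} \<and> smooth_vec N \<tau> \<and> (\<forall>v\<in>N. \<tau> v \<in> ndom i \<and> new i (\<tau> v) = g' v)"
    using o \<tau>(3) by (intro exI[of _ ?N] exI[of _ "\<lambda>v. lift_point i (\<tau> v)"]) blast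
qed

lemma separated_new_old:
  assumes A': "(V', g') \<in> A"
  shows "separated_charts (ndom i) (new i) {w\<in>V'. g' w \<noteq> g c} g'"
  unfolding separated_charts_def
proof (intro ballI impI)
  fix w w' assume w: "w \<in> ndom i" "w' \<in> {w\<in>V'. g' w \<noteq> g c}" "new i w \<noteq> g' w'"
  have b: "blow_map c i w \<in> V" "w' \<in> V'" using w by (auto simp: blow_dom_def)
  \<comment> \<open>An exceptional point lies over the centre, which the old chart omits; so
    distinct points have distinct images below and can be separated there.\<close>
  have ne: "g (blow_map c i w) \<noteq> g' w'"
    using w blow_map_eq_centre[of c i w] by (auto simp: blow_param_eq split: if_splits)
  obtain N N' where N: "open N" "open N'" "blow_map c i w \<in> N" "w' \<in> N'"
    "\<And>v v'. v \<in> N \<Longrightarrow> v \<in> V \<Longrightarrow> v' \<in> N' \<Longrightarrow> v' \<in> V' \<Longrightarrow> g v \<noteq> g' v'"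
    by (rule separated_chartsE[OF good_atlasD(4)[OF good Vg A'] b ne]) (rule that)
  have "open (UNIV \<inter> blow_map c i -` N)"
    by (rule continuous_open_preimage[OF smooth_vec_continuous[OF smooth_blow_map] _ N(1)]) auto
  moreover have "new i v \<noteq> g' v'" if "v \<in> blow_map c i -` N" "v \<in> ndom i" "v' \<in> N'" "v' \<in> V'" for v v'
    using that N(5)[of "blow_map c i v" v'] old_not_Exc[OF A' that(4), symmetric]
    by (auto simp: blow_param_eq blow_dom_def)
  ultimately show "\<exists>N N'. open N \<and> open N' \<and> w \<in> N \<and> w' \<in> N' \<and> (\<forall>v\<in>N \<inter> ndom i. \<forall>v'\<in>N' \<inter> {w\<in>V'. g' w \<noteq> g c}. new i v \<noteq> g' v')"
    using N by (intro exI[of _ "blow_map c i -` N"] exI[of _ N']) auto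
qed

text \<open>The centre is closed in every chart, because each other point can be separated from
  it.\<close>

lemma open_old:
  assumes A': "(V', g') \<in> A"
  shows "open {w\<in>V'. g' w \<noteq> g c}"
proof (subst open_subopen, safe)
  fix w assume w: "w \<in> V'" "g' w \<noteq> g c"
  obtain N N' where N: "open N" "open N'" "w \<in> N" "c \<in> N'"
    "\<And>v v'. v \<in> N \<Longrightarrow> v \<in> V' \<Longrightarrow> v' \<in> N' \<Longrightarrow> v' \<in> V \<Longrightarrow> g' v \<noteq> g v'"
    by (rule separated_chartsE[OF good_atlasD(4)[OF good A' Vg] w(1) cV w(2)]) (rule that)
  show "\<exists>T. open T \<and> w \<in> T \<and> T \<subseteq> {w\<in>V'. g' w \<noteq> g c}"
    using N w cV good_atlasD(1)[OF good A'] by (intro exI[of _ "N \<inter> V'"]) auto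
qed

lemma good_blow: "good_atlas (blow_atlas A (V, g) c)"
proof -
  have old: "transition {w\<in>V1. g1 w \<noteq> g c} g1 {w\<in>V2. g2 w \<noteq> g c} g2 \<and>
      separated_charts {w\<in>V1. g1 w \<noteq> g c} g1 {w\<in>V2. g2 w \<noteq> g c} g2"
    if A: "(V1, g1) \<in> A" "(V2, g2) \<in> A" for V1 g1 V2 g2
  proof
    show "transition {w\<in>V1. g1 w \<noteq> g c} g1 {w\<in>V2. g2 w \<noteq> g c} g2"
      unfolding transition_def
    proof (intro ballI impI)
      fix w w' assume w: "w \<in> {w\<in>V1. g1 w \<noteq> g c}" "w' \<in> {w\<in>V2. g2 w \<noteq> g c}" "g1 w = g2 w'"
      have wV: "w \<in> V1" "w' \<in> V2" using w by auto
      obtain N \<tau> where \<tau>: "open N" "w \<in> N" "N \<subseteq> V1" "smooth_vec N \<tau>"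
        "\<And>v. v \<in> N \<Longrightarrow> \<tau> v \<in> V2" "\<And>v. v \<in> N \<Longrightarrow> g2 (\<tau> v) = g1 v"
        by (rule transitionE[OF good_atlasD(3)[OF good A] wV w(3)]) (rule that)
      show "\<exists>N \<tau>. open N \<and> w \<in> N \<and> N \<subseteq> {w\<in>V1. g1 w \<noteq> g c} \<and> smooth_vec N \<tau> \<and> (\<forall>v\<in>N. \<tau> v \<in> {w\<in>V2. g2 w \<noteq> g c} \<and> g2 (\<tau> v) = g1 v)"
        using \<tau> w smooth_vec_subset[OF \<tau>(4), of "N \<inter> {w\<in>V1. g1 w \<noteq> g c}"] open_old[OF A(1)]
        by (intro exI[of _ "N \<inter> {w\<in>V1. g1 w \<noteq> g c}"] exI[of _ \<tau>]) auto
    qed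
    show "separated_charts {w\<in>V1. g1 w \<noteq> g c} g1 {w\<in>V2. g2 w \<noteq> g c} g2"
      by (rule separated_charts_subset[OF good_atlasD(4)[OF good A]]) auto
  qed
  have "finite (blow_atlas A (V, g) c)" using good unfolding blow_atlas_eq good_atlas_def by auto
  moreover have "open V1 \<and> inj_on g1 V1" if "(V1, g1) \<in> blow_atlas A (V, g) c" for V1 g1
  proof -
    have "inj_on g' {w \<in> V'. g' w \<noteq> g c}" if "(V', g') \<in> A" for V' g'
      by (rule inj_on_subset[OF good_atlasD(2)[OF good that]]) auto
    then show ?thesis
      using that open_old inj_new open_blow_dom[OF open_V] unfolding blow_atlas_eq by auto
  qed
  moreover have "transition V1 g1 V2 g2 \<and> separated_charts V1 g1 V2 g2"
    if "(V1, g1) \<in> blow_atlas A (V, g) c" "(V2, g2) \<in> blow_atlas A (V, g) c" for V1 g1 V2 g2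
    using that unfolding blow_atlas_eq
    by (auto simp: old transition_new_new separated_new_new transition_new_old transition_old_new
        separated_new_old separated_charts_sym[OF separated_new_old])
  ultimately show ?thesis unfolding good_atlas_def by blast
qed

lemma blow_points:
  assumes "p \<in> points (atlas_space (blow_atlas A (V, g) c))"
  shows "(p \<in> M \<and> p \<noteq> g c) \<or> (\<exists>i w. w $ i = 0 \<and> p = Exc (g c) (span {chart_dir i w}))"
proof -
  obtain V1 g1 w where w: "(V1, g1) \<in> blow_atlas A (V, g) c" "w \<in> V1" "p = g1 w"
    using assms by (rule atlas_pointsE)
  then consider V' where "(V', g1) \<in> A" "w \<in> V'" "g1 w \<noteq> g c" | i where "g1 = new i" "w \<in> ndom i"
    unfolding blow_atlas_eq by auto
  then show ?thesis
  proof cases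
    case 1
    then show ?thesis using w(3) atlas_points[OF 1(1,2)] by simp
  next
    case 2
    show ?thesis
    proof (cases "w $ i = 0")
      case True
      then have "p = Exc (g c) (span {chart_dir i w})" using 2 w(3) by (simp add: blow_param_eq)
      then show ?thesis using True by blast
    next
      case False
      then have "p = g (blow_map c i w)" using 2 w(3) by (simp add: blow_param_eq)
      then show ?thesis
        using False new_not_centre[OF 2(2) False] atlas_points[OF Vg, of "blow_map c i w"] 2(2)
        by (simp add: blow_dom_def)
    qed
  qed
qed

lemma blow_points_old: "p \<in> M \<Longrightarrow> p \<noteq> g c \<Longrightarrow> p \<in> points (atlas_space (blow_atlas A (V, g) c))"
  unfolding atlas_space_sel(1) blow_atlas_eq by force

text \<open>A centre \<open>q\<close> of \<open>p\<close> that is present in the blow-up must be a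
  new exceptional point over \<open>g c\<close>. Then \<open>g c\<close> is a centre of
  \<open>p\<close>, so \<open>p\<close> is not an old point and is itself exceptional over
  \<open>g c\<close>. Now \<open>q\<close> would be \<open>g c\<close> or one of its centres,
  although it is larger than \<open>g c\<close> as a datatype term.\<close>

lemma fresh_blow: "fresh (blow_atlas A (V, g) c)"
  unfolding fresh_def
proof (intro ballI equals0I)
  let ?M' = "points (atlas_space (blow_atlas A (V, g) c))"
  fix p q assume p: "p \<in> ?M'" and q: "q \<in> centres p \<inter> ?M'"
  have cM: "g c \<in> M" using atlas_points[OF Vg cV] .
  have old: "centres r \<inter> M = {}" if "r \<in> M" for r using fresh that by (auto simp: fresh_def)
  have "q \<notin> M \<or> q = g c"
    using blow_points[OF p]
  proof
    assume "p \<in> M \<and> p \<noteq> g c"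
    then show ?thesis using old q by blast
  next
    assume "\<exists>i w. w $ i = 0 \<and> p = Exc (g c) (span {chart_dir i w})"
    then have "q \<in> insert (g c) (centres (g c))" using q by auto
    then show ?thesis using old[OF cM] by blast
  qed
  then obtain l where l: "q = Exc (g c) l" using blow_points[of q] q by auto
  then have "g c \<in> centres p" using centres_trans[of q p] q by auto
  then have "p \<notin> M" using old cM by auto
  then obtain l' where "p = Exc (g c) l'" using blow_points[OF p] by auto
  then have "Exc (g c) l = g c \<or> Exc (g c) l \<in> centres (g c)" using q l by auto
  then show False using centres_size by fastforce
qed

end

section \<open>The stages of the Du Val resolution\<close>

definition duval_eqn :: "nat \<Rightarrow> real^3 \<Rightarrow> real" where
  "duval_eqn m v = v$3 * (v$1)^2 + (v$2)^2 - (v$3)^(2*m+1)"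

lemma duval_eqn_iff: "v \<in> duval m \<longleftrightarrow> duval_eqn m v = 0"
  by (auto simp: duval_def duval_eqn_def)

lemma smooth_duval_eqn: "smooth_on S (duval_eqn m)"
proof -
  have "smooth_on UNIV (duval_eqn m)" unfolding duval_eqn_def[abs_def] by (auto intro!: smooth_intros)
  then show ?thesis by (rule smooth_on_subset) simp
qed

text \<open>The part of the Du Val surface where \<open>x\<close> and \<open>z\<close> are local coordinates.\<close>

definition duval_graph :: "nat \<Rightarrow> (real^3) set" where
  "duval_graph k = {v \<in> duval k. v$2 \<noteq> 0}"

text \<open>The chart \<open>g\<close> is crepant for the equation \<open>F\<close> of the strict transform: the equation of
  \<open>duval k\<close> pulls back to \<open>F\<close> times the Jacobian determinant of \<open>g\<close>.  This makes the bracket in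
  the chart the Jacobian bracket of \<open>F\<close>.\<close>

definition crepant :: "nat \<Rightarrow> (real^3) set \<Rightarrow> (real^3 \<Rightarrow> bpoint) \<Rightarrow> (real^3 \<Rightarrow> real) \<Rightarrow> bool" where
  "crepant k V g F \<longleftrightarrow> smooth_on V F \<and> smooth_vec V (\<lambda>w. blowdown (g w)) \<and> (\<exists>u. smooth_on V u \<and>
     (\<forall>w\<in>V. duval_eqn k (blowdown (g w)) = u w * F w \<and>
        jac (\<lambda>x. blowdown (g x) $ 1) (\<lambda>x. blowdown (g x) $ 2) (\<lambda>x. blowdown (g x) $ 3) w = u w))"

lemma crepant_subset: "crepant k V g F \<Longrightarrow> W \<subseteq> V \<Longrightarrow> crepant k W g F"
  unfolding crepant_def
  by (elim conjE exE, intro conjI exI)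
    (erule smooth_on_subset, assumption, erule smooth_vec_subset, assumption, erule smooth_on_subset, assumption, blast)

lemma blowdown_blow_param: "blowdown (blow_param g c i w) = blowdown (g (blow_map c i w))"
  by (simp add: blow_param_eq) (metis blow_map_eq_centre)

lemma frechet_blow_map:
  "frechet_derivative (\<lambda>w. blow_map c i w $ j) (at w) v
     = v $ i * (if j = i then 1 else w $ j) + w $ i * (if j = i then 0 else v $ j)"
proof -
  have "((\<lambda>w. blow_map c i w $ j) has_derivative
      (\<lambda>v. v $ i * (if j = i then 1 else w $ j) + w $ i * (if j = i then 0 else v $ j))) (at w)"
  proof (cases "j = i")
    case True
    have "((\<lambda>w. c $ i + w $ i * 1) has_derivative (\<lambda>v. 0 + v $ i * 1)) (at w)"
      by (intro has_derivative_add has_derivative_const has_derivative_mult_left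
          bounded_linear_imp_has_derivative bounded_linear_vec_nth)
    then show ?thesis using True by (simp add: blow_map_nth)
  next
    case False
    have "((\<lambda>w. c $ j + w $ i * w $ j) has_derivative (\<lambda>v. 0 + (w $ i * v $ j + v $ i * w $ j))) (at w)"
      by (intro has_derivative_add has_derivative_const has_derivative_mult
          bounded_linear_imp_has_derivative bounded_linear_vec_nth)
    then show ?thesis using False by (simp add: blow_map_nth add.commute)
  qed
  from fun_cong[OF frechet_derivative_at[OF this], of v] show ?thesis by (rule sym)
qed

lemma jac_blow_map:
  "jac (\<lambda>x. blow_map c i x $ 1) (\<lambda>x. blow_map c i x $ 2) (\<lambda>x. blow_map c i x $ 3) w = (w $ i)^2"
  using exhaust_3[of i] unfolding jac_def frechet_blow_map
  by (auto simp: axis_def power2_eq_square)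

text \<open>A point blow-up of three-space has Jacobian determinant \<open>(w $ i)^2\<close>, and a
  double point of the surface contributes the same factor to its equation. The two factors balance,
  so blowing up double points keeps charts crepant.\<close>

lemma crepant_blow:
  assumes cr: "crepant k V g F" and V: "open V"
    and F': "\<And>w. w \<in> blow_dom V c i \<Longrightarrow> F (blow_map c i w) = (w $ i)^2 * F' w" "smooth_on (blow_dom V c i) F'"
  shows "crepant k (blow_dom V c i) (blow_param g c i) F'"
proof -
  let ?D = "blow_dom V c i" and ?\<beta> = "\<lambda>w. blowdown (g w)"
  obtain u where u: "smooth_on V u" "\<And>w. w \<in> V \<Longrightarrow> duval_eqn k (?\<beta> w) = u w * F w"
    "\<And>w. w \<in> V \<Longrightarrow> jac (\<lambda>x. ?\<beta> x $ 1) (\<lambda>x. ?\<beta> x $ 2) (\<lambda>x. ?\<beta> x $ 3) w = u w"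
    and sm: "smooth_vec V ?\<beta>" using cr unfolding crepant_def by blast
  have D: "open ?D" by (rule open_blow_dom[OF V])
  have in_V: "blow_map c i w \<in> V" if "w \<in> ?D" for w using that by (simp add: blow_dom_def)
  have "smooth_vec ?D (\<lambda>w. ?\<beta> (blow_map c i w))"
    by (rule smooth_vec_compose[OF sm smooth_blow_map[OF D] D V in_V])
  moreover have "smooth_on ?D (\<lambda>w. (w $ i)^2 * u (blow_map c i w))"
    using smooth_on_compose[OF u(1) smooth_blow_map[OF D] D V in_V] D by (auto intro!: smooth_intros)
  moreover have "jac (\<lambda>x. ?\<beta> (blow_map c i x) $ 1) (\<lambda>x. ?\<beta> (blow_map c i x) $ 2) (\<lambda>x. ?\<beta> (blow_map c i x) $ 3) w
      = (w $ i)^2 * u (blow_map c i w)" if w: "w \<in> ?D" for w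
  proof -
    have b: "blow_map c i differentiable (at w)"
      by (rule smooth_vec_differentiable[OF smooth_blow_map[OF open_UNIV]]) simp
    have d: "(\<lambda>x. ?\<beta> x $ j) differentiable (at (blow_map c i w))" for j
      using sm in_V[OF w] unfolding smooth_vec_cart by (blast intro: smooth_on_differentiable)
    show ?thesis using jac_compose[OF b d[of 1] d[of 2] d[of 3]] u(3)[OF in_V[OF w]] jac_blow_map by simp
  qed
  moreover have "duval_eqn k (?\<beta> (blow_map c i w)) = (w $ i)^2 * u (blow_map c i w) * F' w" if w: "w \<in> ?D" for w
    using u(2)[OF in_V[OF w]] F'(1)[OF w] by simp
  ultimately show ?thesis
    unfolding crepant_def blowdown_blow_param using F'(2) by blast
qed

text \<open>Every exceptional point lies over \<open>y = z = 0\<close>; so the part with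
  \<open>y \<noteq> 0\<close> is never moved, and the strict transform at every stage is the closure
  of this one fixed set.\<close>

definition resolution_inv :: "nat \<Rightarrow> param set \<times> bpoint set \<Rightarrow> bool" where
  "resolution_inv k AS \<longleftrightarrow> (case AS of (A, S) \<Rightarrow>
     good_atlas A \<and> fresh A \<and> (\<exists>V. (V, Base) \<in> A \<and> duval_graph k \<subseteq> V) \<and>
     (\<forall>(V, g)\<in>A. \<exists>F. crepant k V g F) \<and>
     (\<forall>p\<in>points (atlas_space A). (\<exists>v. p = Base v) \<or> blowdown p $ 2 = 0 \<and> blowdown p $ 3 = 0) \<and>
     S = space_topology (atlas_space A) closure_of (Base ` duval_graph k))"

lemma resolution_inv_blow:
  assumes inv: "resolution_inv k (A, S)" and Vg: "(V, g) \<in> A" and cV: "c \<in> V"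
    and c: "blowdown (g c) $ 2 = 0" "blowdown (g c) $ 3 = 0"
    and cr: "\<And>i. \<exists>F. crepant k (blow_dom V c i) (blow_param g c i) F"
  shows "resolution_inv k (blow_up (V, g) c (A, S))"
proof -
  interpret blow_setup A V g c
    by unfold_locales (use inv Vg cV in \<open>auto simp: resolution_inv_def\<close>)
  let ?A = "blow_atlas A (V, g) c" and ?S0 = "Base ` duval_graph k"
  let ?T = "space_topology (atlas_space A)" and ?T' = "space_topology (atlas_space (blow_atlas A (V, g) c))"
  obtain V0 where V0: "(V0, Base) \<in> A" "duval_graph k \<subseteq> V0" using inv by (auto simp: resolution_inv_def)
  have S: "S = ?T closure_of ?S0" using inv by (simp add: resolution_inv_def)
  have nS0: "g c \<notin> ?S0" using c by (auto simp: duval_graph_def)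
  have S0M: "?S0 \<subseteq> M" using V0 atlas_points[OF V0(1)] by blast
  note top = nice_topspace[OF nice_atlas[OF good]] and top' = nice_topspace[OF nice_atlas[OF good_blow]]
  \<comment> \<open>Every point of \<open>S\<close> is a limit of the graph part, and it remains one
    in the blow-up unless it is the centre itself.\<close>
  have "?T' closure_of (S - {g c}) = ?T' closure_of ?S0"
  proof
    have "?S0 \<subseteq> S" unfolding S by (rule closure_of_subset) (simp add: S0M top)
    then have "?S0 \<subseteq> S - {g c}" using nS0 by blast
    then show "?T' closure_of ?S0 \<subseteq> ?T' closure_of (S - {g c})" by (rule closure_of_mono)
    have "S - {g c} \<subseteq> ?T' closure_of ?S0"
    proof
      fix p assume p: "p \<in> S - {g c}"
      then have pM: "p \<in> M" using S closure_of_subset_topspace[of ?T ?S0] top by auto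
      have pc: "\<exists>y. y \<in> ?S0 \<and> y \<in> T" if "p \<in> T" "openin ?T T" for T
        using p that unfolding S Diff_iff in_closure_of by simp
      show "p \<in> ?T' closure_of ?S0"
        unfolding in_closure_of top'
      proof (intro conjI allI impI)
        show "p \<in> points (atlas_space ?A)" using blow_points_old[OF pM] p by simp
        fix T assume T: "p \<in> T \<and> openin ?T' T"
        \<comment> \<open>An open set of the blow-up, stripped of its exceptional points, is open
          below, since the old charts survive without the centre.\<close>
        have "openin ?T (T \<inter> (M - {g c}))"
        proof (rule atlas_openI[OF good])
          fix V' g' assume V': "(V', g') \<in> A"
          then have "({w\<in>V'. g' w \<noteq> g c}, g') \<in> ?A" unfolding blow_atlas_eq by force
          from atlas_preimage[OF good_blow this] have "open {w\<in>{w\<in>V'. g' w \<noteq> g c}. g' w \<in> T}" using T by blast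
          moreover have "{w\<in>{w\<in>V'. g' w \<noteq> g c}. g' w \<in> T} = {w\<in>V'. g' w \<in> T \<inter> (M - {g c})}"
            using atlas_points[OF V'] by auto
          ultimately show "open {w\<in>V'. g' w \<in> T \<inter> (M - {g c})}" by simp
        qed auto
        then have "\<exists>y. y \<in> ?S0 \<and> y \<in> T \<inter> (M - {g c})" by (intro pc) (use p pM T in auto)
        then show "\<exists>y. y \<in> ?S0 \<and> y \<in> T" by blast
      qed
    qed
    then show "?T' closure_of (S - {g c}) \<subseteq> ?T' closure_of ?S0"
      by (rule closure_of_minimal) (rule closedin_closure_of)
  qed
  moreover have "\<exists>V. (V, Base) \<in> ?A \<and> duval_graph k \<subseteq> V"
  proof (intro exI conjI)
    show "({w\<in>V0. Base w \<noteq> g c}, Base) \<in> ?A" using V0 unfolding blow_atlas_eq by force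
    show "duval_graph k \<subseteq> {w\<in>V0. Base w \<noteq> g c}" using V0(2) nS0 by (auto simp: image_iff)
  qed
  moreover have "\<exists>F. crepant k V1 g1 F" if "(V1, g1) \<in> ?A" for V1 g1
  proof -
    have "\<exists>F. crepant k V' g' F" if "(V', g') \<in> A" for V' g' using inv that by (auto simp: resolution_inv_def)
    then have "\<exists>F. crepant k {w\<in>V'. g' w \<noteq> g c} g' F" if "(V', g') \<in> A" for V' g'
      using that crepant_subset[of k V' g' _ "{w\<in>V'. g' w \<noteq> g c}"] by blast
    then show ?thesis using that cr unfolding blow_atlas_eq by auto
  qed
  moreover have "(\<exists>v. p = Base v) \<or> blowdown p $ 2 = 0 \<and> blowdown p $ 3 = 0" if "p \<in> points (atlas_space ?A)" for p
    using blow_points[OF that] inv c by (auto simp: resolution_inv_def)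
  ultimately show ?thesis
    unfolding resolution_inv_def blow_up_def using good_blow fresh_blow by (auto simp: Let_def)
qed

section \<open>The main charts, and density of the part with \<open>y \<noteq> 0\<close>\<close>

lemma main_chart_blowdown:
  "blowdown (main_chart j w) = vector [(w$3)^j * w$1, (w$3)^j * w$2, w$3]"
proof (induction j arbitrary: w)
  case 0
  show ?case by (simp add: vec_eq_iff forall_3)
next
  case (Suc j)
  show ?case
    by (simp add: blowdown_blow_param Suc blow_map_nth vec_eq_iff forall_3)
qed

lemma main_chart_Base:
  "w$3 \<noteq> 0 \<Longrightarrow> main_chart j w = Base (vector [(w$3)^j * w$1, (w$3)^j * w$2, w$3])"
proof (induction j arbitrary: w)
  case 0
  show ?case by (simp add: vec_eq_iff forall_3)
next
  case (Suc j)
  then show ?case by (simp add: blow_param_eq blow_map_nth vec_eq_iff forall_3)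
qed

text \<open>The locus \<open>y = 0\<close> consists of curves with \<open>x^2 = z^(2*k)\<close>,
  near which \<open>y\<close> can be varied at fixed \<open>z\<close>, and of the line
  \<open>y = z = 0\<close>, near which the sign of \<open>z\<close> must be adapted to the value of
  \<open>x\<close>.\<close>

lemma duval_graph_dense:
  assumes v: "v \<in> duval k" and N: "open N" "v \<in> N"
  obtains w where "w \<in> N" "w \<in> duval_graph k"
proof -
  consider "v$2 \<noteq> 0" | "v$2 = 0" "v$3 \<noteq> 0" | "v$2 = 0" "v$3 = 0" by blast
  then show ?thesis
  proof cases
    case 1
    then show ?thesis using that[of v] N v by (simp add: duval_graph_def)
  next
    case 2
    have "v$3 * (v$1)^2 = v$3 * (v$3)^(2*k)" using v 2 by (simp add: duval_def)
    then have x: "(v$1)^2 = (v$3)^(2*k)" using 2 by simp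
    let ?D = "\<lambda>y. (v$3)^(2*k) - y^2 / v$3"
    \<comment> \<open>The points of the surface at height \<open>v$3\<close> with prescribed
      \<open>y\<close>, on the branch of \<open>x\<close> through \<open>v\<close>; the radicand is
      positive for small \<open>y\<close>.\<close>
    define f where "f y = (vector [sgn (v$1) * sqrt (?D y), y, v$3] :: real^3)" for y
    have D0: "0 < ?D 0" using 2 by (simp add: power_mult zero_less_power2)
    have "isCont (\<lambda>y. sgn (v $ 1) * sqrt (?D y)) 0" using 2 by (intro continuous_intros) auto
    then have "isCont (\<lambda>y. f y $ i) 0" for i
      using exhaust_3[of i] by (auto simp: f_def)
    then have "((\<lambda>y. f y $ i) \<longlongrightarrow> f 0 $ i) (at 0)" for i by (simp add: isCont_def)
    then have "(f \<longlongrightarrow> f 0) (at 0)" by (rule vec_tendstoI)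
    moreover have "f 0 = v"
      using 2 by (simp add: f_def vec_eq_iff forall_3 x[symmetric] real_sqrt_abs mult_sgn_abs)
    ultimately have "\<forall>\<^sub>F y in at 0. f y \<in> N" using N topological_tendstoD by fastforce
    moreover have "(?D \<longlongrightarrow> ?D 0) (at 0)" using 2 by (intro tendsto_intros) auto
    then have "\<forall>\<^sub>F y in at 0. 0 < ?D y" using D0 order_tendstoD(1) by blast
    moreover have "\<forall>\<^sub>F y in at (0::real). y \<noteq> 0" by (simp add: eventually_at_filter)
    ultimately have "\<forall>\<^sub>F y in at 0. f y \<in> N \<and> 0 < ?D y \<and> y \<noteq> 0" by eventually_elim auto
    then obtain y where y: "f y \<in> N" "0 < ?D y" "y \<noteq> 0" using eventually_happens by force
    have "sgn (v$1) ^ 2 = 1" using x 2 by (auto simp: sgn_if power2_eq_square)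
    then have "f y \<in> duval k" using y 2 by (simp add: f_def duval_def power_mult_distrib field_simps)
    then show ?thesis using that[of "f y"] y by (simp add: duval_graph_def f_def)
  next
    case 3
    obtain e where e: "e > 0" "ball v e \<subseteq> N" using N open_contains_ball by blast
    \<comment> \<open>A bound for the number \<open>D\<close> below, where
      \<open>\<bar>a\<bar> \<le> \<bar>v$1\<bar> + 1\<close> and \<open>t < 1\<close>.\<close>
    define C where "C = 1 + (\<bar>v$1\<bar> + 1)^2"
    have "((\<lambda>t. 2 * t + sqrt (t * C)) \<longlongrightarrow> 2 * 0 + sqrt (0 * C)) (at_right 0)"
      by (intro tendsto_intros)
    then have "\<forall>\<^sub>F t in at_right 0. 2 * t + sqrt (t * C) < e"
      using e(1) order_tendstoD(2) by fastforce
    moreover have "\<forall>\<^sub>F t in at_right (0::real). t < 1" by (simp add: eventually_at_right_field) (rule exI[of _ 1], simp)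
    moreover have "\<forall>\<^sub>F t in at_right (0::real). 0 < t" by (simp add: eventually_at_filter)
    ultimately have "\<forall>\<^sub>F t in at_right 0. 2 * t + sqrt (t * C) < e \<and> t < 1 \<and> 0 < t" by eventually_elim auto
    from eventually_happens[OF this] obtain t where t: "2 * t + sqrt (t * C) < e" "t < 1" "0 < t"
      using trivial_limit_at_right_real[of 0] by auto
    \<comment> \<open>Two values are excluded, so one of three distinct candidates is
      admissible.\<close>
    have "\<exists>a\<in>{v$1, v$1 + t/2, v$1 + t}. a \<noteq> t^k \<and> a \<noteq> - (t^k)" using t(3) by auto
    then obtain a where a0: "a \<in> {v$1, v$1 + t/2, v$1 + t}" and a': "a \<noteq> t^k" "a \<noteq> - (t^k)" by blast
    have "\<bar>a - v$1\<bar> \<le> t" using a0 t(3) by auto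
    note a = this a'
    define D where "D = t^(2*k) - a^2"
    have "D = (t^k - a) * (t^k + a)" by (simp add: D_def power2_eq_square algebra_simps power_mult mult_2 power_add)
    then have D: "D \<noteq> 0" using a by (simp add: add_eq_0_iff)
    \<comment> \<open>With this sign \<open>z * D\<close> is positive, and the equation of the
      surface, which reads \<open>y^2 = z * D\<close>, has a solution.\<close>
    define z where "z = t * sgn D"
    have z: "\<bar>z\<bar> = t" "z * D = t * \<bar>D\<bar>" "z^2 = t^2"
      using t(3) D by (auto simp: z_def abs_mult sgn_if power2_eq_square)
    define w where "w = (vector [a, sqrt (t * \<bar>D\<bar>), z] :: real^3)"
    have "z^(2*k) = t^(2*k)" by (simp add: power_mult z(3))
    then have "z * a^2 + t * \<bar>D\<bar> = z^(2*k+1)" using z(2) by (simp add: D_def algebra_simps)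
    then have "w \<in> duval_graph k" using t(3) D by (simp add: duval_graph_def duval_def w_def)
    moreover have "w \<in> N"
    proof -
      have "\<bar>a\<bar> \<le> \<bar>v$1\<bar> + 1" using a(1) t(2) by linarith
      then have "a^2 \<le> (\<bar>v$1\<bar> + 1)^2" by (metis abs_ge_zero abs_le_square_iff abs_of_nonneg add_nonneg_nonneg zero_le_one)
      moreover have "t^(2*k) \<le> 1" using t by (simp add: power_le_one)
      moreover have "0 \<le> t^(2*k)" "0 \<le> a^2" using t by auto
      ultimately have "\<bar>D\<bar> \<le> C" unfolding D_def C_def by linarith
      then have y: "sqrt (t * \<bar>D\<bar>) \<le> sqrt (t * C)" using t(3) by simp
      have "norm (w - v) \<le> (\<Sum>i\<in>UNIV. \<bar>(w - v) $ i\<bar>)" by (rule norm_le_l1_cart)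
      also have "\<dots> = \<bar>a - v$1\<bar> + sqrt (t * \<bar>D\<bar>) + \<bar>z\<bar>" using 3 t(3) by (simp add: sum_3 w_def)
      also have "\<dots> < e" using a(1) y z(1) t(1) by linarith
      finally have "w \<in> ball v e" by (simp add: dist_norm norm_minus_commute)
      then show ?thesis using e(2) by blast
    qed
    ultimately show ?thesis using that by blast
  qed
qed

lemma jac_coordinates: "jac (\<lambda>x. x $ 1) (\<lambda>x. x $ 2) (\<lambda>x. x $ 3) w = 1"
  by (simp add: jac_def axis_def)

lemma stage_0_inv: "resolution_inv k (stage k 0)"
proof -
  let ?A = "{(UNIV, Base)}"
  have good: "good_atlas ?A"
  proof -
    have "transition UNIV Base UNIV Base"
      unfolding transition_def by (auto intro!: exI[of _ UNIV] exI[of _ "\<lambda>v. v"] simp: smooth_vec_ident)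
    moreover have "separated_charts UNIV Base UNIV Base"
      unfolding separated_charts_def
    proof (intro ballI impI)
      fix w w' :: "real^3" assume "Base w \<noteq> Base w'"
      then have "w \<noteq> w'" by simp
      then obtain U U' where "open U" "open U'" "w \<in> U" "w' \<in> U'" "U \<inter> U' = {}" using hausdorff by metis
      then show "\<exists>N N'. open N \<and> open N' \<and> w \<in> N \<and> w' \<in> N' \<and> (\<forall>v\<in>N \<inter> UNIV. \<forall>v'\<in>N' \<inter> UNIV. Base v \<noteq> Base v')"
        by (intro exI[of _ U] exI[of _ U']) auto
    qed
    ultimately show ?thesis by (simp add: good_atlas_def inj_on_def)
  qed
  have Mem: "(UNIV, Base) \<in> ?A" by simp
  have pts: "points (atlas_space ?A) = range Base" by (simp add: atlas_space_sel)
  note top = nice_topspace[OF nice_atlas[OF good]]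
  have "Base ` duval k = space_topology (atlas_space ?A) closure_of (Base ` duval_graph k)"
  proof
    have "continuous_on UNIV (duval_eqn k)" by (rule smooth_on_continuous[OF smooth_duval_eqn])
    then have "closed (duval_eqn k -` {0})" by (simp add: continuous_closed_vimage continuous_on_eq_continuous_at)
    moreover have "duval_eqn k -` {0} = duval k" by (auto simp: duval_eqn_iff)
    ultimately have "open (- duval k)" by (simp add: open_Compl)
    then have "openin (space_topology (atlas_space ?A)) (Base ` (- duval k))"
      by (intro atlas_image_open[OF good Mem]) auto
    moreover have "topspace (space_topology (atlas_space ?A)) - Base ` duval k = Base ` (- duval k)"
      unfolding top pts by auto
    ultimately have "closedin (space_topology (atlas_space ?A)) (Base ` duval k)"
      unfolding closedin_def top pts by auto
    then show "space_topology (atlas_space ?A) closure_of (Base ` duval_graph k) \<subseteq> Base ` duval k"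
      by (intro closure_of_minimal) (auto simp: duval_graph_def)
    show "Base ` duval k \<subseteq> space_topology (atlas_space ?A) closure_of (Base ` duval_graph k)"
    proof
      fix p assume "p \<in> Base ` duval k"
      then obtain v where v: "v \<in> duval k" "p = Base v" by auto
      show "p \<in> space_topology (atlas_space ?A) closure_of (Base ` duval_graph k)"
        unfolding in_closure_of top pts
      proof (intro conjI allI impI)
        fix T assume T: "p \<in> T \<and> openin (space_topology (atlas_space ?A)) T"
        have "open {w\<in>UNIV. Base w \<in> T}" by (rule atlas_preimage[OF good Mem]) (use T in simp)
        then obtain w where "w \<in> {w\<in>UNIV. Base w \<in> T}" "w \<in> duval_graph k"
          using duval_graph_dense[OF v(1)] T v(2) by (metis (mono_tags, lifting) UNIV_I mem_Collect_eq)
        then show "\<exists>y. y \<in> Base ` duval_graph k \<and> y \<in> T" by blast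
      qed (use v in auto)
    qed
  qed
  moreover have "crepant k UNIV Base (duval_eqn k)"
    unfolding crepant_def
    by (intro conjI exI[of _ "\<lambda>_. 1"]) (auto simp: smooth_duval_eqn smooth_vec_ident smooth_on_const jac_coordinates)
  moreover have "fresh ?A" by (auto simp: fresh_def pts)
  ultimately show ?thesis using good by (auto simp: resolution_inv_def pts)
qed

section \<open>Equations of the strict transforms\<close>

definition xchart_eqn :: "nat \<Rightarrow> real^3 \<Rightarrow> real" where
  "xchart_eqn n w = w$1 * w$3 + (w$2)^2 - (w$1)^(2*n+1) * (w$3)^(2*n+3)"

lemma blow_dom_UNIV [simp]: "blow_dom UNIV c i = UNIV"
  by (simp add: blow_dom_def)

lemma duval_eqn_blow:
  "duval_eqn (Suc n) (blow_map 0 1 w) = (w$1)^2 * xchart_eqn n w"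
  "duval_eqn (Suc n) (blow_map 0 2 w) = (w$2)^2 * (w$2 * w$3 * (w$1)^2 + 1 - (w$2)^(2*n+1) * (w$3)^(2*n+3))"
  "duval_eqn (Suc n) (blow_map 0 3 w) = (w$3)^2 * duval_eqn n w"
  "xchart_eqn n (blow_map 0 1 w) = (w$1)^2 * (w$3 + (w$2)^2 - (w$1)^(4*n+2) * (w$3)^(2*n+3))"
  "xchart_eqn n (blow_map 0 2 w) = (w$2)^2 * (w$1 * w$3 + 1 - (w$1)^(2*n+1) * (w$2)^(4*n+2) * (w$3)^(2*n+3))"
  "xchart_eqn n (blow_map 0 3 w) = (w$3)^2 * (w$1 + (w$2)^2 - (w$1)^(2*n+1) * (w$3)^(4*n+2))"
proof -
  \<comment> \<open>All exponents are expressed through the single unknown \<open>a^n\<close>, which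
    makes the identities polynomial.\<close>
  have p: "a ^ (2*n+1) = a * (a^n)^2" "a ^ (2*n+3) = a^3 * (a^n)^2" "a ^ (4*n+2) = a^2 * (a^n)^4" "a ^ (2 * Suc n + 1) = a^3 * (a^n)^2"
    for a :: real
    by (simp_all add: power_add power_mult power2_eq_square power3_eq_cube power4_eq_xxxx mult_ac flip: power_mult_distrib)
  show "duval_eqn (Suc n) (blow_map 0 1 w) = (w$1)^2 * xchart_eqn n w"
  "duval_eqn (Suc n) (blow_map 0 2 w) = (w$2)^2 * (w$2 * w$3 * (w$1)^2 + 1 - (w$2)^(2*n+1) * (w$3)^(2*n+3))"
  "duval_eqn (Suc n) (blow_map 0 3 w) = (w$3)^2 * duval_eqn n w"
  "xchart_eqn n (blow_map 0 1 w) = (w$1)^2 * (w$3 + (w$2)^2 - (w$1)^(4*n+2) * (w$3)^(2*n+3))"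
  "xchart_eqn n (blow_map 0 2 w) = (w$2)^2 * (w$1 * w$3 + 1 - (w$1)^(2*n+1) * (w$2)^(4*n+2) * (w$3)^(2*n+3))"
  "xchart_eqn n (blow_map 0 3 w) = (w$3)^2 * (w$1 + (w$2)^2 - (w$1)^(2*n+1) * (w$3)^(4*n+2))"
    unfolding duval_eqn_def xchart_eqn_def blow_map_nth p by (simp_all add: power_mult_distrib, algebra+)
qed

lemma crepant_blow_UNIV:
  assumes "crepant k UNIV g F" "\<And>w. F (blow_map c i w) = (w $ i)^2 * F' w" "smooth_on UNIV F'"
  shows "crepant k UNIV (blow_param g c i) F'"
  using crepant_blow[OF assms(1) open_UNIV, of c i F'] assms by simp

text \<open>The induction has to carry the main chart with its full domain and its equation, because
  the next stage blows up at its origin.\<close>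

lemma stage_inv:
  "j \<le> k \<Longrightarrow> resolution_inv k (stage k j) \<and> (UNIV, main_chart j) \<in> fst (stage k j) \<and>
     crepant k UNIV (main_chart j) (duval_eqn (k - j))"
proof (induction j)
  case 0
  have "crepant k UNIV Base (duval_eqn k)"
    unfolding crepant_def
    by (intro conjI exI[of _ "\<lambda>_. 1"]) (auto simp: smooth_duval_eqn smooth_vec_ident smooth_on_const jac_coordinates)
  then show ?case using stage_0_inv by simp
next
  case (Suc j)
  obtain n where n: "k - j = Suc n" "k - Suc j = n" using Suc.prems by (metis Suc_diff_Suc Suc_le_lessD)
  let ?x = "blow_param (main_chart j) 0 1"
  obtain A S where AS: "stage k j = (A, S)" by fastforce
  have IH: "resolution_inv k (A, S)" "(UNIV, main_chart j) \<in> A" "crepant k UNIV (main_chart j) (duval_eqn (Suc n))"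
    using Suc AS n by auto
  have c1: "crepant k UNIV ?x (xchart_eqn n)"
    by (rule crepant_blow_UNIV[OF IH(3)]) (auto simp: duval_eqn_blow xchart_eqn_def[abs_def] intro!: smooth_intros)
  have c2: "crepant k UNIV (blow_param (main_chart j) 0 2) (\<lambda>w. w$2 * w$3 * (w$1)^2 + 1 - (w$2)^(2*n+1) * (w$3)^(2*n+3))"
    by (rule crepant_blow_UNIV[OF IH(3)]) (auto simp del: power_Suc simp: duval_eqn_blow intro!: smooth_intros)
  have c3: "crepant k UNIV (main_chart (Suc j)) (duval_eqn n)"
    unfolding main_chart.simps by (rule crepant_blow_UNIV[OF IH(3)]) (auto simp: duval_eqn_blow smooth_duval_eqn)
  have d1: "crepant k UNIV (blow_param ?x 0 1) (\<lambda>w. w$3 + (w$2)^2 - (w$1)^(4*n+2) * (w$3)^(2*n+3))"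
    by (rule crepant_blow_UNIV[OF c1]) (auto simp: duval_eqn_blow intro!: smooth_intros)
  have d2: "crepant k UNIV (blow_param ?x 0 2) (\<lambda>w. w$1 * w$3 + 1 - (w$1)^(2*n+1) * (w$2)^(4*n+2) * (w$3)^(2*n+3))"
    by (rule crepant_blow_UNIV[OF c1]) (auto simp: duval_eqn_blow intro!: smooth_intros)
  have d3: "crepant k UNIV (blow_param ?x 0 3) (\<lambda>w. w$1 + (w$2)^2 - (w$1)^(2*n+1) * (w$3)^(4*n+2))"
    by (rule crepant_blow_UNIV[OF c1]) (auto simp: duval_eqn_blow intro!: smooth_intros)
  obtain A1 S1 where AS1: "blow_up (UNIV, main_chart j) 0 (A, S) = (A1, S1)" by fastforce
  have A1: "A1 = blow_atlas A (UNIV, main_chart j) 0" using AS1 by (simp add: blow_up_def Let_def)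
  have inv1: "resolution_inv k (A1, S1)"
    unfolding AS1[symmetric]
  proof (rule resolution_inv_blow[OF IH(1,2)])
    fix i show "\<exists>F. crepant k (blow_dom UNIV 0 i) (blow_param (main_chart j) 0 i) F"
      using exhaust_3[of i] c1 c2 c3 by auto
  qed (simp_all add: main_chart_blowdown)
  have x1: "(UNIV, blow_param (main_chart j) 0 i) \<in> A1" for i
    unfolding A1 blow_atlas_eq by force
  have inv2: "resolution_inv k (blow_up (UNIV, ?x) 0 (A1, S1))"
  proof (rule resolution_inv_blow[OF inv1 x1])
    fix i show "\<exists>F. crepant k (blow_dom UNIV 0 i) (blow_param ?x 0 i) F"
      using exhaust_3[of i] d1 d2 d3 by auto
  qed (simp_all add: blowdown_blow_param main_chart_blowdown blow_map_nth)
  interpret blow_setup A UNIV "main_chart j" 0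
    by unfold_locales (use IH in \<open>auto simp: resolution_inv_def\<close>)
  \<comment> \<open>The second centre of a stage is the direction of the \<open>x\<close>-axis in
    the exceptional plane, which the \<open>z\<close>-chart does not meet; the main chart therefore
    loses no point.\<close>
  have "new 3 w \<noteq> new 1 0" for w
    using new_eq_change_dom(2)[of w 3 0 1] by (auto simp: chart_dir_nth)
  then have "{w\<in>UNIV. new 3 w \<noteq> new 1 0} = UNIV" by auto
  then have "(UNIV, new 3) \<in> blow_atlas A1 (UNIV, new 1) 0"
    unfolding blow_atlas_eq using x1[of 3] by (intro UnI1 image_eqI[where x = "(UNIV, new 3)"]) simp_all
  then have "(UNIV, main_chart (Suc j)) \<in> fst (blow_up (UNIV, ?x) 0 (A1, S1))"
    by (simp add: blow_up_def Let_def)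
  moreover have "stage k (Suc j) = blow_up (UNIV, ?x) 0 (A1, S1)" unfolding stage.simps AS AS1 ..
  ultimately show ?case using inv2 c3 unfolding n(2) by (simp only: simp_thms)
qed

lemma duval_eqn_0_blow:
  assumes "e^2 = 1"
  shows "duval_eqn 0 (blow_map (axis 1 e) 1 w) = (w$1)^2 * (w$3 * (2 * e + w$1) + (w$2)^2)"
    "duval_eqn 0 (blow_map (axis 1 e) 2 w) = (w$2)^2 * (w$3 * (2 * e * w$1 + w$2 * (w$1)^2) + 1)"
    "duval_eqn 0 (blow_map (axis 1 e) 3 w) = (w$3)^2 * (w$1 * (2 * e + w$1 * w$3) + (w$2)^2)"
  unfolding duval_eqn_def blow_map_nth using assms by (simp_all add: axis_def, algebra+)

lemma crepant_last:
  assumes e: "e^2 = 1" and cr: "crepant k V (main_chart k) (duval_eqn 0)" and V: "open V"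
  shows "crepant k (blow_dom V (axis 1 e) 1) (blow_param (main_chart k) (axis 1 e) 1) (\<lambda>w. w$3 * (2 * e + w$1) + (w$2)^2)"
    "crepant k (blow_dom V (axis 1 e) 2) (blow_param (main_chart k) (axis 1 e) 2) (\<lambda>w. w$3 * (2 * e * w$1 + w$2 * (w$1)^2) + 1)"
    "crepant k (blow_dom V (axis 1 e) 3) (blow_param (main_chart k) (axis 1 e) 3) (\<lambda>w. w$1 * (2 * e + w$1 * w$3) + (w$2)^2)"
  by (rule crepant_blow[OF cr V]; (rule duval_eqn_0_blow[OF e])?; auto intro!: smooth_intros open_blow_dom V)+

text \<open>The two last centres enter asymmetrically: charts at the first lose what the second
  blow-up removes, while the second is blown up in a main chart already lacking the first centre.
  Each loss lies over the opposite centre, which allows a statement uniform in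
  \<open>e\<close>.\<close>

lemma resolved_charts:
  shows "resolution_inv k (resolved k)"
    and "\<exists>V. (V, main_chart k) \<in> fst (resolved k) \<and> - {axis 1 1, axis 1 (- 1)} \<subseteq> V \<and> crepant k V (main_chart k) (duval_eqn 0)"
    and "e^2 = 1 \<Longrightarrow> \<exists>V. (V, blow_param (main_chart k) (axis 1 e) 1) \<in> fst (resolved k) \<and>
          {w. blow_map (axis 1 e) 1 w \<noteq> axis 1 (- e)} \<subseteq> V \<and>
          crepant k V (blow_param (main_chart k) (axis 1 e) 1) (\<lambda>w. w$3 * (2 * e + w$1) + (w$2)^2)"
    and "e^2 = 1 \<Longrightarrow> \<exists>V. (V, blow_param (main_chart k) (axis 1 e) 3) \<in> fst (resolved k) \<and>
          {w. blow_map (axis 1 e) 3 w \<noteq> axis 1 (- e)} \<subseteq> V \<and>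
          crepant k V (blow_param (main_chart k) (axis 1 e) 3) (\<lambda>w. w$1 * (2 * e + w$1 * w$3) + (w$2)^2)"
proof -
  let ?m = "main_chart k" and ?p = "axis 1 1 :: real^3" and ?n = "axis 1 (- 1) :: real^3"
  obtain A S where AS: "stage k k = (A, S)" by fastforce
  have st: "resolution_inv k (A, S)" "(UNIV, ?m) \<in> A" "crepant k UNIV ?m (duval_eqn 0)"
    using stage_inv[of k k] AS by auto
  obtain A1 S1 where AS1: "blow_up (UNIV, ?m) ?p (A, S) = (A1, S1)" by fastforce
  have A1: "A1 = blow_atlas A (UNIV, ?m) ?p" using AS1 by (simp add: blow_up_def Let_def)
  have one: "(1::real)^2 = 1" "(-1::real)^2 = 1" by auto
  interpret blow_setup A UNIV ?m ?p
    by unfold_locales (use st in \<open>auto simp: resolution_inv_def\<close>)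
  have inj: "?m v = ?m w \<longleftrightarrow> v = w" for v w using inj_g by (auto dest: inj_onD)
  note L1 = crepant_last[OF one(1) st(3) open_UNIV]
  have inv1: "resolution_inv k (A1, S1)"
    unfolding AS1[symmetric]
  proof (rule resolution_inv_blow[OF st(1,2)])
    fix i show "\<exists>F. crepant k (blow_dom UNIV ?p i) (blow_param ?m ?p i) F"
      using exhaust_3[of i] L1 by auto
  qed (simp_all add: main_chart_blowdown axis_def)
  have "({w\<in>UNIV. ?m w \<noteq> ?m ?p}, ?m) \<in> A1" using st(2) unfolding A1 blow_atlas_eq by force
  moreover have "{w\<in>UNIV. ?m w \<noteq> ?m ?p} = - {?p}" using inj by auto
  ultimately have m1: "(- {?p}, ?m) \<in> A1" by simp
  have o: "open (- {?p})" by (simp add: open_Compl)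
  note L2 = crepant_last[OF one(2) crepant_subset[OF st(3) subset_UNIV] o]
  have np: "?n \<in> - {?p}" by (simp add: axis_eq_axis)
  have R: "resolved k = blow_up (- {?p}, ?m) ?n (A1, S1)" unfolding resolved_def AS AS1 ..
  show "resolution_inv k (resolved k)" unfolding R
  proof (rule resolution_inv_blow[OF inv1 m1 np])
    fix i show "\<exists>F. crepant k (blow_dom (- {?p}) ?n i) (blow_param ?m ?n i) F"
      using exhaust_3[of i] L2 by auto
  qed (simp_all add: main_chart_blowdown axis_def)
  have R1: "fst (resolved k) = blow_atlas A1 (- {?p}, ?m) ?n" unfolding R by (simp add: blow_up_def Let_def)
  have old: "({w\<in>V'. g' w \<noteq> ?m ?n}, g') \<in> fst (resolved k)" if "(V', g') \<in> A1" for V' g'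
    using that unfolding R1 blow_atlas_eq by force
  have "({w\<in>- {?p}. ?m w \<noteq> ?m ?n}, ?m) \<in> fst (resolved k)" by (rule old[OF m1])
  then show "\<exists>V. (V, ?m) \<in> fst (resolved k) \<and> - {?p, ?n} \<subseteq> V \<and> crepant k V ?m (duval_eqn 0)"
    using inj crepant_subset[OF st(3) subset_UNIV] by (intro exI[of _ "{w\<in>- {?p}. ?m w \<noteq> ?m ?n}"]) auto
  have exc: "\<exists>V. (V, blow_param ?m (axis 1 e) i) \<in> fst (resolved k) \<and>
          {w. blow_map (axis 1 e) i w \<noteq> axis 1 (- e)} \<subseteq> V \<and> crepant k V (blow_param ?m (axis 1 e) i) F"
    if e: "e^2 = 1" and cr: "\<And>V. crepant k V ?m (duval_eqn 0) \<Longrightarrow> open V \<Longrightarrow> crepant k (blow_dom V (axis 1 e) i) (blow_param ?m (axis 1 e) i) F"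
    for F i and e :: real
  proof -
    have "(e - 1) * (e + 1) = 0" using e by (simp add: power2_eq_square algebra_simps)
    then consider "e = 1" | "e = - 1" by fastforce
    then show ?thesis
    proof cases
      case 1
      let ?V = "{w\<in>UNIV. new i w \<noteq> ?m ?n}"
      have "(UNIV, new i) \<in> A1" unfolding A1 blow_atlas_eq by force
      then have "(?V, new i) \<in> fst (resolved k)" by (rule old)
      moreover have "{w. blow_map ?p i w \<noteq> ?n} \<subseteq> ?V"
        using new_eq_old_iff(2)[OF st(2), of ?n _ i] inj by auto
      moreover have "crepant k ?V (new i) F"
        using cr[OF st(3) open_UNIV] 1 crepant_subset[of k UNIV "new i" F ?V] by simp
      ultimately show ?thesis using 1 by blast
    next
      case 2
      have "(blow_dom (- {?p}) ?n i, blow_param ?m ?n i) \<in> fst (resolved k)" unfolding R1 blow_atlas_eq by blast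
      then show ?thesis using 2 cr[OF crepant_subset[OF st(3) subset_UNIV] o]
        by (intro exI[of _ "blow_dom (- {?p}) ?n i"]) (auto simp: blow_dom_def)
    qed
  qed
  show "\<exists>V. (V, blow_param (main_chart k) (axis 1 e) 1) \<in> fst (resolved k) \<and>
          {w. blow_map (axis 1 e) 1 w \<noteq> axis 1 (- e)} \<subseteq> V \<and>
          crepant k V (blow_param (main_chart k) (axis 1 e) 1) (\<lambda>w. w$3 * (2 * e + w$1) + (w$2)^2)" if "e^2 = 1"
    by (rule exc[OF that crepant_last(1)[OF that]])
  show "\<exists>V. (V, blow_param (main_chart k) (axis 1 e) 3) \<in> fst (resolved k) \<and>
          {w. blow_map (axis 1 e) 3 w \<noteq> axis 1 (- e)} \<subseteq> V \<and>
          crepant k V (blow_param (main_chart k) (axis 1 e) 3) (\<lambda>w. w$1 * (2 * e + w$1 * w$3) + (w$2)^2)" if "e^2 = 1"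
    by (rule exc[OF that crepant_last(3)[OF that]])
qed

lemma smooth_vec_nth: "smooth_vec S (f :: _ \<Rightarrow> real^'n) \<Longrightarrow> smooth_on S (\<lambda>x. f x $ i)"
  by (simp add: smooth_vec_cart)

section \<open>The Poisson bracket on the surface\<close>

definition graph_dom :: "nat \<Rightarrow> (real^2) set" where
  "graph_dom k = {a. 0 < (a$2)^(2*k+1) - a$2 * (a$1)^2}"

text \<open>For \<open>e = 1\<close> and \<open>e = - 1\<close> the sheet of the surface on which
  \<open>y\<close> has sign \<open>e\<close>, over the coordinates \<open>x\<close> and
  \<open>z\<close>.\<close>

definition graph_map :: "nat \<Rightarrow> real \<Rightarrow> real^2 \<Rightarrow> real^3" where
  "graph_map k e a = vector [a$1, e * sqrt ((a$2)^(2*k+1) - a$2 * (a$1)^2), a$2]"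

lemma graph_map_nth [simp]:
  "graph_map k e a $ 1 = a$1" "graph_map k e a $ 3 = a$2"
  "graph_map k e a $ 2 = e * sqrt ((a$2)^(2*k+1) - a$2 * (a$1)^2)"
  by (simp_all add: graph_map_def)

lemma open_graph_dom: "open (graph_dom k)"
  unfolding graph_dom_def by (intro open_Collect_less continuous_intros)

lemma smooth_graph_map: "smooth_vec (graph_dom k) (graph_map k e)"
  unfolding graph_map_def[abs_def]
  by (intro smooth_vec_vector3 smooth_intros open_graph_dom) (simp add: graph_dom_def)

lemma duval_graphE:
  assumes "v \<in> duval_graph k"
  obtains e a where "e = sgn (v$2)" "e^2 = 1" "a \<in> graph_dom k" "v = graph_map k e a" "a = vector [v$1, v$3]"
proof -
  let ?a = "vector [v$1, v$3] :: real^2"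
  have v: "(v$2)^2 = (v$3)^(2*k+1) - v$3 * (v$1)^2" "v$2 \<noteq> 0" using assms by (auto simp: duval_graph_def duval_def)
  then have "0 < (v$3)^(2*k+1) - v$3 * (v$1)^2" by (metis zero_less_power2)
  then have "?a \<in> graph_dom k" by (simp add: graph_dom_def)
  moreover have "sgn (v$2) * sqrt ((v$2)^2) = v$2" by (simp add: real_sqrt_abs mult_sgn_abs)
  then have "v$2 = sgn (v$2) * sqrt ((v$3)^(2*k+1) - v$3 * (v$1)^2)" unfolding v(1) by (rule sym)
  then have "v = graph_map k (sgn (v$2)) ?a"
    unfolding graph_map_def vec_eq_iff forall_3 vector_2 vector_3 by (intro conjI refl)
  moreover have "(sgn (v$2))^2 = 1" using v(2) by (simp add: sgn_if)
  ultimately show ?thesis using that by blast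
qed

lemma graph_map_duval:
  assumes "a \<in> graph_dom k" "e^2 = 1"
  shows "graph_map k e a \<in> duval_graph k" "sgn (graph_map k e a $ 2) = e"
proof -
  have "(e - 1) * (e + 1) = 0" using assms(2) by (simp add: power2_eq_square algebra_simps)
  then have e: "e = 1 \<or> e = - 1" by auto
  then show "graph_map k e a \<in> duval_graph k" "sgn (graph_map k e a $ 2) = e"
    using assms by (auto simp: graph_dom_def duval_graph_def duval_def power_mult_distrib)
qed

lemma partial_duval_eqn:
  "partial (duval_eqn k) 1 v = 2 * v$3 * v$1" "partial (duval_eqn k) 2 v = 2 * v$2"
  "partial (duval_eqn k) 3 v = - (2 * real k + 1) * (v$3)^(2*k) + (v$1)^2"
proof -
  have n: "((\<lambda>v::real^3. v $ i) has_derivative (\<lambda>d. d $ i)) (at v)" for i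
    by (rule bounded_linear_imp_has_derivative) (rule bounded_linear_vec_nth)
  have "((\<lambda>v. v$3 * (v$1)^2 + (v$2)^2 - (v$3)^(2*k+1)) has_derivative
     (\<lambda>d. (v$3 * (of_nat 2 * d$1 * (v$1)^(2-1)) + d$3 * (v$1)^2 + of_nat 2 * d$2 * (v$2)^(2-1))
        - of_nat (2*k+1) * d$3 * (v$3)^(2*k+1-1))) (at v)"
    by (intro has_derivative_diff has_derivative_add has_derivative_mult has_derivative_power n)
  then have "(duval_eqn k has_derivative
     (\<lambda>d. (v$3 * (of_nat 2 * d$1 * (v$1)^(2-1)) + d$3 * (v$1)^2 + of_nat 2 * d$2 * (v$2)^(2-1))
        - of_nat (2*k+1) * d$3 * (v$3)^(2*k+1-1))) (at v)"
    by (simp add: duval_eqn_def[abs_def])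
  from frechet_derivative_at[OF this, symmetric]
  show "partial (duval_eqn k) 1 v = 2 * v$3 * v$1" "partial (duval_eqn k) 2 v = 2 * v$2"
    "partial (duval_eqn k) 3 v = - (2 * real k + 1) * (v$3)^(2*k) + (v$1)^2"
    by (simp_all add: axis_def algebra_simps)
qed

lemma duval_bracket_eq_jac:
  "smooth_on UNIV f \<Longrightarrow> smooth_on UNIV g \<Longrightarrow> duval_bracket k f g = jac (duval_eqn k) f g"
  by (rule ext) (simp add: duval_bracket_def jac_def partial_duval_eqn Let_def)

text \<open>The bracket in the coordinates \<open>x = a$1\<close> and \<open>z = a$2\<close>,
  determined by \<open>{z, x} = 2 * y\<close>.\<close>

definition graph_bracket :: "nat \<Rightarrow> real \<Rightarrow> (real^2 \<Rightarrow> real) \<Rightarrow> (real^2 \<Rightarrow> real) \<Rightarrow> real^2 \<Rightarrow> real" where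
  "graph_bracket k e f g a = 2 * graph_map k e a $ 2 *
     (partial f 2 a * partial g 1 a - partial f 1 a * partial g 2 a)"

lemma graph_bracket_jac:
  assumes a: "a \<in> graph_dom k" and e: "e^2 = 1"
    and d: "f differentiable (at (graph_map k e a))" "g differentiable (at (graph_map k e a))"
  shows "graph_bracket k e (\<lambda>a. f (graph_map k e a)) (\<lambda>a. g (graph_map k e a)) a
     = jac (duval_eqn k) f g (graph_map k e a)"
proof -
  let ?G = "graph_map k e" and ?F = "duval_eqn k"
  have dG: "?G differentiable (at a)" by (rule smooth_vec_differentiable[OF smooth_graph_map a])
  have dF: "?F differentiable (at (?G a))" by (rule smooth_on_differentiable[OF smooth_duval_eqn[of UNIV]]) simp
  define Y where "Y i = partial (\<lambda>x. ?G x $ 2) i a" for i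
  have c: "partial (\<lambda>x. h (?G x)) 1 a = partial h 1 (?G a) + partial h 2 (?G a) * Y 1"
    "partial (\<lambda>x. h (?G x)) 2 a = partial h 3 (?G a) + partial h 2 (?G a) * Y 2"
    if "h differentiable (at (?G a))" for h
    unfolding partial_compose[OF dG that] sum_3 Y_def by (simp_all add: axis_def)
  \<comment> \<open>Implicit differentiation: the equation vanishes identically along the sheet,
    which determines the partial derivatives \<open>Y\<close> of \<open>y\<close>.\<close>
  have "frechet_derivative (\<lambda>x. ?F (?G x)) (at a) = frechet_derivative (\<lambda>x. 0) (at a)"
    by (rule partial_cong[OF open_graph_dom a])
      (use graph_map_duval(1)[OF _ e] in \<open>simp add: duval_graph_def duval_eqn_iff\<close>)
  then have "partial ?F 1 (?G a) + partial ?F 2 (?G a) * Y 1 = 0" "partial ?F 3 (?G a) + partial ?F 2 (?G a) * Y 2 = 0"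
    using c[OF dF] by simp_all
  moreover have "2 * ?G a $ 2 = partial ?F 2 (?G a)" by (simp only: partial_duval_eqn)
  ultimately show ?thesis
    unfolding graph_bracket_def jac_def c[OF d(1)] c[OF d(2)] by algebra
qed

lemma graph_bracket_cong:
  assumes "open N" "a \<in> N" "\<And>b. b \<in> N \<Longrightarrow> f b = f' b" "\<And>b. b \<in> N \<Longrightarrow> g b = g' b"
  shows "graph_bracket k e f g a = graph_bracket k e f' g' a"
  unfolding graph_bracket_def using partial_cong[OF assms(1,2,3)] partial_cong[OF assms(1,2,4)] by simp

text \<open>In two variables any function times the standard bracket satisfies the Jacobi identity;
  once second derivatives commute, this is an algebraic identity in the partial derivatives at
  \<open>a\<close>.\<close>

lemma graph_bracket_jacobi:
  assumes O: "open O1" "O1 \<subseteq> graph_dom k" "a \<in> O1"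
    and s: "smooth_on O1 f" "smooth_on O1 g" "smooth_on O1 h"
  shows "graph_bracket k e f (graph_bracket k e g h) a + graph_bracket k e g (graph_bracket k e h f) a
    + graph_bracket k e h (graph_bracket k e f g) a = 0"
proof -
  define c where "c a = 2 * graph_map k e a $ 2" for a
  have c: "smooth_on O1 c"
    unfolding c_def[abs_def]
    by (intro smooth_on_mult smooth_on_const O(1) smooth_vec_nth[OF smooth_vec_subset[OF smooth_graph_map O(2)]])
  have dd: "\<phi> differentiable (at a)" if "smooth_on O1 \<phi>" for \<phi> by (rule smooth_on_differentiable[OF that O(3)])
  have P: "partial (graph_bracket k e \<phi> \<psi>) i a =
      partial c i a * (partial \<phi> 2 a * partial \<psi> 1 a - partial \<phi> 1 a * partial \<psi> 2 a)
      + c a * (partial \<phi> 2 a * partial (partial \<psi> 1) i a + partial (partial \<phi> 2) i a * partial \<psi> 1 a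
        - (partial \<phi> 1 a * partial (partial \<psi> 2) i a + partial (partial \<phi> 1) i a * partial \<psi> 2 a))"
    if "smooth_on O1 \<phi>" "smooth_on O1 \<psi>" for \<phi> \<psi> i
  proof -
    have D: "(\<phi>' has_derivative frechet_derivative \<phi>' (at a)) (at a)" if "smooth_on O1 \<phi>'" for \<phi>'
      by (rule smooth_on_has_derivative[OF that O(3)])
    note sp = smooth_on_frechet[OF that(1)] smooth_on_frechet[OF that(2)]
    have "((\<lambda>x. c x * (partial \<phi> 2 x * partial \<psi> 1 x - partial \<phi> 1 x * partial \<psi> 2 x)) has_derivative
      (\<lambda>v. c a * ((partial \<phi> 2 a * frechet_derivative (partial \<psi> 1) (at a) v + frechet_derivative (partial \<phi> 2) (at a) v * partial \<psi> 1 a)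
        - (partial \<phi> 1 a * frechet_derivative (partial \<psi> 2) (at a) v + frechet_derivative (partial \<phi> 1) (at a) v * partial \<psi> 2 a))
        + frechet_derivative c (at a) v * (partial \<phi> 2 a * partial \<psi> 1 a - partial \<phi> 1 a * partial \<psi> 2 a))) (at a)"
      by (intro has_derivative_mult has_derivative_diff D c sp)
    from fun_cong[OF frechet_derivative_at[OF this], of "axis i 1"] show ?thesis
      unfolding graph_bracket_def[abs_def] c_def[symmetric] by simp
  qed
  have C: "partial (partial \<phi> 1) 2 a = partial (partial \<phi> 2) 1 a" if "smooth_on O1 \<phi>" for \<phi>
    by (rule clairaut[OF that O(1,3)])
  have G: "graph_bracket k e \<phi> \<psi> a = c a * (partial \<phi> 2 a * partial \<psi> 1 a - partial \<phi> 1 a * partial \<psi> 2 a)" for \<phi> \<psi>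
    by (simp add: graph_bracket_def c_def)
  show ?thesis
    unfolding G P[OF s(2,3)] P[OF s(3,1)] P[OF s(1,2)] C[OF s(1)] C[OF s(2)] C[OF s(3)] by algebra
qed

section \<open>Extension of the bracket from a dense part\<close>

lemma in_closure_of_Int_open:
  assumes "s \<in> T closure_of D" "openin T W" "s \<in> W"
  shows "s \<in> T closure_of (D \<inter> W)"
  unfolding in_closure_of
proof (intro conjI allI impI)
  show "s \<in> topspace T" using assms(1) by (simp add: in_closure_of)
  fix U assume "s \<in> U \<and> openin T U"
  then have "s \<in> U \<inter> W \<and> openin T (U \<inter> W)" using assms by auto
  then show "\<exists>y. y \<in> D \<inter> W \<and> y \<in> U" using assms(1) unfolding in_closure_of by blast
qed

text \<open>Two local extensions agree where both are defined, by continuity and density; hence the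
  values at each \<open>s\<close> of the extension chosen at \<open>s\<close> fit together
  smoothly.\<close>

lemma dense_extension:
  assumes X: "nice_space X" and S: "S \<subseteq> points X" "D \<subseteq> S" "S \<subseteq> space_topology X closure_of D"
    and loc: "\<And>s. s \<in> S \<Longrightarrow> \<exists>W G. openin (space_topology X) W \<and> s \<in> W \<and> G \<in> smooth_funs X \<and> (\<forall>t\<in>W \<inter> D. \<phi> t = G t)"
  obtains \<Phi> where "\<Phi> \<in> smooth_funs (smooth_subspace X S)" "\<And>t. t \<in> D \<Longrightarrow> \<Phi> t = \<phi> t"
proof -
  obtain W G where WG: "\<And>s. s \<in> S \<Longrightarrow> openin (space_topology X) (W s) \<and> s \<in> W s \<and> G s \<in> smooth_funs X \<and> (\<forall>t\<in>W s \<inter> D. \<phi> t = G s t)"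
    using loc by metis
  have eq: "G t t = G s t" if "s \<in> S" "t \<in> S" "t \<in> W s" for s t
  proof (rule smooth_funs_eq_on_closure[OF X, where D = "D \<inter> (W s \<inter> W t)" and f = "G t" and g = "G s" and s = t])
    show "t \<in> space_topology X closure_of (D \<inter> (W s \<inter> W t))"
      by (rule in_closure_of_Int_open) (use S(3) that WG[OF that(1)] WG[OF that(2)] in auto)
    fix u assume "u \<in> D \<inter> (W s \<inter> W t)"
    then show "G t u = G s u"
      using WG[OF \<open>s \<in> S\<close>] WG[OF \<open>t \<in> S\<close>] by (metis IntE IntI)
  qed (use WG that in auto)
  show ?thesis
  proof (rule that[of "\<lambda>s\<in>S. G s s"])
    have "\<exists>W' F. openin (space_topology X) W' \<and> s \<in> W' \<and> F \<in> smooth_funs X \<and> (\<forall>t\<in>W' \<inter> S. (\<lambda>s\<in>S. G s s) t = F t)"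
      if s: "s \<in> S" for s
      by (rule exI[of _ "W s"], rule exI[of _ "G s"]) (use WG[OF s] eq[OF s] in auto)
    then show "(\<lambda>s\<in>S. G s s) \<in> smooth_funs (smooth_subspace X S)" unfolding smooth_subspace_sel(2) by simp
    show "(\<lambda>s\<in>S. G s s) t = \<phi> t" if "t \<in> D" for t using WG[of t] that S(2) by auto
  qed
qed

text \<open>Instantiated for the whole strict transform and for its half: \<open>S\<close> is the
  surface to be given a bracket, and \<open>D\<close> is a dense part of it on which the surface is
  a graph.\<close>

locale dense_surface =
  fixes k :: nat and A :: "param set" and Z S D :: "bpoint set"
  assumes inv: "resolution_inv k (A, Z)"
    and SM: "S \<subseteq> points (atlas_space A)" and DS: "D \<subseteq> S" and Dgraph: "D \<subseteq> Base ` duval_graph k"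
    and dense: "S \<subseteq> space_topology (atlas_space A) closure_of D"
    and openD: "\<And>e. open {a \<in> graph_dom k. Base (graph_map k e a) \<in> D}"
begin

abbreviation "X \<equiv> atlas_space A"
abbreviation "XS \<equiv> smooth_subspace (atlas_space A) S"

lemma good: "good_atlas A" and niceX: "nice_space X" and niceXS: "nice_space XS"
proof -
  show "good_atlas A" using inv by (simp add: resolution_inv_def)
  then show "nice_space X" by (rule nice_atlas)
  then show "nice_space XS" by (rule nice_subspace[OF _ SM])
qed

lemma base_chart:
  obtains V0 where "(V0, Base) \<in> A" "duval_graph k \<subseteq> V0"
  using inv by (auto simp: resolution_inv_def)

definition region :: "real \<Rightarrow> (real^2) set" where
  "region e = {a \<in> graph_dom k. Base (graph_map k e a) \<in> D}"

lemma open_region: "open (region e)" and region_dom: "region e \<subseteq> graph_dom k"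
  using openD by (auto simp: region_def)

definition on_graph :: "real \<Rightarrow> (bpoint \<Rightarrow> real) \<Rightarrow> real^2 \<Rightarrow> real" where
  "on_graph e f a = f (Base (graph_map k e a))"

lemma D_E:
  assumes "s \<in> D"
  obtains e a where "e^2 = 1" "a \<in> region e" "s = Base (graph_map k e a)" "blowdown s = graph_map k e a"
    "e = sgn (blowdown s $ 2)" "a = vector [blowdown s $ 1, blowdown s $ 3]"
proof -
  obtain v where v: "s = Base v" "v \<in> duval_graph k" using assms Dgraph by auto
  from v(2) obtain e a where ea: "e = sgn (v$2)" "e^2 = 1" "a \<in> graph_dom k" "v = graph_map k e a" "a = vector [v$1, v$3]"
    by (rule duval_graphE)
  have "Base (graph_map k e a) \<in> D" using assms unfolding v(1) ea(4)[symmetric] .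
  then have "a \<in> region e" using ea(3) by (simp only: region_def mem_Collect_eq simp_thms)
  moreover have b: "blowdown s = v" using v(1) by simp
  ultimately show ?thesis
  proof (intro that[of e a])
    show "s = Base (graph_map k e a)" unfolding v(1) by (rule arg_cong[OF ea(4)])
    show "blowdown s = graph_map k e a" using b ea(4) by (rule trans)
    show "e = sgn (blowdown s $ 2)" "a = vector [blowdown s $ 1, blowdown s $ 3]"
      unfolding b by (rule ea(1), rule ea(5))
  qed (rule ea(2))
qed

text \<open>The sign of \<open>y\<close> and the graph coordinates are read off from the point, so
  that no choice of a parametrization enters.\<close>

definition pb :: "(bpoint \<Rightarrow> real) \<Rightarrow> (bpoint \<Rightarrow> real) \<Rightarrow> bpoint \<Rightarrow> real" where
  "pb f h s = (let v = blowdown s; e = sgn (v$2) in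
     graph_bracket k e (on_graph e f) (on_graph e h) (vector [v$1, v$3]))"

lemma pb_graph:
  assumes "a \<in> region e" "e^2 = 1"
  shows "pb f h (Base (graph_map k e a)) = graph_bracket k e (on_graph e f) (on_graph e h) a"
proof -
  have "vector [a$1, a$2] = a" by (simp add: vec_eq_iff forall_2)
  moreover have "sgn (graph_map k e a $ 2) = e" using graph_map_duval(2) assms region_dom by blast
  ultimately show ?thesis by (simp add: pb_def Let_def del: graph_map_nth(3))
qed

lemma smooth_on_graph:
  assumes f: "f \<in> smooth_funs XS" and e: "e^2 = 1"
  shows "smooth_on (region e) (on_graph e f)"
proof (rule smooth_on_local)
  fix a assume a: "a \<in> region e"
  obtain V0 where V0: "(V0, Base) \<in> A" "duval_graph k \<subseteq> V0" by (rule base_chart)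
  have bS: "Base (graph_map k e a) \<in> S" "graph_map k e a \<in> V0"
    using a DS V0(2) graph_map_duval(1)[of a k e] e by (auto simp: region_def)
  obtain N \<phi> where N: "open N" "graph_map k e a \<in> N" "smooth_on N \<phi>"
    "\<And>v. v \<in> N \<Longrightarrow> Base v \<in> S \<Longrightarrow> f (Base v) = \<phi> v"
    by (rule smooth_subspaceD[OF f atlas_chart[OF good V0(1)] bS(2,1)]) (rule that)
  let ?U = "region e \<inter> graph_map k e -` N"
  have sm: "smooth_vec (region e) (graph_map k e)" by (rule smooth_vec_subset[OF smooth_graph_map region_dom])
  have o: "open ?U" by (rule continuous_open_preimage[OF smooth_vec_continuous[OF sm] open_region N(1)])
  have "smooth_on ?U (\<lambda>a. \<phi> (graph_map k e a))"
    by (rule smooth_on_compose[OF N(3) smooth_vec_subset[OF sm] o N(1)]) auto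
  then have "smooth_on ?U (on_graph e f)"
    by (rule smooth_on_eq[OF o]) (use N(4) DS in \<open>auto simp: on_graph_def region_def\<close>)
  then show "\<exists>N. open N \<and> a \<in> N \<and> smooth_on N (on_graph e f)" using o a N(2) by blast
qed

text \<open>Off the exceptional set the chart is inverse to a transition map, so its Jacobian does not vanish.\<close>

lemma pb_chart:
  assumes Vg: "(V, g) \<in> A" and cr: "crepant k V g F" and w: "w \<in> V" "g w \<in> D"
    and N: "open N" "w \<in> N" "N \<subseteq> V" "smooth_on N \<phi>" "smooth_on N \<psi>"
    and f: "\<And>v. v \<in> N \<Longrightarrow> g v \<in> S \<Longrightarrow> f (g v) = \<phi> v" and h: "\<And>v. v \<in> N \<Longrightarrow> g v \<in> S \<Longrightarrow> h (g v) = \<psi> v"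
  shows "F w = 0" "pb f h (g w) = jac F \<phi> \<psi> w"
proof -
  obtain u where u: "smooth_on V u" "\<And>w. w \<in> V \<Longrightarrow> duval_eqn k (blowdown (g w)) = u w * F w"
    "\<And>w. w \<in> V \<Longrightarrow> jac (\<lambda>x. blowdown (g x) $ 1) (\<lambda>x. blowdown (g x) $ 2) (\<lambda>x. blowdown (g x) $ 3) w = u w"
    and sF: "smooth_on V F" and sb: "smooth_vec V (\<lambda>w. blowdown (g w))"
    using cr unfolding crepant_def by blast
  define \<beta> where "\<beta> w = blowdown (g w)" for w
  note u = u[folded \<beta>_def] and sb = sb[folded \<beta>_def]
  obtain e a where ea: "e^2 = 1" "a \<in> region e" "g w = Base (graph_map k e a)" "\<beta> w = graph_map k e a"
    unfolding \<beta>_def using w(2) by (rule D_E)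
  obtain V0 where V0: "(V0, Base) \<in> A" "duval_graph k \<subseteq> V0" by (rule base_chart)
  let ?b = "\<beta> w"
  have b: "?b \<in> V0" "?b \<in> duval_graph k" using ea V0(2) graph_map_duval(1)[of a k e] region_dom by auto
  have gwb: "Base ?b = g w" using ea by simp
  obtain N0 \<tau> where \<tau>: "open N0" "?b \<in> N0" "N0 \<subseteq> V0" "smooth_vec N0 \<tau>"
    "\<And>v. v \<in> N0 \<Longrightarrow> \<tau> v \<in> V" "\<And>v. v \<in> N0 \<Longrightarrow> g (\<tau> v) = Base v"
    by (rule transitionE[OF good_atlasD(3)[OF good V0(1) Vg] b(1) w(1) gwb]) (rule that)
  have \<beta>\<tau>: "\<beta> (\<tau> v) = v" if "v \<in> N0" for v using \<tau>(6)[OF that] by (simp add: \<beta>_def)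
  have injg: "inj_on g V" by (rule good_atlasD(2)[OF good Vg])
  have tb: "\<tau> ?b = w" by (rule inj_onD[OF injg]) (use \<tau>(5,6)[OF \<tau>(2)] gwb w in auto)
  let ?N3 = "{v\<in>V. g v \<in> Base ` N0} \<inter> N"
  have "open {v\<in>V. g v \<in> Base ` N0}"
    by (rule atlas_preimage[OF good Vg atlas_image_open[OF good V0(1) \<tau>(1,3)]])
  then have o3: "open ?N3" using N(1) by blast
  have w3: "w \<in> ?N3" using w(1) gwb \<tau>(2) N(2) by (metis (mono_tags, lifting) IntI imageI mem_Collect_eq)
  have \<tau>\<beta>: "\<beta> v \<in> N0 \<and> \<tau> (\<beta> v) = v" if "v \<in> ?N3" for v
  proof -
    have "g v \<in> Base ` N0" using that by blast
    then obtain x where x: "x \<in> N0" "g v = Base x" by (rule imageE) (rule that)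
    then have "\<beta> v = x" by (simp add: \<beta>_def)
    moreover have "\<tau> x = v" by (rule inj_onD[OF injg]) (use \<tau>(5,6)[OF x(1)] x that in auto)
    ultimately show ?thesis using x by simp
  qed
  have dt: "\<tau> differentiable (at ?b)" by (rule smooth_vec_differentiable[OF \<tau>(4,2)])
  have db: "\<beta> differentiable (at w)" by (rule smooth_vec_differentiable[OF sb w(1)])
  have dbj: "(\<lambda>x. \<beta> x $ j) differentiable (at (\<tau> ?b))" for j
    using sb w(1) unfolding tb smooth_vec_cart by (blast intro: smooth_on_differentiable)
  \<comment> \<open>\<open>\<tau>\<close> is a right inverse of \<open>\<beta>\<close> near the
    point, so the Jacobian \<open>u\<close> of \<open>\<beta>\<close> is nonzero there.\<close>
  have "jac (\<lambda>x. \<beta> (\<tau> x) $ 1) (\<lambda>x. \<beta> (\<tau> x) $ 2) (\<lambda>x. \<beta> (\<tau> x) $ 3) ?b = 1"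
    using jac_cong[OF \<tau>(1,2), of "\<lambda>x. \<beta> (\<tau> x) $ 1" "\<lambda>x. x $ 1" "\<lambda>x. \<beta> (\<tau> x) $ 2" "\<lambda>x. x $ 2"
        "\<lambda>x. \<beta> (\<tau> x) $ 3" "\<lambda>x. x $ 3"] \<beta>\<tau> jac_coordinates by simp
  then have u0: "u w \<noteq> 0" using jac_compose[OF dt dbj[of 1] dbj[of 2] dbj[of 3]] u(3)[OF w(1)] tb by auto
  have "duval_eqn k ?b = 0" using b(2) by (simp add: duval_graph_def duval_eqn_iff)
  then show F0: "F w = 0" using u(2)[OF w(1)] u0 by simp
  let ?N4 = "N0 \<inter> \<tau> -` N"
  have o4: "open ?N4" by (rule continuous_open_preimage[OF smooth_vec_continuous[OF \<tau>(4)] \<tau>(1) N(1)])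
  have b4: "?b \<in> ?N4" using \<tau>(2) tb N(2) by simp
  have st: "smooth_on ?N4 (\<lambda>x. \<kappa> (\<tau> x))" if "smooth_on N \<kappa>" for \<kappa>
    by (rule smooth_on_compose[OF that smooth_vec_subset[OF \<tau>(4)] o4 N(1)]) auto
  have d\<phi>: "(\<lambda>x. \<phi> (\<tau> x)) differentiable (at ?b)" "(\<lambda>x. \<psi> (\<tau> x)) differentiable (at ?b)"
    using smooth_on_differentiable[OF st[OF N(4)] b4] smooth_on_differentiable[OF st[OF N(5)] b4] by auto
  have dE: "duval_eqn k differentiable (at ?b)" by (rule smooth_on_differentiable[OF smooth_duval_eqn[of UNIV]]) simp
  \<comment> \<open>One Jacobian computed twice: as the one below times the determinant
    \<open>u w\<close> of the chart, and inside the chart, where the derivative of \<open>u\<close>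
    drops out because \<open>F w = 0\<close>. Crepancy makes both factors equal to
    \<open>u w\<close>, so they cancel.\<close>
  have "u w * jac (duval_eqn k) (\<lambda>x. \<phi> (\<tau> x)) (\<lambda>x. \<psi> (\<tau> x)) ?b
      = jac (\<lambda>v. duval_eqn k (\<beta> v)) (\<lambda>v. \<phi> (\<tau> (\<beta> v))) (\<lambda>v. \<psi> (\<tau> (\<beta> v))) w"
    using jac_compose[OF db dE d\<phi>] u(3)[OF w(1)] by simp
  also have "\<dots> = jac (\<lambda>v. u v * F v) \<phi> \<psi> w"
    by (rule jac_cong[OF o3 w3]) (use u(2) \<tau>\<beta> in auto)
  also have "\<dots> = u w * jac F \<phi> \<psi> w"
    using frechet_mult[OF smooth_on_differentiable[OF u(1) w(1)] smooth_on_differentiable[OF sF w(1)]] F0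
    by (simp add: jac_def algebra_simps)
  finally have J: "jac (duval_eqn k) (\<lambda>x. \<phi> (\<tau> x)) (\<lambda>x. \<psi> (\<tau> x)) ?b = jac F \<phi> \<psi> w" using u0 by simp
  let ?U = "region e \<inter> graph_map k e -` ?N4"
  have oU: "open ?U"
    by (rule continuous_open_preimage[OF smooth_vec_continuous[OF smooth_vec_subset[OF smooth_graph_map region_dom]] open_region o4])
  have eqU: "on_graph e q a' = \<kappa> (\<tau> (graph_map k e a'))"
    if "a' \<in> ?U" "\<And>v. v \<in> N \<Longrightarrow> g v \<in> S \<Longrightarrow> q (g v) = \<kappa> v" for q \<kappa> a'
  proof -
    have x: "graph_map k e a' \<in> N0" "\<tau> (graph_map k e a') \<in> N" "Base (graph_map k e a') \<in> S"
      using that(1) DS by (auto simp: region_def)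
    then show ?thesis using that(2)[OF x(2)] \<tau>(6)[OF x(1)] by (simp add: on_graph_def)
  qed
  have "pb f h (g w) = graph_bracket k e (on_graph e f) (on_graph e h) a" using ea pb_graph by simp
  also have "\<dots> = graph_bracket k e (\<lambda>a. \<phi> (\<tau> (graph_map k e a))) (\<lambda>a. \<psi> (\<tau> (graph_map k e a))) a"
    by (rule graph_bracket_cong[OF oU]) (use ea(2) b4 ea(4) eqU[where q = f and \<kappa> = \<phi>] eqU[where q = h and \<kappa> = \<psi>] f h in auto)
  also have "\<dots> = jac (duval_eqn k) (\<lambda>x. \<phi> (\<tau> x)) (\<lambda>x. \<psi> (\<tau> x)) (graph_map k e a)"
    by (rule graph_bracket_jac[of a k e "\<lambda>x. \<phi> (\<tau> x)" "\<lambda>x. \<psi> (\<tau> x)"])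
      (use ea d\<phi> region_dom in auto)
  finally show "pb f h (g w) = jac F \<phi> \<psi> w" using J ea(4) by simp
qed

text \<open>The zeros of \<open>F\<close> form a closed set containing the parameters of the dense
  part.\<close>

lemma crepant_vanish:
  assumes Vg: "(V, g) \<in> A" and cr: "crepant k V g F" and w: "w \<in> V" "g w \<in> S"
  shows "F w = 0"
proof (rule ccontr)
  assume "F w \<noteq> 0"
  have V: "open V" by (rule good_atlasD(1)[OF good Vg])
  have "smooth_on V F" using cr by (simp add: crepant_def)
  then have "open (V \<inter> F -` (- {0}))"
    by (intro continuous_open_preimage smooth_on_continuous V open_Compl closed_singleton)
  then have "openin (space_topology X) (g ` (V \<inter> F -` (- {0})))" by (intro atlas_image_open[OF good Vg]) auto
  moreover have "g w \<in> g ` (V \<inter> F -` (- {0}))" using w \<open>F w \<noteq> 0\<close> by auto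
  ultimately obtain t where "t \<in> D" "t \<in> g ` (V \<inter> F -` (- {0}))"
    using dense w(2) unfolding in_closure_of by (meson in_closure_of subsetD)
  then obtain v where v: "v \<in> V" "F v \<noteq> 0" "g v \<in> D" by auto
  show False
    using pb_chart(1)[OF Vg cr v(1,3) V v(1) order_refl smooth_on_const[of V 0] smooth_on_const[of V 0], of "\<lambda>_. 0" "\<lambda>_. 0"] v(2) by simp
qed

lemma chart_at:
  assumes "s \<in> points X"
  obtains V g w F where "(V, g) \<in> A" "w \<in> V" "s = g w" "crepant k V g F"
proof -
  obtain V g w where w: "(V, g) \<in> A" "w \<in> V" "s = g w" using assms by (rule atlas_pointsE)
  moreover have "\<exists>F. crepant k V g F" using inv w(1) by (auto simp: resolution_inv_def)
  ultimately show ?thesis using that by blast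
qed

lemma local_extensions:
  assumes f: "f \<in> smooth_funs XS" and h: "h \<in> smooth_funs XS" and c: "(V, g) \<in> A" "w \<in> V" "g w \<in> S"
  obtains N \<phi> \<psi> where "open N" "w \<in> N" "N \<subseteq> V" "smooth_on N \<phi>" "smooth_on N \<psi>"
    "\<And>v. v \<in> N \<Longrightarrow> g v \<in> S \<Longrightarrow> f (g v) = \<phi> v" "\<And>v. v \<in> N \<Longrightarrow> g v \<in> S \<Longrightarrow> h (g v) = \<psi> v"
proof -
  note ch = atlas_chart[OF good c(1)]
  obtain N1 \<phi> where 1: "open N1" "w \<in> N1" "N1 \<subseteq> V" "smooth_on N1 \<phi>" "\<And>v. v \<in> N1 \<Longrightarrow> g v \<in> S \<Longrightarrow> f (g v) = \<phi> v"
    by (rule smooth_subspaceD[OF f ch c(2,3)]) (rule that)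
  obtain N2 \<psi> where 2: "open N2" "w \<in> N2" "N2 \<subseteq> V" "smooth_on N2 \<psi>" "\<And>v. v \<in> N2 \<Longrightarrow> g v \<in> S \<Longrightarrow> h (g v) = \<psi> v"
    by (rule smooth_subspaceD[OF h ch c(2,3)]) (rule that)
  show ?thesis
    by (rule that[of "N1 \<inter> N2" \<phi> \<psi>]) (use 1 2 smooth_on_subset in \<open>auto intro: smooth_on_subset\<close>)
qed

text \<open>In each chart the smooth function \<open>jac F \<phi> \<psi>\<close> extends the
  bracket, also across exceptional points, where the graph coordinates break down.\<close>

lemma pb_extends:
  assumes f: "f \<in> smooth_funs XS" and h: "h \<in> smooth_funs XS"
  obtains \<Phi> where "\<Phi> \<in> smooth_funs XS" "\<And>t. t \<in> D \<Longrightarrow> \<Phi> t = pb f h t"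
proof (rule dense_extension[OF niceX SM DS dense])
  fix s assume s: "s \<in> S"
  then have "s \<in> points X" using SM by blast
  then obtain V g w F where c: "(V, g) \<in> A" "w \<in> V" "s = g w" "crepant k V g F" by (rule chart_at)
  have gwS: "g w \<in> S" using s c by simp
  obtain N \<phi> \<psi> where N: "open N" "w \<in> N" "N \<subseteq> V" "smooth_on N \<phi>" "smooth_on N \<psi>"
    "\<And>v. v \<in> N \<Longrightarrow> g v \<in> S \<Longrightarrow> f (g v) = \<phi> v" "\<And>v. v \<in> N \<Longrightarrow> g v \<in> S \<Longrightarrow> h (g v) = \<psi> v"
    by (rule local_extensions[OF f h c(1,2) gwS]) (rule that)
  have "smooth_on N F" using c(4) N(3) by (auto simp: crepant_def intro: smooth_on_subset)
  then have sj: "smooth_on N (jac F \<phi> \<psi>)" by (rule smooth_on_jac[OF N(1) _ N(4,5)])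
  obtain G N' where G: "G \<in> smooth_funs X" "open N'" "w \<in> N'" "N' \<subseteq> N" "\<And>v. v \<in> N' \<Longrightarrow> G (g v) = jac F \<phi> \<psi> v"
    by (rule chart_extend[OF atlas_chart[OF good c(1)] N(1,3,2) sj]) (rule that)
  have "pb f h t = G t" if t: "t \<in> g ` N' \<inter> D" for t
  proof -
    obtain v where v: "v \<in> N'" "t = g v" "g v \<in> D" using t by auto
    then have vN: "v \<in> N" "v \<in> V" using G(4) N(3) by auto
    have "pb f h (g v) = jac F \<phi> \<psi> v"
      by (rule pb_chart(2)[OF c(1,4) vN(2) v(3) N(1) vN(1) N(3-7)])
    then show ?thesis using v G(5) by simp
  qed
  moreover have "openin (space_topology X) (g ` N')" using G(2,4) N(3) by (intro atlas_image_open[OF good c(1)]) auto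
  ultimately show "\<exists>W G. openin (space_topology X) W \<and> s \<in> W \<and> G \<in> smooth_funs X \<and> (\<forall>t\<in>W \<inter> D. pb f h t = G t)"
    using G(1,3) c(3) by blast
qed (rule that)

lemma dense_sub: "points XS \<subseteq> space_topology XS closure_of D"
  using dense DS by (auto simp: subspace_topology[OF niceX SM] closure_of_subtopology Int_absorb1)

text \<open>By density the extension that \<open>SOME\<close> chooses is the only one.\<close>

definition bracket :: "bpoint bracket" where
  "bracket = (\<lambda>f\<in>smooth_funs XS. \<lambda>h\<in>smooth_funs XS. SOME \<Phi>. \<Phi> \<in> smooth_funs XS \<and> (\<forall>t\<in>D. \<Phi> t = pb f h t))"

lemma bracket:
  assumes "f \<in> smooth_funs XS" "h \<in> smooth_funs XS"
  shows "bracket f h \<in> smooth_funs XS" "t \<in> D \<Longrightarrow> bracket f h t = pb f h t"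
proof -
  have "\<exists>\<Phi>. \<Phi> \<in> smooth_funs XS \<and> (\<forall>t\<in>D. \<Phi> t = pb f h t)" using pb_extends[OF assms] by metis
  from someI_ex[OF this] show "bracket f h \<in> smooth_funs XS" "t \<in> D \<Longrightarrow> bracket f h t = pb f h t"
    using assms unfolding bracket_def by simp_all
qed

lemma eq_on_S:
  assumes "f \<in> smooth_funs XS" "h \<in> smooth_funs XS" "\<And>e a. e^2 = 1 \<Longrightarrow> a \<in> region e \<Longrightarrow> on_graph e f a = on_graph e h a"
  shows "f = h"
proof (rule smooth_map_closure_eq[OF niceXS assms(1,2) _ dense_sub])
  fix s assume "s \<in> D"
  then obtain e a where "e^2 = 1" "a \<in> region e" "s = Base (graph_map k e a)" by (rule D_E)
  then show "f s = h s" using assms(3) by (simp add: on_graph_def)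
qed

lemma bracket_graph:
  assumes "f \<in> smooth_funs XS" "h \<in> smooth_funs XS" "e^2 = 1" "a \<in> region e"
  shows "on_graph e (bracket f h) a = graph_bracket k e (on_graph e f) (on_graph e h) a"
  using bracket(2)[OF assms(1,2)] pb_graph[OF assms(4,3)] assms(4) by (simp add: on_graph_def region_def)

lemma region_S: "a \<in> region e \<Longrightarrow> Base (graph_map k e a) \<in> S"
  using DS by (auto simp: region_def)

lemma poisson_bracket: "poisson_bracket XS bracket"
  unfolding poisson_bracket_def
proof (intro conjI ballI allI)
  show "bracket \<in> smooth_funs XS \<rightarrow>\<^sub>E (smooth_funs XS \<rightarrow>\<^sub>E smooth_funs XS)"
  proof (rule PiE_I)
    fix f assume f: "f \<in> smooth_funs XS"
    show "bracket f \<in> smooth_funs XS \<rightarrow>\<^sub>E smooth_funs XS"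
      by (rule PiE_I) (use bracket(1)[OF f] f in \<open>auto simp: bracket_def simp del: smooth_subspace_sel\<close>)
  qed (simp add: bracket_def del: smooth_subspace_sel)
  note zero = nice_const[OF niceXS, of 0]
  note lin = nice_lin[OF niceXS] and mul = nice_mult[OF niceXS]
  fix f g assume f: "f \<in> smooth_funs XS" and g: "g \<in> smooth_funs XS"
  \<comment> \<open>Only an equality of two smooth functions can be tested on the graph, so each
    identity is first written as one between members of the algebra, built with the operations of
    \<open>nice_space\<close>.\<close>
  have anti: "(\<lambda>t\<in>points XS. 1 * bracket f g t + bracket g f t) = (\<lambda>t\<in>points XS. 0)"
  proof (rule eq_on_S[OF lin[OF bracket(1)[OF f g] bracket(1)[OF g f]] zero])
    fix e b assume eb: "e^2 = 1" "b \<in> region e"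
    have "graph_bracket k e (on_graph e f) (on_graph e g) b = - graph_bracket k e (on_graph e g) (on_graph e f) b"
      by (simp add: graph_bracket_def algebra_simps)
    then show "on_graph e (\<lambda>t\<in>points XS. 1 * bracket f g t + bracket g f t) b = on_graph e (\<lambda>t\<in>points XS. 0) b"
      using bracket_graph[OF f g eb] bracket_graph[OF g f eb] region_S[OF eb(2)] by (simp add: on_graph_def)
  qed
  show "bracket f g s = - bracket g f s" if "s \<in> points XS" for s
    using fun_cong[OF anti, of s] that by (simp add: eq_neg_iff_add_eq_0)
  fix h a assume h: "h \<in> smooth_funs XS"
  have dg: "on_graph e q differentiable (at b)" if "q \<in> smooth_funs XS" "e^2 = 1" "b \<in> region e" for q e b
    using smooth_on_differentiable[OF smooth_on_graph[OF that(1,2)] that(3)] .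
  have linear: "bracket (\<lambda>t\<in>points XS. a * f t + g t) h = (\<lambda>t\<in>points XS. a * bracket f h t + bracket g h t)"
  proof (rule eq_on_S[OF bracket(1)[OF lin[OF f g] h] lin[OF bracket(1)[OF f h] bracket(1)[OF g h]]])
    fix e b assume eb: "e^2 = 1" "b \<in> region e"
    have "graph_bracket k e (on_graph e (\<lambda>t\<in>points XS. a * f t + g t)) (on_graph e h) b
        = graph_bracket k e (\<lambda>b. a * on_graph e f b + on_graph e g b) (on_graph e h) b"
      by (rule graph_bracket_cong[OF open_region eb(2)]) (use region_S in \<open>auto simp: on_graph_def\<close>)
    also have "\<dots> = a * graph_bracket k e (on_graph e f) (on_graph e h) b + graph_bracket k e (on_graph e g) (on_graph e h) b"
      using dg[OF f eb] dg[OF g eb]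
      by (simp add: graph_bracket_def frechet_add frechet_mult differentiable_mult algebra_simps)
    finally show "on_graph e (bracket (\<lambda>t\<in>points XS. a * f t + g t) h) b = on_graph e (\<lambda>t\<in>points XS. a * bracket f h t + bracket g h t) b"
      using bracket_graph[OF lin[OF f g] h eb] bracket_graph[OF f h eb] bracket_graph[OF g h eb] region_S[OF eb(2)]
      by (simp add: on_graph_def)
  qed
  show "bracket (\<lambda>t\<in>points XS. a * f t + g t) h s = a * bracket f h s + bracket g h s" if "s \<in> points XS" for s
    using fun_cong[OF linear, of s] that by simp
  have leibniz: "bracket (\<lambda>t\<in>points XS. f t * g t) h = (\<lambda>t\<in>points XS. 1 * (\<lambda>t\<in>points XS. f t * bracket g h t) t + (\<lambda>t\<in>points XS. g t * bracket f h t) t)"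
  proof (rule eq_on_S[OF bracket(1)[OF mul[OF f g] h] lin[OF mul[OF f bracket(1)[OF g h]] mul[OF g bracket(1)[OF f h]]]])
    fix e b assume eb: "e^2 = 1" "b \<in> region e"
    have "graph_bracket k e (on_graph e (\<lambda>t\<in>points XS. f t * g t)) (on_graph e h) b
        = graph_bracket k e (\<lambda>b. on_graph e f b * on_graph e g b) (on_graph e h) b"
      by (rule graph_bracket_cong[OF open_region eb(2)]) (use region_S in \<open>auto simp: on_graph_def\<close>)
    also have "\<dots> = on_graph e f b * graph_bracket k e (on_graph e g) (on_graph e h) b + on_graph e g b * graph_bracket k e (on_graph e f) (on_graph e h) b"
      using dg[OF f eb] dg[OF g eb]
      by (simp add: graph_bracket_def frechet_mult algebra_simps)
    finally show "on_graph e (bracket (\<lambda>t\<in>points XS. f t * g t) h) b =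
        on_graph e (\<lambda>t\<in>points XS. 1 * (\<lambda>t\<in>points XS. f t * bracket g h t) t + (\<lambda>t\<in>points XS. g t * bracket f h t) t) b"
      using bracket_graph[OF mul[OF f g] h eb] bracket_graph[OF f h eb] bracket_graph[OF g h eb] region_S[OF eb(2)]
      by (simp add: on_graph_def)
  qed
  show "bracket (\<lambda>t\<in>points XS. f t * g t) h s = f s * bracket g h s + g s * bracket f h s" if "s \<in> points XS" for s
    using fun_cong[OF leibniz, of s] that by simp
  note br = bracket(1)
  have jacobi: "(\<lambda>t\<in>points XS. 1 * bracket f (bracket g h) t + (\<lambda>t\<in>points XS. 1 * bracket g (bracket h f) t + bracket h (bracket f g) t) t) = (\<lambda>t\<in>points XS. 0)"
  proof (rule eq_on_S[OF lin[OF br[OF f br[OF g h]] lin[OF br[OF g br[OF h f]] br[OF h br[OF f g]]]] zero])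
    fix e b assume eb: "e^2 = 1" "b \<in> region e"
    have J: "on_graph e (bracket p (bracket q r)) b = graph_bracket k e (on_graph e p) (graph_bracket k e (on_graph e q) (on_graph e r)) b"
      if "p \<in> smooth_funs XS" "q \<in> smooth_funs XS" "r \<in> smooth_funs XS" for p q r
      unfolding bracket_graph[OF that(1) br[OF that(2,3)] eb]
      by (rule graph_bracket_cong[OF open_region eb(2)]) (auto simp: bracket_graph[OF that(2,3) eb(1)])
    have "on_graph e (bracket f (bracket g h)) b + on_graph e (bracket g (bracket h f)) b + on_graph e (bracket h (bracket f g)) b = 0"
      unfolding J[OF f g h] J[OF g h f] J[OF h f g]
      by (rule graph_bracket_jacobi[OF open_region region_dom eb(2) smooth_on_graph[OF f eb(1)] smooth_on_graph[OF g eb(1)] smooth_on_graph[OF h eb(1)]])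
    then show "on_graph e (\<lambda>t\<in>points XS. 1 * bracket f (bracket g h) t + (\<lambda>t\<in>points XS. 1 * bracket g (bracket h f) t + bracket h (bracket f g) t) t) b = on_graph e (\<lambda>t\<in>points XS. 0) b"
      using region_S[OF eb(2)] by (simp add: on_graph_def)
  qed
  show "bracket f (bracket g h) s + bracket g (bracket h f) s + bracket h (bracket f g) s = 0"
    if "s \<in> points XS" for s using fun_cong[OF jacobi, of s] that by (simp add: add.assoc)
qed

lemma bracket_unique:
  assumes B: "poisson_bracket XS B" and "\<And>f h s. f \<in> smooth_funs XS \<Longrightarrow> h \<in> smooth_funs XS \<Longrightarrow> s \<in> D \<Longrightarrow> B f h s = pb f h s"
  shows "B = bracket"
proof -
  have BP: "B \<in> smooth_funs XS \<rightarrow>\<^sub>E (smooth_funs XS \<rightarrow>\<^sub>E smooth_funs XS)"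
    using B unfolding poisson_bracket_def by (rule conjunct1)
  have bP: "bracket \<in> smooth_funs XS \<rightarrow>\<^sub>E (smooth_funs XS \<rightarrow>\<^sub>E smooth_funs XS)"
    using poisson_bracket unfolding poisson_bracket_def by (rule conjunct1)
  show ?thesis
  proof (rule PiE_ext[OF BP bP])
    fix f assume f: "f \<in> smooth_funs XS"
    show "B f = bracket f"
    proof (rule PiE_ext[OF PiE_mem[OF BP f] PiE_mem[OF bP f]])
      fix h assume h: "h \<in> smooth_funs XS"
      show "B f h = bracket f h"
        by (rule smooth_map_closure_eq[OF niceXS PiE_mem[OF PiE_mem[OF BP f] h] bracket(1)[OF f h] _ dense_sub])
          (simp only: assms(2)[OF f h] bracket(2)[OF f h])
    qed
  qed
qed

text \<open>Both sides are smooth and agree on \<open>D\<close>. The formula is needed at all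
  points, in particular on the exceptional set and on the boundary, where the bracket is to be shown
  nondegenerate.\<close>

lemma bracket_chart:
  assumes f: "f \<in> smooth_funs XS" and h: "h \<in> smooth_funs XS"
    and Vg: "(V, g) \<in> A" and cr: "crepant k V g F" and w: "w \<in> V" "g w \<in> S"
    and N: "open N" "w \<in> N" "N \<subseteq> V" "smooth_on N \<phi>" "smooth_on N \<psi>"
    and loc: "\<And>v. v \<in> N \<Longrightarrow> g v \<in> S \<Longrightarrow> f (g v) = \<phi> v" "\<And>v. v \<in> N \<Longrightarrow> g v \<in> S \<Longrightarrow> h (g v) = \<psi> v"
  shows "bracket f h (g w) = jac F \<phi> \<psi> w"
proof -
  have "smooth_on N F" using cr N(3) by (auto simp: crepant_def intro: smooth_on_subset)
  then have sj: "smooth_on N (jac F \<phi> \<psi>)" by (rule smooth_on_jac[OF N(1) _ N(4,5)])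
  obtain G N' where G: "G \<in> smooth_funs X" "open N'" "w \<in> N'" "N' \<subseteq> N" "\<And>v. v \<in> N' \<Longrightarrow> G (g v) = jac F \<phi> \<psi> v"
    by (rule chart_extend[OF atlas_chart[OF good Vg] N(1,3,2) sj]) (rule that)
  have oW: "openin (space_topology X) (g ` N')" using G(2,4) N(3) by (intro atlas_image_open[OF good Vg]) auto
  have "bracket f h (g w) = restrict G S (g w)"
  proof (rule smooth_funs_eq_on_closure[OF niceXS bracket(1)[OF f h] smooth_subspace_restrict[OF niceX SM G(1)]])
    fix t assume t: "t \<in> D \<inter> g ` N'"
    then obtain v where v: "v \<in> N'" "t = g v" "g v \<in> D" by auto
    then have vN: "v \<in> N" "v \<in> V" using G(4) N(3) by auto
    have "pb f h (g v) = jac F \<phi> \<psi> v"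
      by (rule pb_chart(2)[OF Vg cr vN(2) v(3) N(1) vN(1) N(3-5) loc])
    then show "bracket f h t = restrict G S t" using v G(5) bracket(2)[OF f h v(3)] DS by auto
  next
    have "g w \<in> space_topology X closure_of (D \<inter> g ` N')"
      by (rule in_closure_of_Int_open[OF _ oW]) (use dense w(2) G(3) in auto)
    moreover have "S \<inter> (D \<inter> g ` N') = D \<inter> g ` N'" using DS by auto
    ultimately show "g w \<in> space_topology XS closure_of (D \<inter> g ` N')"
      using w(2) by (simp add: subspace_topology[OF niceX SM] closure_of_subtopology)
  qed
  then show ?thesis using G(3,5) w(2) by simp
qed

section \<open>Identification with the pulled-back bracket\<close>

lemma smooth_blowdown:
  assumes "smooth_on UNIV F"
  shows "compose (points XS) F blowdown \<in> smooth_funs XS"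
proof (rule smooth_subspaceI)
  fix s assume s: "s \<in> S"
  then have "s \<in> points X" using SM by blast
  then obtain V g w E where c: "(V, g) \<in> A" "w \<in> V" "s = g w" "crepant k V g E" by (rule chart_at)
  have "smooth_on V (\<lambda>v. F (blowdown (g v)))"
    by (rule smooth_on_compose[OF assms _ good_atlasD(1)[OF good c(1)] open_UNIV]) (use c(4) in \<open>auto simp: crepant_def\<close>)
  then show "\<exists>V g w N \<phi>. is_chart X V g \<and> s = g w \<and> open N \<and> w \<in> N \<and> N \<subseteq> V \<and> smooth_on N (\<phi> :: real^3 \<Rightarrow> real) \<and>
      (\<forall>v\<in>N. g v \<in> S \<longrightarrow> compose (points XS) F blowdown (g v) = \<phi> v)"
    using c atlas_chart[OF good c(1)] good_atlasD(1)[OF good c(1)]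
    by (intro exI[of _ V] exI[of _ g] exI[of _ w] exI[of _ V] exI[of _ "\<lambda>v. F (blowdown (g v))"]) (auto simp: compose_def)
qed (simp add: compose_def)

lemma pb_blowdown:
  assumes F: "smooth_on UNIV F" and G: "smooth_on UNIV G" and s: "s \<in> D"
  shows "pb (compose (points XS) F blowdown) (compose (points XS) G blowdown) s = jac (duval_eqn k) F G (blowdown s)"
proof -
  obtain e a where ea: "e^2 = 1" "a \<in> region e" "s = Base (graph_map k e a)" "blowdown s = graph_map k e a"
    using s by (rule D_E)
  have "pb (compose (points XS) F blowdown) (compose (points XS) G blowdown) s
      = graph_bracket k e (on_graph e (compose (points XS) F blowdown)) (on_graph e (compose (points XS) G blowdown)) a"
    using pb_graph ea by simp
  also have "\<dots> = graph_bracket k e (\<lambda>a. F (graph_map k e a)) (\<lambda>a. G (graph_map k e a)) a"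
    by (rule graph_bracket_cong[OF open_region ea(2)]) (use region_S in \<open>auto simp: on_graph_def compose_def\<close>)
  also have "\<dots> = jac (duval_eqn k) F G (graph_map k e a)"
    by (rule graph_bracket_jac)
      (use ea region_dom smooth_on_differentiable[OF F] smooth_on_differentiable[OF G] in auto)
  finally show ?thesis using ea by simp
qed

lemma smooth_jac_duval: "smooth_on UNIV F \<Longrightarrow> smooth_on UNIV G \<Longrightarrow> smooth_on UNIV (jac (duval_eqn k) F G)"
  by (intro smooth_on_jac smooth_duval_eqn) auto

lemma bracket_blowdown: "poisson_map XS bracket euclidean_smooth (duval_bracket k) blowdown"
  unfolding poisson_map_def
proof (intro conjI ballI)
  show "smooth_map XS euclidean_smooth blowdown"
    unfolding smooth_map_def using smooth_blowdown by auto
  fix F G :: "real^3 \<Rightarrow> real" assume "F \<in> smooth_funs euclidean_smooth" "G \<in> smooth_funs euclidean_smooth"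
  then have F: "smooth_on UNIV F" and G: "smooth_on UNIV G" by auto
  show "bracket (compose (points XS) F blowdown) (compose (points XS) G blowdown) = compose (points XS) (duval_bracket k F G) blowdown"
  proof (rule smooth_map_closure_eq[OF niceXS bracket(1)[OF smooth_blowdown[OF F] smooth_blowdown[OF G]] _ _ dense_sub])
    show "compose (points XS) (duval_bracket k F G) blowdown \<in> smooth_funs XS"
      unfolding duval_bracket_eq_jac[OF F G] by (rule smooth_blowdown[OF smooth_jac_duval[OF F G]])
    fix s assume s: "s \<in> D"
    then show "bracket (compose (points XS) F blowdown) (compose (points XS) G blowdown) s = compose (points XS) (duval_bracket k F G) blowdown s"
      using bracket(2)[OF smooth_blowdown[OF F] smooth_blowdown[OF G] s] pb_blowdown[OF F G s] DS
      by (auto simp: compose_def duval_bracket_eq_jac[OF F G])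
  qed
qed

text \<open>For uniqueness, the blow-down is a local chart at a point of \<open>D\<close>, so every
  function is there locally a pullback from three-space and its brackets are forced; density does
  the rest.\<close>

lemma pullback_blowdown: "pullback_bracket XS euclidean_smooth (duval_bracket k) blowdown = bracket"
  unfolding pullback_bracket_def
proof (rule the_equality)
  show "poisson_bracket XS bracket \<and> poisson_map XS bracket euclidean_smooth (duval_bracket k) blowdown"
    using poisson_bracket bracket_blowdown by blast
next
  fix B assume B: "poisson_bracket XS B \<and> poisson_map XS B euclidean_smooth (duval_bracket k) blowdown"
  show "B = bracket"
  proof (rule bracket_unique)
    show "poisson_bracket XS B" using B by blast
    fix f h s assume f: "f \<in> smooth_funs XS" and h: "h \<in> smooth_funs XS" and s: "s \<in> D"
    obtain e a where ea: "e^2 = 1" "a \<in> region e" "s = Base (graph_map k e a)" "blowdown s = graph_map k e a"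
      using s by (rule D_E)
    let ?b = "graph_map k e a"
    obtain V0 where V0: "(V0, Base) \<in> A" "duval_graph k \<subseteq> V0" by (rule base_chart)
    have b: "?b \<in> V0" "Base ?b \<in> S" using ea V0(2) graph_map_duval(1)[of a k e] region_dom region_S by auto
    obtain N \<phi> \<psi> where N: "open N" "?b \<in> N" "N \<subseteq> V0" "smooth_on N \<phi>" "smooth_on N \<psi>"
      "\<And>v. v \<in> N \<Longrightarrow> Base v \<in> S \<Longrightarrow> f (Base v) = \<phi> v" "\<And>v. v \<in> N \<Longrightarrow> Base v \<in> S \<Longrightarrow> h (Base v) = \<psi> v"
      by (rule local_extensions[OF f h V0(1) b]) (rule that)
    obtain F N1 where F: "smooth_on UNIV F" "open N1" "?b \<in> N1" "N1 \<subseteq> N" "\<And>v. v \<in> N1 \<Longrightarrow> F v = \<phi> v"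
      by (rule euclidean_extend[OF N(1,2,4)]) (rule that)
    obtain G N2 where G: "smooth_on UNIV G" "open N2" "?b \<in> N2" "N2 \<subseteq> N" "\<And>v. v \<in> N2 \<Longrightarrow> G v = \<psi> v"
      by (rule euclidean_extend[OF N(1,2,5)]) (rule that)
    let ?F = "compose (points XS) F blowdown" and ?G = "compose (points XS) G blowdown"
    let ?W = "Base ` (N1 \<inter> N2) \<inter> S"
    have "openin (space_topology X) (Base ` (N1 \<inter> N2))"
      using F(2,4) G(2) N(3) by (intro atlas_image_open[OF good V0(1)]) auto
    then have oW: "openin (space_topology XS) ?W"
      unfolding subspace_topology[OF niceX SM] openin_subtopology by blast
    have sW: "s \<in> ?W" using F(3) G(3) ea(3) b(2) by auto
    have eqs: "f t = ?F t" "h t = ?G t" if "t \<in> ?W" for t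
      using that F(4,5) G(4,5) N(6,7) by (auto simp: compose_def)
    have "B f h s = B ?F ?G s"
      by (rule poisson_bracket_local[OF niceXS conjunct1[OF B] f smooth_blowdown[OF F(1)] h smooth_blowdown[OF G(1)] oW sW eqs])
    also have "\<dots> = compose (points XS) (duval_bracket k F G) blowdown s"
      using B F(1) G(1) unfolding poisson_map_def by simp
    also have "\<dots> = pb ?F ?G s"
      using pb_blowdown[OF F(1) G(1) s] s DS by (auto simp: compose_def duval_bracket_eq_jac[OF F(1) G(1)])
    also have "\<dots> = bracket ?F ?G s" using bracket(2)[OF smooth_blowdown[OF F(1)] smooth_blowdown[OF G(1)] s] by simp
    also have "\<dots> = bracket f h s"
      by (rule poisson_bracket_local[OF niceXS poisson_bracket smooth_blowdown[OF F(1)] f smooth_blowdown[OF G(1)] h oW sW])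
        (simp_all only: eqs)
    finally show "B f h s = pb f h s" using bracket(2)[OF f h s] by simp
  qed
qed

end

locale sub_surface = big: dense_surface k A Z S D + dense_surface k A Z T E
  for k A Z S D T E +
  assumes TS: "T \<subseteq> S" and ED: "E \<subseteq> D"
begin

abbreviation "XT \<equiv> smooth_subspace (atlas_space A) T"
abbreviation "XB \<equiv> smooth_subspace (atlas_space A) S"

lemma sub_sub: "smooth_subspace XB T = XT"
  by (rule subspace_subspace[OF niceX big.SM TS])

lemma restrict_smooth: "F \<in> smooth_funs XB \<Longrightarrow> restrict F T \<in> smooth_funs XT"
  using smooth_subspace_restrict[OF big.niceXS, of T F] TS unfolding sub_sub by simp

lemma pb_restrict:
  assumes "s \<in> E"
  shows "pb (restrict F T) (restrict G T) s = pb F G s"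
proof -
  obtain e a where ea: "e^2 = 1" "a \<in> region e" "s = Base (graph_map k e a)" using assms by (rule D_E)
  have a': "a \<in> big.region e" using ea(2) ED by (auto simp: region_def big.region_def)
  show ?thesis
    unfolding ea(3) pb_graph[OF ea(2,1)]
    by (rule graph_bracket_cong[OF open_region ea(2)]) (use region_S in \<open>auto simp: on_graph_def\<close>)
qed

text \<open>The bracket is forced because every smooth function on the subset is locally the
  restriction of one on the larger surface.\<close>

lemma pullback_restriction: "pullback_bracket XT XB big.bracket id = bracket"
  unfolding pullback_bracket_def
proof (rule the_equality)
  have comp: "compose (points XT) F id = restrict F T" for F :: "bpoint \<Rightarrow> real" by (auto simp: compose_def)
  have pm: "poisson_map XT bracket XB big.bracket id"
    unfolding poisson_map_def
  proof (intro conjI ballI)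
    show "smooth_map XT XB id"
      unfolding smooth_map_def comp using TS restrict_smooth by (auto simp del: smooth_subspace_sel(2))
    fix F G assume F: "F \<in> smooth_funs XB" and G: "G \<in> smooth_funs XB"
    show "bracket (compose (points XT) F id) (compose (points XT) G id) = compose (points XT) (big.bracket F G) id"
      unfolding comp
    proof (rule smooth_map_closure_eq[OF niceXS bracket(1) _ _ dense_sub])
      fix s assume s: "s \<in> E"
      then show "bracket (restrict F T) (restrict G T) s = restrict (big.bracket F G) T s"
        using bracket(2)[OF restrict_smooth[OF F] restrict_smooth[OF G] s] pb_restrict[OF s, of F G] big.bracket(2)[OF F G] ED DS
        by (auto simp: subset_iff)
    qed (use F G restrict_smooth big.bracket(1) in blast)+
  qed
  then show "poisson_bracket XT bracket \<and> poisson_map XT bracket XB big.bracket id"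
    using poisson_bracket by blast
  fix B assume B: "poisson_bracket XT B \<and> poisson_map XT B XB big.bracket id"
  show "B = bracket"
  proof (rule bracket_unique)
    show "poisson_bracket XT B" using B by blast
    fix f h s assume f: "f \<in> smooth_funs XT" and h: "h \<in> smooth_funs XT" and s: "s \<in> E"
    have sT: "s \<in> T" using s DS by blast
    obtain W1 F where 1: "openin (space_topology XB) W1" "s \<in> W1" "F \<in> smooth_funs XB" "\<forall>t\<in>W1 \<inter> T. f t = F t"
      using f sT unfolding sub_sub[symmetric] smooth_subspace_sel(2)[of f] by meson
    obtain W2 G where 2: "openin (space_topology XB) W2" "s \<in> W2" "G \<in> smooth_funs XB" "\<forall>t\<in>W2 \<inter> T. h t = G t"
      using h sT unfolding sub_sub[symmetric] smooth_subspace_sel(2)[of h] by meson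
    let ?W = "(W1 \<inter> W2) \<inter> T"
    have oW: "openin (space_topology XT) ?W"
      unfolding sub_sub[symmetric] subspace_topology[OF big.niceXS, of T, simplified, OF TS] openin_subtopology
      using 1(1) 2(1) by blast
    have sW: "s \<in> ?W" using 1 2 sT by blast
    have eqs: "f t = restrict F T t" "h t = restrict G T t" if "t \<in> ?W" for t using that 1 2 by auto
    have "B f h s = B (restrict F T) (restrict G T) s"
      by (rule poisson_bracket_local[OF niceXS conjunct1[OF B] f restrict_smooth[OF 1(3)] h restrict_smooth[OF 2(3)] oW sW eqs])
    also have "\<dots> = restrict (big.bracket F G) T s"
      using B 1(3) 2(3) unfolding poisson_map_def comp by simp
    also have "\<dots> = bracket (restrict F T) (restrict G T) s"
      using pm 1(3) 2(3) unfolding poisson_map_def comp by simp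
    also have "\<dots> = bracket f h s"
      by (rule poisson_bracket_local[OF niceXS poisson_bracket restrict_smooth[OF 1(3)] f restrict_smooth[OF 2(3)] h oW sW])
        (simp_all only: eqs)
    finally show "B f h s = pb f h s" using bracket(2)[OF f h s] by simp
  qed
qed

end

section \<open>The half of the resolution over \<open>z \<ge> 0\<close>\<close>

abbreviation Z_atlas :: "nat \<Rightarrow> param set" where "Z_atlas k \<equiv> fst (resolved k)"
abbreviation Z_ambient :: "nat \<Rightarrow> bpoint smooth_space" where "Z_ambient k \<equiv> atlas_space (Z_atlas k)"

definition plus_graph :: "nat \<Rightarrow> bpoint set" where
  "plus_graph k = Base ` {v \<in> duval_graph k. 0 < v$3}"

text \<open>A description of the points of \<open>Z_plus\<close> that avoids the interior;
  \<open>plus_points_eq\<close> identifies the two.\<close>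

definition plus_points :: "nat \<Rightarrow> bpoint set" where
  "plus_points k = space_topology (Z_ambient k) closure_of plus_graph k"

lemma resolved_inv: "resolution_inv k (Z_atlas k, snd (resolved k))"
  using resolved_charts(1)[of k] by simp

lemma good_Z: "good_atlas (Z_atlas k)" and nice_Z: "nice_space (Z_ambient k)"
  and Z_closure: "snd (resolved k) = space_topology (Z_ambient k) closure_of (Base ` duval_graph k)"
  using resolved_inv[of k] nice_atlas by (auto simp: resolution_inv_def)

lemma open_graph_part:
  assumes "\<And>a e. e^2 = 1 \<Longrightarrow> a \<in> graph_dom k \<Longrightarrow> P (graph_map k e a) \<longleftrightarrow> Q a" "open {a \<in> graph_dom k. Q a}"
  shows "open {a \<in> graph_dom k. Base (graph_map k e a) \<in> Base ` {v \<in> duval_graph k. P v}}"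
proof (cases "e^2 = 1")
  case True
  have "{a \<in> graph_dom k. Base (graph_map k e a) \<in> Base ` {v \<in> duval_graph k. P v}} = {a \<in> graph_dom k. Q a}"
    using assms(1)[OF True] graph_map_duval(1)[OF _ True] by (auto simp del: graph_map_nth)
  then show ?thesis using assms(2) by simp
next
  case False
  \<comment> \<open>For \<open>e\<close> other than \<open>1\<close> and \<open>- 1\<close> the
    formula leaves the surface, and the set in question is empty.\<close>
  have "graph_map k e a \<notin> duval_graph k" if "a \<in> graph_dom k" for a
  proof
    assume "graph_map k e a \<in> duval_graph k"
    then have "a$2 * (a$1)^2 + e^2 * ((a$2)^(2*k+1) - a$2 * (a$1)^2) = (a$2)^(2*k+1)"
      using that by (simp add: duval_graph_def duval_def power_mult_distrib graph_dom_def)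
    then have "(e^2 - 1) * ((a$2)^(2*k+1) - a$2 * (a$1)^2) = 0" by (simp add: algebra_simps)
    then show False using False that by (auto simp: graph_dom_def)
  qed
  then have "{a \<in> graph_dom k. Base (graph_map k e a) \<in> Base ` {v \<in> duval_graph k. P v}} = {}" by auto
  then show ?thesis by (simp only: open_empty)
qed

lemma closure_in_ambient: "space_topology (Z_ambient k) closure_of B \<subseteq> points (Z_ambient k)"
  using closure_of_subset_topspace nice_topspace[OF nice_Z] by metis

lemma duval_graph_points: "Base ` duval_graph k \<subseteq> points (Z_ambient k)"
  using resolved_inv[of k] atlas_points by (fastforce simp: resolution_inv_def)

lemma duval_graph_subset_Z: "Base ` duval_graph k \<subseteq> snd (resolved k)"
  unfolding Z_closure by (rule closure_of_subset) (simp add: nice_topspace[OF nice_Z] duval_graph_points)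

lemma plus_graph_subset: "plus_graph k \<subseteq> Base ` duval_graph k"
  by (auto simp: plus_graph_def)

lemma plus_graph_points: "plus_graph k \<subseteq> plus_points k"
  unfolding plus_points_def
  by (rule closure_of_subset)
    (simp only: nice_topspace[OF nice_Z] order_trans[OF plus_graph_subset duval_graph_points])

lemma plus_points_subset: "plus_points k \<subseteq> snd (resolved k)"
  unfolding plus_points_def Z_closure by (rule closure_of_mono[OF plus_graph_subset])

interpretation Z: dense_surface k "Z_atlas k" "snd (resolved k)" "snd (resolved k)" "Base ` duval_graph k" for k
proof unfold_locales
  show "resolution_inv k (Z_atlas k, snd (resolved k))" by (rule resolved_inv)
  show "snd (resolved k) \<subseteq> points (Z_ambient k)" unfolding Z_closure by (rule closure_in_ambient)
  show "Base ` duval_graph k \<subseteq> snd (resolved k)" by (rule duval_graph_subset_Z)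
  show "snd (resolved k) \<subseteq> space_topology (Z_ambient k) closure_of (Base ` duval_graph k)" unfolding Z_closure ..
  show "open {a \<in> graph_dom k. Base (graph_map k e a) \<in> Base ` duval_graph k}" for e
    using open_graph_part[where P = "\<lambda>_. True" and Q = "\<lambda>_. True" and k = k] open_graph_dom by simp
qed simp

interpretation P: sub_surface k "Z_atlas k" "snd (resolved k)" "snd (resolved k)" "Base ` duval_graph k" "plus_points k" "plus_graph k" for k
proof unfold_locales
  show "plus_points k \<subseteq> points (Z_ambient k)" unfolding plus_points_def by (rule closure_in_ambient)
  show "plus_points k \<subseteq> space_topology (Z_ambient k) closure_of plus_graph k" unfolding plus_points_def ..
  show "open {a \<in> graph_dom k. Base (graph_map k e a) \<in> plus_graph k}" for e
    unfolding plus_graph_def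
    by (rule open_graph_part[where Q = "\<lambda>a. 0 < a$2"])
      (auto intro!: open_Collect_conj open_Collect_less continuous_intros simp: graph_dom_def)
qed (rule plus_graph_points plus_graph_subset plus_points_subset resolved_inv)+

lemma Z_bracket_eq: "Z_bracket k = Z.bracket k"
  unfolding Z_bracket_def Z_space_def by (rule Z.pullback_blowdown)

lemma Z_blowdown_duval:
  assumes "s \<in> snd (resolved k)"
  shows "blowdown s \<in> duval k"
proof -
  have "s \<in> points (Z_ambient k)" using assms Z.SM by blast
  then obtain V g w F where c: "(V, g) \<in> Z_atlas k" "w \<in> V" "s = g w" "crepant k V g F" by (rule Z.chart_at)
  have "F w = 0" by (rule Z.crepant_vanish[OF c(1,4,2)]) (use assms c in simp)
  then show ?thesis using c by (auto simp: crepant_def duval_eqn_iff)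
qed

lemma Z_height_continuous: "continuous_map (space_topology (Z_space k)) euclideanreal (\<lambda>s. blowdown s $ 3)"
proof -
  have "continuous_map (space_topology (Z_space k)) euclideanreal (compose (points (Z_space k)) (\<lambda>v. v $ 3) blowdown)"
    unfolding Z_space_def by (rule smooth_fun_continuous[OF Z.niceXS Z.smooth_blowdown]) (rule smooth_on_nth)
  then show ?thesis
    by (rule continuous_map_eq) (simp add: compose_def Z_space_def nice_topspace[OF Z.niceXS])
qed

lemma Z_topology: "space_topology (Z_space k) = subtopology (space_topology (Z_ambient k)) (snd (resolved k))"
  unfolding Z_space_def by (rule subspace_topology[OF nice_Z Z.SM])

lemma Z_topspace: "topspace (space_topology (Z_space k)) = snd (resolved k)"
  using nice_topspace[OF Z.niceXS] by (simp add: Z_space_def)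

text \<open>The open part \<open>z > 0\<close> lies in the interior. Conversely there are graph
  points arbitrarily near an interior point; they have \<open>z \<ge> 0\<close> and
  \<open>y \<noteq> 0\<close>, and the equation then excludes \<open>z = 0\<close>.\<close>

lemma plus_points_eq:
  "space_topology (Z_space k) closure_of (space_topology (Z_space k) interior_of
     {s \<in> points (Z_space k). blowdown s \<in> duval_plus k}) = plus_points k"
proof -
  let ?T = "space_topology (Z_space k)" and ?X = "space_topology (Z_ambient k)" and ?Z = "snd (resolved k)"
  let ?H = "{s \<in> points (Z_space k). blowdown s \<in> duval_plus k}"
  have pts: "points (Z_space k) = ?Z" by (simp add: Z_space_def)
  have "openin ?T {s \<in> topspace ?T. blowdown s $ 3 \<in> {0<..}}"
    by (rule openin_continuous_map_preimage[OF Z_height_continuous]) (simp add: open_openin[symmetric])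
  moreover have "{s \<in> topspace ?T. blowdown s $ 3 \<in> {0<..}} \<subseteq> ?H"
    using Z_blowdown_duval by (auto simp: Z_topspace pts duval_plus_def)
  ultimately have "{s \<in> topspace ?T. blowdown s $ 3 \<in> {0<..}} \<subseteq> ?T interior_of ?H"
    by (rule interior_of_maximal[rotated])
  moreover have "plus_graph k \<subseteq> {s \<in> topspace ?T. blowdown s $ 3 \<in> {0<..}}"
    using plus_graph_subset[of k] duval_graph_subset_Z[of k] by (auto simp: Z_topspace plus_graph_def)
  ultimately have sub: "plus_graph k \<subseteq> ?T interior_of ?H" by blast
  have int: "?T interior_of ?H \<subseteq> plus_points k"
  proof
    fix s assume s: "s \<in> ?T interior_of ?H"
    obtain I where I: "openin ?X I" "?T interior_of ?H = I \<inter> ?Z"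
      using openin_interior_of[of ?T ?H] unfolding Z_topology openin_subtopology by blast
    have sZ: "s \<in> ?X closure_of (Base ` duval_graph k)" using s I(2) Z_closure by blast
    show "s \<in> plus_points k"
      unfolding plus_points_def in_closure_of
    proof (intro conjI allI impI)
      show "s \<in> topspace ?X" using sZ by (simp add: in_closure_of)
      fix W assume W: "s \<in> W \<and> openin ?X W"
      then have "s \<in> W \<inter> I \<and> openin ?X (W \<inter> I)" using s I by auto
      moreover have "\<forall>U. s \<in> U \<and> openin ?X U \<longrightarrow> (\<exists>y. y \<in> Base ` duval_graph k \<and> y \<in> U)"
        using sZ unfolding in_closure_of by (rule conjunct2)
      ultimately obtain t where t: "t \<in> Base ` duval_graph k" "t \<in> W \<inter> I" by meson
      then have "t \<in> ?T interior_of ?H" unfolding I(2) using duval_graph_subset_Z[of k] by blast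
      then have "t \<in> ?H" by (rule subsetD[OF interior_of_subset])
      then obtain v where v: "t = Base v" "v \<in> duval_graph k" "0 \<le> v$3" using t(1) by (auto simp: duval_plus_def)
      then have "v$3 \<noteq> 0" by (auto simp: duval_graph_def duval_def)
      then have "t \<in> plus_graph k" using v by (simp add: plus_graph_def)
      then show "\<exists>y. y \<in> plus_graph k \<and> y \<in> W" using t by blast
    qed
  qed
  show ?thesis
  proof
    have "?T closure_of (?T interior_of ?H) \<subseteq> ?X closure_of (?T interior_of ?H)"
      unfolding Z_topology by (rule closure_of_subtopology_subset)
    also have "\<dots> \<subseteq> plus_points k"
      by (rule closure_of_minimal[OF int]) (simp add: plus_points_def)
    finally show "?T closure_of (?T interior_of ?H) \<subseteq> plus_points k" .
    have "plus_points k \<subseteq> ?T closure_of plus_graph k"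
    proof -
      have "?Z \<inter> plus_graph k = plus_graph k" using plus_graph_subset duval_graph_subset_Z by blast
      then have "?T closure_of plus_graph k = ?Z \<inter> plus_points k"
        unfolding Z_topology closure_of_subtopology plus_points_def by simp
      then show ?thesis using plus_points_subset by blast
    qed
    also have "\<dots> \<subseteq> ?T closure_of (?T interior_of ?H)" by (rule closure_of_mono[OF sub])
    finally show "plus_points k \<subseteq> ?T closure_of (?T interior_of ?H)" .
  qed
qed

lemma Z_plus_eq: "Z_plus k = smooth_subspace (Z_ambient k) (plus_points k)"
  unfolding Z_plus_def plus_points_eq unfolding Z_space_def
  by (rule subspace_subspace[OF nice_Z Z.SM plus_points_subset])

lemma Z_plus_bracket_eq: "Z_plus_bracket k = P.bracket k"
  unfolding Z_plus_bracket_def Z_plus_eq Z_bracket_eq Z_space_def by (rule P.pullback_restriction)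

lemma plus_height: "s \<in> plus_points k \<Longrightarrow> 0 \<le> blowdown s $ 3"
proof -
  assume s: "s \<in> plus_points k"
  let ?h = "compose (points (smooth_subspace (Z_ambient k) (plus_points k))) (\<lambda>v. v $ 3) blowdown"
  let ?T = "space_topology (smooth_subspace (Z_ambient k) (plus_points k))"
  have c: "continuous_map ?T euclideanreal ?h"
    by (rule smooth_fun_continuous[OF P.niceXS P.smooth_blowdown]) (rule smooth_on_nth)
  have "closedin ?T {t \<in> topspace ?T. ?h t \<in> {0..}}" by (rule closedin_continuous_map_preimage[OF c]) simp
  moreover have "plus_graph k \<subseteq> {t \<in> topspace ?T. ?h t \<in> {0..}}"
    using plus_graph_points[of k] by (auto simp: nice_topspace[OF P.niceXS] compose_def plus_graph_def)
  ultimately have "?T closure_of plus_graph k \<subseteq> {t \<in> topspace ?T. ?h t \<in> {0..}}" by (rule closure_of_minimal[rotated])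
  moreover have "s \<in> ?T closure_of plus_graph k" using P.dense_sub[of k] s by auto
  ultimately show ?thesis using s by (auto simp: compose_def)
qed

lemma ambient_Base:
  assumes "s \<in> points (Z_ambient k)" "blowdown s $ 3 \<noteq> 0"
  shows "s = Base (blowdown s)"
proof -
  have "(\<exists>v. s = Base v) \<or> blowdown s $ 2 = 0 \<and> blowdown s $ 3 = 0"
    using assms(1) resolved_inv[of k] unfolding resolution_inv_def case_prod_conv by blast
  then show ?thesis using assms(2) by auto
qed

section \<open>Boundary charts\<close>

text \<open>In such a chart \<open>\<rho>\<close> parametrizes the surface \<open>F = 0\<close> with inverse \<open>\<pi>\<close>, the first
  parameter being nonnegative on the half of the resolution; \<open>\<mu>\<close> computes the coordinates in the
  last \<open>z\<close>-chart.\<close>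

definition plus_chart :: "nat \<Rightarrow> (real^3 \<Rightarrow> bpoint) \<Rightarrow> (real^3) set \<Rightarrow> (real^3 \<Rightarrow> real) \<Rightarrow> (real^3 \<Rightarrow> real^2) \<Rightarrow>
    (real^2) set \<Rightarrow> (real^2 \<Rightarrow> real^3) \<Rightarrow> (real^3 \<Rightarrow> real^3) \<Rightarrow> bool" where
  "plus_chart k g N F \<pi> Q \<rho> \<mu> \<longleftrightarrow> (\<exists>V. (V, g) \<in> Z_atlas k \<and> N \<subseteq> V \<and> crepant k V g F) \<and>
     open N \<and> smooth_vec N \<pi> \<and> open Q \<and> smooth_vec Q \<rho> \<and> smooth_vec UNIV \<mu> \<and>
     (\<forall>w\<in>N. F w = 0 \<longrightarrow> \<pi> w \<in> Q \<and> \<rho> (\<pi> w) = w \<and> (\<exists>i. partial F i w \<noteq> 0) \<and> (0 < \<mu> w $ 3 \<longrightarrow> 0 \<le> \<pi> w $ 1)) \<and>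
     (\<forall>a\<in>Q. \<rho> a \<in> N \<and> F (\<rho> a) = 0 \<and> \<pi> (\<rho> a) = a \<and> duval_eqn 0 (\<mu> (\<rho> a)) = 0 \<and>
        (0 \<le> a $ 1 \<longrightarrow> 0 \<le> \<mu> (\<rho> a) $ 3) \<and> (0 < a $ 1 \<and> a $ 2 \<noteq> 0 \<longrightarrow> 0 < \<mu> (\<rho> a) $ 3 \<and> \<mu> (\<rho> a) $ 2 \<noteq> 0)) \<and>
     (\<forall>w. blowdown (g w) = blowdown (main_chart k (\<mu> w)))"

text \<open>Solves \<open>z * (1 - x^2) = y^2\<close> for \<open>z\<close>. The shift of
  \<open>x\<close> by \<open>1\<close> places the chart in the open half-plane:
  \<open>z \<ge> 0\<close> holds on all of it, so the curve \<open>z = 0\<close> is no boundary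
  here.\<close>

definition cap_map :: "real^2 \<Rightarrow> real^3" where
  "cap_map a = vector [a$1 - 1, a$2, (a$2)^2 / (1 - (a$1 - 1)^2)]"

lemma abs_less_one_square: "\<bar>x::real\<bar> < 1 \<Longrightarrow> x^2 < 1"
  by (simp add: abs_square_less_1)

lemma plus_chart_cap:
  "plus_chart k (main_chart k) {w. \<bar>w$1\<bar> < 1} (duval_eqn 0) (\<lambda>w. vector [w$1 + 1, w$2])
     {a. \<bar>a$1 - 1\<bar> < 1} cap_map (\<lambda>w. w)"
  unfolding plus_chart_def
proof (intro conjI ballI impI allI)
  obtain V where V: "(V, main_chart k) \<in> Z_atlas k" "- {axis 1 1, axis 1 (- 1)} \<subseteq> V" "crepant k V (main_chart k) (duval_eqn 0)"
    using resolved_charts(2) by blast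
  have "{w::real^3. \<bar>w$1\<bar> < 1} \<subseteq> - {axis 1 1, axis 1 (- 1)}" by (auto simp: axis_def)
  then show "\<exists>V. (V, main_chart k) \<in> Z_atlas k \<and> {w. \<bar>w$1\<bar> < 1} \<subseteq> V \<and> crepant k V (main_chart k) (duval_eqn 0)"
    using V by blast
  show o: "open {w::real^3. \<bar>w$1\<bar> < 1}" "open {a::real^2. \<bar>a$1 - 1\<bar> < 1}"
    by (intro open_Collect_less continuous_intros)+
  show "smooth_vec {w::real^3. \<bar>w$1\<bar> < 1} (\<lambda>w. vector [w$1 + 1, w$2] :: real^2)"
    by (intro smooth_vec_vector2 smooth_intros o)
  have nz: "1 - (a$1 - 1)^2 > 0" if "a \<in> {a::real^2. \<bar>a$1 - 1\<bar> < 1}" for a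
    using abs_less_one_square[of "a$1 - 1"] that by simp
  show "smooth_vec {a::real^2. \<bar>a$1 - 1\<bar> < 1} cap_map"
    unfolding cap_map_def[abs_def] by (intro smooth_vec_vector3 smooth_intros o) (use nz in force)
  show "smooth_vec UNIV (\<lambda>w::real^3. w)" by (rule smooth_vec_ident)
  fix w :: "real^3" assume w: "w \<in> {w. \<bar>w$1\<bar> < 1}" "duval_eqn 0 w = 0"
  have sq: "1 - (w$1)^2 > 0" using abs_less_one_square w(1) by simp
  show "vector [w$1 + 1, w$2] \<in> {a::real^2. \<bar>a$1 - 1\<bar> < 1}" "0 \<le> (vector [w$1 + 1, w$2] :: real^2) $ 1" using w by auto
  have "w$3 * (1 - (w$1)^2) = (w$2)^2" using w(2) by (simp add: duval_eqn_def algebra_simps)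
  then have "w$3 = (w$2)^2 / (1 - (w$1)^2)" using sq by (simp add: field_simps)
  then show "cap_map (vector [w$1 + 1, w$2]) = w" by (simp add: cap_map_def vec_eq_iff forall_3)
  show "\<exists>i. partial (duval_eqn 0) i w \<noteq> 0" using sq by (intro exI[of _ 3]) (simp add: partial_duval_eqn)
next
  fix a :: "real^2" assume a: "a \<in> {a. \<bar>a$1 - 1\<bar> < 1}"
  have sq: "1 - (a$1 - 1)^2 > 0" using abs_less_one_square a by simp
  show "cap_map a \<in> {w. \<bar>w$1\<bar> < 1}" using a by (simp add: cap_map_def)
  show "duval_eqn 0 (cap_map a) = 0" "duval_eqn 0 (cap_map a) = 0"
    using sq by (simp_all add: duval_eqn_def cap_map_def field_simps)
  show "vector [cap_map a $ 1 + 1, cap_map a $ 2] = a" by (simp add: cap_map_def vec_eq_iff forall_2)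
  show "0 \<le> cap_map a $ 3" using sq by (simp add: cap_map_def)
  assume "0 < a$1 \<and> a$2 \<noteq> 0"
  then show "0 < cap_map a $ 3" "cap_map a $ 2 \<noteq> 0" using sq by (simp_all add: cap_map_def)
qed simp

text \<open>Solves the strict transform in the \<open>x\<close>-chart at \<open>(e, 0, 0)\<close>
  for its third coordinate. The first parameter is oriented so that \<open>z\<close> is
  \<open>a$1\<close> times the nonnegative function \<open>(a$2)^2 / (2 - a$1)\<close>.\<close>

definition u_map :: "real \<Rightarrow> real^2 \<Rightarrow> real^3" where
  "u_map e a = vector [- e * a$1, a$2, - e * (a$2)^2 / (2 - a$1)]"

lemma has_derivative_nth: "((\<lambda>v::real^'n. v $ i) has_derivative (\<lambda>d. d $ i)) (at v)"
  by (rule bounded_linear_imp_has_derivative) (rule bounded_linear_vec_nth)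

lemma partial_u_eqn: "partial (\<lambda>w::real^3. w$3 * (2 * e + w$1) + (w$2)^2) 3 w = 2 * e + w$1"
proof -
  have "((\<lambda>w::real^3. w$3 * (2 * e + w$1) + (w$2)^2) has_derivative
     (\<lambda>d. (w$3 * (0 + d$1) + d$3 * (2 * e + w$1)) + of_nat 2 * d$2 * (w$2)^(2-1))) (at w)"
    by (intro has_derivative_add has_derivative_mult has_derivative_power has_derivative_nth has_derivative_const)
  from frechet_derivative_at[OF this, symmetric] show ?thesis by (simp add: axis_def)
qed

lemma partial_z_eqn: "partial (\<lambda>w::real^3. w$1 * (2 * e + w$1 * w$3) + (w$2)^2) 1 w = 2 * e + 2 * w$1 * w$3"
proof -
  have "((\<lambda>w::real^3. w$1 * (2 * e + w$1 * w$3) + (w$2)^2) has_derivative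
     (\<lambda>d. (w$1 * (0 + (w$1 * d$3 + d$1 * w$3)) + d$1 * (2 * e + w$1 * w$3)) + of_nat 2 * d$2 * (w$2)^(2-1))) (at w)"
    by (intro has_derivative_add has_derivative_mult has_derivative_power has_derivative_nth has_derivative_const)
  from frechet_derivative_at[OF this, symmetric] show ?thesis by (simp add: axis_def)
qed

lemma plus_chart_u:
  assumes e: "e = 1 \<or> e = - 1"
  shows "plus_chart k (blow_param (main_chart k) (axis 1 e) 1) {w. \<bar>w$1\<bar> < 1}
     (\<lambda>w. w$3 * (2 * e + w$1) + (w$2)^2) (\<lambda>w. vector [- e * w$1, w$2])
     {a. \<bar>a$1\<bar> < 1} (u_map e) (blow_map (axis 1 e) 1)"
  unfolding plus_chart_def
proof (intro conjI ballI impI allI)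
  have e2: "e^2 = 1" "\<bar>e\<bar> = 1" using e by auto
  obtain V where V: "(V, blow_param (main_chart k) (axis 1 e) 1) \<in> Z_atlas k"
    "{w. blow_map (axis 1 e) 1 w \<noteq> axis 1 (- e)} \<subseteq> V"
    "crepant k V (blow_param (main_chart k) (axis 1 e) 1) (\<lambda>w. w$3 * (2 * e + w$1) + (w$2)^2)"
    using resolved_charts(3)[OF e2(1)] by blast
  have "blow_map (axis 1 e) 1 w $ 1 \<noteq> axis 1 (- e) $ 1" if "\<bar>w$1\<bar> < 1" for w
    using that e by (auto simp: blow_map_nth axis_def)
  then have "{w. \<bar>w$1\<bar> < 1} \<subseteq> {w. blow_map (axis 1 e) 1 w \<noteq> axis 1 (- e)}" by fastforce
  then show "\<exists>V. (V, blow_param (main_chart k) (axis 1 e) 1) \<in> Z_atlas k \<and> {w. \<bar>w$1\<bar> < 1} \<subseteq> V \<and>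
      crepant k V (blow_param (main_chart k) (axis 1 e) 1) (\<lambda>w. w$3 * (2 * e + w$1) + (w$2)^2)"
    using V by blast
  show o: "open {w::real^3. \<bar>w$1\<bar> < 1}" "open {a::real^2. \<bar>a$1\<bar> < 1}"
    by (intro open_Collect_less continuous_intros)+
  show "smooth_vec {w::real^3. \<bar>w$1\<bar> < 1} (\<lambda>w. vector [- e * w$1, w$2] :: real^2)"
    by (intro smooth_vec_vector2 smooth_intros o)
  show "smooth_vec {a::real^2. \<bar>a$1\<bar> < 1} (u_map e)"
    unfolding u_map_def[abs_def] by (intro smooth_vec_vector3 smooth_intros o) auto
  show "smooth_vec UNIV (blow_map (axis 1 e) 1)" by (rule smooth_blow_map) simp
  fix w :: "real^3" assume w: "w \<in> {w. \<bar>w$1\<bar> < 1}" "w$3 * (2 * e + w$1) + (w$2)^2 = 0"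
  show "vector [- e * w$1, w$2] \<in> {a::real^2. \<bar>a$1\<bar> < 1}" using w e by auto
  have nz: "2 * e + w$1 \<noteq> 0" "2 + e * w$1 \<noteq> 0" using w(1) e by auto
  have "w$3 * (2 + e * w$1) = - e * (w$2)^2" using w(2) e by (auto simp: algebra_simps)
  then have w3: "w$3 = - e * (w$2)^2 / (2 + e * w$1)" using nz by (simp add: field_simps)
  then show "u_map e (vector [- e * w$1, w$2]) = w" using e by (auto simp: u_map_def vec_eq_iff forall_3)
  show "\<exists>i. partial (\<lambda>w. w$3 * (2 * e + w$1) + (w$2)^2) i w \<noteq> 0"
    using nz by (intro exI[of _ 3]) (simp only: partial_u_eqn not_False_eq_True)
  \<comment> \<open>On the surface \<open>z\<close> is \<open>- e * w$1\<close> times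
    \<open>(w$2)^2 / (2 + e * w$1)\<close>, so a positive \<open>z\<close> determines the sign of
    the first parameter.\<close>
  assume "0 < blow_map (axis 1 e) 1 w $ 3"
  then have "0 < w$1 * w$3" by (simp add: blow_map_nth axis_def)
  moreover have p: "0 < 2 + e * w$1" using w(1) e by auto
  ultimately have "0 < w$1 * w$3 * (2 + e * w$1)" by (rule mult_pos_pos)
  also have "\<dots> = - (e * w$1) * (w$2)^2" using p by (simp add: w3 field_simps)
  finally have pr: "0 < - (e * w$1) * (w$2)^2" .
  then have "0 < (w$2)^2" by auto
  with pr have "0 < - (e * w$1)" by (rule zero_less_mult_pos2)
  then show "0 \<le> (vector [- e * w$1, w$2] :: real^2) $ 1" by simp
next
  fix a :: "real^2" assume a: "a \<in> {a. \<bar>a$1\<bar> < 1}"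
  have p: "0 < 2 - a$1" using a by auto
  let ?w = "u_map e a" and ?m = "blow_map (axis 1 e) 1 (u_map e a)"
  show "?w \<in> {w. \<bar>w$1\<bar> < 1}" using a e by (auto simp: u_map_def)
  show "?w$3 * (2 * e + ?w$1) + (?w$2)^2 = 0" using e p by (auto simp: u_map_def field_simps)
  show "vector [- e * ?w$1, ?w$2] = a" using e by (auto simp: u_map_def vec_eq_iff forall_2)
  have m: "?m $ 1 = e * (1 - a$1)" "?m $ 2 = - e * a$1 * a$2" "?m $ 3 = a$1 * (a$2)^2 / (2 - a$1)"
    using e by (auto simp: blow_map_nth axis_def u_map_def algebra_simps)
  show "duval_eqn 0 ?m = 0" unfolding duval_eqn_def m using e p by (auto simp: field_simps power2_eq_square)
  show "0 \<le> ?m $ 3" if "0 \<le> a$1" unfolding m using that p by simp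
  assume "0 < a$1 \<and> a$2 \<noteq> 0"
  then show "0 < ?m $ 3" "?m $ 2 \<noteq> 0" unfolding m using p e by auto
qed (simp add: blowdown_blow_param)

text \<open>The root of the quadratic equation for the first coordinate that stays finite as
  \<open>z\<close> tends to \<open>0\<close>, in the rationalized form, which is smooth
  there.\<close>

definition z_map :: "real \<Rightarrow> real^2 \<Rightarrow> real^3" where
  "z_map e a = vector [- e * (a$2)^2 / (1 + sqrt (1 - a$1 * (a$2)^2)), a$2, a$1]"

lemma z_map_main:
  assumes "a$1 * (a$2)^2 < 1" and e: "e = 1 \<or> e = - 1"
  shows "a$1 * z_map e a $ 1 = e * (sqrt (1 - a$1 * (a$2)^2) - 1)"
proof -
  define s where "s = sqrt (1 - a$1 * (a$2)^2)"
  have s: "s^2 = 1 - a$1 * (a$2)^2" "0 < s" using assms(1) by (simp_all add: s_def)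
  have "a$1 * z_map e a $ 1 * (1 + s) = - e * (a$1 * (a$2)^2)"
    using s(2) by (simp add: z_map_def s_def[symmetric] field_simps)
  also have "\<dots> = e * (s^2 - 1)" unfolding s(1) by simp
  also have "\<dots> = e * (s - 1) * (1 + s)" by (simp add: algebra_simps power2_eq_square)
  finally show ?thesis using s(2) by (simp add: s_def[symmetric])
qed

text \<open>The strict transform is quadratic in the first coordinate;
  \<open>0 < e * w$1 * w$3 + 1\<close> selects one of its roots, and
  \<open>w$3 * (w$2)^2 < 1\<close> keeps the radicand positive.\<close>

lemma plus_chart_z:
  assumes e: "e = 1 \<or> e = - 1"
  shows "plus_chart k (blow_param (main_chart k) (axis 1 e) 3) {w. w$3 * (w$2)^2 < 1 \<and> 0 < e * w$1 * w$3 + 1}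
     (\<lambda>w. w$1 * (2 * e + w$1 * w$3) + (w$2)^2) (\<lambda>w. vector [w$3, w$2])
     {a. a$1 * (a$2)^2 < 1} (z_map e) (blow_map (axis 1 e) 3)"
    (is "plus_chart k ?g ?N ?F ?\<pi> ?Q _ _")
  unfolding plus_chart_def
proof (intro conjI ballI impI allI)
  have e2: "e^2 = 1" "e * e = 1" using e by auto
  obtain V where V: "(V, ?g) \<in> Z_atlas k" "{w. blow_map (axis 1 e) 3 w \<noteq> axis 1 (- e)} \<subseteq> V" "crepant k V ?g ?F"
    using resolved_charts(4)[OF e2(1)] by blast
  have "blow_map (axis 1 e) 3 w \<noteq> axis 1 (- e)" for w
  proof
    assume h: "blow_map (axis 1 e) 3 w = axis 1 (- e)"
    then have "w$3 = 0" using arg_cong[OF h, of "\<lambda>v. v $ 3"] unfolding blow_map_nth by (simp add: axis_def)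
    then show False using arg_cong[OF h, of "\<lambda>v. v $ 1"] e unfolding blow_map_nth by (auto simp: axis_def)
  qed
  then show "\<exists>V. (V, ?g) \<in> Z_atlas k \<and> ?N \<subseteq> V \<and> crepant k V ?g ?F" using V by blast
  show o: "open ?N" "open ?Q" by (intro open_Collect_conj open_Collect_less continuous_intros)+
  show "smooth_vec ?N ?\<pi>" by (intro smooth_vec_vector2 smooth_intros o)
  have sp: "0 < 1 + sqrt (1 - a$1 * (a$2)^2)" if "a \<in> ?Q" for a
    using that by (intro add_pos_nonneg) auto
  show "smooth_vec ?Q (z_map e)"
    unfolding z_map_def[abs_def] by (intro smooth_vec_vector3 smooth_intros o) (use sp in force)+
  show "smooth_vec UNIV (blow_map (axis 1 e) 3)" by (rule smooth_blow_map) simp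
  fix w :: "real^3" assume w: "w \<in> ?N" "?F w = 0"
  show "?\<pi> w \<in> ?Q" using w by simp
  define s where "s = sqrt (1 - w$3 * (w$2)^2)"
  have s: "s^2 = 1 - w$3 * (w$2)^2" "0 < s" using w(1) by (simp_all add: s_def)
  \<comment> \<open>Completing the square: on the surface \<open>e * w$1 * w$3 + 1\<close> is the
    square root \<open>s\<close>.\<close>
  have "(e * w$1 * w$3 + 1)^2 = 1 + w$3 * (w$1 * (2 * e + w$1 * w$3))"
    using e by (auto simp: power2_eq_square algebra_simps)
  also have "w$1 * (2 * e + w$1 * w$3) = - ((w$2)^2)" using w(2) by simp
  also have "1 + w$3 * (- (w$2)\<^sup>2) = s\<^sup>2" using s(1) by simp
  finally have "e * w$1 * w$3 + 1 = s" using w(1) s(2) by (simp add: power2_eq_iff_nonneg)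
  then have "1 + s = 2 + e * w$1 * w$3" by simp
  then have "w$1 * (e * (1 + s)) = w$1 * (2 * e + (e * e) * w$1 * w$3)" by (simp add: algebra_simps)
  also have "\<dots> = - ((w$2)^2)" using w(2) e2(2) by simp
  finally have "w$1 * (1 + s) * e = - ((w$2)^2)" by (simp add: algebra_simps)
  then have "w$1 * (1 + s) = - e * (w$2)^2" using e by (auto simp: algebra_simps)
  then have "w$1 = - e * (w$2)^2 / (1 + s)" using s(2) by (simp add: field_simps)
  then show "z_map e (?\<pi> w) = w" by (simp add: z_map_def vec_eq_iff forall_3 s_def)
  have "2 * e + 2 * w$1 * w$3 = 2 * e * (e * w$1 * w$3 + 1)" using e by auto
  then have "2 * e + 2 * w$1 * w$3 \<noteq> 0" using w(1) e by auto
  then show "\<exists>i. partial ?F i w \<noteq> 0" by (intro exI[of _ 1]) (simp only: partial_z_eqn not_False_eq_True)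
  assume "0 < blow_map (axis 1 e) 3 w $ 3"
  then show "0 \<le> ?\<pi> w $ 1" by (simp add: blow_map_nth axis_def)
next
  have e2: "e^2 = 1" "e * e = 1" using e by auto
  fix a :: "real^2" assume a: "a \<in> ?Q"
  let ?w = "z_map e a" and ?m = "blow_map (axis 1 e) 3 (z_map e a)"
  define s where "s = sqrt (1 - a$1 * (a$2)^2)"
  have s: "s^2 = 1 - a$1 * (a$2)^2" "0 < s" using a by (simp_all add: s_def)
  have zm: "a$1 * ?w$1 = e * (s - 1)" unfolding s_def by (rule z_map_main) (use a e in auto)
  have w: "?w$2 = a$2" "?w$3 = a$1" "?w$1 * (1 + s) = - e * (a$2)^2"
    using s(2) by (simp_all add: z_map_def s_def[symmetric])
  have es: "e * ?w$1 * ?w$3 + 1 = s"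
  proof -
    have "e * ?w$1 * ?w$3 + 1 = e * (a$1 * ?w$1) + 1" by (simp add: w)
    also have "\<dots> = (e * e) * (s - 1) + 1" unfolding zm by (simp add: algebra_simps)
    finally show ?thesis using e2 by simp
  qed
  show "?w \<in> ?N" using es s(2) a w by simp
  have "?w$1 * (2 * e + ?w$1 * ?w$3) = ?w$1 * (2 * e + e * (s - 1))" using zm w(2) by (simp add: mult.commute)
  also have "\<dots> = e * (?w$1 * (1 + s))" by (simp add: algebra_simps)
  also have "\<dots> = - ((a$2)^2)" unfolding w(3) using e by auto
  finally show "?F ?w = 0" using w(1) by simp
  show "?\<pi> ?w = a" using w by (simp add: vec_eq_iff forall_2)
  have m: "?m $ 1 = e * s" "?m $ 2 = a$1 * a$2" "?m $ 3 = a$1"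
    using zm w by (simp_all add: blow_map_nth axis_def algebra_simps)
  have es2: "(e * s)^2 = 1 - a$1 * (a$2)^2" using e2 s(1) by (simp add: power_mult_distrib)
  show "duval_eqn 0 ?m = 0" unfolding duval_eqn_def m es2 by (simp add: algebra_simps power2_eq_square)
  show "0 \<le> ?m $ 3" if "0 \<le> a$1" unfolding m using that .
  assume "0 < a$1 \<and> a$2 \<noteq> 0"
  then show "0 < ?m $ 3" "?m $ 2 \<noteq> 0" unfolding m by auto
qed (simp add: blowdown_blow_param)

section \<open>Position of the half inside the boundary charts\<close>

lemma duval_main:
  assumes "v \<in> duval k" "v$3 \<noteq> 0"
  obtains w where "duval_eqn 0 w = 0" "w$3 = v$3" "main_chart k w = Base v" "v = vector [(w$3)^k * w$1, (w$3)^k * w$2, w$3]"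
proof
  let ?w = "vector [v$1 / (v$3)^k, v$2 / (v$3)^k, v$3] :: real^3"
  have "v$3 * (v$1)^2 + (v$2)^2 = v$3 * ((v$3)^k)^2"
    using assms(1) by (simp add: duval_def power_mult power_mult_distrib power2_eq_square mult_2 power_add)
  then show "duval_eqn 0 ?w = 0" using assms(2) by (simp add: duval_eqn_def field_simps)
  show v: "v = vector [(?w$3)^k * ?w$1, (?w$3)^k * ?w$2, ?w$3]" using assms(2) by (simp add: vec_eq_iff forall_3)
  show "main_chart k ?w = Base v" using main_chart_Base[of ?w k] v assms(2) by simp
  show "?w $ 3 = v$3" by simp
qed

lemma main_duval:
  assumes "duval_eqn 0 w = 0"
  shows "blowdown (main_chart k w) \<in> duval k"
proof -
  have "w$3 * (w$1)^2 + (w$2)^2 = w$3" using assms by (simp add: duval_eqn_def)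
  then have "((w$3)^k)^2 * (w$3 * (w$1)^2 + (w$2)^2) = ((w$3)^k)^2 * w$3" by simp
  moreover have p: "(w$3)^(2*k+1) = ((w$3)^k)^2 * w$3" by (simp add: power_even_eq)
  ultimately show ?thesis
    unfolding main_chart_blowdown duval_def mem_Collect_eq vector_3 p
    by (simp add: power_mult_distrib algebra_simps)
qed

lemma plus_chartD:
  assumes "plus_chart k g N F \<pi> Q \<rho> \<mu>"
  obtains V where "(V, g) \<in> Z_atlas k" "N \<subseteq> V" "crepant k V g F" "is_chart (Z_ambient k) V g"
    "open N" "smooth_vec N \<pi>" "open Q" "smooth_vec Q \<rho>"
  using assms atlas_chart[OF good_Z] unfolding plus_chart_def by blast

lemma plus_chart_fwd:
  assumes "plus_chart k g N F \<pi> Q \<rho> \<mu>" "w \<in> N" "F w = 0"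
  shows "\<pi> w \<in> Q" "\<rho> (\<pi> w) = w" "\<exists>i. partial F i w \<noteq> 0" "0 < \<mu> w $ 3 \<Longrightarrow> 0 \<le> \<pi> w $ 1"
  using assms unfolding plus_chart_def by blast+

lemma plus_chart_bwd:
  assumes "plus_chart k g N F \<pi> Q \<rho> \<mu>" "a \<in> Q"
  shows "\<rho> a \<in> N" "F (\<rho> a) = 0" "\<pi> (\<rho> a) = a" "duval_eqn 0 (\<mu> (\<rho> a)) = 0"
    "0 \<le> a $ 1 \<Longrightarrow> 0 \<le> \<mu> (\<rho> a) $ 3" "0 < a $ 1 \<Longrightarrow> a $ 2 \<noteq> 0 \<Longrightarrow> 0 < \<mu> (\<rho> a) $ 3 \<and> \<mu> (\<rho> a) $ 2 \<noteq> 0"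
  using assms unfolding plus_chart_def by blast+

lemma plus_chart_blowdown:
  assumes "plus_chart k g N F \<pi> Q \<rho> \<mu>"
  shows "blowdown (g w) = vector [(\<mu> w $ 3)^k * \<mu> w $ 1, (\<mu> w $ 3)^k * \<mu> w $ 2, \<mu> w $ 3]"
proof -
  have "blowdown (g w) = blowdown (main_chart k (\<mu> w))" using assms unfolding plus_chart_def by blast
  then show ?thesis by (simp only: main_chart_blowdown)
qed

lemma plus_chart_graph:
  assumes pc: "plus_chart k g N F \<pi> Q \<rho> \<mu>" and a: "a \<in> Q" "0 < a$1" "a$2 \<noteq> 0"
  shows "g (\<rho> a) \<in> plus_graph k"
proof -
  obtain V where V: "(V, g) \<in> Z_atlas k" "N \<subseteq> V" using pc by (rule plus_chartD)
  note b = plus_chart_bwd[OF pc a(1)]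
  have m: "0 < \<mu> (\<rho> a) $ 3" "\<mu> (\<rho> a) $ 2 \<noteq> 0" using b(6)[OF a(2,3)] by auto
  have p: "g (\<rho> a) \<in> points (Z_ambient k)" using atlas_points[OF V(1)] b(1) V(2) by blast
  have bd: "blowdown (g (\<rho> a)) = blowdown (main_chart k (\<mu> (\<rho> a)))"
    unfolding plus_chart_blowdown[OF pc] main_chart_blowdown ..
  have "blowdown (g (\<rho> a)) \<in> duval_graph k"
    using main_duval[OF b(4)] m unfolding bd duval_graph_def by (simp add: main_chart_blowdown)
  moreover have "0 < blowdown (g (\<rho> a)) $ 3" unfolding plus_chart_blowdown[OF pc] using m by simp
  ultimately show ?thesis using ambient_Base[OF p] unfolding plus_graph_def by (metis (mono_tags, lifting) image_eqI less_irrefl mem_Collect_eq)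
qed

text \<open>One direction is closedness: a point with negative first parameter has a neighbourhood
  free of \<open>plus_graph\<close>. For the other, each parameter with \<open>0 \<le> a$1\<close>
  is a limit of parameters with \<open>0 < a$1\<close> and \<open>a$2 \<noteq> 0\<close>, which
  belong to \<open>plus_graph\<close>.\<close>

lemma plus_chart_iff:
  assumes pc: "plus_chart k g N F \<pi> Q \<rho> \<mu>" and w: "w \<in> N"
  shows "g w \<in> plus_points k \<longleftrightarrow> F w = 0 \<and> 0 \<le> \<pi> w $ 1"
proof
  obtain V where V: "(V, g) \<in> Z_atlas k" "N \<subseteq> V" "crepant k V g F" "is_chart (Z_ambient k) V g"
    "open N" "smooth_vec N \<pi>" "open Q" "smooth_vec Q \<rho>" using pc by (rule plus_chartD)
  have wV: "w \<in> V" using w V(2) by blast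
  {
    assume s: "g w \<in> plus_points k"
    have F0: "F w = 0" by (rule P.crepant_vanish[OF V(1,3) wV s])
    moreover have "0 \<le> \<pi> w $ 1"
    proof (rule ccontr)
      assume neg: "\<not> 0 \<le> \<pi> w $ 1"
      let ?N = "N \<inter> (\<lambda>w. \<pi> w $ 1) -` {..<0}"
      have o: "open ?N"
        by (rule continuous_open_preimage[OF smooth_on_continuous[OF smooth_vec_nth[OF V(6)]] V(5)]) simp
      have "openin (space_topology (Z_ambient k)) (g ` ?N)" using V(2) by (intro chart_image[OF V(4) o]) auto
      moreover have "g w \<in> g ` ?N" using w neg by auto
      ultimately obtain t where t: "t \<in> plus_graph k" "t \<in> g ` ?N"
        using s unfolding plus_points_def in_closure_of by meson
      then obtain v where v: "v \<in> N" "\<pi> v $ 1 < 0" "t = g v" by auto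
      have "F v = 0" by (rule P.crepant_vanish[OF V(1,3)]) (use v t V(2) plus_graph_points in auto)
      moreover have "0 < blowdown (g v) $ 3" using t(1) v(3) by (auto simp: plus_graph_def)
      then have "0 < \<mu> v $ 3" unfolding plus_chart_blowdown[OF pc] by simp
      ultimately show False using plus_chart_fwd(4)[OF pc v(1)] v(2) by fastforce
    qed
    ultimately show "F w = 0 \<and> 0 \<le> \<pi> w $ 1" ..
  }
  assume h: "F w = 0 \<and> 0 \<le> \<pi> w $ 1"
  let ?a = "\<pi> w"
  have a: "?a \<in> Q" "\<rho> ?a = w" using plus_chart_fwd[OF pc w] h by auto
  show "g w \<in> plus_points k"
    unfolding plus_points_def in_closure_of
  proof (intro conjI allI impI)
    show "g w \<in> topspace (space_topology (Z_ambient k))"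
      using atlas_points[OF V(1) wV] nice_topspace[OF nice_Z] by simp
    fix U assume U: "g w \<in> U \<and> openin (space_topology (Z_ambient k)) U"
    have "open {v\<in>V. g v \<in> U}" by (rule chart_preimage[OF V(4)]) (use U in simp)
    then have "open (Q \<inter> \<rho> -` {v\<in>V. g v \<in> U})"
      by (rule continuous_open_preimage[OF smooth_vec_continuous[OF V(8)] V(7)])
    moreover have "?a \<in> Q \<inter> \<rho> -` {v\<in>V. g v \<in> U}" using a U wV by simp
    ultimately obtain d where d: "0 < d" "ball ?a d \<subseteq> Q \<inter> \<rho> -` {v\<in>V. g v \<in> U}" by (meson open_contains_ball)
    \<comment> \<open>Each coordinate moves by at most \<open>d/4\<close>, which keeps the point in
      the ball and brings it into the part where \<open>y \<noteq> 0\<close> and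
      \<open>z > 0\<close>.\<close>
    define a' :: "real^2" where "a' = vector [?a$1 + d/4, if ?a$2 = 0 then d/4 else ?a$2]"
    have "norm (a' - ?a) \<le> (\<Sum>i\<in>UNIV. \<bar>(a' - ?a) $ i\<bar>)" by (rule norm_le_l1_cart)
    also have "\<dots> < d" using d(1) by (auto simp: sum_2 a'_def)
    finally have "a' \<in> ball ?a d" by (simp add: dist_norm norm_minus_commute)
    then have a': "a' \<in> Q" "g (\<rho> a') \<in> U" using d(2) by auto
    have "g (\<rho> a') \<in> plus_graph k"
      by (rule plus_chart_graph[OF pc a'(1)]) (use h d(1) in \<open>auto simp: a'_def\<close>)
    then show "\<exists>y. y \<in> plus_graph k \<and> y \<in> U" using a'(2) by blast
  qed
qed

text \<open>Compact sets are closed because the atlas is Hausdorff; this is what controls the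
  closure over \<open>z = 0\<close>.\<close>

lemma atlas_compact_image:
  assumes "(V, g) \<in> Z_atlas k" "compact L" "L \<subseteq> V"
  shows "closedin (space_topology (Z_ambient k)) (g ` L)"
proof -
  have V: "open V" by (rule good_atlasD(1)[OF good_Z assms(1)])
  have "continuous_map (top_of_set V) (space_topology (Z_ambient k)) g"
    unfolding continuous_map nice_topspace[OF nice_Z]
    using atlas_preimage[OF good_Z assms(1)] atlas_points[OF assms(1)] V by (auto simp: openin_open_eq)
  then have "compactin (space_topology (Z_ambient k)) (g ` L)"
    by (rule image_compactin[rotated]) (use assms(2,3) in \<open>simp add: compactin_subtopology\<close>)
  then show ?thesis by (rule compactin_imp_closedin[OF Hausdorff_atlas[OF good_Z]])
qed

lemma compact_box2: "compact {a::real^2. c1 \<le> a$1 \<and> a$1 \<le> d1 \<and> c2 \<le> a$2 \<and> a$2 \<le> d2}"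
proof -
  have "{a::real^2. c1 \<le> a$1 \<and> a$1 \<le> d1 \<and> c2 \<le> a$2 \<and> a$2 \<le> d2} = cbox (vector [c1, c2]) (vector [d1, d2])"
    by (auto simp: mem_box_cart forall_2)
  then show ?thesis by simp
qed

lemma plus_chart_compact:
  assumes pc: "plus_chart k g N F \<pi> Q \<rho> \<mu>" and L: "compact L" "L \<subseteq> Q"
  shows "closedin (space_topology (Z_ambient k)) (g ` \<rho> ` L)"
proof -
  obtain V where V: "(V, g) \<in> Z_atlas k" "N \<subseteq> V" "smooth_vec Q \<rho>" using pc by (rule plus_chartD)
  have "compact (\<rho> ` L)"
    by (rule compact_continuous_image[OF continuous_on_subset[OF smooth_vec_continuous[OF V(3)] L(2)] L(1)])
  moreover have "\<rho> ` L \<subseteq> V" using plus_chart_bwd(1)[OF pc] L(2) V(2) by blast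
  ultimately show ?thesis by (rule atlas_compact_image[OF V(1)])
qed

lemma plus_chart_member:
  assumes pc: "plus_chart k g N F \<pi> Q \<rho> \<mu>" and w: "w \<in> N" "F w = 0" "\<pi> w \<in> L"
  shows "g w \<in> g ` \<rho> ` L"
  using plus_chart_fwd(2)[OF pc w(1,2)] w(3) by force

text \<open>The part of the resolution over \<open>0 < z < 1\<close> lies in the images of compact subsets of the
  boundary charts, so its closure does not leave these charts.\<close>

lemma plus_cover:
  assumes s: "s \<in> plus_points k"
  obtains g N F \<pi> Q \<rho> \<mu> w where "plus_chart k g N F \<pi> Q \<rho> \<mu>" "w \<in> N" "s = g w"
proof (cases "0 < blowdown s $ 3")
  case True
  let ?v = "blowdown s"
  have d: "?v \<in> duval k" using Z_blowdown_duval plus_points_subset s by blast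
  have sB: "s = Base ?v" by (rule ambient_Base) (use s P.SM True in auto)
  obtain w where w: "duval_eqn 0 w = 0" "w$3 = ?v$3" "main_chart k w = Base ?v"
    using duval_main[OF d] True by force
  have eq: "w$3 * (1 - (w$1)^2) = (w$2)^2" using w(1) by (simp add: duval_eqn_def algebra_simps)
  then have "0 \<le> w$3 * (1 - (w$1)^2)" by simp
  then have le: "(w$1)^2 \<le> 1" using True w(2) by (simp add: zero_le_mult_iff)
  show ?thesis
  proof (cases "\<bar>w$1\<bar> < 1")
    case True
    then show ?thesis using that[OF plus_chart_cap, of w] w(3) sB by simp
  next
    case False
    then have one: "w$1 = 1 \<or> w$1 = - 1" using le by (simp add: abs_square_le_1) linarith
    then have e: "w$1 = 1 \<or> w$1 = - 1" "w$2 = 0" using eq by auto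
    \<comment> \<open>The point lies on one of the two lines \<open>x = 1\<close> and
      \<open>x = - 1\<close> with \<open>y = 0\<close>; these pass through the last centres and are
      seen in the \<open>z\<close>-charts.\<close>
    let ?w = "vector [0, 0, w$3] :: real^3"
    have "blow_map (axis 1 (w$1)) 3 ?w = w" using e(2) by (simp add: vec_eq_iff forall_3 blow_map_nth axis_def)
    then have "blow_param (main_chart k) (axis 1 (w$1)) 3 ?w = s" using w sB True by (simp add: blow_param_eq)
    then show ?thesis using that[OF plus_chart_z[OF e(1)], of ?w] by simp
  qed
next
  case False
  let ?T = "space_topology (Z_ambient k)"
  \<comment> \<open>The bounds come from the estimates below: \<open>\<bar>y\<bar> \<le> 1\<close>
    for \<open>\<bar>x\<bar> \<le> 1/2\<close> in the cap, quotients of absolute value at most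
    \<open>2\<close> near the centres, and \<open>t * (2 - t) \<le> 3/4\<close> for
    \<open>t \<le> 1/2\<close>. The boxes lie inside the parameter domains, so their images are
    closed.\<close>
  let ?L0 = "{a::real^2. 1/2 \<le> a$1 \<and> a$1 \<le> 3/2 \<and> -1 \<le> a$2 \<and> a$2 \<le> 1}"
  let ?Lu = "{a::real^2. 0 \<le> a$1 \<and> a$1 \<le> 1/2 \<and> -2 \<le> a$2 \<and> a$2 \<le> 2}"
  let ?Lz = "{a::real^2. 0 \<le> a$1 \<and> a$1 \<le> 1 \<and> -2 \<le> a$2 \<and> a$2 \<le> 2} \<inter> {a. a$1 * (a$2)^2 \<le> 3/4}"
  let ?gu = "\<lambda>e. blow_param (main_chart k) (axis 1 e) 1" and ?gz = "\<lambda>e. blow_param (main_chart k) (axis 1 e) 3"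
  let ?K = "main_chart k ` cap_map ` ?L0 \<union> ((?gu 1 ` u_map 1 ` ?Lu \<union> ?gu (-1) ` u_map (-1) ` ?Lu) \<union>
      (?gz 1 ` z_map 1 ` ?Lz \<union> ?gz (-1) ` z_map (-1) ` ?Lz))"
  have cz: "compact ?Lz"
    by (intro compact_Int_closed compact_box2 closed_Collect_le continuous_intros)
  have K: "closedin ?T ?K"
    using cz by (intro closedin_Un plus_chart_compact[OF plus_chart_cap] plus_chart_compact[OF plus_chart_u]
        plus_chart_compact[OF plus_chart_z] compact_box2) auto
  have inK: "t \<in> ?K" if t: "t \<in> plus_graph k" "blowdown t $ 3 < 1" for t
  proof -
    obtain v where v: "t = Base v" "v \<in> duval k" "0 < v$3" "v$3 < 1" using t by (auto simp: plus_graph_def duval_graph_def)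
    obtain w where w: "duval_eqn 0 w = 0" "w$3 = v$3" "main_chart k w = Base v"
      using duval_main[OF v(2)] v(3) by force
    define x y z where xyz: "x = w$1" "y = w$2" "z = w$3"
    have z: "0 < z" "z < 1" using v w(2) by (auto simp: xyz)
    have eq: "y^2 = z * (1 - x^2)" using w(1) by (simp add: duval_eqn_def algebra_simps xyz)
    then have "0 \<le> z * (1 - x^2)" by (metis zero_le_power2)
    then have x2: "x^2 \<le> 1" using z by (simp add: zero_le_mult_iff)
    then have x1: "\<bar>x\<bar> \<le> 1" by (simp add: abs_square_le_1)
    show ?thesis
    proof (cases "\<bar>x\<bar> \<le> 1/2")
      case True
      have "z * (1 - x^2) \<le> 1 * 1" using z x2 by (intro mult_mono) auto
      then have "y^2 \<le> 1" using eq by simp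
      then have "\<bar>y\<bar> \<le> 1" by (simp add: abs_square_le_1)
      then have "main_chart k w \<in> main_chart k ` cap_map ` ?L0"
        using True w(1) by (intro plus_chart_member[OF plus_chart_cap]) (auto simp: xyz)
      then show ?thesis using w(3) v(1) by simp
    next
      case False
      define e where "e = sgn x"
      \<comment> \<open>The distance in \<open>x\<close> from the nearer of the two last centres; in
        terms of it \<open>1 - x^2\<close> is \<open>t * (2 - t)\<close>.\<close>
      define t where "t = 1 - \<bar>x\<bar>"
      have e: "e = 1 \<or> e = - 1" "e * \<bar>x\<bar> = x" using False by (auto simp: e_def sgn_if)
      have tt: "0 \<le> t" "t \<le> 1/2" using False x1 by (auto simp: t_def)
      have xe: "x - e = - e * t" using e by (auto simp: t_def algebra_simps)
      have "1 - x^2 = (1 - \<bar>x\<bar>) * (1 + \<bar>x\<bar>)" by (simp add: algebra_simps power2_eq_square)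
      then have y2: "y^2 = z * (t * (2 - t))" using eq by (simp add: t_def)
      \<comment> \<open>Of the two displacements \<open>t\<close> and \<open>z\<close> from the
        centre the larger serves as divisor, so that all quotients remain bounded.\<close>
      show ?thesis
      proof (cases "z \<le> t")
        case True
        then have t0: "0 < t" using z by simp
        define u where "u = - e * t"
        have u: "u \<noteq> 0" "u^2 = t^2" using e(1) t0 by (auto simp: u_def)
        have eu: "e + u = w$1" using xe unfolding u_def xyz(1) by linarith
        let ?w = "vector [u, y / u, z / u] :: real^3"
        have "blow_map (axis 1 e) 1 ?w = w"
          using u(1) eu by (simp add: vec_eq_iff forall_3 blow_map_nth axis_def xyz)
        then have gw: "?gu e ?w = t'" if "t' = Base v" for t' using u(1) w(3) that by (simp add: blow_param_eq)
        have "z / t \<le> 1" using True t0 by simp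
        then have "(z / t) * (2 - t) \<le> 1 * 2" using tt z t0 by (intro mult_mono) auto
        moreover have "(y / u)^2 = (z / t) * (2 - t)"
          unfolding power_divide u(2) y2 using t0 by (simp add: power2_eq_square)
        ultimately have "(y / u)^2 \<le> 2^2" by simp
        then have "\<bar>y / u\<bar> \<le> 2" by (metis abs_le_square_iff abs_numeral)
        then have yu: "- 2 \<le> y / u" "y / u \<le> 2" by linarith+
        have Fw: "z / u * (2 * e + u) + (y / u)^2 = 0"
        proof -
          have "z / u * (2 * e + u) + (y / u)^2 = (z * u * (2 * e + u) + y^2) / u^2"
            using u(1) by (simp add: field_simps power2_eq_square)
          also have "z * u * (2 * e + u) + y^2 = 0" unfolding y2 u_def using e(1) by (auto simp: algebra_simps)
          finally show ?thesis by simp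
        qed
        have "\<bar>u\<bar> < 1" "- e * u = t" using tt e(1) by (auto simp: u_def)
        with yu Fw tt have "?gu e ?w \<in> ?gu e ` u_map e ` ?Lu"
          by (intro plus_chart_member[OF plus_chart_u[OF e(1)]]) simp_all
        then show ?thesis using gw[OF v(1)] e(1) by auto
      next
        case False
        let ?w = "vector [(x - e) / z, y / z, z] :: real^3"
        have "blow_map (axis 1 e) 3 ?w = w"
          using z by (simp add: vec_eq_iff forall_3 blow_map_nth axis_def xyz)
        then have gw: "?gz e ?w = t'" if "t' = Base v" for t' using z w(3) that by (simp add: blow_param_eq)
        have yz: "(y / z)^2 = t * (2 - t) / z" unfolding power_divide y2 using z by (simp add: power2_eq_square)
        have "t / z \<le> 1" using False z by simp
        then have "(t / z) * (2 - t) \<le> 1 * 2" using tt z by (intro mult_mono) auto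
        then have "(y / z)^2 \<le> 2^2" using yz by simp
        then have "\<bar>y / z\<bar> \<le> 2" by (metis abs_le_square_iff abs_numeral)
        then have yzb: "- 2 \<le> y / z" "y / z \<le> 2" by linarith+
        have b: "z * (y / z)^2 \<le> 3/4"
        proof -
          have "0 \<le> (1/2 - t) * (3/2 - t)" using tt by (intro mult_nonneg_nonneg) auto
          moreover have "t * (2 - t) = 3/4 - (1/2 - t) * (3/2 - t)" by algebra
          ultimately have "t * (2 - t) \<le> 3/4" by linarith
          then show ?thesis unfolding yz using z by simp
        qed
        have Fw: "(x - e) / z * (2 * e + (x - e) / z * z) + (y / z)^2 = 0"
          unfolding xe yz using z e(1) by (auto simp: field_simps)
        have "0 < e * ((x - e) / z) * z + 1" using z e(1) tt unfolding xe by auto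
        with yzb b Fw z have "?gz e ?w \<in> ?gz e ` z_map e ` ?Lz"
          by (intro plus_chart_member[OF plus_chart_z[OF e(1)]]) (simp_all only: vector_2 vector_3 mem_Collect_eq Int_iff, simp_all)
        then show ?thesis using gw[OF v(1)] e(1) by auto
      qed
    qed
  qed
  \<comment> \<open>As \<open>z \<le> 0\<close> at \<open>s\<close>, only graph points with
    \<open>z < 1\<close> accumulate there, and these lie in the closed set.\<close>
  have "s \<in> ?K"
  proof -
    let ?S = "smooth_subspace (Z_ambient k) (plus_points k)"
    let ?h = "compose (points ?S) (\<lambda>v. v $ 3) blowdown"
    have c: "continuous_map (space_topology ?S) euclideanreal ?h"
      by (rule smooth_fun_continuous[OF P.niceXS P.smooth_blowdown]) (rule smooth_on_nth)
    have oh: "openin (space_topology ?S) {t \<in> topspace (space_topology ?S). ?h t \<in> {..<1}}"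
      by (rule openin_continuous_map_preimage[OF c]) (simp add: open_openin[symmetric])
    have sh: "s \<in> {t \<in> topspace (space_topology ?S). ?h t \<in> {..<1}}"
      using False s by (simp add: nice_topspace[OF P.niceXS] compose_def)
    obtain W where W: "openin ?T W" "{t \<in> topspace (space_topology ?S). ?h t \<in> {..<1}} = W \<inter> plus_points k"
      using oh unfolding subspace_topology[OF nice_Z P.SM] openin_subtopology by blast
    have "s \<in> ?T closure_of (plus_graph k \<inter> W)"
      by (rule in_closure_of_Int_open[OF _ W(1)]) (use s sh W(2) in \<open>auto simp: plus_points_def\<close>)
    moreover have "plus_graph k \<inter> W \<subseteq> ?K"
    proof
      fix t assume t: "t \<in> plus_graph k \<inter> W"
      then have "t \<in> W \<inter> plus_points k" using plus_graph_points by blast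
      then have h1: "?h t < 1" using W(2) by blast
      have "t \<in> plus_points k" using \<open>t \<in> W \<inter> plus_points k\<close> by blast
      with h1 have "blowdown t $ 3 < 1" by (simp add: compose_def)
      from IntD1[OF t] this show "t \<in> ?K" by (rule inK)
    qed
    from closure_of_minimal[OF this K] have "?T closure_of (plus_graph k \<inter> W) \<subseteq> ?K" .
    ultimately show ?thesis by (rule subsetD[rotated])
  qed
  then show ?thesis
  proof (elim UnE)
    assume "s \<in> main_chart k ` cap_map ` ?L0"
    then obtain a where a: "a \<in> ?L0" "s = main_chart k (cap_map a)" by blast
    then have "a \<in> {a. \<bar>a$1 - 1\<bar> < 1}" by auto
    then show ?thesis using that[OF plus_chart_cap plus_chart_bwd(1)[OF plus_chart_cap] a(2)] by blast
  next
    assume "s \<in> ?gu 1 ` u_map 1 ` ?Lu"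
    then obtain a where a: "a \<in> ?Lu" "s = ?gu 1 (u_map 1 a)" by blast
    from a(1) have "a \<in> {a. \<bar>a$1\<bar> < 1}" by auto
    then show ?thesis using that[OF plus_chart_u[of 1] plus_chart_bwd(1)[OF plus_chart_u[of 1]] a(2)] by blast
  next
    assume "s \<in> ?gu (-1) ` u_map (-1) ` ?Lu"
    then obtain a where a: "a \<in> ?Lu" "s = ?gu (-1) (u_map (-1) a)" by blast
    from a(1) have "a \<in> {a. \<bar>a$1\<bar> < 1}" by auto
    then show ?thesis using that[OF plus_chart_u[of "-1"] plus_chart_bwd(1)[OF plus_chart_u[of "-1"]] a(2)] by blast
  next
    assume "s \<in> ?gz 1 ` z_map 1 ` ?Lz"
    then obtain a where a: "a \<in> ?Lz" "s = ?gz 1 (z_map 1 a)" by blast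
    from a(1) have "a \<in> {a. a$1 * (a$2)^2 < 1}" by auto
    then show ?thesis using that[OF plus_chart_z[of 1] plus_chart_bwd(1)[OF plus_chart_z[of 1]] a(2)] by blast
  next
    assume "s \<in> ?gz (-1) ` z_map (-1) ` ?Lz"
    then obtain a where a: "a \<in> ?Lz" "s = ?gz (-1) (z_map (-1) a)" by blast
    from a(1) have "a \<in> {a. a$1 * (a$2)^2 < 1}" by auto
    then show ?thesis using that[OF plus_chart_z[of "-1"] plus_chart_bwd(1)[OF plus_chart_z[of "-1"]] a(2)] by blast
  qed
qed

section \<open>The manifold and its symplectic structure\<close>

lemma nice_Z_plus: "nice_space (Z_plus k)"
  unfolding Z_plus_eq by (rule P.niceXS)

lemma Z_plus_topology: "space_topology (Z_plus k) = subtopology (space_topology (Z_ambient k)) (plus_points k)"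
  unfolding Z_plus_eq by (rule subspace_topology[OF nice_Z P.SM])

lemma points_Z_plus [simp]: "points (Z_plus k) = plus_points k"
  by (simp add: Z_plus_eq)

lemma manifold_Z_plus: "manifold_with_boundary TYPE(real^2) (Z_plus k)"
  unfolding manifold_with_boundary_def
proof (intro conjI ballI)
  show "Hausdorff_space (space_topology (Z_plus k))"
    unfolding Z_plus_topology by (intro Hausdorff_space_subtopology Hausdorff_atlas good_Z)
  show "second_countable (space_topology (Z_plus k))"
    unfolding Z_plus_topology by (intro second_countable_subtopology second_countable_atlas good_Z)
  show "smooth_funs (smooth_subspace (Z_plus k) (points (Z_plus k))) = smooth_funs (Z_plus k)"
    by (rule nice_subspace_self[OF nice_Z_plus])
  fix s assume "s \<in> points (Z_plus k)"
  then have s: "s \<in> plus_points k" by simp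
  obtain g N F \<pi> Q \<rho> \<mu> w where pc: "plus_chart k g N F \<pi> Q \<rho> \<mu>" and w: "w \<in> N" "s = g w"
    using s by (rule plus_cover)
  obtain V where V: "(V, g) \<in> Z_atlas k" "N \<subseteq> V" "crepant k V g F" "is_chart (Z_ambient k) V g"
    "open N" "smooth_vec N \<pi>" "open Q" "smooth_vec Q \<rho>" using pc by (rule plus_chartD)
  let ?b = "axis 1 1 :: real^2" and ?W = "g ` N \<inter> plus_points k"
  let ?H = "Q \<inter> {a. 0 \<le> a $ 1}"
  have half: "{v. 0 \<le> v \<bullet> ?b} = {a. 0 \<le> a $ 1}" by (simp add: inner_axis)
  have "diffeomorphism (smooth_subspace (Z_ambient k) ?W) (smooth_subspace euclidean_smooth ?H) (\<lambda>s. \<pi> (inv_into V g s))"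
  proof (rule chart_diffeomorphism[OF V(4) chart_euclidean V(5,2,6,7) _ V(8)])
    show "?H \<subseteq> Q" by blast
    show "\<pi> w \<in> ?H \<and> \<rho> (\<pi> w) = w" if "w \<in> N" "g w \<in> plus_points k" for w
      using plus_chart_iff[OF pc that(1)] plus_chart_fwd[OF pc that(1)] that(2) by blast
    show "\<rho> a \<in> N \<and> g (\<rho> a) \<in> plus_points k \<and> \<pi> (\<rho> a) = a" if "a \<in> ?H" for a
      using plus_chart_bwd[OF pc, of a] plus_chart_iff[OF pc, of "\<rho> a"] that by auto
  qed
  moreover have "smooth_subspace (Z_plus k) ?W = smooth_subspace (Z_ambient k) ?W"
    unfolding Z_plus_eq by (rule subspace_subspace[OF nice_Z P.SM]) blast
  moreover have "openin (space_topology (Z_plus k)) ?W"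
    unfolding Z_plus_topology openin_subtopology using chart_image[OF V(4,5,2)] by blast
  moreover have "openin (top_of_set {v. 0 \<le> v \<bullet> ?b}) ?H"
    unfolding half using V(7) by (metis Int_commute openin_open_Int)
  moreover have "?b \<in> Basis" by (simp add: axis_in_Basis_iff)
  ultimately show "\<exists>W H h. \<exists>b\<in>Basis. openin (space_topology (Z_plus k)) W \<and> s \<in> W \<and>
      openin (top_of_set {v::real^2. 0 \<le> v \<bullet> b}) H \<and>
      diffeomorphism (smooth_subspace (Z_plus k) W) (smooth_subspace euclidean_smooth H) h"
    using w s by (metis IntI imageI)
qed

text \<open>By the Leibniz rule a derivation at \<open>s\<close> kills products of two functions
  vanishing at \<open>s\<close>; it also kills constants. This is the form in which Hadamard's lemma
  presents a function with zero gradient.\<close>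

lemma tangent_vector_products:
  assumes X: "nice_space X" and v: "v \<in> tangent_vectors X s" and s: "s \<in> points X" and "finite I"
    and "\<And>i. i \<in> I \<Longrightarrow> P i \<in> smooth_funs X \<and> H i \<in> smooth_funs X \<and> P i s = 0 \<and> H i s = 0"
  shows "(\<lambda>t\<in>points X. c + (\<Sum>i\<in>I. P i t * H i t)) \<in> smooth_funs X \<and> v (\<lambda>t\<in>points X. c + (\<Sum>i\<in>I. P i t * H i t)) = 0"
  using assms(4,5)
proof (induction I)
  case empty
  show ?case using tangent_vector_const[OF X v s] nice_const[OF X] by (simp only: sum.empty add_0_right simp_thms)
next
  case (insert j I)
  let ?f = "\<lambda>t\<in>points X. c + (\<Sum>i\<in>I. P i t * H i t)" and ?p = "\<lambda>t\<in>points X. P j t * H j t"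
  have "?f \<in> smooth_funs X \<and> v ?f = 0" by (rule insert.IH[OF insert.prems]) simp
  note IH = conjunct1[OF this] conjunct2[OF this]
  have j: "P j \<in> smooth_funs X" "H j \<in> smooth_funs X" "P j s = 0" "H j s = 0" using insert.prems by auto
  have p: "?p \<in> smooth_funs X" by (rule nice_mult[OF X j(1,2)])
  have "v ?p = P j s * v (H j) + H j s * v (P j)" using v j(1,2) unfolding tangent_vectors_def by blast
  then have "v ?p = 0" using j by simp
  moreover have "v (\<lambda>t\<in>points X. 1 * ?p t + ?f t) = 1 * v ?p + v ?f" using v p IH(1) unfolding tangent_vectors_def by blast
  ultimately have v0: "v (\<lambda>t\<in>points X. 1 * ?p t + ?f t) = 0" using IH(2) by linarith
  have eq: "(\<lambda>t\<in>points X. 1 * ?p t + ?f t) = (\<lambda>t\<in>points X. c + (\<Sum>i\<in>insert j I. P i t * H i t))"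
    using insert.hyps by (intro ext) simp
  from nice_lin[OF X p IH(1), of 1] v0 show ?case unfolding eq by (rule conjI)
qed

text \<open>If \<open>f\<close> has zero bracket with all coordinates, the gradient of an ambient
  extension \<open>\<phi>\<close> is a multiple of that of \<open>F\<close>. Subtracting this
  multiple of \<open>F\<close>, which vanishes on the surface, gives another extension of
  \<open>f\<close>, now with zero gradient; by Hadamard's lemma every tangent vector kills
  it.\<close>

lemma symplectic_Z_plus: "symplectic_manifold TYPE(real^2) (Z_plus k) (Z_plus_bracket k)"
  unfolding symplectic_manifold_def
proof (intro conjI ballI impI)
  show "manifold_with_boundary TYPE(real^2) (Z_plus k)" by (rule manifold_Z_plus)
  show "poisson_bracket (Z_plus k) (Z_plus_bracket k)"
    unfolding Z_plus_bracket_eq Z_plus_eq by (rule P.poisson_bracket)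
  fix s f v
  assume "s \<in> points (Z_plus k)" and f: "f \<in> smooth_funs (Z_plus k)"
    and null: "\<forall>g\<in>smooth_funs (Z_plus k). Z_plus_bracket k f g s = 0" and v: "v \<in> tangent_vectors (Z_plus k) s"
  then have s: "s \<in> plus_points k" by simp
  let ?X = "Z_ambient k" and ?S = "plus_points k" and ?Y = "Z_plus k"
  obtain g N F \<pi> Q \<rho> \<mu> w where pc: "plus_chart k g N F \<pi> Q \<rho> \<mu>" and w: "w \<in> N" "s = g w"
    using s by (rule plus_cover)
  obtain V where V: "(V, g) \<in> Z_atlas k" "N \<subseteq> V" "crepant k V g F" "is_chart ?X V g" "open N" using pc by (rule plus_chartD)
  have wV: "w \<in> V" and gw: "g w \<in> ?S" using w V(2) s by auto
  have F0: "F x = 0" if "x \<in> V" "g x \<in> ?S" for x by (rule P.crepant_vanish[OF V(1,3) that])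
  obtain M \<phi> where M: "open M" "w \<in> M" "M \<subseteq> V" "smooth_on M \<phi>" "\<And>x. x \<in> M \<Longrightarrow> g x \<in> ?S \<Longrightarrow> f (g x) = \<phi> x"
    by (rule smooth_subspaceD[OF f[unfolded Z_plus_eq] V(4) wV gw]) (rule that)
  have sF: "smooth_on M F" using V(3) M(3) by (auto simp: crepant_def intro: smooth_on_subset)
  have "jac F \<phi> (\<lambda>x. x $ j) w = 0" for j
  proof -
    obtain G M' where G: "G \<in> smooth_funs ?X" "open M'" "w \<in> M'" "M' \<subseteq> M" "\<And>x. x \<in> M' \<Longrightarrow> G (g x) = x $ j"
      by (rule chart_extend[OF V(4) M(1,3,2) smooth_on_nth[of M j]]) (rule that)
    have h: "restrict G ?S \<in> smooth_funs ?Y" unfolding Z_plus_eq by (rule smooth_subspace_restrict[OF nice_Z P.SM G(1)])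
    have "Z_plus_bracket k f (restrict G ?S) (g w) = jac F \<phi> (\<lambda>x. x $ j) w"
      unfolding Z_plus_bracket_eq
      by (rule P.bracket_chart[OF f[unfolded Z_plus_eq] h[unfolded Z_plus_eq] V(1,3) wV gw G(2,3)])
        (use G M smooth_on_subset[OF M(4)] in \<open>auto intro: smooth_on_nth\<close>)
    then show ?thesis using null h w(2) by simp
  qed
  then obtain l where l: "\<And>i. partial \<phi> i w = l * partial F i w"
    using jac_gradient_parallel[of F \<phi> w] plus_chart_fwd(3)[OF pc w(1) F0[OF wV gw]] by blast
  obtain r where r: "0 < r" "ball w r \<subseteq> M" using M(1,2) open_contains_ball by blast
  define \<phi>' where "\<phi>' x = \<phi> x + (- l) * F x" for x
  have s\<phi>': "smooth_on (ball w r) \<phi>'"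
    unfolding \<phi>'_def[abs_def]
    by (intro smooth_on_add smooth_on_mult smooth_on_const smooth_on_subset[OF M(4) r(2)] smooth_on_subset[OF sF r(2)]) auto
  have dM: "\<phi> differentiable (at w)" "F differentiable (at w)"
    using smooth_on_differentiable[OF M(4,2)] smooth_on_differentiable[OF sF M(2)] by auto
  have d0: "partial \<phi>' i w = 0" for i
  proof -
    have "partial (\<lambda>x. (- l) * F x) i w = (- l) * partial F i w + partial (\<lambda>x. - l) i w * F w"
      by (rule frechet_mult[OF differentiable_const dM(2)])
    moreover have "partial \<phi>' i w = partial \<phi> i w + partial (\<lambda>x. (- l) * F x) i w"
      unfolding \<phi>'_def[abs_def] by (rule frechet_add[OF dM(1) differentiable_mult[OF differentiable_const dM(2)]])
    ultimately show ?thesis using l[of i] by simp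
  qed
  obtain h where h: "\<And>b. smooth_on (ball w r) (h b)"
    "\<And>x. x \<in> ball w r \<Longrightarrow> \<phi>' x = \<phi>' w + (\<Sum>b\<in>Basis. ((x - w) \<bullet> b) * h b x)"
    "\<And>b. h b w = frechet_derivative \<phi>' (at w) b"
    by (rule hadamard[OF s\<phi>' r(1)]) (rule that)
  have hb: "h b w = 0" if "b \<in> Basis" for b
    using that d0 unfolding h(3) by (auto simp: Basis_vec_def)
  have oB: "open (ball w r)" "ball w r \<subseteq> V" "w \<in> ball w r" using r M(3) by auto
  have "\<exists>P H B. P \<in> smooth_funs ?X \<and> H \<in> smooth_funs ?X \<and> open B \<and> w \<in> B \<and> B \<subseteq> ball w r \<and>
      (\<forall>x\<in>B. P (g x) = (x - w) \<bullet> b \<and> H (g x) = h b x)" for b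
  proof -
    have "smooth_on (ball w r) (\<lambda>x. (x - w) \<bullet> b)" unfolding inner_diff_left by (auto intro!: smooth_intros)
    then obtain P B1 where P: "P \<in> smooth_funs ?X" "open B1" "w \<in> B1" "B1 \<subseteq> ball w r" "\<And>x. x \<in> B1 \<Longrightarrow> P (g x) = (x - w) \<bullet> b"
      by (rule chart_extend[OF V(4) oB]) (rule that)
    obtain H B2 where H: "H \<in> smooth_funs ?X" "open B2" "w \<in> B2" "B2 \<subseteq> ball w r" "\<And>x. x \<in> B2 \<Longrightarrow> H (g x) = h b x"
      by (rule chart_extend[OF V(4) oB h(1)]) (rule that)
    show ?thesis by (rule exI[of _ P], rule exI[of _ H], rule exI[of _ "B1 \<inter> B2"]) (use P H in auto)
  qed
  then obtain P H B where PH: "\<And>b. P b \<in> smooth_funs ?X \<and> H b \<in> smooth_funs ?X \<and> open (B b) \<and> w \<in> B b \<and> B b \<subseteq> ball w r \<and>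
      (\<forall>x\<in>B b. P b (g x) = (x - w) \<bullet> b \<and> H b (g x) = h b x)" by metis
  let ?q = "\<lambda>t\<in>points ?Y. \<phi>' w + (\<Sum>b\<in>Basis. restrict (P b) ?S t * restrict (H b) ?S t)"
  have q: "?q \<in> smooth_funs ?Y \<and> v ?q = 0"
  proof (rule tangent_vector_products[OF nice_Z_plus v])
    show "restrict (P b) ?S \<in> smooth_funs ?Y \<and> restrict (H b) ?S \<in> smooth_funs ?Y \<and> restrict (P b) ?S s = 0 \<and> restrict (H b) ?S s = 0"
      if "b \<in> Basis" for b
      using PH[of b] hb[OF that] s w(2) unfolding Z_plus_eq by (auto simp del: smooth_subspace_sel(2) intro: smooth_subspace_restrict[OF nice_Z P.SM])
  qed (use s in auto)
  let ?B = "\<Inter>b\<in>Basis. B b"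
  have oI: "open ?B" using PH by (intro open_INT) auto
  have B0: "w \<in> ?B" "?B \<subseteq> ball w r" using PH by (blast, use PH SOME_Basis in blast)
  have oW: "openin (space_topology ?Y) (g ` ?B \<inter> ?S)"
    unfolding Z_plus_topology openin_subtopology using chart_image[OF V(4) oI] B0(2) oB(2) by blast
  have "v f = v ?q"
  proof (rule tangent_vector_local[OF nice_Z_plus v f conjunct1[OF q] oW])
    show "s \<in> g ` ?B \<inter> ?S" using B0(1) w(2) s by blast
    fix t assume t: "t \<in> g ` ?B \<inter> ?S"
    then obtain x where x: "x \<in> ?B" "t = g x" "g x \<in> ?S" by blast
    then have xr: "x \<in> ball w r" using B0(2) by blast
    then have xM: "x \<in> M" "x \<in> V" using r(2) M(3) by auto
    have "f t = \<phi>' x" using M(5)[OF xM(1) x(3)] F0[OF xM(2) x(3)] x(2) by (simp add: \<phi>'_def)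
    also have "\<dots> = \<phi>' w + (\<Sum>b\<in>Basis. ((x - w) \<bullet> b) * h b x)" by (rule h(2)[OF xr])
    also have "\<dots> = ?q t" using x PH by simp
    finally show "f t = ?q t" .
  qed
  then show "v f = 0" using q by simp
qed

section \<open>The plane modulo the group\<close>

definition plane_act :: "int \<Rightarrow> real \<Rightarrow> real^2 \<Rightarrow> real^2" where
  "plane_act n e v = vector [v$1 + of_int n * v$2, e * v$2]"

lemma plane_act_nth [simp]: "plane_act n e v $ 1 = v$1 + of_int n * v$2" "plane_act n e v $ 2 = e * v$2"
  by (simp_all add: plane_act_def)

lemma vec2_eq_iff: "(u::real^2) = v \<longleftrightarrow> u$1 = v$1 \<and> u$2 = v$2"
  by (simp add: vec_eq_iff forall_2)

lemma G'_act: "(vector [vector [1, of_int n], vector [0, e]] :: real^2^2) *v u = plane_act n e u"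
  by (simp add: vec2_eq_iff matrix_vector_mult_def sum_2)

lemma G'_E:
  assumes "g \<in> G'"
  obtains n e where "e = 1 \<or> e = - 1" "g = vector [vector [1, of_int n], vector [0, e]]" "(*v) g = plane_act n e"
proof -
  obtain n e where "e = 1 \<or> e = - 1" "g = vector [vector [1, of_int n], vector [0, e]]"
    using assms unfolding G'_def by blast
  then show ?thesis using that G'_act by blast
qed

lemma G'_I: "e = 1 \<or> e = - 1 \<Longrightarrow> vector [vector [1, of_int n], vector [0, e]] \<in> G'"
  unfolding G'_def by blast

text \<open>The closed orbit relation in explicit form, by \<open>plane_rel_eq\<close>: off the axis
  \<open>q = 0\<close> the classes are plain orbits.\<close>

definition orbit_or_axis :: "((real^2) \<times> (real^2)) set" where
  "orbit_or_axis = {(u, v). (u$2 = 0 \<and> v$2 = 0) \<or> (u$2 \<noteq> 0 \<and> (\<exists>n e. (e = 1 \<or> e = - 1) \<and> v = plane_act n e u))}"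

lemma equiv_orbit_or_axis: "equiv UNIV orbit_or_axis"
proof (rule equivI)
  show "refl orbit_or_axis"
  proof (rule refl_onI)
    fix u :: "real^2"
    have "u = plane_act 0 1 u" by (simp add: vec2_eq_iff)
    then show "(u, u) \<in> orbit_or_axis" unfolding orbit_or_axis_def by blast
  qed
  show "sym orbit_or_axis"
  proof (rule symI)
    fix u v assume uv: "(u, v) \<in> orbit_or_axis"
    show "(v, u) \<in> orbit_or_axis"
    proof (cases "u$2 = 0")
      case True
      then show ?thesis using uv by (auto simp: orbit_or_axis_def)
    next
      case False
      then obtain n e where ne: "e = 1 \<or> e = - 1" "v = plane_act n e u" using uv by (auto simp: orbit_or_axis_def)
      have "u = plane_act (if e = 1 then - n else n) e v" using ne by (auto simp: vec2_eq_iff)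
      moreover have "v$2 \<noteq> 0" using ne False by auto
      ultimately show ?thesis using ne(1) unfolding orbit_or_axis_def by blast
    qed
  qed
  show "trans orbit_or_axis"
  proof (rule transI)
    fix u v w assume uv: "(u, v) \<in> orbit_or_axis" and vw: "(v, w) \<in> orbit_or_axis"
    show "(u, w) \<in> orbit_or_axis"
    proof (cases "u$2 = 0")
      case True
      then show ?thesis using uv vw by (auto simp: orbit_or_axis_def)
    next
      case False
      then obtain n e where ne: "e = 1 \<or> e = - 1" "v = plane_act n e u" using uv by (auto simp: orbit_or_axis_def)
      then have "v$2 \<noteq> 0" using False by auto
      then obtain m d where md: "d = 1 \<or> d = - 1" "w = plane_act m d v" using vw by (auto simp: orbit_or_axis_def)
      have "w = plane_act (if e = 1 then n + m else n - m) (d * e) u"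
        using ne md by (auto simp: vec2_eq_iff algebra_simps)
      moreover have "d * e = 1 \<or> d * e = - 1" using ne md by auto
      ultimately show ?thesis using False unfolding orbit_or_axis_def by blast
    qed
  qed
qed simp

text \<open>Up to sign \<open>q\<close> is constant on orbits, and where \<open>q \<noteq> 0\<close>
  the shift is the integer \<open>(p' - p) / q\<close>; these quotients converge, and the integers
  form a closed set.\<close>

lemma orbit_limit:
  assumes "xs \<longlonglongrightarrow> x" "ys \<longlonglongrightarrow> y" "\<And>n. \<exists>m e. (e = 1 \<or> e = - 1) \<and> ys n = plane_act m e (xs n)"
  shows "(x, y) \<in> orbit_or_axis"
proof -
  have c: "(\<lambda>n. xs n $ i) \<longlonglongrightarrow> x $ i" "(\<lambda>n. ys n $ i) \<longlonglongrightarrow> y $ i" for i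
    using assms(1,2) by (auto intro: tendsto_vec_nth)
  have ab: "\<bar>ys n $ 2\<bar> = \<bar>xs n $ 2\<bar>" for n using assms(3)[of n] by auto
  have "(\<lambda>n. \<bar>ys n $ 2\<bar>) \<longlonglongrightarrow> \<bar>y $ 2\<bar>" "(\<lambda>n. \<bar>ys n $ 2\<bar>) \<longlonglongrightarrow> \<bar>x $ 2\<bar>"
    using tendsto_rabs[OF c(2)[of 2]] tendsto_rabs[OF c(1)[of 2]] unfolding ab by auto
  then have eq: "\<bar>y $ 2\<bar> = \<bar>x $ 2\<bar>" by (rule LIMSEQ_unique)
  show ?thesis
  proof (cases "x$2 = 0")
    case True
    then show ?thesis using eq by (simp add: orbit_or_axis_def)
  next
    case False
    let ?m = "\<lambda>n. (ys n $ 1 - xs n $ 1) / xs n $ 2"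
    have lim: "?m \<longlonglongrightarrow> (y$1 - x$1) / x$2" by (intro tendsto_intros c False)
    have "?m n \<in> \<int>" for n using assms(3)[of n] by (cases "xs n $ 2 = 0") auto
    then have "(y$1 - x$1) / x$2 \<in> \<int>" by (intro closed_sequentially[OF closed_Ints _ lim]) auto
    then obtain m where "(y$1 - x$1) / x$2 = of_int m" by (rule Ints_cases)
    then have m: "y$1 = x$1 + of_int m * x$2" using False by (simp add: field_simps)
    have "y$2 = x$2 \<or> y$2 = - (x$2)" using eq by linarith
    then have "y = plane_act m 1 x \<or> y = plane_act m (- 1) x" using m by (auto simp: vec2_eq_iff)
    then show ?thesis using False unfolding orbit_or_axis_def by blast
  qed
qed

text \<open>The orbit of a point at height \<open>t\<close> contains points at spacing
  \<open>t\<close> in the direction of \<open>p\<close>, which approximate any target as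
  \<open>t\<close> tends to \<open>0\<close>. The shift is the integer part of the required distance
  divided by \<open>t\<close>.\<close>

lemma axis_sequences:
  fixes u v :: "real^2"
  assumes "u$2 = 0" "v$2 = 0"
  obtains xs ys :: "nat \<Rightarrow> real^2" where "xs \<longlonglongrightarrow> u" "ys \<longlonglongrightarrow> v" "\<And>n. \<exists>m. ys n = plane_act m 1 (xs n)"
proof -
  define t where "t n = inverse (real (Suc n))" for n
  define m where "m n = \<lfloor>(v$1 - u$1) / t n\<rfloor>" for n
  define xs where "xs n = (vector [u$1, t n] :: real^2)" for n
  have t: "t \<longlonglongrightarrow> 0" "0 < t n" for n
    unfolding t_def by (rule LIMSEQ_inverse_real_of_nat, simp)
  have bound: "v$1 - u$1 - t n \<le> of_int (m n) * t n" "of_int (m n) * t n \<le> v$1 - u$1" for n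
  proof -
    have f: "(v$1 - u$1) / t n - 1 \<le> of_int (m n)" "of_int (m n) \<le> (v$1 - u$1) / t n"
      unfolding m_def by linarith+
    have "((v$1 - u$1) / t n - 1) * t n \<le> of_int (m n) * t n" using f(1) t(2)[of n] by (intro mult_right_mono) auto
    moreover have "((v$1 - u$1) / t n - 1) * t n = v$1 - u$1 - t n" using t(2)[of n] by (simp add: field_simps)
    ultimately show "v$1 - u$1 - t n \<le> of_int (m n) * t n" by linarith
    have "of_int (m n) * t n \<le> (v$1 - u$1) / t n * t n" using f(2) t(2)[of n] by (intro mult_right_mono) auto
    then show "of_int (m n) * t n \<le> v$1 - u$1" using t(2)[of n] by simp
  qed
  have "(\<lambda>n. of_int (m n) * t n) \<longlonglongrightarrow> v$1 - u$1"
  proof (rule tendsto_sandwich[OF always_eventually always_eventually])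
    show "(\<lambda>n. v$1 - u$1 - t n) \<longlonglongrightarrow> v$1 - u$1" using tendsto_diff[OF tendsto_const t(1), of "v$1 - u$1"] by simp
    show "(\<lambda>n. v$1 - u$1) \<longlonglongrightarrow> v$1 - u$1" by (rule tendsto_const)
  qed (use bound in auto)
  then have "(\<lambda>n. u$1 + of_int (m n) * t n) \<longlonglongrightarrow> u$1 + (v$1 - u$1)" by (intro tendsto_intros)
  then have l: "(\<lambda>n. u$1 + of_int (m n) * t n) \<longlonglongrightarrow> v$1" by simp
  show ?thesis
  proof (rule that[of xs "\<lambda>n. plane_act (m n) 1 (xs n)"])
    show "xs \<longlonglongrightarrow> u"
    proof (rule vec_tendstoI)
      fix i show "(\<lambda>n. xs n $ i) \<longlonglongrightarrow> u $ i"
        using exhaust_2[of i] t(1) assms by (auto simp: xs_def)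
    qed
    show "(\<lambda>n. plane_act (m n) 1 (xs n)) \<longlonglongrightarrow> v"
    proof (rule vec_tendstoI)
      fix i show "(\<lambda>n. plane_act (m n) 1 (xs n) $ i) \<longlonglongrightarrow> v $ i"
        using exhaust_2[of i] t(1) l assms by (auto simp: xs_def)
    qed
  qed blast
qed

lemma plane_rel_eq: "plane_rel = orbit_or_axis"
  unfolding closed_orbit_rel_def euclidean_topology limitin_canonical_iff euclidean_smooth_sel(1)
proof
  let ?L = "{(x, y) |x y. \<exists>xs ys :: nat \<Rightarrow> real^2. (\<forall>n. xs n \<in> UNIV \<and> (\<exists>g\<in>G'. ys n = g *v xs n)) \<and> xs \<longlonglongrightarrow> x \<and> ys \<longlonglongrightarrow> y}"
  have "?L \<subseteq> orbit_or_axis"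
  proof
    fix z assume "z \<in> ?L"
    then obtain x y xs ys where z: "z = (x, y)" "\<And>n. \<exists>g\<in>G'. ys n = g *v xs n" "xs \<longlonglongrightarrow> x" "ys \<longlonglongrightarrow> y" by blast
    have "\<exists>m e. (e = 1 \<or> e = - 1) \<and> ys n = plane_act m e (xs n)" for n
    proof -
      obtain g where g: "g \<in> G'" "ys n = g *v xs n" using z(2) by blast
      obtain m e where "e = 1 \<or> e = - 1" "(*v) g = plane_act m e" using g(1) by (rule G'_E)
      then show ?thesis using g(2) by auto
    qed
    then show "z \<in> orbit_or_axis" unfolding z(1) by (rule orbit_limit[OF z(3,4)])
  qed
  then show "\<Inter> {R. equiv UNIV R \<and> ?L \<subseteq> R} \<subseteq> orbit_or_axis" using equiv_orbit_or_axis by blast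
  show "orbit_or_axis \<subseteq> \<Inter> {R. equiv UNIV R \<and> ?L \<subseteq> R}"
  proof -
    have "orbit_or_axis \<subseteq> ?L"
    proof
      fix z assume "z \<in> orbit_or_axis"
      then obtain u v where z: "z = (u, v)" "(u$2 = 0 \<and> v$2 = 0) \<or> (\<exists>n e. (e = 1 \<or> e = - 1) \<and> v = plane_act n e u)"
        unfolding orbit_or_axis_def by blast
      from z(2) have "\<exists>xs ys :: nat \<Rightarrow> real^2. (\<forall>n. xs n \<in> UNIV \<and> (\<exists>g\<in>G'. ys n = g *v xs n)) \<and> xs \<longlonglongrightarrow> u \<and> ys \<longlonglongrightarrow> v"
      proof
        assume "u$2 = 0 \<and> v$2 = 0"
        then obtain xs ys :: "nat \<Rightarrow> real^2" where xy: "xs \<longlonglongrightarrow> u" "ys \<longlonglongrightarrow> v" "\<And>n. \<exists>m. ys n = plane_act m 1 (xs n)"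
          using axis_sequences by metis
        have "\<exists>g\<in>G'. ys n = g *v xs n" for n
          using xy(3)[of n] G'_act[of _ 1] G'_I[of 1] by metis
        then show ?thesis using xy by blast
      next
        assume "\<exists>n e. (e = 1 \<or> e = - 1) \<and> v = plane_act n e u"
        then obtain n e where ne: "e = 1 \<or> e = - 1" "v = plane_act n e u" by blast
        have "\<exists>g\<in>G'. v = g *v u" using ne G'_act[of n e u] G'_I[OF ne(1)] by metis
        then show ?thesis by (intro exI[of _ "\<lambda>_. u"] exI[of _ "\<lambda>_. v"]) auto
      qed
      then show "z \<in> ?L" unfolding z(1) by blast
    qed
    then show ?thesis by (intro Inter_greatest) (elim CollectE conjE, erule subset_trans)
  qed
qed

section \<open>Classes in the quotient and the fibres of \<open>phi_map\<close>\<close>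

abbreviation plane_class :: "real^2 \<Rightarrow> (real^2) set" where "plane_class m \<equiv> plane_rel `` {m}"

lemma plane_class_eq_iff: "plane_class u = plane_class v \<longleftrightarrow> (u, v) \<in> orbit_or_axis"
  unfolding plane_rel_eq by (rule eq_equiv_class_iff[OF equiv_orbit_or_axis]) auto

lemma phi_map_nth:
  "v$2 \<noteq> 0 \<Longrightarrow> phi_map k v = vector [(v$2)^(2*k) * cos (2*pi*(v$1)/(v$2)), (v$2)^(2*k+1) * sin (2*pi*(v$1)/(v$2)), (v$2)^2]"
  "v$2 = 0 \<Longrightarrow> phi_map k v = 0"
  by (simp_all add: phi_map_def Let_def)

lemma phi_map_act:
  assumes e: "e = 1 \<or> e = - 1"
  shows "phi_map k (plane_act n e v) = phi_map k v"
proof (cases "v$2 = 0")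
  case True
  then show ?thesis by (simp add: phi_map_nth)
next
  case False
  have a: "2 * pi * (v$1 + of_int n * v$2) / (e * v$2) = e * (2 * pi * v$1 / v$2 + 2 * pi * of_int n)"
    using e False by (auto simp: field_simps)
  have cs: "cos (e * x) = cos x" "sin (e * x) = e * sin x" for x using e by auto
  have "cos (2 * pi * v$1 / v$2 + 2 * pi * of_int n) = cos (2 * pi * v$1 / v$2)"
    "sin (2 * pi * v$1 / v$2 + 2 * pi * of_int n) = sin (2 * pi * v$1 / v$2)"
    by (simp_all add: cos_add sin_add)
  then have c: "cos (2 * pi * (v$1 + of_int n * v$2) / (e * v$2)) = cos (2 * pi * v$1 / v$2)"
    "sin (2 * pi * (v$1 + of_int n * v$2) / (e * v$2)) = e * sin (2 * pi * v$1 / v$2)"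
    unfolding a cs by simp_all
  have p: "(e * v$2)^(2*k) = (v$2)^(2*k)" "(e * v$2)^(2*k+1) * e = (v$2)^(2*k+1)" "(e * v$2)^2 = (v$2)^2"
    using e by (auto simp: power_mult_distrib)
  have nz: "plane_act n e v $ 2 \<noteq> 0" using False e by auto
  show ?thesis
    unfolding phi_map_nth(1)[OF nz] phi_map_nth(1)[OF False] plane_act_nth c p(1,3) mult.assoc[symmetric] p(2) ..
qed

text \<open>The third coordinate determines \<open>q\<close> up to sign; then cosine and sine
  determine the angle \<open>2 * pi * p / q\<close> up to the corresponding sign and up to full
  turns, which are the shifts of \<open>p\<close> by multiples of \<open>q\<close>.\<close>

lemma phi_map_eq_iff: "phi_map k u = phi_map k v \<longleftrightarrow> (u, v) \<in> orbit_or_axis"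
proof
  assume eq: "phi_map k u = phi_map k v"
  show "(u, v) \<in> orbit_or_axis"
  proof (cases "u$2 = 0")
    case True
    have "v$2 = 0"
    proof (rule ccontr)
      assume "v$2 \<noteq> 0"
      then have "phi_map k v $ 3 \<noteq> 0" by (simp add: phi_map_nth)
      then show False using eq True by (simp add: phi_map_nth)
    qed
    then show ?thesis using True by (simp add: orbit_or_axis_def)
  next
    case False
    have v0: "v$2 \<noteq> 0"
    proof
      assume "v$2 = 0"
      then have "phi_map k u $ 3 = 0" using eq by (simp add: phi_map_nth)
      then show False using False by (simp add: phi_map_nth)
    qed
    let ?a = "2 * pi * u$1 / u$2" and ?b = "2 * pi * v$1 / v$2"
    have c: "(u$2)^(2*k) * cos ?a = (v$2)^(2*k) * cos ?b" "(u$2)^(2*k+1) * sin ?a = (v$2)^(2*k+1) * sin ?b" "(u$2)^2 = (v$2)^2"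
      using arg_cong[OF eq, of "\<lambda>w. w $ 1"] arg_cong[OF eq, of "\<lambda>w. w $ 2"] arg_cong[OF eq, of "\<lambda>w. w $ 3"]
      unfolding phi_map_nth(1)[OF False] phi_map_nth(1)[OF v0] vector_3 by auto
    define e where "e = v$2 / u$2"
    have ve: "v$2 = e * u$2" using False by (simp add: e_def)
    have "e^2 = 1" using c(3) v0 by (simp add: e_def power_divide)
    then have e: "e = 1 \<or> e = - 1" by (simp add: power2_eq_1_iff)
    have p: "(v$2)^(2*k) = (u$2)^(2*k)" "(v$2)^(2*k+1) = e * (u$2)^(2*k+1)"
      using e by (auto simp: ve power_mult_distrib)
    have "cos ?a = cos ?b" using c(1) False unfolding p by simp
    moreover have "sin ?a = e * sin ?b" using c(2) False unfolding p by simp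
    ultimately have "sin (e * ?b) = sin ?a \<and> cos (e * ?b) = cos ?a" using e by auto
    then obtain n :: int where n: "e * ?b = ?a + 2 * pi * n" using sin_cos_eq_iff by blast
    have "e * ?b = 2 * pi * v$1 / u$2" using e by (auto simp: ve)
    then have "2 * pi * v$1 / u$2 = 2 * pi * u$1 / u$2 + 2 * pi * n" using n by simp
    then have "2 * pi * v$1 = 2 * pi * (u$1 + of_int n * u$2)" using False by (simp add: field_simps)
    then have "v = plane_act n e u" using ve by (simp add: vec2_eq_iff)
    then show ?thesis using False e unfolding orbit_or_axis_def by blast
  qed
next
  assume "(u, v) \<in> orbit_or_axis"
  then consider "u$2 = 0" "v$2 = 0" | n e where "e = 1 \<or> e = - 1" "v = plane_act n e u"
    unfolding orbit_or_axis_def by blast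
  then show "phi_map k u = phi_map k v" by cases (simp_all add: phi_map_nth(2) phi_map_act)
qed

lemma plane_quotient_points: "points plane_quotient = range plane_class"
  by (simp add: poisson_quotient_def quotient_space_def Let_def)

lemma phi_bar_class: "phi_bar k (plane_class m) = phi_map k m"
proof -
  have "phi_map k ` plane_class m = {phi_map k m}"
  proof -
    have "(m, v) \<in> orbit_or_axis" if "v \<in> plane_class m" for v using that by (simp only: plane_rel_eq Image_singleton_iff)
    then have c: "phi_map k v = phi_map k m" if "v \<in> plane_class m" for v
      using phi_map_eq_iff[of k m v] that by metis
    have "m \<in> plane_class m" using equiv_class_self[OF equiv_orbit_or_axis, of m] by (simp add: plane_rel_eq)
    then have "(\<lambda>v. phi_map k m) ` plane_class m = {phi_map k m}" by (rule image_constant)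
    moreover have "phi_map k ` plane_class m = (\<lambda>v. phi_map k m) ` plane_class m" by (rule image_cong[OF refl c])
    ultimately show ?thesis by (rule trans[rotated])
  qed
  then show ?thesis by (simp add: phi_bar_def)
qed

lemma psi_phi: "psi_map k (phi_map k m) = plane_class m"
proof -
  have d: "phi_map k m \<in> phi_bar k ` points plane_quotient"
    unfolding plane_quotient_points by (rule image_eqI[where x = "plane_class m"]) (simp_all add: phi_bar_class)
  let ?c = "inv_into (points plane_quotient) (phi_bar k) (phi_map k m)"
  have "?c \<in> points plane_quotient" "phi_bar k ?c = phi_map k m"
    using inv_into_into[OF d] f_inv_into_f[OF d] by auto
  then obtain m' where m': "?c = plane_class m'" "phi_map k m' = phi_map k m"
    unfolding plane_quotient_points using phi_bar_class by auto
  then have "?c = plane_class m" using phi_map_eq_iff plane_class_eq_iff by metis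
  then show ?thesis using d by (simp add: psi_map_def)
qed

text \<open>At the origin the value comes from the inverse of \<open>phi_bar k\<close>, at the
  remaining points from the default in \<open>psi_map\<close>; both are the class of the
  axis.\<close>

lemma psi_axis:
  assumes "d$3 = 0"
  shows "psi_map k d = plane_class 0"
proof (cases "d \<in> phi_bar k ` points plane_quotient")
  case True
  then obtain m where m: "d = phi_map k m" unfolding plane_quotient_points using phi_bar_class by auto
  then have "m$2 = 0" using assms by (cases "m$2 = 0") (auto simp: phi_map_nth)
  then have "(m, 0) \<in> orbit_or_axis" by (simp add: orbit_or_axis_def)
  then show ?thesis using m psi_phi plane_class_eq_iff by metis
qed (simp add: psi_map_def)

lemma phi_map_main:
  assumes z: "0 < z" and c: "cos t = x" "sin t = y / sqrt z"
  shows "phi_map k (vector [sqrt z * t / (2 * pi), sqrt z]) = vector [z^k * x, z^k * y, z]"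
proof -
  have s: "0 < sqrt z" "(sqrt z)^2 = z" using z by auto
  have "2 * pi * (sqrt z * t / (2 * pi)) / sqrt z = t" using s by simp
  moreover have "(sqrt z)^(2*k) = z^k" using s(2) by (simp add: power_mult)
  ultimately show ?thesis using s c by (simp add: phi_map_nth vec_eq_iff forall_3)
qed

lemma main_angle:
  assumes "duval_eqn 0 w = 0" "0 < w$3"
  obtains t where "cos t = w$1" "sin t = w$2 / sqrt (w$3)"
proof -
  have "w$3 * (w$1)^2 + (w$2)^2 = w$3" using assms(1) by (simp add: duval_eqn_def)
  then have "(w$1)^2 + (w$2 / sqrt (w$3))^2 = 1" using assms(2) by (simp add: power_divide field_simps)
  then show ?thesis using sincos_total_2pi that by metis
qed

lemma plane_quotient_smooth:
  "F \<in> smooth_funs plane_quotient \<longleftrightarrow> F \<in> extensional (range plane_class) \<and>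
     (\<exists>f. smooth_on UNIV f \<and> (\<forall>g\<in>G'. \<forall>m. f (g *v m) = f m) \<and> (\<forall>m. F (plane_class m) = f m))"
  by (auto simp: poisson_quotient_def quotient_space_def Let_def)

lemma invariant_act:
  assumes "\<forall>g\<in>G'. \<forall>m. f (g *v m) = f m" "e = 1 \<or> e = - 1"
  shows "f (plane_act n e m) = f m"
  using assms(1) G'_I[OF assms(2), of n] G'_act[of n e m] by metis

section \<open>The discrete action off the axis\<close>

abbreviation off_axis :: "(real^2) set" where "off_axis \<equiv> {m. m$2 \<noteq> 0}"

lemma open_off_axis: "open off_axis"
  by (intro open_Collect_neq continuous_intros)

lemma closure_off_axis: "closure off_axis = UNIV"
proof (rule set_eqI, rule iffI)
  fix m :: "real^2" assume "m \<in> UNIV"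
  show "m \<in> closure off_axis"
    unfolding closure_approachable
  proof (intro allI impI)
    fix e :: real assume e: "0 < e"
    let ?m = "vector [m$1, if m$2 = 0 then e/2 else m$2] :: real^2"
    have "norm (?m - m) \<le> (\<Sum>i\<in>UNIV. \<bar>(?m - m) $ i\<bar>)" by (rule norm_le_l1_cart)
    also have "\<dots> < e" using e by (auto simp: sum_2)
    finally show "\<exists>y\<in>off_axis. dist y m < e" using e by (intro bexI[of _ ?m]) (auto simp: dist_norm)
  qed
qed simp

lemma off_axis_saturated: "plane_rel `` off_axis \<subseteq> off_axis"
  by (auto simp: plane_rel_eq orbit_or_axis_def)

lemma free_off_axis: "free_on G' (mat 1) (*v) off_axis"
  unfolding free_on_def
proof (intro ballI impI)
  fix g m assume g: "g \<in> G'" and m: "m \<in> off_axis" "g *v m = m"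
  obtain n e where ne: "e = 1 \<or> e = - 1" "g = vector [vector [1, of_int n], vector [0, e]]" "(*v) g = plane_act n e"
    using g by (rule G'_E)
  have "n = 0" "e = 1" using m ne by (auto simp: vec2_eq_iff)
  then show "g = mat 1" unfolding ne(2) by (simp add: vec_eq_iff forall_2 mat_def)
qed

text \<open>A nontrivial shift moves \<open>p\<close> by at least \<open>\<bar>q\<bar>\<close>, and
  a reflection moves \<open>q\<close> by \<open>2 * \<bar>q\<bar>\<close>; hence the radius of the
  ball.\<close>

lemma discrete_off_axis: "discrete_orbits_on euclidean_smooth G' (*v) off_axis"
  unfolding discrete_orbits_on_def euclidean_topology
proof (intro ballI)
  fix m :: "real^2" assume m: "m \<in> off_axis"
  have "g *v m = m" if g: "g \<in> G'" "g *v m \<in> ball m \<bar>m$2\<bar>" for g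
  proof -
    obtain n e where ne: "e = 1 \<or> e = - 1" "(*v) g = plane_act n e" using g(1) by (rule G'_E)
    have d: "norm (m - plane_act n e m) < \<bar>m$2\<bar>" using g(2) ne(2) by (simp add: dist_norm)
    have "\<bar>(m - plane_act n e m) $ i\<bar> < \<bar>m$2\<bar>" for i
      using component_le_norm_cart[of "m - plane_act n e m" i] d by linarith
    from this[of 1] this[of 2] have b: "\<bar>of_int n\<bar> * \<bar>m$2\<bar> < 1 * \<bar>m$2\<bar>" "\<bar>m$2 - e * m$2\<bar> < \<bar>m$2\<bar>"
      by (simp_all add: abs_mult)
    have "\<bar>of_int n :: real\<bar> < 1" using b(1) by (rule mult_right_less_imp_less) simp
    then have "n = 0" by linarith
    moreover have "e = 1" using b(2) ne(1) by auto
    ultimately show ?thesis using ne(2) by (simp add: vec2_eq_iff)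
  qed
  then show "\<exists>W. openin euclidean W \<and> m \<in> W \<and> (\<forall>g\<in>G'. g *v m \<in> W \<longrightarrow> g *v m = m)"
    using m by (intro exI[of _ "ball m \<bar>m$2\<bar>"]) (auto simp: open_openin[symmetric])
qed

text \<open>On a compact set off the axis \<open>\<bar>q\<bar>\<close> is bounded below and
  \<open>\<bar>p\<bar>\<close> above; as \<open>n * q\<close> is a difference of two values of
  \<open>p\<close>, only finitely many \<open>n\<close> occur.\<close>

lemma proper_off_axis: "proper_on euclidean_smooth G' (*v) off_axis"
  unfolding proper_on_def euclidean_topology compactin_euclidean_iff
proof (intro allI impI)
  fix K :: "(real^2) set" assume K: "K \<subseteq> off_axis" "compact K"
  show "finite {g \<in> G'. (*v) g ` K \<inter> K \<noteq> {}}"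
  proof (cases "K = {}")
    case False
    have "continuous_on K (\<lambda>m. \<bar>m$2\<bar>)" by (intro continuous_intros)
    then obtain m0 where m0: "m0 \<in> K" "\<And>m. m \<in> K \<Longrightarrow> \<bar>m0$2\<bar> \<le> \<bar>m$2\<bar>"
      using continuous_attains_inf[OF K(2) False] by blast
    have d: "0 < \<bar>m0$2\<bar>" using m0(1) K(1) by auto
    obtain C where C: "\<And>m. m \<in> K \<Longrightarrow> norm m \<le> C"
      using compact_imp_bounded[OF K(2)] unfolding bounded_iff by blast
    let ?B = "\<lceil>2 * C / \<bar>m0$2\<bar>\<rceil>"
    have "{g \<in> G'. (*v) g ` K \<inter> K \<noteq> {}} \<subseteq>
        (\<lambda>(n, e). vector [vector [1, of_int n], vector [0, e]]) ` ({- ?B..?B} \<times> {1, - 1})"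
    proof
      fix g assume "g \<in> {g \<in> G'. (*v) g ` K \<inter> K \<noteq> {}}"
      then obtain m where g: "g \<in> G'" "m \<in> K" "g *v m \<in> K" by auto
      obtain n e where ne: "e = 1 \<or> e = - 1" "g = vector [vector [1, of_int n], vector [0, e]]" "(*v) g = plane_act n e"
        using g(1) by (rule G'_E)
      have "\<bar>(g *v m) $ 1\<bar> \<le> C" "\<bar>m$1\<bar> \<le> C"
        using component_le_norm_cart[of "g *v m" 1] component_le_norm_cart[of m 1] C[OF g(2)] C[OF g(3)] by linarith+
      then have "\<bar>of_int n * m$2\<bar> \<le> 2 * C" unfolding ne(3) by simp
      then have "\<bar>of_int n\<bar> * \<bar>m$2\<bar> \<le> 2 * C" by (simp add: abs_mult)
      moreover have "\<bar>of_int n\<bar> * \<bar>m0$2\<bar> \<le> \<bar>of_int n\<bar> * \<bar>m$2\<bar>" using m0(2)[OF g(2)] by (intro mult_left_mono) auto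
      ultimately have "\<bar>of_int n\<bar> * \<bar>m0$2\<bar> \<le> 2 * C" by linarith
      then have "\<bar>of_int n\<bar> \<le> 2 * C / \<bar>m0$2\<bar>" using d by (simp add: field_simps)
      then have "n \<in> {- ?B..?B}" by simp linarith
      then show "g \<in> (\<lambda>(n, e). vector [vector [1, of_int n], vector [0, e]]) ` ({- ?B..?B} \<times> {1, - 1})"
        using ne(1,2) by (intro image_eqI[of _ _ "(n, e)"]) auto
    qed
    then show ?thesis by (rule finite_subset) (intro finite_imageI finite_cartesian_product finite_atLeastAtMost_int, simp)
  qed simp
qed

section \<open>Borel's theorem\<close>

lemma smooth_on_DERIV:
  "smooth_on S f \<Longrightarrow> x \<in> S \<Longrightarrow> (f has_real_derivative frechet_derivative f (at x) 1) (at x)"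
  using directional_DERIV[of S f 0 x 1] by simp

definition cutoff :: "real \<Rightarrow> real" where
  "cutoff t = smooth_step (2 - t^2)"

lemma smooth_on_cutoff: "smooth_on UNIV cutoff"
  unfolding cutoff_def[abs_def]
  by (rule smooth_on_compose[OF smooth_on_smooth_step]) (auto intro!: smooth_intros)

lemma cutoff_eq_1: "\<bar>t\<bar> \<le> 1 \<Longrightarrow> cutoff t = 1"
  unfolding cutoff_def using abs_square_le_1[of t] by (intro smooth_step_eq) simp

lemma cutoff_eq_0: "2 \<le> \<bar>t\<bar> \<Longrightarrow> cutoff t = 0"
proof -
  assume "2 \<le> \<bar>t\<bar>"
  then have "2^2 \<le> \<bar>t\<bar>^2" by (intro power_mono) auto
  then show ?thesis unfolding cutoff_def by (intro smooth_step_eq) simp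
qed

lemma cutoff_bounds: "0 \<le> cutoff t" "cutoff t \<le> 1"
proof -
  have "0 \<le> flat_exp 0 t" for t by (simp add: flat_exp_def)
  then show "0 \<le> cutoff t" "cutoff t \<le> 1"
    using smooth_step_denominator[of "2 - t^2"] by (auto simp: cutoff_def smooth_step_def)
qed

definition nth_deriv :: "nat \<Rightarrow> (real \<Rightarrow> real) \<Rightarrow> real \<Rightarrow> real" where
  "nth_deriv n f = ((\<lambda>f x. frechet_derivative f (at x) 1) ^^ n) f"

lemma nth_deriv_0 [simp]: "nth_deriv 0 f = f"
  by (simp add: nth_deriv_def)

lemma smooth_on_nth_deriv: "smooth_on UNIV f \<Longrightarrow> smooth_on UNIV (nth_deriv n f)"
  by (induction n) (auto simp: nth_deriv_def intro: smooth_on_frechet)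

lemma DERIV_nth_deriv:
  "smooth_on UNIV f \<Longrightarrow> (nth_deriv n f has_real_derivative nth_deriv (Suc n) f x) (at x)"
  using smooth_on_DERIV[OF smooth_on_nth_deriv, of f x n] by (simp add: nth_deriv_def)

lemma nth_deriv_bounded:
  assumes f: "smooth_on UNIV f" and z: "\<And>t. 2 < \<bar>t\<bar> \<Longrightarrow> f t = 0"
  shows "\<exists>B. \<forall>t. \<bar>nth_deriv n f t\<bar> \<le> B"
proof -
  have z': "nth_deriv n f t = 0" if "2 < \<bar>t\<bar>" for t
    using that
  proof (induction n arbitrary: t)
    case (Suc n)
    have o: "open {t::real. 2 < \<bar>t\<bar>}" by (intro open_Collect_less continuous_intros)
    have "(nth_deriv n f has_real_derivative 0) (at t)"
      by (rule has_field_derivative_transform_within_open[OF DERIV_const o]) (use Suc in auto)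
    then show ?case using DERIV_unique DERIV_nth_deriv[OF f] by blast
  qed (use z in simp)
  have "bounded (nth_deriv n f ` {-2..2})"
    by (intro compact_imp_bounded compact_continuous_image)
      (auto intro: continuous_on_subset[OF smooth_on_continuous[OF smooth_on_nth_deriv[OF f]]])
  then obtain B where "\<forall>y\<in>nth_deriv n f ` {-2..2}. norm y \<le> B" unfolding bounded_iff ..
  then have B: "\<bar>nth_deriv n f t\<bar> \<le> B" if "t \<in> {-2..2}" for t using that by simp
  have "\<bar>nth_deriv n f t\<bar> \<le> max B 0" for t
    using B[of t] z'[of t] by (cases "2 < \<bar>t\<bar>") (auto simp: le_max_iff_disj not_less abs_le_iff)
  then show ?thesis by blast
qed

text \<open>The function is the series of \<open>c j * t^j * cutoff (l j * t)\<close>, with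
  \<open>l j\<close> so large that it can be differentiated termwise any number of times. The
  conclusion is the asymptotic expansion from the right, the form in which \<open>h\<close> is
  compared with a Taylor polynomial.\<close>

theorem borel:
  fixes c :: "nat \<Rightarrow> real"
  obtains h where "smooth_on UNIV h"
    "\<And>N. \<exists>C. \<forall>t\<in>{0..1}. \<bar>h t - (\<Sum>j<N. c j * t^j)\<bar> \<le> C * t^N"
proof -
  define \<psi> where "\<psi> j t = t^j * cutoff t" for j and t :: real
  have \<psi>: "smooth_on UNIV (\<psi> j)" for j
    unfolding \<psi>_def[abs_def] by (intro smooth_intros smooth_on_cutoff) auto
  have "\<exists>B. \<forall>t. \<bar>nth_deriv n (\<psi> j) t\<bar> \<le> B" for n j
    by (rule nth_deriv_bounded[OF \<psi>]) (simp add: \<psi>_def cutoff_eq_0)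
  then obtain B where B: "\<And>n j t. \<bar>nth_deriv n (\<psi> j) t\<bar> \<le> B n j" by metis
  have B0: "0 \<le> B n j" for n j using B[of n j 0] by simp
  \<comment> \<open>Bounds the derivatives of order below \<open>j\<close> of the
    \<open>j\<close>-th function; for a given order this leaves out only finitely many terms of the
    series.\<close>
  define M where "M j = (\<Sum>n<j. B n j)" for j
  have M: "B n j \<le> M j" if "n < j" for n j
    unfolding M_def by (rule member_le_sum) (use that B0 in auto)
  have M0: "0 \<le> M j" for j by (simp add: M_def sum_nonneg B0)
  \<comment> \<open>Chosen to make \<open>l2\<close> true: one factor \<open>1 / l j\<close>
    outweighs the coefficient and the derivative bounds, up to \<open>(1/2)^j\<close>. The summand
    \<open>1\<close> ensures \<open>1 \<le> l j\<close>.\<close>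
  define l where "l j = 1 + 2^j * \<bar>c j\<bar> * (1 + M j)" for j
  have l1: "1 \<le> l j" for j using M0[of j] by (simp add: l_def)
  have l2: "\<bar>c j\<bar> * (1 + M j) / l j \<le> (1/2)^j" for j
  proof -
    have "\<bar>c j\<bar> * (1 + M j) * 2^j \<le> l j" by (simp add: l_def mult.assoc mult.left_commute)
    then show ?thesis using l1[of j] by (simp add: field_simps power_one_over)
  qed
  \<comment> \<open>The \<open>n\<close>-th derivative of
    \<open>c j * t^j * cutoff (l j * t)\<close>, which equals
    \<open>c j / l j ^ j * \<psi> j (l j * t)\<close>.\<close>
  define T where "T n j t = c j * l j ^ n / l j ^ j * nth_deriv n (\<psi> j) (l j * t)" for n j t
  have D: "(T n j has_real_derivative T (Suc n) j t) (at t)" for n j t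
  proof -
    have "((\<lambda>t. nth_deriv n (\<psi> j) (l j * t)) has_real_derivative nth_deriv (Suc n) (\<psi> j) (l j * t) * l j) (at t)"
      by (rule DERIV_chain2[OF DERIV_nth_deriv[OF \<psi>]]) (auto intro!: derivative_eq_intros)
    from DERIV_cmult[OF this, of "c j * l j ^ n / l j ^ j"] show ?thesis
      unfolding T_def[abs_def] by (simp add: mult_ac)
  qed
  \<comment> \<open>Since \<open>n < j\<close>, at least one factor \<open>1 / l j\<close> survives
    the chain rule.\<close>
  have bnd: "norm (T n j t) \<le> (1/2)^j" if "n < j" for n j t
  proof -
    obtain i where i: "j = Suc (n + i)" using less_imp_Suc_add[OF \<open>n < j\<close>] by blast
    have "\<bar>T n j t\<bar> = \<bar>c j\<bar> * l j^n / l j^j * \<bar>nth_deriv n (\<psi> j) (l j * t)\<bar>"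
      using l1[of j] by (simp add: T_def abs_mult)
    also have "\<dots> \<le> \<bar>c j\<bar> * l j^n / l j^j * (1 + M j)"
      using B[of n j "l j * t"] M[OF that] l1[of j] by (intro mult_left_mono) auto
    also have "\<dots> = \<bar>c j\<bar> * (1 + M j) / l j / l j ^ i"
      using l1[of j] unfolding i by (simp add: power_add field_simps)
    also have "\<dots> \<le> \<bar>c j\<bar> * (1 + M j) / l j / 1"
      using l1[of j] M0[of j] by (intro divide_left_mono) auto
    finally show ?thesis using l2[of j] by simp
  qed
  have ev: "\<forall>\<^sub>F j in sequentially. \<forall>t\<in>UNIV. norm (T n j t) \<le> (1/2)^j" for n
    using eventually_gt_at_top[of n] by eventually_elim (use bnd in blast)
  have uc: "uniformly_convergent_on UNIV (\<lambda>m t. \<Sum>j<m. T n j t)" for n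
    by (rule Weierstrass_m_test'_ev[OF ev]) simp
  have sm: "summable (\<lambda>j. T n j t)" for n t
    by (rule summable_comparison_test_ev[OF _ summable_geometric[of "1/2"]])
      (use ev[of n] in \<open>auto elim: eventually_mono\<close>)
  define H where "H n t = suminf (\<lambda>j. T n j t)" for n t
  have "(H n has_real_derivative H (Suc n) t) (at t)" for n t
    unfolding H_def[abs_def]
    by (rule has_field_derivative_series'(2)[of UNIV "T n" "T (Suc n)" 0 t])
      (use D uc sm in auto)
  then have H: "smooth_on UNIV (H 0)" by (intro smooth_on_DERIV_sequence) auto
  have T0: "T 0 j t = c j * t^j * cutoff (l j * t)" for j t
    using l1[of j] by (simp add: T_def \<psi>_def power_mult_distrib)
  have "\<exists>C. \<forall>t\<in>{0..1}. \<bar>H 0 t - (\<Sum>j<N. c j * t^j)\<bar> \<le> C * t^N" for N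
  proof -
    \<comment> \<open>For \<open>j < N\<close> the term differs from \<open>c j * t^j\<close> only
      where \<open>1 \<le> l j * t\<close>, and there \<open>(l j * t)^N\<close> is at least
      \<open>1\<close>. For \<open>j > N\<close> the cutoff forces \<open>l j * t \<le> 2\<close>,
      so one extra factor \<open>t\<close> is at most \<open>2 / l j\<close>.\<close>
    define K where "K j = (if j < Suc N then \<bar>c j\<bar> * l j ^ N else 2 * (1/2)^j)" for j
    have K: "summable K"
    proof (rule summable_comparison_test_ev)
      show "\<forall>\<^sub>F j in sequentially. norm (K j) \<le> 2 * (1/2)^j"
        using eventually_gt_at_top[of N] by eventually_elim (simp add: K_def)
    qed (simp add: summable_mult)
    have le: "\<bar>T 0 j t - (if j < N then c j * t^j else 0)\<bar> \<le> K j * t^N" if t: "t \<in> {0..1}" for j t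
    proof -
      have lt: "0 \<le> l j * t" using l1[of j] t by simp
      consider "j < N" "l j * t \<le> 1" | "j < N" "1 \<le> l j * t" | "j = N" | "N < j" "2 \<le> l j * t" | "N < j" "l j * t \<le> 2"
        by linarith
      then show ?thesis
      proof cases
        case 1
        then show ?thesis using lt t l1[of j] by (simp add: T0 cutoff_eq_1 K_def)
      next
        case 2
        have "\<bar>T 0 j t - c j * t^j\<bar> = \<bar>c j\<bar> * t^j * \<bar>cutoff (l j * t) - 1\<bar>"
        proof -
          have "T 0 j t - c j * t^j = c j * t^j * (cutoff (l j * t) - 1)" by (simp add: T0 algebra_simps)
          then show ?thesis using t by (simp add: abs_mult)
        qed
        also have "\<dots> \<le> \<bar>c j\<bar> * 1 * 1"
          using cutoff_bounds[of "l j * t"] t by (intro mult_mono) (auto simp: power_le_one)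
        also have "\<dots> \<le> \<bar>c j\<bar> * (l j * t)^N" using 2 by (simp add: mult_le_cancel_left1)
        finally show ?thesis using 2 by (simp add: K_def power_mult_distrib mult.assoc)
      next
        case 3
        have "\<bar>T 0 j t\<bar> = \<bar>c j\<bar> * cutoff (l j * t) * t^j"
          using t cutoff_bounds[of "l j * t"] by (simp add: T0 abs_mult)
        also have "\<dots> \<le> \<bar>c j\<bar> * l j ^ N * t^j"
          using cutoff_bounds[of "l j * t"] t one_le_power[OF l1, of j N]
          by (intro mult_right_mono mult_left_mono) auto
        finally show ?thesis using 3 by (simp add: K_def)
      next
        case 4
        then show ?thesis using lt t by (simp add: T0 cutoff_eq_0 K_def)
      next
        case 5
        obtain i where i: "j = Suc (N + i)" using less_imp_Suc_add[OF \<open>N < j\<close>] by blast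
        have "\<bar>T 0 j t\<bar> = \<bar>c j\<bar> * t * t^i * cutoff (l j * t) * t^N"
          using t cutoff_bounds[of "l j * t"] unfolding i by (simp add: T0 abs_mult power_add)
        also have "\<dots> \<le> \<bar>c j\<bar> * t * 1 * 1 * t^N"
          using cutoff_bounds[of "l j * t"] t by (intro mult_right_mono mult_mono) (auto simp: power_le_one)
        also have "\<dots> \<le> 2 * (1/2)^j * t^N"
        proof (rule mult_right_mono)
          have "\<bar>c j\<bar> * t \<le> \<bar>c j\<bar> * (2 / l j)"
            using 5 l1[of j] by (intro mult_left_mono) (auto simp: field_simps)
          also have "\<dots> \<le> 2 * (\<bar>c j\<bar> * (1 + M j) / l j)"
          proof -
            have "\<bar>c j\<bar> \<le> \<bar>c j\<bar> * (1 + M j)" using M0[of j] by (simp add: mult_le_cancel_left1)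
            then show ?thesis using l1[of j] by (simp add: divide_right_mono)
          qed
          also have "\<dots> \<le> 2 * (1/2)^j" using l2[of j] by simp
          finally show "\<bar>c j\<bar> * t * 1 * 1 \<le> 2 * (1/2)^j" by simp
        qed (use t in simp)
        finally show ?thesis using 5 by (simp add: K_def)
      qed
    qed
    have "\<bar>H 0 t - (\<Sum>j<N. c j * t^j)\<bar> \<le> suminf K * t^N" if t: "t \<in> {0..1}" for t
    proof -
      have s: "(\<lambda>j. if j < N then c j * t^j else 0) sums (\<Sum>j<N. c j * t^j)"
        using sums_If_finite_set[of "{..<N}" "\<lambda>j. c j * t^j"] by simp
      have "(\<lambda>j. T 0 j t - (if j < N then c j * t^j else 0)) sums (H 0 t - (\<Sum>j<N. c j * t^j))"
        unfolding H_def by (rule sums_diff[OF summable_sums[OF sm] s])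
      then have e: "H 0 t - (\<Sum>j<N. c j * t^j) = (\<Sum>j. T 0 j t - (if j < N then c j * t^j else 0))"
        by (rule sums_unique)
      have "norm (\<Sum>j. T 0 j t - (if j < N then c j * t^j else 0)) \<le> (\<Sum>j. K j * t^N)"
        by (rule norm_suminf_le) (use le[OF t] K in \<open>auto intro: summable_mult2\<close>)
      then show ?thesis using e suminf_mult2[OF K, of "t^N"] by simp
    qed
    then show ?thesis by blast
  qed
  then show thesis using H that by blast
qed

section \<open>Flat invariant functions\<close>

abbreviation shift_invariant :: "(real^2 \<Rightarrow> real) \<Rightarrow> bool" where
  "shift_invariant r \<equiv> (\<forall>n v. r (plane_act n 1 v) = r v)"

definition flat_bound :: "(real^2 \<Rightarrow> real) \<Rightarrow> bool" where
  "flat_bound r \<longleftrightarrow> (\<forall>N. \<exists>C. \<forall>v. 0 < v$2 \<and> v$2 \<le> 1 \<longrightarrow> \<bar>r v\<bar> \<le> C * (v$2)^N)"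

text \<open>Invariance is asked for the shifts only: if \<open>r\<close> is even in
  \<open>q\<close>, then \<open>angular r\<close> is odd, and the class has to be closed under
  \<open>angular\<close> and \<open>radial\<close>.\<close>

definition flat :: "(real^2 \<Rightarrow> real) \<Rightarrow> bool" where
  "flat r \<longleftrightarrow> smooth_on UNIV r \<and> shift_invariant r \<and> flat_bound r"

lemma partial_plane_act:
  assumes f: "smooth_on UNIV f" and inv: "\<And>v. f (plane_act n e v) = f v"
  shows "partial f 1 v = partial f 1 (plane_act n e v)"
    and "partial f 2 v = n * partial f 1 (plane_act n e v) + e * partial f 2 (plane_act n e v)"
proof -
  have bl: "bounded_linear (plane_act n e)"
    by (rule linear_conv_bounded_linear[THEN iffD1]) (auto intro!: linearI simp: vec2_eq_iff algebra_simps)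
  have "((\<lambda>v. f (plane_act n e v)) has_derivative
      (\<lambda>w. frechet_derivative f (at (plane_act n e v)) (plane_act n e w))) (at v)"
    by (rule has_derivative_compose[OF bounded_linear_imp_has_derivative[OF bl]
        smooth_on_has_derivative[OF f]]) simp
  then have d: "frechet_derivative f (at v) w = frechet_derivative f (at (plane_act n e v)) (plane_act n e w)" for w
    using frechet_derivative_at inv by (metis (no_types, lifting) ext)
  have df: "f differentiable (at x)" for x using smooth_on_differentiable[OF f] by simp
  show "partial f 1 v = partial f 1 (plane_act n e v)"
    unfolding d[of "axis 1 1"] by (subst partial_frechet[OF df]) (simp add: sum_2 axis_def)
  show "partial f 2 v = n * partial f 1 (plane_act n e v) + e * partial f 2 (plane_act n e v)"
    unfolding d[of "axis 2 1"] by (subst partial_frechet[OF df]) (simp add: sum_2 axis_def)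
qed

lemma smooth_bounded_strip:
  assumes f: "smooth_on UNIV (f :: real^2 \<Rightarrow> real)"
  obtains B where "0 \<le> B" "\<And>v. \<bar>v$1\<bar> \<le> 1 \<Longrightarrow> \<bar>v$2\<bar> \<le> 1 \<Longrightarrow> \<bar>f v\<bar> \<le> B"
proof -
  have "bounded (f ` cball 0 2)"
    by (intro compact_imp_bounded compact_continuous_image)
      (auto intro: continuous_on_subset[OF smooth_on_continuous[OF f]])
  then obtain B where B: "\<forall>y\<in>f ` cball 0 2. norm y \<le> B" unfolding bounded_iff ..
  have "\<bar>f v\<bar> \<le> max B 0" if "\<bar>v$1\<bar> \<le> 1" "\<bar>v$2\<bar> \<le> 1" for v
  proof -
    have "norm v \<le> 2" using norm_le_l1_cart[of v] that by (simp add: sum_2)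
    then show ?thesis using B by (auto simp: le_max_iff_disj)
  qed
  then show thesis using that[of "max B 0"] by simp
qed

lemma shift_reduce:
  assumes "0 < v$2"
  obtains n where "0 \<le> plane_act n 1 v $ 1" "plane_act n 1 v $ 1 \<le> v$2" "plane_act n 1 v $ 2 = v$2"
proof -
  have "0 \<le> plane_act (- \<lfloor>v$1 / v$2\<rfloor>) 1 v $ 1" "plane_act (- \<lfloor>v$1 / v$2\<rfloor>) 1 v $ 1 \<le> v$2"
    using floor_divide_lower[OF assms, of "v$1"] floor_divide_upper[OF assms, of "v$1"]
    by (auto simp: plane_act_nth algebra_simps)
  then show thesis using that[of "- \<lfloor>v$1 / v$2\<rfloor>"] by (simp add: plane_act_nth)
qed

lemma line_mean_value:
  fixes f :: "real^2 \<Rightarrow> real"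
  assumes f: "smooth_on UNIV f"
    and B: "\<And>x. x \<in> {min s t..max s t} \<Longrightarrow> \<bar>frechet_derivative f (at (v + x *\<^sub>R u)) u\<bar> \<le> B"
  shows "\<bar>f (v + t *\<^sub>R u) - f (v + s *\<^sub>R u)\<bar> \<le> \<bar>t - s\<bar> * B"
proof -
  let ?f' = "\<lambda>x. frechet_derivative f (at (v + x *\<^sub>R u)) u"
  have "norm (f (v + t *\<^sub>R u) - f (v + s *\<^sub>R u)) \<le> B * norm (t - s)"
  proof (rule field_differentiable_bound[where S = "{min s t..max s t}" and f = "\<lambda>x. f (v + x *\<^sub>R u)" and f' = ?f'])
    show "((\<lambda>x. f (v + x *\<^sub>R u)) has_field_derivative ?f' x) (at x within {min s t..max s t})" for x
      by (rule has_field_derivative_at_within, rule directional_DERIV[OF f]) simp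
    show "norm (?f' x) \<le> B" if "x \<in> {min s t..max s t}" for x using B[OF that] by simp
  qed (auto simp: convex_closed_interval)
  then show ?thesis by (simp only: real_norm_def mult.commute)
qed

lemma mean_value_point:
  fixes f :: "real^2 \<Rightarrow> real"
  assumes f: "smooth_on UNIV f" and "0 < t"
  obtains x where "0 < x" "x < t" "f (v + t *\<^sub>R u) - f v = t * frechet_derivative f (at (v + x *\<^sub>R u)) u"
proof -
  have "\<exists>x. 0 < x \<and> x < t \<and>
      f (v + t *\<^sub>R u) - f (v + 0 *\<^sub>R u) = (t - 0) * frechet_derivative f (at (v + x *\<^sub>R u)) u"
    by (rule MVT2[OF \<open>0 < t\<close>]) (rule directional_DERIV[OF f], simp)
  then show thesis using that by auto
qed

lemma shift_invariant_partial1: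
  assumes "smooth_on UNIV g" "shift_invariant g"
  shows "shift_invariant (partial g 1)"
  using partial_plane_act(1)[of g _ 1] assms by metis

text \<open>Induction on the exponent for all \<open>g\<close> at once: over one period the
  derivative in \<open>p\<close> has a zero within distance \<open>q\<close>, and the hypothesis
  applied to this derivative bounds its slope. Each step gains a factor \<open>q\<close>.\<close>

lemma partial1_flat:
  assumes "smooth_on UNIV g" "shift_invariant g"
  shows "\<exists>C\<ge>0. \<forall>v. 0 < v$2 \<and> v$2 \<le> 1 \<and> 0 \<le> v$1 \<and> v$1 \<le> v$2 \<longrightarrow> \<bar>partial g 1 v\<bar> \<le> C * (v$2)^j"
  using assms
proof (induction j arbitrary: g)
  case 0
  obtain B where "0 \<le> B" "\<And>v. \<bar>v$1\<bar> \<le> 1 \<Longrightarrow> \<bar>v$2\<bar> \<le> 1 \<Longrightarrow> \<bar>partial g 1 v\<bar> \<le> B"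
    by (rule smooth_bounded_strip[OF smooth_on_frechet[OF 0(1), of "axis 1 1"]]) blast
  then show ?case by (intro exI[of _ B]) auto
next
  case (Suc j)
  have p: "smooth_on UNIV (partial g 1)" "shift_invariant (partial g 1)"
    using smooth_on_frechet[OF Suc.prems(1)] shift_invariant_partial1[OF Suc.prems] by auto
  obtain C where C: "0 \<le> C" "\<And>v. 0 < v$2 \<Longrightarrow> v$2 \<le> 1 \<Longrightarrow> 0 \<le> v$1 \<Longrightarrow> v$1 \<le> v$2 \<Longrightarrow>
      \<bar>partial (partial g 1) 1 v\<bar> \<le> C * (v$2)^j"
    using Suc.IH[OF p] by blast
  have "\<bar>partial g 1 v\<bar> \<le> C * (v$2)^Suc j" if v: "0 < v$2" "v$2 \<le> 1" "0 \<le> v$1" "v$1 \<le> v$2" for v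
  proof -
    define w :: "real^2" where "w = vector [0, v$2]"
    have w: "v = w + v$1 *\<^sub>R axis 1 1" "w + v$2 *\<^sub>R axis 1 1 = plane_act 1 1 w"
      by (auto simp: w_def vec2_eq_iff plane_act_nth axis_def)
    obtain x where x: "0 < x" "x < v$2"
      "g (w + v$2 *\<^sub>R axis 1 1) - g w = v$2 * partial g 1 (w + x *\<^sub>R axis 1 1)"
      by (rule mean_value_point[OF Suc.prems(1) v(1)])
    have "partial g 1 (w + x *\<^sub>R axis 1 1) = 0" using x v Suc.prems(2) by (simp add: w(2))
    moreover have "\<bar>partial g 1 (w + v$1 *\<^sub>R axis 1 1) - partial g 1 (w + x *\<^sub>R axis 1 1)\<bar> \<le> \<bar>v$1 - x\<bar> * (C * (v$2)^j)"
    proof (rule line_mean_value[OF p(1)])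
      fix s assume "s \<in> {min x (v$1)..max x (v$1)}"
      then show "\<bar>partial (partial g 1) 1 (w + s *\<^sub>R axis 1 1)\<bar> \<le> C * (v$2)^j"
        using C(2)[of "w + s *\<^sub>R axis 1 1"] v x by (auto simp: w_def axis_def)
    qed
    ultimately have "\<bar>partial g 1 v\<bar> \<le> \<bar>v$1 - x\<bar> * (C * (v$2)^j)" by (simp flip: w(1))
    also have "\<dots> \<le> v$2 * (C * (v$2)^j)"
      using C(1) v x by (intro mult_right_mono) auto
    finally show ?thesis by (simp add: mult_ac)
  qed
  then show ?case using C(1) by blast
qed

text \<open>An interpolation argument: as \<open>r\<close> is flat, the mean value theorem makes the
  derivative small at some nearby point, and the bounded second derivative carries this over to
  \<open>v\<close>.\<close>

lemma flat_partial_bound: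
  assumes "flat r" and u: "0 \<le> u$1" "u$1 \<le> 1" "0 \<le> u$2" "u$2 \<le> 1"
  shows "\<exists>C\<ge>0. \<forall>v. 0 < v$2 \<and> v$2 \<le> 1 \<and> 0 \<le> v$1 \<and> v$1 \<le> v$2 \<longrightarrow>
    \<bar>frechet_derivative r (at v) u\<bar> \<le> C * (v$2)^N"
proof -
  have sm: "smooth_on UNIV r" and fb: "flat_bound r" using assms by (auto simp: flat_def)
  let ?d = "\<lambda>v. frechet_derivative r (at v) u"
  obtain B where B: "0 \<le> B" "\<And>v. \<bar>v$1\<bar> \<le> 1 \<Longrightarrow> \<bar>v$2\<bar> \<le> 1 \<Longrightarrow> \<bar>frechet_derivative ?d (at v) u\<bar> \<le> B"
    by (rule smooth_bounded_strip[OF smooth_on_frechet[OF smooth_on_frechet[OF sm, of u], of u]]) blast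
  \<comment> \<open>The exponent \<open>2 * N + 1\<close> pays for the division by a step length of
    order \<open>q^(N+1)\<close> and leaves \<open>q^N\<close>.\<close>
  obtain C where C: "\<And>v. 0 < v$2 \<Longrightarrow> v$2 \<le> 1 \<Longrightarrow> \<bar>r v\<bar> \<le> C * (v$2)^(2 * N + 1)"
    using fb unfolding flat_bound_def by blast
  have C0: "0 \<le> C" using C[of "vector [0, 1]"] by simp
  have "\<bar>?d v\<bar> \<le> (C * 4 + B) * (v$2)^N" if v: "0 < v$2" "v$2 \<le> 1" "0 \<le> v$1" "v$1 \<le> v$2" for v
  proof -
    \<comment> \<open>At most \<open>q / 2\<close>, so that stepping back from \<open>v\<close>
      along \<open>u\<close>, whose entries are between \<open>0\<close> and \<open>1\<close>, keeps
      the second coordinate between \<open>q / 2\<close> and \<open>q\<close>.\<close>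
    define e where "e = (v$2)^(N+1) / 2"
    have qN: "v$2 * (v$2)^N \<le> v$2 * 1" "v$2 * (v$2)^N \<le> 1 * (v$2)^N" "0 \<le> (v$2)^N"
      using v by (auto intro!: mult_left_mono mult_right_mono simp: power_le_one)
    have e: "0 < e" "e \<le> (v$2)/2" "e \<le> (v$2)^N" "2 * e = (v$2)^(N+1)"
    proof -
      show "0 < e" using v by (simp add: e_def)
      show "e \<le> v$2 / 2" using qN by (simp add: e_def)
      have "(v$2)^(N+1) / 2 \<le> (v$2)^(N+1)" using v by simp
      then show "e \<le> (v$2)^N" unfolding e_def using qN by simp
    qed (simp add: e_def)
    define w where "w = v + (- e) *\<^sub>R u"
    have w: "w + e *\<^sub>R u = v" by (simp add: w_def)
    have box: "\<bar>(w + s *\<^sub>R u)$1\<bar> \<le> 1" "v$2/2 \<le> (w + s *\<^sub>R u)$2" "(w + s *\<^sub>R u)$2 \<le> v$2"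
      if s: "0 \<le> s" "s \<le> e" for s
    proof -
      have a: "0 \<le> (e - s) * u$i \<and> (e - s) * u$i \<le> e" if "0 \<le> u$i" "u$i \<le> 1" for i
        using mult_mono[of "e - s" e "u$i" 1] that s by simp
      have c: "(w + s *\<^sub>R u)$i = v$i - (e - s) * u$i" for i by (simp add: w_def algebra_simps)
      show "\<bar>(w + s *\<^sub>R u)$1\<bar> \<le> 1" "v$2/2 \<le> (w + s *\<^sub>R u)$2" "(w + s *\<^sub>R u)$2 \<le> v$2"
        unfolding c using a[OF u(1,2)] a[OF u(3,4)] e v by linarith+
    qed
    have rb: "\<bar>r (w + s *\<^sub>R u)\<bar> \<le> C * (v$2)^(2*N+1)" if s: "0 \<le> s" "s \<le> e" for s
    proof -
      have "\<bar>r (w + s *\<^sub>R u)\<bar> \<le> C * ((w + s *\<^sub>R u)$2)^(2*N+1)"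
        by (rule C) (use box[OF s] v in auto)
      also have "\<dots> \<le> C * (v$2)^(2*N+1)"
        using box[OF s] v C0 by (intro mult_left_mono power_mono) auto
      finally show ?thesis .
    qed
    obtain x where x: "0 < x" "x < e" "r (w + e *\<^sub>R u) - r w = e * ?d (w + x *\<^sub>R u)"
      by (rule mean_value_point[OF sm e(1)])
    have "e * \<bar>?d (w + x *\<^sub>R u)\<bar> = \<bar>r (w + e *\<^sub>R u) - r w\<bar>"
      unfolding x(3) abs_mult using e(1) by simp
    also have "\<dots> \<le> 2 * (C * (v$2)^(2*N+1))"
      using rb[of e] rb[of 0] e(1) by simp
    also have "\<dots> = 4 * C * (v$2)^N * e"
    proof -
      have "(v$2)^(2*N+1) = (v$2)^N * (v$2)^(N+1)" by (simp add: mult_2 power_add)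
      then have "(v$2)^(2*N+1) = (v$2)^N * (2 * e)" by (simp only: e(4))
      then show ?thesis by simp
    qed
    finally have 1: "\<bar>?d (w + x *\<^sub>R u)\<bar> \<le> 4 * C * (v$2)^N"
      using e(1) by (simp add: mult.commute[of _ e])
    have "\<bar>?d (w + e *\<^sub>R u) - ?d (w + x *\<^sub>R u)\<bar> \<le> \<bar>e - x\<bar> * B"
    proof (rule line_mean_value[OF smooth_on_frechet[OF sm]])
      fix s assume "s \<in> {min x e..max x e}"
      then have "0 \<le> s" "s \<le> e" using x by auto
      then show "\<bar>frechet_derivative ?d (at (w + s *\<^sub>R u)) u\<bar> \<le> B"
        using box[of s] v by (intro B(2)) auto
    qed
    also have "\<dots> \<le> (v$2)^N * B" using x e B(1) by (intro mult_right_mono) auto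
    finally show ?thesis using 1 unfolding w by (simp add: algebra_simps)
  qed
  then show ?thesis using B(1) C0 by (intro exI[of _ "C * 4 + B"]) auto
qed

text \<open>The strip \<open>0 \<le> p \<le> q\<close> meets every shift orbit in the half-plane
  \<open>q > 0\<close>, and it is bounded for \<open>q \<le> 1\<close>.\<close>

lemma flat_boundI:
  assumes "shift_invariant r"
    and "\<And>N. \<exists>C. \<forall>v. 0 < v$2 \<and> v$2 \<le> 1 \<and> 0 \<le> v$1 \<and> v$1 \<le> v$2 \<longrightarrow> \<bar>r v\<bar> \<le> C * (v$2)^N"
  shows "flat_bound r"
  unfolding flat_bound_def
proof
  fix N
  obtain C where C: "\<And>v. 0 < v$2 \<Longrightarrow> v$2 \<le> 1 \<Longrightarrow> 0 \<le> v$1 \<Longrightarrow> v$1 \<le> v$2 \<Longrightarrow> \<bar>r v\<bar> \<le> C * (v$2)^N"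
    using assms(2)[of N] by blast
  have "\<bar>r v\<bar> \<le> C * (v$2)^N" if v: "0 < v$2" "v$2 \<le> 1" for v
  proof -
    obtain n where n: "0 \<le> plane_act n 1 v $ 1" "plane_act n 1 v $ 1 \<le> v$2" "plane_act n 1 v $ 2 = v$2"
      by (rule shift_reduce[OF v(1)])
    then show ?thesis using C[of "plane_act n 1 v"] v assms(1) by simp
  qed
  then show "\<exists>C. \<forall>v. 0 < v$2 \<and> v$2 \<le> 1 \<longrightarrow> \<bar>r v\<bar> \<le> C * (v$2)^N" by blast
qed

text \<open>Up to constants these are the angular and the radial derivative, in the angle \<open>2\<pi>p/q\<close> and \<open>q\<close>.\<close>

definition angular :: "(real^2 \<Rightarrow> real) \<Rightarrow> real^2 \<Rightarrow> real" where
  "angular r v = v$2 * partial r 1 v"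

definition radial :: "(real^2 \<Rightarrow> real) \<Rightarrow> real^2 \<Rightarrow> real" where
  "radial r v = v$1 * partial r 1 v + v$2 * partial r 2 v"

text \<open>Under a shift the first term of \<open>radial\<close> gains \<open>n * q\<close> times
  the derivative in \<open>p\<close>, and the second loses the same amount; this is why the two
  derivatives occur in this combination.\<close>

lemma flat_angular_radial:
  assumes r: "flat r"
  shows "flat (angular r)" "flat (radial r)"
proof -
  have sm: "smooth_on UNIV r" and inv: "shift_invariant r" using r by (auto simp: flat_def)
  have s: "smooth_on UNIV (angular r)" "smooth_on UNIV (radial r)"
    unfolding angular_def[abs_def] radial_def[abs_def]
    by (auto intro!: smooth_intros smooth_on_frechet[OF sm] simp: smooth_vec_cart)
  have p1: "partial r 1 (plane_act n 1 v) = partial r 1 v" for n v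
    using partial_plane_act(1)[OF sm, of n 1 v] inv by simp
  have p2: "partial r 2 v = n * partial r 1 v + partial r 2 (plane_act n 1 v)" for n v
    using partial_plane_act(2)[OF sm, of n 1 v] inv p1 by simp
  have i1: "shift_invariant (angular r)"
    by (simp add: angular_def plane_act_nth p1)
  have i2: "shift_invariant (radial r)"
  proof (intro allI)
    show "radial r (plane_act n 1 v) = radial r v" for n v
      unfolding radial_def plane_act_nth p1 p2[of v n] by (simp add: algebra_simps)
  qed
  have b: "\<exists>C\<ge>0. \<forall>v. 0 < v$2 \<and> v$2 \<le> 1 \<and> 0 \<le> v$1 \<and> v$1 \<le> v$2 \<longrightarrow> \<bar>partial r i v\<bar> \<le> C * (v$2)^N" for i N
    by (rule flat_partial_bound[OF r]) (auto simp: axis_def)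
  have "\<exists>C. \<forall>v. 0 < v$2 \<and> v$2 \<le> 1 \<and> 0 \<le> v$1 \<and> v$1 \<le> v$2 \<longrightarrow> \<bar>angular r v\<bar> \<le> C * (v$2)^N \<and> \<bar>radial r v\<bar> \<le> C * (v$2)^N" for N
  proof -
    obtain C D where C: "0 \<le> C" "\<And>v. 0 < v$2 \<Longrightarrow> v$2 \<le> 1 \<Longrightarrow> 0 \<le> v$1 \<Longrightarrow> v$1 \<le> v$2 \<Longrightarrow> \<bar>partial r 1 v\<bar> \<le> C * (v$2)^N"
      and D: "0 \<le> D" "\<And>v. 0 < v$2 \<Longrightarrow> v$2 \<le> 1 \<Longrightarrow> 0 \<le> v$1 \<Longrightarrow> v$1 \<le> v$2 \<Longrightarrow> \<bar>partial r 2 v\<bar> \<le> D * (v$2)^N"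
      using b[of 1 N] b[of 2 N] by blast
    have "\<bar>angular r v\<bar> \<le> (C + D) * (v$2)^N \<and> \<bar>radial r v\<bar> \<le> (C + D) * (v$2)^N"
      if v: "0 < v$2" "v$2 \<le> 1" "0 \<le> v$1" "v$1 \<le> v$2" for v
    proof -
      have a: "\<bar>t * d\<bar> \<le> E * (v$2)^N" if "0 \<le> t" "t \<le> 1" "\<bar>d\<bar> \<le> E * (v$2)^N" for t d E
        using mult_mono[OF that(2,3)] that(1) by (simp add: abs_mult)
      have "0 \<le> D * (v$2)^N" using D v by simp
      then show ?thesis using a[OF _ v(2) C(2)[OF v]] a[OF _ v(2) D(2)[OF v]] a[OF v(3) _ C(2)[OF v]] v
        unfolding angular_def radial_def by (simp add: distrib_right)
    qed
    then show ?thesis by blast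
  qed
  note bb = this
  have "\<exists>C. \<forall>v. 0 < v$2 \<and> v$2 \<le> 1 \<and> 0 \<le> v$1 \<and> v$1 \<le> v$2 \<longrightarrow> \<bar>angular r v\<bar> \<le> C * (v$2)^N"
    "\<exists>C. \<forall>v. 0 < v$2 \<and> v$2 \<le> 1 \<and> 0 \<le> v$1 \<and> v$1 \<le> v$2 \<longrightarrow> \<bar>radial r v\<bar> \<le> C * (v$2)^N" for N
    using bb[of N] by blast+
  then have "flat_bound (angular r)" "flat_bound (radial r)"
    using flat_boundI[OF i1] flat_boundI[OF i2] by simp_all
  then show "flat (angular r)" "flat (radial r)" using s i1 i2 by (auto simp: flat_def)
qed

text \<open>On \<open>p = 0\<close> the odd Taylor coefficients at \<open>q = 0\<close> vanish, so
  the series is one in \<open>q^2\<close>, and Borel's theorem realizes it by \<open>h\<close>. The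
  remainder has three parts: the variation in \<open>p\<close> over a period, the Taylor remainder,
  and the error in Borel's theorem.\<close>

lemma even_flat_expansion:
  fixes f :: "real^2 \<Rightarrow> real"
  assumes f: "smooth_on UNIV f" and inv: "shift_invariant f" and ev: "\<And>v. f (plane_act 0 (-1) v) = f v"
  obtains h where "smooth_on UNIV h" "flat (\<lambda>v. f v - h ((v$2)^2))" "h 0 = f 0"
proof -
  define e where "e q = f (vector [0, q])" for q :: real
  have e: "smooth_on UNIV e"
    unfolding e_def[abs_def] by (rule smooth_on_compose[OF f]) (auto intro!: smooth_vec_vector2 smooth_intros)
  have odd0: "nth_deriv n e (- q) = (-1)^n * nth_deriv n e q" for n q
  proof (induction n arbitrary: q)
    case 0
    show ?case using ev[of "vector [0, q]"] by (simp add: e_def plane_act_def)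
  next
    case (Suc n)
    have "((\<lambda>q. nth_deriv n e (- q)) has_real_derivative - nth_deriv (Suc n) e (- q)) (at q)"
      using DERIV_chain2[OF DERIV_nth_deriv[OF e, of n "- q"] DERIV_minus[OF DERIV_ident]] by simp
    moreover have "((\<lambda>q. (-1)^n * nth_deriv n e q) has_real_derivative (-1)^n * nth_deriv (Suc n) e q) (at q)"
      by (rule DERIV_cmult[OF DERIV_nth_deriv[OF e]])
    ultimately have "- nth_deriv (Suc n) e (- q) = (-1)^n * nth_deriv (Suc n) e q"
      unfolding Suc using DERIV_unique by blast
    then show ?case by simp
  qed
  have odd: "nth_deriv (Suc (2 * n)) e 0 = 0" for n using odd0[of "Suc (2 * n)" 0] by simp
  define c where "c j = nth_deriv (2 * j) e 0 / fact (2 * j)" for j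
  obtain h where h: "smooth_on UNIV h"
    "\<And>N. \<exists>C. \<forall>t\<in>{0..1}. \<bar>h t - (\<Sum>j<N. c j * t^j)\<bar> \<le> C * t^N"
    by (rule borel[of c]) blast
  define r where "r v = f v - h ((v$2)^2)" for v
  have sums: "(\<Sum>m<2*N. nth_deriv m e 0 / fact m * q^m) = (\<Sum>j<N. c j * (q^2)^j)" for N and q :: real
    by (induction N) (simp_all add: odd c_def power_mult)
  have inv_r: "shift_invariant r" using inv by (simp add: r_def plane_act_nth)
  have "\<exists>C. \<forall>v. 0 < v$2 \<and> v$2 \<le> 1 \<and> 0 \<le> v$1 \<and> v$1 \<le> v$2 \<longrightarrow> \<bar>r v\<bar> \<le> C * (v$2)^N" for N
  proof -
    obtain A where A: "0 \<le> A" "\<And>v. 0 < v$2 \<Longrightarrow> v$2 \<le> 1 \<Longrightarrow> 0 \<le> v$1 \<Longrightarrow> v$1 \<le> v$2 \<Longrightarrow> \<bar>partial f 1 v\<bar> \<le> A * (v$2)^N"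
      using partial1_flat[OF f inv, of N] by blast
    \<comment> \<open>Taylor expansion to order \<open>n\<close> in \<open>q\<close> corresponds to
      \<open>Suc N\<close> terms in \<open>q^2\<close>.\<close>
    define n where "n = 2 * Suc N"
    obtain C where C: "\<And>t. t \<in> {0..1} \<Longrightarrow> \<bar>h t - (\<Sum>j<Suc N. c j * t^j)\<bar> \<le> C * t^Suc N"
      using h(2)[of "Suc N"] by blast
    have C0: "0 \<le> C" using C[of 1] by simp
    have "bounded (nth_deriv n e ` {0..1})"
      by (intro compact_imp_bounded compact_continuous_image)
        (auto intro: continuous_on_subset[OF smooth_on_continuous[OF smooth_on_nth_deriv[OF e]]])
    then obtain B where "\<forall>y\<in>nth_deriv n e ` {0..1}. norm y \<le> B" unfolding bounded_iff ..
    then have B: "\<bar>nth_deriv n e t\<bar> \<le> B" if "t \<in> {0..1}" for t using that by simp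
    have B0: "0 \<le> B" using B[of 0] by simp
    have "\<bar>r v\<bar> \<le> (A + B + C) * (v$2)^N" if v: "0 < v$2" "v$2 \<le> 1" "0 \<le> v$1" "v$1 \<le> v$2" for v
    proof -
      have "\<bar>f (vector [0, v$2] + v$1 *\<^sub>R axis 1 1) - f (vector [0, v$2] + 0 *\<^sub>R axis 1 1)\<bar> \<le> \<bar>v$1 - 0\<bar> * (A * (v$2)^N)"
      proof (rule line_mean_value[OF f])
        show "\<bar>partial f 1 (vector [0, v$2] + x *\<^sub>R axis 1 1)\<bar> \<le> A * (v$2)^N"
          if "x \<in> {min 0 (v$1)..max 0 (v$1)}" for x
          using A(2)[of "vector [0, v$2] + x *\<^sub>R axis 1 1"] that v by (auto simp: axis_def)
      qed
      moreover have "vector [0, v$2] + v$1 *\<^sub>R axis 1 1 = v" by (simp add: vec2_eq_iff axis_def)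
      ultimately have "\<bar>f v - e (v$2)\<bar> \<le> v$1 * (A * (v$2)^N)" using v by (simp add: e_def)
      also have "\<dots> \<le> 1 * (A * (v$2)^N)" using v A(1) by (intro mult_right_mono) auto
      finally have 1: "\<bar>f v - e (v$2)\<bar> \<le> A * (v$2)^N" by simp
      have pw: "(v$2)^n \<le> (v$2)^N" using v by (intro power_decreasing) (auto simp: n_def)
      obtain t where t: "0 < t" "t < v$2"
        "e (v$2) = (\<Sum>m<n. nth_deriv m e 0 / fact m * (v$2)^m) + nth_deriv n e t / fact n * (v$2)^n"
        using Maclaurin[of "v$2" n "\<lambda>m. nth_deriv m e" e] v DERIV_nth_deriv[OF e] by (auto simp: n_def)
      have "\<bar>nth_deriv n e t / fact n\<bar> \<le> B / 1"
        unfolding abs_divide using B[of t] t v by (intro frac_le) auto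
      then have "\<bar>nth_deriv n e t / fact n * (v$2)^n\<bar> \<le> B * (v$2)^N"
        unfolding abs_mult using pw v B0 by (intro mult_mono) auto
      then have 2: "\<bar>e (v$2) - (\<Sum>j<Suc N. c j * ((v$2)^2)^j)\<bar> \<le> B * (v$2)^N"
        using t(3) sums[of "v$2" "Suc N"] unfolding n_def by simp
      have "\<bar>h ((v$2)^2) - (\<Sum>j<Suc N. c j * ((v$2)^2)^j)\<bar> \<le> C * ((v$2)^2)^Suc N"
        by (rule C) (use v in \<open>auto simp: power_le_one\<close>)
      also have "((v$2)^2)^Suc N = (v$2)^n" by (simp only: n_def power_mult)
      also have "C * (v$2)^n \<le> C * (v$2)^N" by (rule mult_left_mono[OF pw C0])
      finally show ?thesis using 1 2 unfolding r_def distrib_right by linarith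
    qed
    then show ?thesis by blast
  qed
  then have "flat_bound r" by (rule flat_boundI[OF inv_r])
  moreover have "smooth_on UNIV r"
    unfolding r_def[abs_def]
    by (intro smooth_intros f smooth_on_compose[OF h(1)]) (auto intro!: smooth_intros simp: smooth_vec_cart)
  moreover have "h 0 = f 0"
  proof -
    have "vector [0, 0] = (0 :: real^2)" by (simp add: vec2_eq_iff)
    then show ?thesis using h(2)[of 1] by (force simp: c_def e_def)
  qed
  ultimately show thesis using that[OF h(1)] inv_r by (auto simp: flat_def r_def[abs_def])
qed

section \<open>Polar coordinates\<close>

text \<open>Rotation by the angle \<open>t\<close> belonging to \<open>a\<close> turns the pair into
  \<open>(C, S)\<close>, which is \<open>(1, 0)\<close> at \<open>a\<close>; where \<open>C\<close>
  is positive, \<open>arctan (S / C)\<close> is a smooth branch of the angle.\<close>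

lemma angle_branch:
  assumes W: "open W" and x: "smooth_on W x" and s: "smooth_on W s"
    and a: "a \<in> W" and c: "\<And>b. b \<in> W \<Longrightarrow> (x b)^2 + (s b)^2 = 1"
  obtains N \<theta> where "open N" "a \<in> N" "N \<subseteq> W" "smooth_on N \<theta>"
    "\<And>b. b \<in> N \<Longrightarrow> cos (\<theta> b) = x b \<and> sin (\<theta> b) = s b"
proof -
  obtain t where t: "x a = cos t" "s a = sin t" using sincos_total_2pi[OF c[OF a]] by metis
  define C where "C b = cos t * x b + sin t * s b" for b
  define S where "S b = cos t * s b - sin t * x b" for b
  have sm: "smooth_on W C" "smooth_on W S"
    unfolding C_def[abs_def] S_def[abs_def] by (intro smooth_intros x s W)+
  define N where "N = W \<inter> C -` {0<..}"
  have N: "open N" unfolding N_def by (rule continuous_open_preimage[OF smooth_on_continuous[OF sm(1)] W]) simp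
  have sub: "N \<subseteq> W" by (auto simp: N_def)
  show thesis
  proof (rule that[of N "\<lambda>b. t + arctan (S b / C b)"])
    show "a \<in> N" using a by (simp add: N_def C_def t flip: power2_eq_square)
    show "smooth_on N (\<lambda>b. t + arctan (S b / C b))"
      by (intro smooth_intros N smooth_on_subset[OF sm(1) sub] smooth_on_subset[OF sm(2) sub]) (auto simp: N_def)
    fix b assume b: "b \<in> N"
    then have pos: "0 < C b" and bW: "b \<in> W" by (auto simp: N_def)
    have "(C b)^2 + (S b)^2 = ((cos t)^2 + (sin t)^2) * ((x b)^2 + (s b)^2)"
      unfolding C_def S_def by algebra
    then have one: "(C b)^2 + (S b)^2 = 1" using c[OF bW] by simp
    have "1 + (S b / C b)^2 = 1 / (C b)^2" using one pos by (simp add: field_simps)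
    then have sq: "sqrt (1 + (S b / C b)^2) = 1 / C b" using pos by (simp add: real_sqrt_divide)
    have cs: "cos (arctan (S b / C b)) = C b" "sin (arctan (S b / C b)) = S b"
      using pos by (simp_all add: cos_arctan sin_arctan sq)
    have id: "cos t * C b - sin t * S b = x b" "sin t * C b + cos t * S b = s b"
    proof -
      have "cos t * C b - sin t * S b = ((cos t)^2 + (sin t)^2) * x b"
        unfolding C_def S_def by algebra
      then show "cos t * C b - sin t * S b = x b" by simp
      have "sin t * C b + cos t * S b = ((cos t)^2 + (sin t)^2) * s b"
        unfolding C_def S_def by algebra
      then show "sin t * C b + cos t * S b = s b" by simp
    qed
    then show "cos (t + arctan (S b / C b)) = x b \<and> sin (t + arctan (S b / C b)) = s b"
      by (simp add: cos_add sin_add cs)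
  qed (use N sub in auto)
qed

text \<open>
  The value at the point of the half-plane \<open>q > 0\<close> with \<open>q\<^sup>2 = z\<close> and \<open>(cos, sin) = (x, y/q)\<close> of
  the angle \<open>2\<pi>p/q\<close>; shift invariance makes the choice of the angle irrelevant.
\<close>

definition polar_value :: "(real^2 \<Rightarrow> real) \<Rightarrow> real \<Rightarrow> real \<Rightarrow> real \<Rightarrow> real" where
  "polar_value r x y z =
     r (vector [sqrt z * (SOME \<theta>. cos \<theta> = x \<and> sin \<theta> = y / sqrt z) / (2 * pi), sqrt z])"

lemma polar_value_eq:
  assumes "shift_invariant r" "cos \<theta> = x" "sin \<theta> = y / sqrt z"
  shows "polar_value r x y z = r (vector [sqrt z * \<theta> / (2 * pi), sqrt z])"
proof -
  define \<eta> where "\<eta> = (SOME \<theta>. cos \<theta> = x \<and> sin \<theta> = y / sqrt z)"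
  have "cos \<eta> = x \<and> sin \<eta> = y / sqrt z" unfolding \<eta>_def by (rule someI[of _ \<theta>]) (use assms in simp)
  then obtain n where "\<eta> = \<theta> + 2 * pi * of_int n"
    using sin_cos_eq_iff[of \<eta> \<theta>] assms by (metis mult.assoc mult.commute)
  then have "vector [sqrt z * \<eta> / (2 * pi), sqrt z] = plane_act n 1 (vector [sqrt z * \<theta> / (2 * pi), sqrt z])"
    by (simp add: vec2_eq_iff plane_act_nth field_simps)
  then show ?thesis using assms(1) by (simp add: polar_value_def \<eta>_def)
qed

lemma smooth_polar:
  assumes W: "open W" and x: "smooth_on W x" and y: "smooth_on W y" and z: "smooth_on W z"
    and pos: "\<And>b. b \<in> W \<Longrightarrow> 0 < z b" and e: "\<And>b. b \<in> W \<Longrightarrow> z b * (x b)^2 + (y b)^2 = z b" and a: "a \<in> W"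
  obtains N \<theta> where "open N" "a \<in> N" "N \<subseteq> W" "smooth_on N \<theta>"
    "\<And>b. b \<in> N \<Longrightarrow> cos (\<theta> b) = x b \<and> sin (\<theta> b) = y b / sqrt (z b)"
proof (rule angle_branch[OF W x _ a, of "\<lambda>b. y b / sqrt (z b)"])
  show "smooth_on W (\<lambda>b. y b / sqrt (z b))"
    by (intro smooth_intros y z W) (use pos in \<open>auto simp: less_imp_neq[symmetric]\<close>)
  show "(x b)^2 + (y b / sqrt (z b))^2 = 1" if "b \<in> W" for b
    using e[OF that] pos[OF that] by (simp add: field_simps)
qed (use that in blast)

lemma has_derivative_zero_squeeze:
  fixes f g :: "'a::real_normed_vector \<Rightarrow> real"
  assumes g: "(g has_derivative (\<lambda>v. 0)) (at a)" and z: "f a = 0" "g a = 0"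
    and le: "\<forall>\<^sub>F b in nhds a. \<bar>f b\<bar> \<le> K * g b"
  shows "(f has_derivative (\<lambda>v. 0)) (at a)"
proof -
  have "((\<lambda>b. \<bar>g b\<bar> / norm (b - a)) \<longlongrightarrow> 0) (at a)"
    using g z by (simp add: has_derivative_iff_norm)
  then have t: "((\<lambda>b. \<bar>K\<bar> * (\<bar>g b\<bar> / norm (b - a))) \<longlongrightarrow> 0) (at a)"
    by (rule tendsto_mult_right_zero)
  have "\<forall>\<^sub>F b in at a. \<bar>f b\<bar> \<le> K * g b" using le by (simp add: eventually_nhds_conv_at)
  then have "\<forall>\<^sub>F b in at a. norm (\<bar>f b\<bar> / norm (b - a)) \<le> \<bar>K\<bar> * (\<bar>g b\<bar> / norm (b - a))"
  proof eventually_elim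
    case (elim b)
    have "\<bar>f b\<bar> \<le> \<bar>K\<bar> * \<bar>g b\<bar>" using elim abs_ge_self[of "K * g b"] by (simp add: abs_mult)
    then show ?case by (simp add: divide_right_mono)
  qed
  from Lim_null_comparison[OF this t] show ?thesis using z by (simp add: has_derivative_iff_norm)
qed

text \<open>\<open>x\<close>, \<open>y\<close> and \<open>z\<close> stand for the coordinates of the
  last \<open>z\<close>-chart as functions of the parameters of a boundary chart. They are smooth
  across \<open>z = 0\<close>, whereas the angle exists only for \<open>z > 0\<close>.\<close>

locale polar =
  fixes W :: "'a::euclidean_space set" and x y z :: "'a \<Rightarrow> real"
  assumes open_W: "open W" and smooth_xyz: "smooth_on W x" "smooth_on W y" "smooth_on W z"
    and cone: "\<And>b. b \<in> W \<Longrightarrow> 0 < z b \<Longrightarrow> z b * (x b)^2 + (y b)^2 = z b"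
begin

text \<open>The coefficient \<open>c\<close>, the negative power of \<open>q = sqrt z\<close> and
  the function \<open>r\<close> are all parameters, because differentiation produces sums of terms
  of the same kind.\<close>

definition polar_term :: "('a \<Rightarrow> real) \<Rightarrow> nat \<Rightarrow> (real^2 \<Rightarrow> real) \<Rightarrow> 'a \<Rightarrow> real" where
  "polar_term c n r a = (if 0 < z a then c a / sqrt (z a) ^ n * polar_value r (x a) (y a) (z a) else 0)"

abbreviation "dv f a v \<equiv> frechet_derivative f (at a) v"

text \<open>The product rule with \<open>dq = dz / (2 * q)\<close> and
  \<open>d\<theta> = (x * dy - y * dx) / q - x * y * dz / (2 * q^3)\<close>, the derivatives of
  \<open>r\<close> being expressed by \<open>angular\<close> and \<open>radial\<close>.\<close>

definition polar_term_derivative :: "('a \<Rightarrow> real) \<Rightarrow> nat \<Rightarrow> (real^2 \<Rightarrow> real) \<Rightarrow> 'a \<Rightarrow> 'a \<Rightarrow> real" where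
  "polar_term_derivative c n r a v =
     polar_term (\<lambda>b. dv c b v) n r a +
     polar_term (\<lambda>b. - (n / 2) * c b * dv z b v) (n + 2) r a +
     polar_term (\<lambda>b. c b * (x b * dv y b v - y b * dv x b v) / (2 * pi)) (n + 1) (angular r) a +
     polar_term (\<lambda>b. - c b * x b * y b * dv z b v / (4 * pi)) (n + 3) (angular r) a +
     polar_term (\<lambda>b. c b * dv z b v / 2) (n + 2) (radial r) a"

lemma polar_term_pos:
  assumes c: "smooth_on W c" and r: "flat r" and a: "a \<in> W" "0 < z a"
  shows "(polar_term c n r has_derivative polar_term_derivative c n r a) (at a)"
proof -
  let ?W = "W \<inter> z -` {0<..}"
  have oW: "open ?W" by (rule continuous_open_preimage[OF smooth_on_continuous[OF smooth_xyz(3)] open_W]) simp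
  have sW: "smooth_on ?W f" if "smooth_on W f" for f using smooth_on_subset[OF that] by simp
  obtain N \<theta> where N: "open N" "a \<in> N" "N \<subseteq> ?W" and \<theta>: "smooth_on N \<theta>"
    and cs: "\<And>b. b \<in> N \<Longrightarrow> cos (\<theta> b) = x b \<and> sin (\<theta> b) = y b / sqrt (z b)"
    by (rule smooth_polar[OF oW sW[OF smooth_xyz(1)] sW[OF smooth_xyz(2)] sW[OF smooth_xyz(3)], of a])
      (use cone a in auto)
  have smr: "smooth_on UNIV r" and inv: "shift_invariant r" using r by (auto simp: flat_def)
  have inv': "shift_invariant (angular r)" "shift_invariant (radial r)"
    using flat_angular_radial[OF r] by (simp_all add: flat_def)
  have d: "(f has_derivative dv f a) (at a)" if "smooth_on W f" for f
    using smooth_on_has_derivative[OF that a(1)] .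
  note dx = d[OF smooth_xyz(1)] and dy = d[OF smooth_xyz(2)] and dz = d[OF smooth_xyz(3)] and dc = d[OF c]
  have d\<theta>: "(\<theta> has_derivative dv \<theta> a) (at a)" by (rule smooth_on_has_derivative[OF \<theta> N(2)])
  define q where "q = sqrt (z a)"
  have q: "0 < q" "z a = q^2" using a by (auto simp: q_def)
  have dq: "((\<lambda>b. sqrt (z b)) has_derivative (\<lambda>v. dv z a v / (2 * q))) (at a)"
    using has_derivative_real_sqrt[OF a(2) dz] q(1) by (simp add: q_def divide_simps mult_ac)
  have xa: "cos (\<theta> a) = x a" and ya: "sin (\<theta> a) = y a / q" using cs[OF N(2)] by (auto simp: q_def)
  \<comment> \<open>The differentials of \<open>x\<close> and \<open>y\<close> are expressed by that
    of the angle, from \<open>cos \<theta> = x\<close> and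
    \<open>sin \<theta> * sqrt z = y\<close>.\<close>
  have "((\<lambda>b. cos (\<theta> b)) has_derivative (\<lambda>v. - (y a / q) * dv \<theta> a v)) (at a)"
    using has_derivative_cos[OF d\<theta>] by (simp add: ya mult.commute)
  then have "(x has_derivative (\<lambda>v. - (y a / q) * dv \<theta> a v)) (at a)"
    by (rule has_derivative_transform_within_open[OF _ N(1,2)]) (use cs in auto)
  from has_derivative_unique[OF dx this] have 1: "dv x a v = - (y a / q) * dv \<theta> a v" for v by (rule fun_cong)
  have "((\<lambda>b. sin (\<theta> b)) has_derivative (\<lambda>v. x a * dv \<theta> a v)) (at a)"
    using has_derivative_sin[OF d\<theta>] by (simp add: xa mult.commute)
  from has_derivative_mult[OF this dq]
  have "((\<lambda>b. sin (\<theta> b) * sqrt (z b)) has_derivative (\<lambda>v. y a / q * (dv z a v / (2 * q)) + x a * dv \<theta> a v * q)) (at a)"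
    by (simp add: ya flip: q_def)
  then have "(y has_derivative (\<lambda>v. y a / q * (dv z a v / (2 * q)) + x a * dv \<theta> a v * q)) (at a)"
    by (rule has_derivative_transform_within_open[OF _ N(1,2)]) (use cs N(3) in force)
  from has_derivative_unique[OF dy this] have 2: "dv y a v = y a / q * (dv z a v / (2 * q)) + x a * dv \<theta> a v * q" for v
    by (rule fun_cong)
  have one: "x a ^ 2 + (y a / q)^2 = 1" using sin_cos_squared_add2[of "\<theta> a"] by (simp add: xa ya)
  define m where "m b = (sqrt (z b) * \<theta> b / (2 * pi)) *\<^sub>R axis 1 1 + sqrt (z b) *\<^sub>R (axis 2 1 :: real^2)" for b
  have m_eq: "vector [sqrt (z b) * \<theta> b / (2 * pi), sqrt (z b)] = m b" for b
    by (simp add: m_def vec2_eq_iff axis_def)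
  define m1 where "m1 v = (dv z a v / (2 * q) * \<theta> a + q * dv \<theta> a v) / (2 * pi)" for v
  have dm: "(m has_derivative (\<lambda>v. m1 v *\<^sub>R axis 1 1 + (dv z a v / (2 * q)) *\<^sub>R axis 2 1)) (at a)"
    unfolding m_def[abs_def] m1_def
    by (rule derivative_eq_intros dq d\<theta> refl | simp add: algebra_simps flip: q_def)+
  define R where "R v = m1 v * partial r 1 (m a) + dv z a v / (2 * q) * partial r 2 (m a)" for v
  have "frechet_derivative r (at (m a)) (m1 v *\<^sub>R axis 1 1 + (dv z a v / (2 * q)) *\<^sub>R axis 2 1) = R v" for v
    by (subst partial_frechet[OF smooth_on_differentiable[OF smr]]) (simp_all add: sum_2 R_def axis_def)
  then have dR: "((\<lambda>b. r (m b)) has_derivative R) (at a)"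
    using has_derivative_compose[OF dm smooth_on_has_derivative[OF smr UNIV_I]] by simp
  have pv: "polar_value f (x b) (y b) (z b) = f (m b)" if "shift_invariant f" "b \<in> N" for f b
    unfolding m_eq[symmetric] using cs[OF that(2)] by (intro polar_value_eq[OF that(1)]) auto
  have di: "((\<lambda>b. inverse (sqrt (z b)) ^ n) has_derivative (\<lambda>v. - n * (dv z a v / (2 * q)) / (q * q^n))) (at a)"
  proof -
    have "((\<lambda>b. inverse (sqrt (z b))) has_derivative (\<lambda>v. - (inverse q * (dv z a v / (2 * q)) * inverse q))) (at a)"
      using Deriv.has_derivative_inverse[OF _ dq] q(1) by (simp flip: q_def)
    from has_derivative_power[OF this, of n] show ?thesis
      by (rule has_derivative_eq_rhs, cases n)
        (use q(1) in \<open>simp_all add: fun_eq_iff field_simps flip: q_def\<close>)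
  qed
  have "((\<lambda>b. c b * inverse (sqrt (z b)) ^ n * r (m b)) has_derivative polar_term_derivative c n r a) (at a)"
  proof (rule has_derivative_eq_rhs[OF has_derivative_mult[OF has_derivative_mult[OF dc di] dR]])
    \<comment> \<open>The two relations are solved for the differential of the angle by means of
      \<open>one\<close>, which says that squared cosine and sine add up to
      \<open>1\<close>.\<close>
    have key: "dv \<theta> a v = (x a * dv y a v - y a * dv x a v) / q - x a * y a * dv z a v / (2 * q^3)" for v
    proof -
      have "dv \<theta> a v = (x a ^ 2 + (y a / q)^2) * dv \<theta> a v" using one by simp
      also have "\<dots> = (x a * dv y a v - y a * dv x a v) / q - x a * y a * dv z a v / (2 * q^3)"
        unfolding 1 2 using q(1) by (simp add: field_simps power2_eq_square power3_eq_cube)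
      finally show ?thesis .
    qed
    show "(\<lambda>v. c a * inverse (sqrt (z a)) ^ n * R v +
        (c a * (- n * (dv z a v / (2 * q)) / (q * q^n)) + dv c a v * inverse (sqrt (z a)) ^ n) * r (m a))
      = polar_term_derivative c n r a"
    proof
      fix v
      have ma: "m a $ 1 = q * \<theta> a / (2 * pi)" "m a $ 2 = q" by (simp_all add: m_def axis_def q_def)
      have R: "R v = dv z a v / (2 * q^2) * radial r (m a) + dv \<theta> a v / (2 * pi) * angular r (m a)"
        unfolding R_def m1_def radial_def angular_def ma using q(1) by (simp add: field_simps power2_eq_square)
      have R': "R v = dv z a v / (2 * q^2) * radial r (m a) + ((x a * dv y a v - y a * dv x a v) / (2 * pi * q) -
          x a * y a * dv z a v / (4 * pi * q^3)) * angular r (m a)"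
        unfolding R key using q(1) by (simp add: field_simps)
      show "c a * inverse (sqrt (z a)) ^ n * R v +
        (c a * (- n * (dv z a v / (2 * q)) / (q * q^n)) + dv c a v * inverse (sqrt (z a)) ^ n) * r (m a)
        = polar_term_derivative c n r a v"
        unfolding polar_term_derivative_def polar_term_def R'
          pv[OF inv N(2)] pv[OF inv'(1) N(2)] pv[OF inv'(2) N(2)] q_def[symmetric] power_add
        using a(2) q(1) by (simp add: field_simps power2_eq_square power3_eq_cube)
    qed
  qed
  then show ?thesis
    by (rule has_derivative_transform_within_open[OF _ N(1,2)])
      (use N(3) pv[OF inv] in \<open>force simp: polar_term_def divide_inverse power_inverse\<close>)
qed

lemma polar_term_nonpos:
  assumes c: "smooth_on W c" and r: "flat r" and a: "a \<in> W" "z a \<le> 0"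
  shows "(polar_term c n r has_derivative polar_term_derivative c n r a) (at a)"
proof -
  have zero: "polar_term_derivative c n r a = (\<lambda>v. 0)"
    using a by (simp add: polar_term_derivative_def polar_term_def fun_eq_iff)
  have cont: "isCont f a" if "smooth_on W f" for f
    using smooth_on_continuous[OF that] open_W a(1) continuous_on_eq_continuous_at by blast
  show ?thesis
  proof (cases "z a = 0")
    case False
    have "open (W \<inter> z -` {..<0})"
      by (rule continuous_open_preimage[OF smooth_on_continuous[OF smooth_xyz(3)] open_W]) simp
    then show ?thesis unfolding zero
      by (rule has_derivative_transform_within_open[OF has_derivative_const[of 0]])
        (use a False in \<open>auto simp: polar_term_def\<close>)
  next
    case True
    \<comment> \<open>Of the exponent \<open>n + 4\<close>, the part \<open>n\<close> cancels the
      pole, and the remaining \<open>q^4 = z^2\<close> has zero derivative where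
      \<open>z = 0\<close>.\<close>
    obtain C where C: "\<And>v. 0 < v$2 \<Longrightarrow> v$2 \<le> 1 \<Longrightarrow> \<bar>r v\<bar> \<le> C * (v$2)^(n + 4)"
      using r unfolding flat_def flat_bound_def by blast
    have C0: "0 \<le> C" using C[of "vector [0, 1]"] by simp
    have dz: "((\<lambda>b. (z b)^2) has_derivative (\<lambda>v. 0)) (at a)"
      using has_derivative_power[OF smooth_on_has_derivative[OF smooth_xyz(3) a(1)], of 2] True by simp
    have "\<forall>\<^sub>F b in nhds a. \<bar>polar_term c n r b\<bar> \<le> ((\<bar>c a\<bar> + 1) * C) * (z b)^2"
    proof -
      have "\<forall>\<^sub>F b in nhds a. z b < 1"
        using order_tendstoD(2)[OF cont[OF smooth_xyz(3), unfolded isCont_def continuous_at], of 1] True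
        by (simp add: eventually_nhds_conv_at)
      moreover have "\<forall>\<^sub>F b in nhds a. \<bar>c b\<bar> < \<bar>c a\<bar> + 1"
        using order_tendstoD(2)[OF tendsto_rabs[OF cont[OF c, unfolded isCont_def continuous_at]], of "\<bar>c a\<bar> + 1"]
        by (simp add: eventually_nhds_conv_at)
      ultimately show ?thesis
      proof eventually_elim
        case (elim b)
        show ?case
        proof (cases "0 < z b")
          case True
          define q where "q = sqrt (z b)"
          have q: "0 < q" "q \<le> 1" "(z b)^2 = q^4"
            using True elim(1) by (auto simp: q_def real_sqrt_le_1_iff power4_eq_xxxx power2_eq_square mult.assoc)
          have "\<bar>polar_value r (x b) (y b) (z b)\<bar> \<le> C * q^(n+4)"
            unfolding polar_value_def q_def[symmetric] using C[of "vector [_, q]"] q by simp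
          then have "\<bar>c b\<bar> / q^n * \<bar>polar_value r (x b) (y b) (z b)\<bar> \<le> (\<bar>c a\<bar> + 1) / q^n * (C * q^(n+4))"
            using elim(2) q(1) by (intro mult_mono divide_right_mono) auto
          also have "\<dots> = (\<bar>c a\<bar> + 1) * C * (z b)^2" using q by (simp add: power_add)
          finally show ?thesis using True q(1) by (simp add: polar_term_def abs_mult flip: q_def)
        qed (use C0 in \<open>simp add: polar_term_def\<close>)
      qed
    qed
    then show ?thesis unfolding zero
      using has_derivative_zero_squeeze[OF dz] True by (simp add: polar_term_def)
  qed
qed

text \<open>Induction on the order for all \<open>c\<close>, \<open>n\<close> and \<open>r\<close>
  at once, since the derivative leads to other coefficients, higher poles and other flat
  functions.\<close>

lemma smooth_on_polar_term:
  assumes "smooth_on W c" "flat r"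
  shows "smooth_on W (polar_term c n r)"
proof -
  have D: "(polar_term c n r has_derivative polar_term_derivative c n r a) (at a)"
    if "smooth_on W c" "flat r" "a \<in> W" for c n r a
    using polar_term_pos[OF that] polar_term_nonpos[OF that] by (cases "0 < z a") auto
  have "Ck_on j W (polar_term c n r)" if "smooth_on W c" "flat r" for j c n r
    using that
  proof (induction j arbitrary: c n r)
    case 0
    then show ?case using has_derivative_continuous[OF D] by (auto intro!: continuous_at_imp_continuous_on)
  next
    case (Suc j)
    note i = smooth_xyz open_W Suc.prems(1) smooth_xyz[THEN smooth_on_frechet] Suc.prems(1)[THEN smooth_on_frechet]
    show ?case
    proof (rule Ck_on_SucI[OF open_W D[OF Suc.prems]])
      show "Ck_on j W (\<lambda>a. polar_term_derivative c n r a v)" for v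
        unfolding polar_term_derivative_def
        by (intro Ck_on_add Suc.IH Suc.prems(2) flat_angular_radial smooth_intros i) auto
    qed
  qed
  then show ?thesis using assms by (simp add: smooth_on_def)
qed

end

section \<open>The resolution map\<close>

abbreviation resolve :: "nat \<Rightarrow> bpoint \<Rightarrow> (real^2) set" where
  "resolve k \<equiv> psi_map k \<circ> blowdown"

lemma plus_points_ambient: "plus_points k \<subseteq> points (Z_ambient k)"
  using plus_points_subset P.SM by blast

lemma psi_main:
  assumes "0 < w$3" "cos t = w$1" "sin t = w$2 / sqrt (w$3)"
  shows "psi_map k (vector [(w$3)^k * w$1, (w$3)^k * w$2, w$3]) = plane_class (vector [sqrt (w$3) * t / (2 * pi), sqrt (w$3)])"
  using psi_phi[of k "vector [sqrt (w$3) * t / (2 * pi), sqrt (w$3)]"] phi_map_main[OF assms] by simp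

lemma resolve_cases:
  assumes s: "s \<in> plus_points k"
  obtains (off) m where "0 < blowdown s $ 3" "0 < m$2" "phi_map k m = blowdown s" "resolve k s = plane_class m"
    | (axis) "blowdown s $ 3 = 0" "resolve k s = plane_class 0"
proof (cases "blowdown s $ 3 = 0")
  case True
  then show thesis using axis psi_axis by simp
next
  case False
  have d: "blowdown s \<in> duval k" using s Z_blowdown_duval plus_points_subset by blast
  obtain w where w: "duval_eqn 0 w = 0" "w$3 = blowdown s $ 3" "blowdown s = vector [(w$3)^k * w$1, (w$3)^k * w$2, w$3]"
    by (rule duval_main[OF d False])
  have p: "0 < w$3" using plus_height[OF s] False w(2) by simp
  obtain t where t: "cos t = w$1" "sin t = w$2 / sqrt (w$3)" by (rule main_angle[OF w(1) p])
  show thesis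
  proof (rule off[of "vector [sqrt (w$3) * t / (2 * pi), sqrt (w$3)]"])
    show "phi_map k (vector [sqrt (w$3) * t / (2 * pi), sqrt (w$3)]) = blowdown s"
      unfolding w(3) by (rule phi_map_main[OF p t])
    show "resolve k s = plane_class (vector [sqrt (w$3) * t / (2 * pi), sqrt (w$3)])"
      unfolding comp_apply w(3) by (rule psi_main[OF p t])
  qed (use p w(2) in auto)
qed

text \<open>A function of the two parameters, composed with \<open>\<pi>\<close>, is an extension to
  an open set of the three-dimensional chart. Smoothness may therefore be tested on the parameter
  domains, which reach across the boundary.\<close>

lemma plus_smoothI:
  assumes ext: "f \<in> extensional S" and S: "S \<subseteq> plus_points k"
    and loc: "\<And>g N F \<pi> Q \<rho> \<mu> a. plus_chart k g N F \<pi> Q \<rho> \<mu> \<Longrightarrow> a \<in> Q \<Longrightarrow> g (\<rho> a) \<in> S \<Longrightarrow>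
      \<exists>Q' \<phi>. open Q' \<and> a \<in> Q' \<and> Q' \<subseteq> Q \<and> smooth_on Q' \<phi> \<and> (\<forall>b\<in>Q'. g (\<rho> b) \<in> S \<longrightarrow> f (g (\<rho> b)) = \<phi> b)"
  shows "f \<in> smooth_funs (smooth_subspace (Z_ambient k) S)"
proof (rule smooth_subspaceI[OF ext])
  fix s assume s: "s \<in> S"
  obtain g N F \<pi> Q \<rho> \<mu> w where pc: "plus_chart k g N F \<pi> Q \<rho> \<mu>" and w: "w \<in> N" "s = g w"
    by (rule plus_cover[of s k]) (use s S in blast)
  obtain V where V: "(V, g) \<in> Z_atlas k" "N \<subseteq> V" "crepant k V g F" "is_chart (Z_ambient k) V g"
    "open N" "smooth_vec N \<pi>" "open Q" "smooth_vec Q \<rho>" using pc by (rule plus_chartD)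
  have returns: "\<pi> v \<in> Q" "\<rho> (\<pi> v) = v" if "v \<in> N" "g v \<in> S" for v
    using plus_chart_fwd(1,2)[OF pc that(1)] plus_chart_iff[OF pc that(1)] that(2) S by blast+
  have gw: "g w \<in> S" using s w(2) by simp
  obtain Q' \<phi> where Q': "open Q'" "\<pi> w \<in> Q'" "Q' \<subseteq> Q" "smooth_on Q' \<phi>"
    "\<And>b. b \<in> Q' \<Longrightarrow> g (\<rho> b) \<in> S \<Longrightarrow> f (g (\<rho> b)) = \<phi> b"
    using loc[OF pc returns(1)[OF w(1) gw]] gw unfolding returns(2)[OF w(1) gw] by blast
  have o: "open (N \<inter> \<pi> -` Q')"
    by (rule continuous_open_preimage[OF smooth_vec_continuous[OF V(6)] V(5) Q'(1)])
  have "smooth_on (N \<inter> \<pi> -` Q') (\<lambda>v. \<phi> (\<pi> v))"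
    by (rule smooth_on_compose[OF Q'(4) smooth_vec_subset[OF V(6)] o Q'(1)]) auto
  moreover have "f (g v) = \<phi> (\<pi> v)" if "v \<in> N \<inter> \<pi> -` Q'" "g v \<in> S" for v
    using Q'(5)[of "\<pi> v"] returns(2)[of v] that by auto
  ultimately show "\<exists>V g w N \<phi>. is_chart (Z_ambient k) V g \<and> s = g w \<and> open N \<and> w \<in> N \<and> N \<subseteq> V \<and>
      smooth_on N (\<phi> :: real^3 \<Rightarrow> real) \<and> (\<forall>v\<in>N. g v \<in> S \<longrightarrow> f (g v) = \<phi> v)"
    using V(2,4) w o Q'(2) by (intro exI[of _ V] exI[of _ g] exI[of _ w] exI[of _ "N \<inter> \<pi> -` Q'"]
        exI[of _ "\<lambda>v. \<phi> (\<pi> v)"] conjI ballI impI) auto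
qed

section \<open>Smoothness of the map up to the boundary\<close>

lemma polar_plus_chart:
  assumes pc: "plus_chart k g N F \<pi> Q \<rho> \<mu>"
  shows "polar Q (\<lambda>a. \<mu> (\<rho> a) $ 1) (\<lambda>a. \<mu> (\<rho> a) $ 2) (\<lambda>a. \<mu> (\<rho> a) $ 3)"
proof
  obtain V where V: "open Q" "smooth_vec Q \<rho>" using pc by (rule plus_chartD)
  have "smooth_vec UNIV \<mu>" using pc by (simp add: plus_chart_def)
  from smooth_vec_compose[OF this V(2,1)] have sm: "smooth_vec Q (\<lambda>a. \<mu> (\<rho> a))" by simp
  then show "open Q" "smooth_on Q (\<lambda>a. \<mu> (\<rho> a) $ 1)" "smooth_on Q (\<lambda>a. \<mu> (\<rho> a) $ 2)" "smooth_on Q (\<lambda>a. \<mu> (\<rho> a) $ 3)"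
    using V(1) unfolding smooth_vec_cart by blast+
  show "\<mu> (\<rho> b) $ 3 * (\<mu> (\<rho> b) $ 1)^2 + (\<mu> (\<rho> b) $ 2)^2 = \<mu> (\<rho> b) $ 3" if "b \<in> Q" for b
    using plus_chart_bwd(4)[OF pc that] by (simp add: duval_eqn_def)
qed

lemma quotient_lift:
  assumes "F \<in> smooth_funs plane_quotient"
  shows "smooth_on UNIV (\<lambda>m. F (plane_class m))" "e = 1 \<or> e = - 1 \<Longrightarrow> F (plane_class (plane_act n e m)) = F (plane_class m)"
proof -
  obtain f where f: "smooth_on UNIV f" "\<forall>g\<in>G'. \<forall>m. f (g *v m) = f m" "\<forall>m. F (plane_class m) = f m"
    using assms unfolding plane_quotient_smooth by blast
  show "smooth_on UNIV (\<lambda>m. F (plane_class m))" using f(1,3) by simp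
  show "F (plane_class (plane_act n e m)) = F (plane_class m)" if "e = 1 \<or> e = - 1"
    using invariant_act[OF f(2) that] f(3) by simp
qed

lemma resolve_smooth:
  assumes F: "F \<in> smooth_funs plane_quotient"
  shows "compose (plus_points k) F (resolve k) \<in> smooth_funs (Z_plus k)"
proof -
  define f where "f m = F (plane_class m)" for m
  have f: "smooth_on UNIV f" "shift_invariant f" "\<And>v. f (plane_act 0 (- 1) v) = f v"
    using quotient_lift[OF F] by (simp_all add: f_def[abs_def])
  obtain h where h: "smooth_on UNIV h" "flat (\<lambda>v. f v - h ((v$2)^2))" "h 0 = f 0"
    by (rule even_flat_expansion[OF f])
  define r where "r v = f v - h ((v$2)^2)" for v
  have r: "flat r" using h(2) by (simp add: r_def[abs_def])
  then have inv: "shift_invariant r" by (simp add: flat_def)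
  show ?thesis unfolding Z_plus_eq
  proof (rule plus_smoothI)
    fix g N E \<pi> Q \<rho> \<mu> a
    assume pc: "plus_chart k g N E \<pi> Q \<rho> \<mu>" and a: "a \<in> Q"
    define x where "x = (\<lambda>a. \<mu> (\<rho> a) $ 1)"
    define y where "y = (\<lambda>a. \<mu> (\<rho> a) $ 2)"
    define z where "z = (\<lambda>a. \<mu> (\<rho> a) $ 3)"
    interpret polar Q x y z using polar_plus_chart[OF pc] by (simp only: x_def y_def z_def)
    \<comment> \<open>Defined on the whole parameter domain, also for negative \<open>z\<close>;
      this is the required extension across the boundary. Where \<open>z = 0\<close> it equals
      \<open>h 0 = f 0\<close>, the value at the class of the axis.\<close>
    let ?\<phi> = "\<lambda>a. h (z a) + polar_term (\<lambda>_. 1) 0 r a"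
    have "smooth_on Q ?\<phi>"
      by (intro smooth_intros open_W smooth_on_polar_term r smooth_on_compose[OF h(1)]) (auto simp: smooth_xyz)
    moreover have "compose (plus_points k) F (resolve k) (g (\<rho> b)) = ?\<phi> b" if b: "b \<in> Q" "g (\<rho> b) \<in> plus_points k" for b
    proof -
      note bd = plus_chart_blowdown[OF pc, of "\<rho> b"]
      have "0 \<le> z b" using plus_height[OF b(2)] unfolding bd by (simp add: z_def)
      then consider "z b = 0" | "0 < z b" by linarith
      then show ?thesis
      proof cases
        case 1
        then have "psi_map k (blowdown (g (\<rho> b))) = plane_class 0"
          unfolding bd by (intro psi_axis) (simp add: z_def)
        then show ?thesis using 1 b(2) h(3) by (simp add: compose_def polar_term_def f_def)
      next
        case 2
        obtain t where t: "cos t = x b" "sin t = y b / sqrt (z b)"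
          using main_angle[OF plus_chart_bwd(4)[OF pc b(1)]] 2 unfolding x_def y_def z_def by blast
        let ?m = "vector [sqrt (z b) * t / (2 * pi), sqrt (z b)] :: real^2"
        have "psi_map k (blowdown (g (\<rho> b))) = plane_class ?m"
          unfolding bd z_def by (rule psi_main) (use 2 t in \<open>auto simp: x_def y_def z_def\<close>)
        then have "compose (plus_points k) F (resolve k) (g (\<rho> b)) = f ?m" using b(2) by (simp add: compose_def f_def)
        also have "\<dots> = h (z b) + r ?m" using 2 by (simp add: r_def)
        finally show ?thesis using 2 polar_value_eq[OF inv t] by (simp add: polar_term_def)
      qed
    qed
    ultimately show "\<exists>Q' \<phi>. open Q' \<and> a \<in> Q' \<and> Q' \<subseteq> Q \<and> smooth_on Q' \<phi> \<and> (\<forall>b\<in>Q'. g (\<rho> b) \<in> plus_points k \<longrightarrow>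
        compose (plus_points k) F (resolve k) (g (\<rho> b)) = \<phi> b)"
      using a open_W by blast
  qed (auto simp: compose_def)
qed

lemma resolve_smooth_map: "smooth_map (Z_plus k) plane_quotient (resolve k)"
  unfolding smooth_map_def points_Z_plus plane_quotient_points
proof (intro conjI ballI)
  show "resolve k \<in> plus_points k \<rightarrow> range plane_class"
  proof
    fix s assume "s \<in> plus_points k"
    then show "resolve k s \<in> range plane_class" by (rule resolve_cases) (metis rangeI)+
  qed
qed (rule resolve_smooth)

section \<open>The resolution map is Poisson\<close>

lemma plane_bracket_eq:
  assumes "smooth_on UNIV f" "smooth_on UNIV g"
  shows "plane_bracket f g v = v$2 / (2 * pi) * (partial f 1 v * partial g 2 v - partial f 2 v * partial g 1 v)"
  using assms by (simp add: plane_bracket_def)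

text \<open>The determinant of the action is \<open>e\<close>, and the coefficient \<open>q\<close>
  of the bracket is multiplied by \<open>e\<close> as well; the product of the two factors is
  \<open>1\<close>.\<close>

lemma plane_bracket_act:
  assumes f: "smooth_on UNIV f" "\<And>v. f (plane_act n e v) = f v"
    and g: "smooth_on UNIV g" "\<And>v. g (plane_act n e v) = g v" and e: "e = 1 \<or> e = - 1"
  shows "plane_bracket f g (plane_act n e v) = plane_bracket f g v"
  unfolding plane_bracket_eq[OF f(1) g(1)] partial_plane_act[OF f, of v] partial_plane_act[OF g, of v]
  using e by (auto simp: algebra_simps)

abbreviation quotient_plane_bracket :: "(real^2) set bracket" where
  "quotient_plane_bracket \<equiv> quotient_bracket euclidean_smooth plane_bracket G' (*v)"

text \<open>The representative chosen by \<open>SOME\<close> is irrelevant: on the axis the bracket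
  vanishes together with \<open>q\<close>, and elsewhere it is invariant under the group.\<close>

lemma quotient_bracket_class:
  assumes F: "F \<in> smooth_funs plane_quotient" and G: "G \<in> smooth_funs plane_quotient"
  shows "quotient_plane_bracket F G (plane_class m) = plane_bracket (\<lambda>m. F (plane_class m)) (\<lambda>m. G (plane_class m)) m"
proof -
  define m' where "m' = (SOME m'. m' \<in> plane_class m)"
  have "m = plane_act 0 1 m" by (simp add: vec2_eq_iff)
  then have "(m, m) \<in> orbit_or_axis" unfolding orbit_or_axis_def by blast
  then have "m \<in> plane_class m" by (simp add: plane_rel_eq)
  then have "m' \<in> plane_class m" unfolding m'_def by (rule someI[of "\<lambda>x. x \<in> plane_class m"])
  then have m': "(m, m') \<in> orbit_or_axis" by (simp add: plane_rel_eq)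
  have "plane_class m \<in> points plane_quotient" unfolding plane_quotient_points by blast
  then have "quotient_plane_bracket F G (plane_class m) = plane_bracket (\<lambda>m. F (plane_class m)) (\<lambda>m. G (plane_class m)) m'"
    unfolding quotient_bracket_def Let_def using F G by (simp add: m'_def)
  also have "\<dots> = plane_bracket (\<lambda>m. F (plane_class m)) (\<lambda>m. G (plane_class m)) m"
  proof (cases "m$2 = 0")
    case True
    then have "m'$2 = 0" using m' by (auto simp: orbit_or_axis_def)
    then show ?thesis unfolding plane_bracket_eq[OF quotient_lift(1)[OF F] quotient_lift(1)[OF G]] using True by simp
  next
    case False
    then obtain n e where "e = 1 \<or> e = - 1" "m' = plane_act n e m" using m' by (auto simp: orbit_or_axis_def)
    then show ?thesis using plane_bracket_act[OF quotient_lift(1)[OF F] _ quotient_lift(1)[OF G], of n e m]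
        quotient_lift(2)[OF F] quotient_lift(2)[OF G] by simp
  qed
  finally show ?thesis .
qed

lemma quotient_bracket_smooth:
  assumes F: "F \<in> smooth_funs plane_quotient" and G: "G \<in> smooth_funs plane_quotient"
  shows "quotient_plane_bracket F G \<in> smooth_funs plane_quotient"
  unfolding plane_quotient_smooth
proof (intro conjI exI[of _ "plane_bracket (\<lambda>m. F (plane_class m)) (\<lambda>m. G (plane_class m))"] ballI allI)
  note f = quotient_lift[OF F] and g = quotient_lift[OF G]
  show "quotient_plane_bracket F G \<in> extensional (range plane_class)"
    unfolding quotient_bracket_def Let_def plane_quotient_points using F G by simp
  show "smooth_on UNIV (plane_bracket (\<lambda>m. F (plane_class m)) (\<lambda>m. G (plane_class m)))"
    using plane_bracket_eq[OF f(1) g(1), abs_def]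
    by (simp only: ext) (auto intro!: smooth_intros smooth_on_frechet f(1) g(1) simp: smooth_vec_cart)
  show "plane_bracket (\<lambda>m. F (plane_class m)) (\<lambda>m. G (plane_class m)) (\<gamma> *v m) =
      plane_bracket (\<lambda>m. F (plane_class m)) (\<lambda>m. G (plane_class m)) m" if \<gamma>: "\<gamma> \<in> G'" for \<gamma> m
  proof -
    obtain n e where e: "e = 1 \<or> e = - 1" "(*v) \<gamma> = plane_act n e" using \<gamma> by (rule G'_E)
    show ?thesis unfolding e(2) by (rule plane_bracket_act[OF f(1) f(2)[OF e(1)] g(1) g(2)[OF e(1)] e(1)])
  qed
qed (rule quotient_bracket_class[OF F G])

text \<open>The coordinates of \<open>phi_map k m\<close> in the last \<open>z\<close>-chart, where
  they do not depend on \<open>k\<close>.\<close>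

definition main_coords :: "real^2 \<Rightarrow> real^3" where
  "main_coords m = vector [cos (2*pi*(m$1)/(m$2)), m$2 * sin (2*pi*(m$1)/(m$2)), (m$2)^2]"

lemma main_coords_eqn: "m$2 \<noteq> 0 \<Longrightarrow> duval_eqn 0 (main_coords m) = 0"
proof -
  let ?t = "2*pi*(m$1)/(m$2)"
  have "(m$2)^2 * (cos ?t)^2 + (m$2 * sin ?t)^2 = (m$2)^2 * ((cos ?t)^2 + (sin ?t)^2)" by algebra
  then show ?thesis by (simp add: duval_eqn_def main_coords_def)
qed

lemma smooth_main_coords: "smooth_vec off_axis main_coords"
  unfolding main_coords_def[abs_def]
  by (intro smooth_vec_vector3 smooth_intros open_off_axis) auto

lemma phi_map_main_coords:
  assumes "m$2 \<noteq> 0"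
  shows "main_chart k (main_coords m) = Base (phi_map k m)"
  using main_chart_Base[of "main_coords m" k] assms
  by (simp add: main_coords_def phi_map_nth(1) mult_ac flip: power_mult)

lemma phi_map_duval: "m$2 \<noteq> 0 \<Longrightarrow> phi_map k m \<in> duval k"
  using main_duval[OF main_coords_eqn, of m k] phi_map_main_coords[of m k] by simp

lemma phi_map_3: "phi_map k m $ 3 = (m$2)^2"
  by (cases "m$2 = 0") (simp_all add: phi_map_nth)

lemma smooth_phi_map: "smooth_vec off_axis (phi_map k)"
  unfolding smooth_vec_cart
proof
  fix i
  have "smooth_vec off_axis (\<lambda>v. vector [(v$2)^(2*k) * cos (2*pi*(v$1)/(v$2)), (v$2)^(2*k+1) * sin (2*pi*(v$1)/(v$2)), (v$2)^2] :: real^3)"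
    by (intro smooth_vec_vector3 smooth_intros open_off_axis) auto
  then have "smooth_on off_axis (\<lambda>v. (vector [(v$2)^(2*k) * cos (2*pi*(v$1)/(v$2)), (v$2)^(2*k+1) * sin (2*pi*(v$1)/(v$2)), (v$2)^2] :: real^3) $ i)"
    unfolding smooth_vec_cart by blast
  then show "smooth_on off_axis (\<lambda>v. phi_map k v $ i)"
    by (rule smooth_on_eq[OF open_off_axis]) (simp add: phi_map_nth(1))
qed

lemma partial_phi_map:
  assumes "m$2 \<noteq> 0"
  shows "partial (\<lambda>x. phi_map k x $ 1) 1 m = - ((m$2)^(2*k) * sin (2*pi*(m$1)/(m$2)) * (2*pi/(m$2)))"
    and "partial (\<lambda>x. phi_map k x $ 3) 1 m = 0" "partial (\<lambda>x. phi_map k x $ 3) 2 m = 2 * m$2"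
proof -
  have "smooth_on off_axis (\<lambda>x. phi_map k x $ 1)" using smooth_phi_map unfolding smooth_vec_cart by blast
  from directional_DERIV[OF this, of m 0 "axis 1 1"] assms
  have 1: "((\<lambda>t. phi_map k (m + t *\<^sub>R axis 1 1) $ 1) has_real_derivative partial (\<lambda>x. phi_map k x $ 1) 1 m) (at 0)"
    by simp
  have "phi_map k (m + t *\<^sub>R axis 1 1) $ 1 = (m$2)^(2*k) * cos (2*pi*(m$1 + t)/(m$2))" for t
    using assms by (simp add: phi_map_nth(1) axis_def)
  moreover have "((\<lambda>t. (m$2)^(2*k) * cos (2*pi*(m$1 + t)/(m$2))) has_real_derivative
      - ((m$2)^(2*k) * sin (2*pi*(m$1)/(m$2)) * (2*pi/(m$2)))) (at 0)"
    by (rule derivative_eq_intros refl | use assms in simp)+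
  ultimately show "partial (\<lambda>x. phi_map k x $ 1) 1 m = - ((m$2)^(2*k) * sin (2*pi*(m$1)/(m$2)) * (2*pi/(m$2)))"
    using DERIV_unique[OF 1] by simp
  have "((\<lambda>x::real^2. x$2) has_derivative (\<lambda>h. h$2)) (at m)"
    by (rule bounded_linear_imp_has_derivative[OF bounded_linear_vec_nth])
  from has_derivative_power[OF this, of 2]
  have "((\<lambda>x. phi_map k x $ 3) has_derivative (\<lambda>h. 2 * m$2 * h$2)) (at m)"
    by (simp add: phi_map_3 mult_ac)
  from frechet_derivative_at[OF this, symmetric]
  show "partial (\<lambda>x. phi_map k x $ 3) 1 m = 0" "partial (\<lambda>x. phi_map k x $ 3) 2 m = 2 * m$2"
    by (simp_all add: axis_def)
qed

text \<open>As \<open>z = q^2\<close> does not involve \<open>p\<close>, the Jacobian determinant of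
  the map from \<open>(p, q)\<close> to \<open>(x, z)\<close> is \<open>2 * q\<close> times the
  derivative of \<open>x\<close> in \<open>p\<close>. Multiplied by \<open>q / (2 * pi)\<close> it
  becomes \<open>- 2 * y\<close>, the value of \<open>{x, z}\<close> on the graph.\<close>

lemma resolve_poisson_graph:
  assumes F: "F \<in> smooth_funs plane_quotient" and G: "G \<in> smooth_funs plane_quotient"
    and e: "e^2 = 1" and a: "a \<in> P.region k e" and m: "0 < m$2" "phi_map k m = graph_map k e a"
  shows "graph_bracket k e (P.on_graph k e (compose (plus_points k) F (resolve k)))
           (P.on_graph k e (compose (plus_points k) G (resolve k))) a
       = plane_bracket (\<lambda>m. F (plane_class m)) (\<lambda>m. G (plane_class m)) m"
proof -
  define \<beta> where "\<beta> x = (vector [phi_map k x $ 1, phi_map k x $ 3] :: real^2)" for x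
  define H where "H = {x::real^2. 0 < x$2}"
  have H: "open H" "H \<subseteq> off_axis" unfolding H_def by (auto intro!: open_Collect_less continuous_intros)
  have sp: "smooth_on H (\<lambda>x. phi_map k x $ i)" for i
    using smooth_vec_subset[OF smooth_phi_map H(2)] unfolding smooth_vec_cart by blast
  have s\<beta>: "smooth_vec H \<beta>" unfolding \<beta>_def[abs_def] by (intro smooth_vec_vector2 sp)
  \<comment> \<open>Restricts to \<open>q > 0\<close> and to the sheet with sign \<open>e\<close>,
    so that \<open>\<beta>\<close> takes values in a single graph region.\<close>
  define U where "U = H \<inter> (\<lambda>x. e * phi_map k x $ 2) -` {0<..}"
  have U: "open U" unfolding U_def
    by (rule continuous_open_preimage[OF smooth_on_continuous H(1)]) (auto intro!: smooth_intros sp H(1))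
  have g: "graph_map k e (\<beta> x) = phi_map k x \<and> \<beta> x \<in> P.region k e" if x: "x \<in> U" for x
  proof -
    have x2: "0 < x$2" "0 < e * phi_map k x $ 2" using x by (auto simp: U_def H_def)
    have dg: "phi_map k x \<in> duval_graph k"
      using phi_map_duval[of x k] x2 by (auto simp: duval_graph_def)
    have se: "sgn (phi_map k x $ 2) = e"
      using e x2(2) by (auto simp: power2_eq_1_iff zero_less_mult_iff)
    obtain e' b where b: "e' = sgn (phi_map k x $ 2)" "b \<in> graph_dom k" "phi_map k x = graph_map k e' b"
      "b = vector [phi_map k x $ 1, phi_map k x $ 3]"
      using dg by (rule duval_graphE)
    have b\<beta>: "\<beta> x = b" unfolding \<beta>_def by (rule b(4)[symmetric])
    have "e' = e" using b(1) se by (rule trans)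
    then have eq: "graph_map k e (\<beta> x) = phi_map k x" "\<beta> x \<in> graph_dom k"
      unfolding b\<beta> using b(2) b(3)[symmetric] by (simp_all only:)
    have "Base (phi_map k x) \<in> plus_graph k" unfolding plus_graph_def using dg x2 by (simp add: phi_map_3)
    then show ?thesis using eq by (simp add: P.region_def)
  qed
  have sgna: "sgn (graph_map k e a $ 2) = e" "graph_map k e a \<in> duval_graph k"
    using graph_map_duval[of a k e] a e P.region_dom by blast+
  have "0 < sgn y * y" if "y \<noteq> 0" for y :: real using that by (auto simp: sgn_if)
  from this[of "graph_map k e a $ 2"] have "0 < e * phi_map k m $ 2"
    unfolding sgna(1) m(2) using sgna(2) by (simp add: duval_graph_def del: graph_map_nth)
  then have mU: "m \<in> U" using m(1) by (simp add: U_def H_def)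
  have \<beta>m: "\<beta> m = a" unfolding \<beta>_def m(2) by (simp add: vec2_eq_iff)
  have part: "partial (\<lambda>x. E (plane_class x)) i m =
      partial (P.on_graph k e (compose (plus_points k) E (resolve k))) 1 a * partial (\<lambda>x. phi_map k x $ 1) i m +
      partial (P.on_graph k e (compose (plus_points k) E (resolve k))) 2 a * partial (\<lambda>x. phi_map k x $ 3) i m"
    if E: "E \<in> smooth_funs plane_quotient" for E i
  proof -
    let ?E = "P.on_graph k e (compose (plus_points k) E (resolve k))"
    have "smooth_on (P.region k e) ?E"
      using P.smooth_on_graph[OF _ e] resolve_smooth[OF E] unfolding Z_plus_eq by blast
    then have d: "?E differentiable (at (\<beta> m))" using smooth_on_differentiable a unfolding \<beta>m by blast
    have "?E (\<beta> x) = E (plane_class x)" if x: "x \<in> U" for x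
    proof -
      have "Base (phi_map k x) \<in> plus_graph k" using g[OF x] by (auto simp: P.region_def)
      then have "Base (phi_map k x) \<in> plus_points k" using plus_graph_points by blast
      then show ?thesis using g[OF x] psi_phi[of k x] by (simp add: P.on_graph_def compose_def)
    qed
    then have "partial (\<lambda>x. E (plane_class x)) i m = partial (\<lambda>x. ?E (\<beta> x)) i m"
      by (intro fun_cong[OF partial_cong[OF U mU]]) (rule sym)
    also have "\<dots> = (\<Sum>j\<in>UNIV. partial ?E j (\<beta> m) * partial (\<lambda>x. \<beta> x $ j) i m)"
      by (rule partial_compose[OF smooth_vec_differentiable[OF s\<beta>] d]) (use mU in \<open>simp add: U_def\<close>)
    finally show ?thesis by (simp add: sum_2 \<beta>m) (simp add: \<beta>_def)
  qed
  have m2: "m$2 \<noteq> 0" using m(1) by simp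
  have y: "graph_map k e a $ 2 = (m$2)^(2*k) * m$2 * sin (2*pi*(m$1)/(m$2))"
    unfolding m(2)[symmetric] using m2 by (simp add: phi_map_nth(1))
  show ?thesis
    unfolding graph_bracket_def y plane_bracket_eq[OF quotient_lift(1)[OF F] quotient_lift(1)[OF G]]
      part[OF F] part[OF G] partial_phi_map[OF m2]
    using m2 by (simp add: field_simps)
qed

lemma resolve_poisson: "poisson_map (Z_plus k) (Z_plus_bracket k) plane_quotient quotient_plane_bracket (resolve k)"
  unfolding poisson_map_def points_Z_plus Z_plus_bracket_eq
proof (intro conjI ballI resolve_smooth_map)
  fix F G assume F: "F \<in> smooth_funs plane_quotient" and G: "G \<in> smooth_funs plane_quotient"
  note sm = resolve_smooth[of _ k, unfolded Z_plus_eq]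
  show "P.bracket k (compose (plus_points k) F (resolve k)) (compose (plus_points k) G (resolve k)) =
      compose (plus_points k) (quotient_plane_bracket F G) (resolve k)"
  proof (rule P.eq_on_S[OF P.bracket(1)[OF sm[OF F] sm[OF G]] sm[OF quotient_bracket_smooth[OF F G]]])
    fix e :: real and a assume e: "e^2 = 1" and a: "a \<in> P.region k e"
    have B: "Base (graph_map k e a) \<in> plus_graph k" using a by (simp add: P.region_def)
    then have s: "Base (graph_map k e a) \<in> plus_points k" using plus_graph_points by blast
    have pos: "0 < graph_map k e a $ 3" using B by (auto simp: plus_graph_def)
    from s obtain m where m: "0 < m$2" "phi_map k m = graph_map k e a" "psi_map k (graph_map k e a) = plane_class m"
      by (rule resolve_cases) (use pos in auto)
    have "P.on_graph k e (compose (plus_points k) (quotient_plane_bracket F G) (resolve k)) a =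
        quotient_plane_bracket F G (plane_class m)"
      using s m(3) by (simp add: P.on_graph_def compose_def)
    then show "P.on_graph k e (P.bracket k (compose (plus_points k) F (resolve k)) (compose (plus_points k) G (resolve k))) a
        = P.on_graph k e (compose (plus_points k) (quotient_plane_bracket F G) (resolve k)) a"
      unfolding P.bracket_graph[OF sm[OF F] sm[OF G] e a] resolve_poisson_graph[OF F G e a m(1,2)]
        quotient_bracket_class[OF F G] by simp
  qed
qed

section \<open>The resolution map over the free part\<close>

text \<open>Where the cosine is strictly between \<open>- 1\<close> and \<open>1\<close> the point
  is in the cap; otherwise the sine vanishes and the point lies on a line through one of the last
  centres, seen in a \<open>z\<close>-chart.\<close>

lemma phi_map_plus_points:
  assumes m: "m$2 \<noteq> 0"
  shows "Base (phi_map k m) \<in> plus_points k"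
proof -
  let ?t = "2*pi*(m$1)/(m$2)"
  define w where "w = main_coords m"
  have w: "w$1 = cos ?t" "w$2 = m$2 * sin ?t" "w$3 = (m$2)^2" by (simp_all add: w_def main_coords_def)
  have b: "main_chart k w = Base (phi_map k m)" unfolding w_def by (rule phi_map_main_coords[OF m])
  have d: "duval_eqn 0 w = 0" unfolding w_def by (rule main_coords_eqn[OF m])
  have le: "\<bar>w$1\<bar> \<le> 1" unfolding w by simp
  show ?thesis
  proof (cases "\<bar>w$1\<bar> < 1")
    case True
    then show ?thesis using plus_chart_iff[OF plus_chart_cap, of w k] d by (simp add: b)
  next
    case False
    then have e: "w$1 = 1 \<or> w$1 = - 1" using le by (auto simp: abs_if split: if_splits)
    then have "(cos ?t)^2 = 1" unfolding w(1) by auto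
    then have "sin ?t = 0" using sin_cos_squared_add[of ?t] by simp
    then have w2: "w$2 = 0" by (simp add: w(2))
    let ?w = "vector [0, 0, (m$2)^2] :: real^3"
    have "axis 1 (w$1) + (m$2)^2 *\<^sub>R chart_dir 3 ?w = w"
      unfolding vec_eq_iff forall_3 using w2 w(3) by (simp add: chart_dir_def axis_def)
    then have "blow_param (main_chart k) (axis 1 (w$1)) 3 ?w = Base (phi_map k m)"
      using m b by (simp add: blow_param_def)
    then show ?thesis using plus_chart_iff[OF plus_chart_z[OF e], of ?w k] by simp
  qed
qed

definition free_part :: "nat \<Rightarrow> bpoint set" where
  "free_part k = {s \<in> plus_points k. resolve k s \<in> plane_class ` off_axis}"

lemma phi_map_free_part:
  assumes "m \<in> off_axis"
  shows "Base (phi_map k m) \<in> free_part k" "resolve k (Base (phi_map k m)) = plane_class m"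
proof -
  show "resolve k (Base (phi_map k m)) = plane_class m" by (simp add: psi_phi)
  then show "Base (phi_map k m) \<in> free_part k"
    using phi_map_plus_points[of m k] assms unfolding free_part_def by blast
qed

lemma free_part_eq:
  assumes s: "s \<in> plus_points k" and m: "m \<in> off_axis" and eq: "resolve k s = plane_class m"
  shows "s = Base (phi_map k m)" "0 < blowdown s $ 3"
proof -
  have "0 < blowdown s $ 3 \<and> blowdown s = phi_map k m"
    using s
  proof (cases rule: resolve_cases)
    case (off u)
    have "plane_class u = plane_class m" using off(4) eq by (rule trans[OF sym])
    then have "phi_map k u = phi_map k m" unfolding plane_class_eq_iff phi_map_eq_iff .
    then show ?thesis using off by simp
  next
    case axis
    have "plane_class 0 = plane_class m" using axis(2) eq by (rule trans[OF sym])
    then have "(0, m) \<in> orbit_or_axis" unfolding plane_class_eq_iff .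
    then show ?thesis using m by (simp add: orbit_or_axis_def)
  qed
  then show "0 < blowdown s $ 3" "s = Base (phi_map k m)"
    using ambient_Base[of s k] s plus_points_ambient by force+
qed

lemma free_part_pos: "s \<in> free_part k \<Longrightarrow> 0 < blowdown s $ 3"
  unfolding free_part_def using free_part_eq(2) by blast

lemma bij_free_part: "bij_betw (resolve k) (free_part k) (plane_class ` off_axis)"
proof (rule bij_betwI')
  fix s t assume s: "s \<in> free_part k" and t: "t \<in> free_part k"
  obtain m where m: "m \<in> off_axis" "resolve k s = plane_class m" using s unfolding free_part_def by blast
  show "resolve k s = resolve k t \<longleftrightarrow> s = t"
  proof
    assume "resolve k s = resolve k t"
    then have "resolve k t = plane_class m" using m(2) by (rule trans[OF sym])
    then have "t = Base (phi_map k m)" "s = Base (phi_map k m)"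
      using free_part_eq(1)[OF _ m(1)] m(2) s t unfolding free_part_def by blast+
    then show "s = t" by simp
  qed simp
next
  fix c assume "c \<in> plane_class ` off_axis"
  then obtain m where "m \<in> off_axis" "c = plane_class m" by blast
  then show "\<exists>s\<in>free_part k. c = resolve k s" using phi_map_free_part[of m k] by metis
qed (simp add: free_part_def)

lemma inv_free_part:
  assumes "m \<in> off_axis"
  shows "inv_into (free_part k) (resolve k) (plane_class m) = Base (phi_map k m)"
  using inv_into_f_f[OF bij_betw_imp_inj_on[OF bij_free_part] phi_map_free_part(1)[OF assms]]
    phi_map_free_part(2)[OF assms] by metis

abbreviation free_quotient :: "(real^2) set smooth_space" where
  "free_quotient \<equiv> quotient_space plane_rel (smooth_subspace euclidean_smooth off_axis) G' (*v)"

lemma points_free_quotient: "points free_quotient = plane_class ` off_axis"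
  by (simp add: quotient_space_def Let_def)

lemma smooth_free_quotient:
  "F \<in> smooth_funs free_quotient \<longleftrightarrow> F \<in> extensional (plane_class ` off_axis) \<and>
     (\<exists>f\<in>smooth_funs (smooth_subspace euclidean_smooth off_axis).
        (\<forall>g\<in>G'. \<forall>m\<in>off_axis. f (g *v m) = f m) \<and> (\<forall>m\<in>off_axis. F (plane_class m) = f m))"
  unfolding quotient_space_def Let_def smooth_subspace_sel(1) smooth_space.select_convs mem_Collect_eq ..

lemma smooth_on_off_axis:
  assumes "f \<in> smooth_funs (smooth_subspace euclidean_smooth off_axis)"
  shows "smooth_on off_axis f"
proof (rule smooth_on_local)
  fix m :: "real^2" assume m: "m \<in> off_axis"
  obtain N \<phi> where N: "open N" "m \<in> N" "smooth_on N \<phi>" "\<And>v. v \<in> N \<Longrightarrow> v \<in> off_axis \<Longrightarrow> f v = \<phi> v"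
    by (rule smooth_subspaceD[OF assms chart_euclidean UNIV_I m]) (rule that)
  have "smooth_on (N \<inter> off_axis) f"
    by (rule smooth_on_eq[OF open_Int[OF N(1) open_off_axis] smooth_on_subset[OF N(3)]]) (use N(4) in auto)
  then show "\<exists>N. open N \<and> m \<in> N \<and> smooth_on N f" using N(1,2) m open_off_axis by blast
qed

text \<open>Where \<open>z > 0\<close> a local branch of the angle gives a smooth lift
  \<open>l\<close> to the plane off the axis, so no expansion at the axis enters.\<close>

lemma resolve_smooth_free:
  assumes F: "F \<in> smooth_funs free_quotient"
  shows "compose (free_part k) F (resolve k) \<in> smooth_funs (smooth_subspace (Z_ambient k) (free_part k))"
proof (rule plus_smoothI)
  obtain f where "f \<in> smooth_funs (smooth_subspace euclidean_smooth off_axis)"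
    and Ff: "\<And>m. m \<in> off_axis \<Longrightarrow> F (plane_class m) = f m" using F unfolding smooth_free_quotient by blast
  then have f: "smooth_on off_axis f" by (intro smooth_on_off_axis)
  fix g N E \<pi> Q \<rho> \<mu> a
  assume pc: "plus_chart k g N E \<pi> Q \<rho> \<mu>" and a: "a \<in> Q" "g (\<rho> a) \<in> free_part k"
  define x where "x = (\<lambda>a. \<mu> (\<rho> a) $ 1)"
  define y where "y = (\<lambda>a. \<mu> (\<rho> a) $ 2)"
  define z where "z = (\<lambda>a. \<mu> (\<rho> a) $ 3)"
  interpret polar Q x y z using polar_plus_chart[OF pc] by (simp only: x_def y_def z_def)
  let ?W = "Q \<inter> z -` {0<..}"
  have oW: "open ?W" by (rule continuous_open_preimage[OF smooth_on_continuous[OF smooth_xyz(3)] open_W]) simp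
  have sW: "smooth_on ?W j" if "smooth_on Q j" for j using smooth_on_subset[OF that] by simp
  note bd = plus_chart_blowdown[OF pc]
  have az: "0 < z a" using free_part_pos[OF a(2)] unfolding bd by (simp add: z_def)
  obtain N' \<theta> where N': "open N'" "a \<in> N'" "N' \<subseteq> ?W" and \<theta>: "smooth_on N' \<theta>"
    and cs: "\<And>b. b \<in> N' \<Longrightarrow> cos (\<theta> b) = x b \<and> sin (\<theta> b) = y b / sqrt (z b)"
    by (rule smooth_polar[OF oW sW[OF smooth_xyz(1)] sW[OF smooth_xyz(2)] sW[OF smooth_xyz(3)], of a])
      (use cone a az in auto)
  define l where "l b = (vector [sqrt (z b) * \<theta> b / (2 * pi), sqrt (z b)] :: real^2)" for b
  have sz: "smooth_on N' (\<lambda>b. sqrt (z b))"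
    by (rule smooth_on_sqrt[OF N'(1) smooth_on_subset[OF smooth_xyz(3)]]) (use N'(3) in auto)
  have "smooth_vec N' l" unfolding l_def[abs_def]
    by (intro smooth_vec_vector2 smooth_intros sz \<theta> N'(1)) simp_all
  then have "smooth_on N' (\<lambda>b. f (l b))"
    by (rule smooth_on_compose[OF f _ N'(1) open_off_axis]) (use N'(3) in \<open>auto simp: l_def\<close>)
  moreover have "compose (free_part k) F (resolve k) (g (\<rho> b)) = f (l b)" if b: "b \<in> N'" "g (\<rho> b) \<in> free_part k" for b
  proof -
    have bz: "0 < z b" using b(1) N'(3) by auto
    have "psi_map k (blowdown (g (\<rho> b))) = plane_class (l b)"
      unfolding bd l_def z_def by (rule psi_main) (use bz cs[OF b(1)] in \<open>auto simp: x_def y_def z_def\<close>)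
    then show ?thesis using b(2) Ff[of "l b"] bz by (simp add: compose_def l_def)
  qed
  ultimately show "\<exists>Q' \<phi>. open Q' \<and> a \<in> Q' \<and> Q' \<subseteq> Q \<and> smooth_on Q' \<phi> \<and> (\<forall>b\<in>Q'. g (\<rho> b) \<in> free_part k \<longrightarrow>
      compose (free_part k) F (resolve k) (g (\<rho> b)) = \<phi> b)"
    using N' by (intro exI[of _ N'] exI[of _ "\<lambda>b. f (l b)"]) auto
qed (auto simp: compose_def free_part_def)

text \<open>Off the axis \<open>phi_map\<close> factors through \<open>main_coords\<close> into the
  last \<open>z\<close>-chart, whose omitted points have \<open>z = 0\<close>; this gives
  smoothness. Invariance under the group is that of \<open>phi_map\<close>.\<close>

lemma inv_resolve_smooth:
  assumes H: "H \<in> smooth_funs (smooth_subspace (Z_ambient k) (free_part k))"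
  shows "compose (plane_class ` off_axis) H (inv_into (free_part k) (resolve k)) \<in> smooth_funs free_quotient"
  unfolding smooth_free_quotient
proof (intro conjI bexI[of _ "\<lambda>m\<in>off_axis. H (Base (phi_map k m))"] ballI)
  show "(\<lambda>m\<in>off_axis. H (Base (phi_map k m))) \<in> smooth_funs (smooth_subspace euclidean_smooth off_axis)"
  proof (rule smooth_subspaceI)
    fix m :: "real^2" assume m: "m \<in> off_axis"
    obtain V where V: "(V, main_chart k) \<in> Z_atlas k" "- {axis 1 1, axis 1 (- 1)} \<subseteq> V"
      using resolved_charts(2) by blast
    have "main_coords m $ 3 \<noteq> 0" using m by (simp add: main_coords_def)
    then have mV: "main_coords m \<in> V" using V(2) by (auto simp: axis_def)
    have mb: "main_chart k (main_coords x) = Base (phi_map k x)" if "x \<in> off_axis" for x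
      using phi_map_main_coords[of x k] that by simp
    have mS: "main_chart k (main_coords m) \<in> free_part k"
      unfolding mb[OF m] by (rule phi_map_free_part(1)[OF m])
    obtain N \<phi> where N: "open N" "main_coords m \<in> N" "N \<subseteq> V" "smooth_on N \<phi>"
      "\<And>v. v \<in> N \<Longrightarrow> main_chart k v \<in> free_part k \<Longrightarrow> H (main_chart k v) = \<phi> v"
      by (rule smooth_subspaceD[OF H atlas_chart[OF good_Z V(1)] mV mS]) (rule that)
    let ?N = "off_axis \<inter> main_coords -` N"
    have o: "open ?N"
      by (rule continuous_open_preimage[OF smooth_vec_continuous[OF smooth_main_coords] open_off_axis N(1)])
    have sm: "smooth_on ?N (\<lambda>x. \<phi> (main_coords x))"
      by (rule smooth_on_compose[OF N(4) smooth_vec_subset[OF smooth_main_coords] o N(1)]) auto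
    have "(\<lambda>m\<in>off_axis. H (Base (phi_map k m))) x = \<phi> (main_coords x)" if x: "x \<in> ?N" for x
      using N(5)[of "main_coords x"] mb[of x] phi_map_free_part(1)[of x k] x by auto
    then show "\<exists>V g w N \<phi>. is_chart euclidean_smooth V g \<and> m = g w \<and> open N \<and> w \<in> N \<and> N \<subseteq> V \<and>
        smooth_on N (\<phi> :: real^2 \<Rightarrow> real) \<and> (\<forall>v\<in>N. g v \<in> off_axis \<longrightarrow> (\<lambda>m\<in>off_axis. H (Base (phi_map k m))) (g v) = \<phi> v)"
      using chart_euclidean o sm m N(2)
      by (intro exI[of _ UNIV] exI[of _ "\<lambda>x. x"] exI[of _ m] exI[of _ ?N] exI[of _ "\<lambda>x. \<phi> (main_coords x)"] conjI ballI impI) auto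
  qed simp
  show "(\<lambda>m\<in>off_axis. H (Base (phi_map k m))) (\<gamma> *v m) = (\<lambda>m\<in>off_axis. H (Base (phi_map k m))) m"
    if \<gamma>: "\<gamma> \<in> G'" and m: "m \<in> off_axis" for \<gamma> m
  proof -
    obtain n e where e: "e = 1 \<or> e = - 1" "(*v) \<gamma> = plane_act n e" using \<gamma> by (rule G'_E)
    show ?thesis unfolding e(2) using m e(1) phi_map_act[OF e(1), of k n m] by auto
  qed
  show "compose (plane_class ` off_axis) H (inv_into (free_part k) (resolve k)) (plane_class m) =
      (\<lambda>m\<in>off_axis. H (Base (phi_map k m))) m" if m: "m \<in> off_axis" for m
  proof -
    have "plane_class m \<in> plane_class ` off_axis" using m by blast
    then show ?thesis using m unfolding compose_def by (simp only: restrict_apply' inv_free_part[OF m])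
  qed
qed (simp add: compose_def)

lemma resolve_diffeomorphism:
  "diffeomorphism (smooth_subspace (Z_ambient k) (free_part k)) free_quotient (resolve k)"
  unfolding diffeomorphism_def smooth_map_def points_free_quotient smooth_subspace_sel(1)
proof (intro conjI ballI bij_free_part resolve_smooth_free inv_resolve_smooth)
  show "resolve k \<in> free_part k \<rightarrow> plane_class ` off_axis" by (auto simp: free_part_def)
  show "inv_into (free_part k) (resolve k) \<in> plane_class ` off_axis \<rightarrow> free_part k"
    using bij_betwE[OF bij_betw_inv_into[OF bij_free_part]] by blast
qed

theorem theorem5p5:
  fixes k :: nat
  shows "symplectic_resolution TYPE(real^2) euclidean_smooth plane_bracket G' (mat 1) (*v)
           (Z_plus k) (Z_plus_bracket k) (psi_map k \<circ> blowdown)"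
proof -
  have "{s \<in> points (Z_plus k). resolve k s \<in> points free_quotient} = free_part k"
    unfolding points_free_quotient free_part_def points_Z_plus ..
  moreover have "smooth_subspace (Z_plus k) (free_part k) = smooth_subspace (Z_ambient k) (free_part k)"
    unfolding Z_plus_eq by (rule subspace_subspace[OF nice_Z plus_points_ambient]) (auto simp: free_part_def)
  ultimately have "diffeomorphism (smooth_subspace (Z_plus k) {s \<in> points (Z_plus k). resolve k s \<in> points free_quotient})
      free_quotient (resolve k)"
    using resolve_diffeomorphism[of k] by (simp only:)
  moreover have "symplectic_realization TYPE(real^2) euclidean_smooth plane_bracket G' (*v) (Z_plus k) (Z_plus_bracket k) (resolve k)"
    unfolding symplectic_realization_def
    by (intro conjI symplectic_Z_plus resolve_smooth_map resolve_poisson)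
  ultimately show ?thesis
    unfolding symplectic_resolution_def Let_def
    by (intro conjI exI[of _ off_axis] off_axis_saturated discrete_off_axis proper_off_axis free_off_axis)
      (simp_all add: open_off_axis closure_off_axis)
qed

end
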